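(* Let $k$ be an algebraically closed field of characteristic $0$, let $V=k^{m|n}$ and let $r\ge 0$ be an integer. Let $\rho_r$ be the diagonal tensor representation of the general linear supergroup $\mathbf{GL}(m|n)$ on $T^r(V)=V^{\otimes r}$. Then there is a one-to-one correspondence between the irreducible representations of the symmetric group $S_r$ and the irreducible representations of $\mathbf{GL}(m|n)$ occurring in $\rho_r$.
   Context: All algebras are over $k$. A commutative superalgebra is a $\mathbf{Z}/2$-graded algebra $A=A_0\oplus A_1$ with $xy=(-1)^{p(x)p(y)}yx$ for homogeneous $x,y$, where $p$ denotes parity. $V=k^{m|n}=V_0\oplus V_1$ is the super vector space with even part $V_0=k^m$ and odd part $V_1=k^n$. For a finite-dimensional super vector space $W$, $\mathbf{End}(W)(A)=(A\otimes\mathrm{End}(W))_0$, where $\mathrm{End}(W)$ is graded by parity-preserving and parity-reversing endomorphisms. $\mathbf{GL}(m|n)$ is the functor sending a commutative superalgebra $A$ to the group of automorphisms of the $A$-supermodule $A\otimes V$, i.e. block matrices $\begin{pmatrix} a&\beta\\ \gamma& d\end{pmatrix}$ with $a$ ($m\times m$) and $d$ ($n\times n$) invertible with entries in $A_0$, and $\beta,\gamma$ with entries in $A_1$. A representation (action) of $\mathbf{GL}(m|n)$ on a super vector space $W$ is a natural transformation $\mathbf{GL}(m|n)\to\mathbf{End}(W)$, i.e. a family of maps $\mathbf{GL}(m|n)(A)\to\mathbf{End}(W)(A)$, functorial in $A$ (and compatible with the group structure). $T^r(V)$ is a super vector space with $p(v_1\otimes\cdots\otimes v_r)=p(v_1)+\cdots+p(v_r)$,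 and $A\otimes T^r(V)$ is identified with the $r$-fold tensor product of $A\otimes V$ over $A$. The representation $\rho_r$ is $$\rho_{r,A}(g)(v_1\otimes\cdots\otimes v_r)=g(v_1)\otimes\cdots\otimes g(v_r),\qquad g\in\mathbf{GL}(m|n)(A),\ v_i\in A\otimes V.$$
   Formalization: Only the irreducible representations of S_r occurring in T^r(V) (sign-rule action) are taken: with all of them the claim fails for m=1, n=0, r=2. Superalgebras A range over those in a fixed set into which k^N embeds, which suffices by representability of GL(m|n). *)

theory Defs
  imports
    "HOL-Computational_Algebra.Polynomial"
    "HOL-Library.Z2"
    "HOL-Algebra.Module"
    "HOL-Algebra.Sym_Groups"
begin

section \<open>Commutative superalgebras\<close>

text \<open>
  The ground field is a type \<open>'k\<close>; parities are elements of the two-element field \<open>bit\<close>.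
  Superalgebras are carrier-based, with elements drawn from a type \<open>'u\<close>, so that functors on
  superalgebras range over all superalgebras whose elements live in the universe \<open>'u\<close>.
\<close>

record ('k, 'u) superalgebra = "('k, 'u) module" +
  grade :: "bit \<Rightarrow> 'u set"

definition koszul :: "bit \<Rightarrow> 'k::field" where
  "koszul p = (if p = 0 then 1 else - 1)"

locale comm_superalgebra = ring A for A :: "('k::field, 'u) superalgebra" (structure) +
  assumes smult_closed: "x \<in> carrier A \<Longrightarrow> c \<odot> x \<in> carrier A"
    and smult_l_distr: "x \<in> carrier A \<Longrightarrow> (c + d) \<odot> x = c \<odot> x \<oplus> d \<odot> x"
    and smult_r_distr: "x \<in> carrier A \<Longrightarrow> y \<in> carrier A \<Longrightarrow> c \<odot> (x \<oplus> y) = c \<odot> x \<oplus> c \<odot> y"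
    and smult_assoc: "x \<in> carrier A \<Longrightarrow> (c * d) \<odot> x = c \<odot> (d \<odot> x)"
    and smult_one: "x \<in> carrier A \<Longrightarrow> 1 \<odot> x = x"
    and smult_mult_l: "x \<in> carrier A \<Longrightarrow> y \<in> carrier A \<Longrightarrow> (c \<odot> x) \<otimes> y = c \<odot> (x \<otimes> y)"
    and smult_mult_r: "x \<in> carrier A \<Longrightarrow> y \<in> carrier A \<Longrightarrow> x \<otimes> (c \<odot> y) = c \<odot> (x \<otimes> y)"
    and grade_subset: "grade A p \<subseteq> carrier A"
    and grade_zero: "\<zero> \<in> grade A p"
    and grade_add: "x \<in> grade A p \<Longrightarrow> y \<in> grade A p \<Longrightarrow> x \<oplus> y \<in> grade A p"
    and grade_smult: "x \<in> grade A p \<Longrightarrow> c \<odot> x \<in> grade A p"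
    and grade_sum: "x \<in> carrier A \<Longrightarrow> \<exists>y\<in>grade A 0. \<exists>z\<in>grade A 1. x = y \<oplus> z"
    and grade_disjoint: "grade A 0 \<inter> grade A 1 = {\<zero>}"
    and grade_one: "\<one> \<in> grade A 0"
    and grade_mult: "x \<in> grade A p \<Longrightarrow> y \<in> grade A q \<Longrightarrow> x \<otimes> y \<in> grade A (p + q)"
    and supercomm: "x \<in> grade A p \<Longrightarrow> y \<in> grade A q \<Longrightarrow> x \<otimes> y = koszul (p * q) \<odot> (y \<otimes> x)"

definition superalgebra_hom ::
  "('k, 'u) superalgebra \<Rightarrow> ('k, 'u) superalgebra \<Rightarrow> ('u \<Rightarrow> 'u) set" where
  "superalgebra_hom A B =
     {\<phi> \<in> ring_hom A B.
        (\<forall>c. \<forall>x\<in>carrier A. \<phi> (c \<odot>\<^bsub>A\<^esub> x) = c \<odot>\<^bsub>B\<^esub> \<phi> x) \<and>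
        (\<forall>p. \<phi> ` grade A p \<subseteq> grade B p)}"


section \<open>The functors \<open>End\<close> and \<open>GL\<close>\<close>

text \<open>
  A finite-dimensional super vector space \<open>W\<close> is given by a homogeneous basis
  \<open>(e\<^sub>i)\<close> indexed by a finite set \<open>I\<close>, with parities \<open>p\<close>.  Elements of \<open>A \<otimes> W\<close> are written
  \<open>\<Sum> e\<^sub>i x\<^sub>i\<close> with coefficients on the right, where \<open>e\<^sub>i a\<close> means
  \<open>(-1)^(p(e\<^sub>i) p(a)) a \<otimes> e\<^sub>i\<close>.  An even \<open>A\<close>-linear endomorphism \<open>X\<close> has the matrix given
  by \<open>X e\<^sub>j = \<Sum> e\<^sub>i X\<^sub>i\<^sub>j\<close>, where \<open>X\<^sub>i\<^sub>j\<close> has parity \<open>p i + p j\<close>.  With coefficients on the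
  right, composition is the product of matrices without signs.
\<close>

definition End_super ::
  "'i set \<Rightarrow> ('i \<Rightarrow> bit) \<Rightarrow> ('k, 'u) superalgebra \<Rightarrow> ('i \<Rightarrow> 'i \<Rightarrow> 'u) monoid" where
  "End_super I p A =
     \<lparr>carrier = (\<Pi>\<^sub>E i\<in>I. \<Pi>\<^sub>E j\<in>I. grade A (p i + p j)),
      monoid.mult = (\<lambda>X Y. \<lambda>i\<in>I. \<lambda>j\<in>I. \<Oplus>\<^bsub>A\<^esub>l\<in>I. X i l \<otimes>\<^bsub>A\<^esub> Y l j),
      one = (\<lambda>i\<in>I. \<lambda>j\<in>I. if i = j then \<one>\<^bsub>A\<^esub> else \<zero>\<^bsub>A\<^esub>)\<rparr>"

definition map_matrix :: "'i set \<Rightarrow> ('u \<Rightarrow> 'u) \<Rightarrow> ('i \<Rightarrow> 'i \<Rightarrow> 'u) \<Rightarrow> ('i \<Rightarrow> 'i \<Rightarrow> 'u)" where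
  "map_matrix I \<phi> X = (\<lambda>i\<in>I. \<lambda>j\<in>I. \<phi> (X i j))"

text \<open>\<open>V = k^(m|n)\<close> has basis indexed by \<open>{..<m + n}\<close>, the first \<open>m\<close> basis vectors being even.\<close>

definition par_V :: "nat \<Rightarrow> nat \<Rightarrow> bit" where
  "par_V m i = (if i < m then 0 else 1)"

definition GL :: "nat \<Rightarrow> nat \<Rightarrow> ('k, 'u) superalgebra \<Rightarrow> (nat \<Rightarrow> nat \<Rightarrow> 'u) monoid" where
  "GL m n A = units_of (End_super {..<m + n} (par_V m) A)"


section \<open>Representations of \<open>GL(m|n)\<close>\<close>

record ('k, 'u, 'i) gl_rep =
  gl_basis :: "'i set"
  gl_par :: "'i \<Rightarrow> bit"
  gl_act :: "('k, 'u) superalgebra \<Rightarrow> (nat \<Rightarrow> nat \<Rightarrow> 'u) \<Rightarrow> ('i \<Rightarrow> 'i \<Rightarrow> 'u)"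

definition is_gl_rep :: "nat \<Rightarrow> nat \<Rightarrow> ('k::field, 'u, 'i) gl_rep \<Rightarrow> bool" where
  "is_gl_rep m n W \<longleftrightarrow>
     finite (gl_basis W) \<and>
     (\<forall>A. comm_superalgebra A \<longrightarrow>
        gl_act W A \<in> hom (GL m n A) (End_super (gl_basis W) (gl_par W) A) \<and>
        gl_act W A \<one>\<^bsub>GL m n A\<^esub> = \<one>\<^bsub>End_super (gl_basis W) (gl_par W) A\<^esub>) \<and>
     (\<forall>A B. comm_superalgebra A \<longrightarrow> comm_superalgebra B \<longrightarrow>
        (\<forall>\<phi>\<in>superalgebra_hom A B. \<forall>g\<in>carrier (GL m n A).
           gl_act W B (map_matrix {..<m + n} \<phi> g) = map_matrix (gl_basis W) \<phi> (gl_act W A g)))"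

text \<open>The coordinate space \<open>k^I\<close> consists of the functions vanishing outside \<open>I\<close>.\<close>

definition coord_space :: "'i set \<Rightarrow> ('i \<Rightarrow> 'k::field) set" where
  "coord_space I = {u. \<forall>i. i \<notin> I \<longrightarrow> u i = 0}"

definition is_subspace :: "'i set \<Rightarrow> ('i \<Rightarrow> 'k::field) set \<Rightarrow> bool" where
  "is_subspace I U \<longleftrightarrow>
     U \<subseteq> coord_space I \<and> (\<lambda>_. 0) \<in> U \<and>
     (\<forall>u\<in>U. \<forall>v\<in>U. (\<lambda>i. u i + v i) \<in> U) \<and>
     (\<forall>c. \<forall>u\<in>U. (\<lambda>i. c * u i) \<in> U)"

definition is_super_subspace :: "'i set \<Rightarrow> ('i \<Rightarrow> bit) \<Rightarrow> ('i \<Rightarrow> 'k::field) set \<Rightarrow> bool" where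
  "is_super_subspace I p U \<longleftrightarrow>
     is_subspace I U \<and> (\<forall>u\<in>U. \<forall>q. (\<lambda>i. if p i = q then u i else 0) \<in> U)"

text \<open>\<open>A \<otimes> U\<close> inside \<open>A \<otimes> k^I\<close>, as the \<open>A\<close>-span of \<open>U\<close>.\<close>

definition base_change ::
  "('k::field, 'u) superalgebra \<Rightarrow> 'i set \<Rightarrow> ('i \<Rightarrow> 'k) set \<Rightarrow> ('i \<Rightarrow> 'u) set" where
  "base_change A I U =
     {(\<lambda>i\<in>I. \<Oplus>\<^bsub>A\<^esub>u\<in>F. u i \<odot>\<^bsub>A\<^esub> c u) | F c. finite F \<and> F \<subseteq> U \<and> c \<in> F \<rightarrow> carrier A}"

definition is_gl_subrep ::
  "nat \<Rightarrow> nat \<Rightarrow> ('k::field, 'u, 'i) gl_rep \<Rightarrow> ('i \<Rightarrow> 'k) set \<Rightarrow> bool" where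
  "is_gl_subrep m n W U \<longleftrightarrow>
     is_super_subspace (gl_basis W) (gl_par W) U \<and>
     (\<forall>A. comm_superalgebra A \<longrightarrow>
        (\<forall>g\<in>carrier (GL m n A). \<forall>x\<in>base_change A (gl_basis W) U.
           (\<lambda>i\<in>gl_basis W. \<Oplus>\<^bsub>A\<^esub>j\<in>gl_basis W. gl_act W A g i j \<otimes>\<^bsub>A\<^esub> x j)
             \<in> base_change A (gl_basis W) U))"

definition irreducible_gl_rep :: "nat \<Rightarrow> nat \<Rightarrow> ('k::field, 'u, 'i) gl_rep \<Rightarrow> bool" where
  "irreducible_gl_rep m n W \<longleftrightarrow>
     is_gl_rep m n W \<and> gl_basis W \<noteq> {} \<and>
     (\<forall>U. is_gl_subrep m n W U \<longrightarrow> U = {\<lambda>_. 0} \<or> U = coord_space (gl_basis W))"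

definition lin_map ::
  "'i set \<Rightarrow> 'j set \<Rightarrow> ('j \<Rightarrow> 'i \<Rightarrow> 'k::field) \<Rightarrow> ('i \<Rightarrow> 'k) \<Rightarrow> ('j \<Rightarrow> 'k)" where
  "lin_map I J T u = (\<lambda>j. if j \<in> J then \<Sum>i\<in>I. T j i * u i else 0)"

text \<open>Morphisms of representations are even linear maps \<open>T\<close>, given by their matrices.\<close>

definition gl_intertwiner ::
  "nat \<Rightarrow> nat \<Rightarrow> ('k::field, 'u, 'i) gl_rep \<Rightarrow> ('k, 'u, 'j) gl_rep \<Rightarrow> ('j \<Rightarrow> 'i \<Rightarrow> 'k) \<Rightarrow> bool" where
  "gl_intertwiner m n W W' T \<longleftrightarrow>
     (\<forall>j\<in>gl_basis W'. \<forall>i\<in>gl_basis W. gl_par W' j \<noteq> gl_par W i \<longrightarrow> T j i = 0) \<and>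
     (\<forall>A. comm_superalgebra A \<longrightarrow>
        (\<forall>g\<in>carrier (GL m n A). \<forall>j\<in>gl_basis W'. \<forall>i\<in>gl_basis W.
           (\<Oplus>\<^bsub>A\<^esub>l\<in>gl_basis W. T j l \<odot>\<^bsub>A\<^esub> gl_act W A g l i) =
           (\<Oplus>\<^bsub>A\<^esub>l\<in>gl_basis W'. T l i \<odot>\<^bsub>A\<^esub> gl_act W' A g j l)))"

definition gl_occurs_in ::
  "nat \<Rightarrow> nat \<Rightarrow> ('k::field, 'u, 'i) gl_rep \<Rightarrow> ('k, 'u, 'j) gl_rep \<Rightarrow> bool" where
  "gl_occurs_in m n L W \<longleftrightarrow>
     (\<exists>T. gl_intertwiner m n L W T \<and>
          inj_on (lin_map (gl_basis L) (gl_basis W) T) (coord_space (gl_basis L)))"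

definition gl_iso :: "nat \<Rightarrow> nat \<Rightarrow> ('k::field, 'u, 'i) gl_rep rel" where
  "gl_iso m n =
     {(W, W'). is_gl_rep m n W \<and> is_gl_rep m n W' \<and>
        (\<exists>T. gl_intertwiner m n W W' T \<and>
             bij_betw (lin_map (gl_basis W) (gl_basis W') T)
               (coord_space (gl_basis W)) (coord_space (gl_basis W')))}"


section \<open>The tensor representation of \<open>GL(m|n)\<close>\<close>

definition tensor_basis :: "nat \<Rightarrow> nat \<Rightarrow> nat \<Rightarrow> nat list set" where
  "tensor_basis m n r = {is. length is = r \<and> set is \<subseteq> {..<m + n}}"

definition tensor_par :: "nat \<Rightarrow> nat list \<Rightarrow> bit" where
  "tensor_par m is = sum_list (map (par_V m) is)"

text \<open>
  \<open>tensor_coeff m A g is js\<close> is the coefficient of \<open>e\<^sub>i\<^sub>1 \<otimes> \<dots> \<otimes> e\<^sub>i\<^sub>r\<close> in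
  \<open>g e\<^sub>j\<^sub>1 \<otimes> \<dots> \<otimes> g e\<^sub>j\<^sub>r\<close>, the tensor product being taken over \<open>A\<close>.  In the recursion,
  \<open>(e\<^sub>i a) \<otimes> (w b) = (-1)^(p(a) p(w)) (e\<^sub>i \<otimes> w) (a b)\<close> with \<open>a = g\<^sub>i\<^sub>j\<close>.
\<close>

fun tensor_coeff ::
  "nat \<Rightarrow> ('k::field, 'u) superalgebra \<Rightarrow> (nat \<Rightarrow> nat \<Rightarrow> 'u) \<Rightarrow> nat list \<Rightarrow> nat list \<Rightarrow> 'u" where
  "tensor_coeff m A g (i # is) (j # js) =
     koszul ((par_V m i + par_V m j) * tensor_par m is) \<odot>\<^bsub>A\<^esub>
       (g i j \<otimes>\<^bsub>A\<^esub> tensor_coeff m A g is js)"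
| "tensor_coeff m A g _ _ = \<one>\<^bsub>A\<^esub>"

definition tensor_rep :: "nat \<Rightarrow> nat \<Rightarrow> nat \<Rightarrow> ('k::field, 'u, nat list) gl_rep" where
  "tensor_rep m n r =
     \<lparr>gl_basis = tensor_basis m n r,
      gl_par = tensor_par m,
      gl_act = (\<lambda>A g. \<lambda>is\<in>tensor_basis m n r. \<lambda>js\<in>tensor_basis m n r. tensor_coeff m A g is js)\<rparr>"


section \<open>Linear representations of a group, and \<open>S\<^sub>r\<close> acting on tensors\<close>

record ('g, 'k, 'i) lin_rep =
  lr_basis :: "'i set"
  lr_act :: "'g \<Rightarrow> 'i \<Rightarrow> 'i \<Rightarrow> 'k"

definition End_lin :: "'i set \<Rightarrow> ('i \<Rightarrow> 'i \<Rightarrow> 'k::field) monoid" where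
  "End_lin I =
     \<lparr>carrier = (\<Pi>\<^sub>E i\<in>I. \<Pi>\<^sub>E j\<in>I. UNIV),
      monoid.mult = (\<lambda>X Y. \<lambda>i\<in>I. \<lambda>j\<in>I. \<Sum>l\<in>I. X i l * Y l j),
      one = (\<lambda>i\<in>I. \<lambda>j\<in>I. if i = j then 1 else 0)\<rparr>"

definition is_lin_rep :: "('g, 'b) monoid_scheme \<Rightarrow> ('g, 'k::field, 'i) lin_rep \<Rightarrow> bool" where
  "is_lin_rep G M \<longleftrightarrow>
     finite (lr_basis M) \<and> lr_act M \<in> hom G (End_lin (lr_basis M)) \<and>
     lr_act M \<one>\<^bsub>G\<^esub> = \<one>\<^bsub>End_lin (lr_basis M)\<^esub>"

definition is_lin_subrep ::
  "('g, 'b) monoid_scheme \<Rightarrow> ('g, 'k::field, 'i) lin_rep \<Rightarrow> ('i \<Rightarrow> 'k) set \<Rightarrow> bool" where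
  "is_lin_subrep G M U \<longleftrightarrow>
     is_subspace (lr_basis M) U \<and>
     (\<forall>g\<in>carrier G. \<forall>u\<in>U. lin_map (lr_basis M) (lr_basis M) (lr_act M g) u \<in> U)"

definition irreducible_lin_rep ::
  "('g, 'b) monoid_scheme \<Rightarrow> ('g, 'k::field, 'i) lin_rep \<Rightarrow> bool" where
  "irreducible_lin_rep G M \<longleftrightarrow>
     is_lin_rep G M \<and> lr_basis M \<noteq> {} \<and>
     (\<forall>U. is_lin_subrep G M U \<longrightarrow> U = {\<lambda>_. 0} \<or> U = coord_space (lr_basis M))"

definition lin_intertwiner ::
  "('g, 'b) monoid_scheme \<Rightarrow> ('g, 'k::field, 'i) lin_rep \<Rightarrow> ('g, 'k, 'j) lin_rep \<Rightarrow>
   ('j \<Rightarrow> 'i \<Rightarrow> 'k) \<Rightarrow> bool" where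
  "lin_intertwiner G M M' T \<longleftrightarrow>
     (\<forall>g\<in>carrier G. \<forall>j\<in>lr_basis M'. \<forall>i\<in>lr_basis M.
        (\<Sum>l\<in>lr_basis M. T j l * lr_act M g l i) = (\<Sum>l\<in>lr_basis M'. lr_act M' g j l * T l i))"

definition lin_occurs_in ::
  "('g, 'b) monoid_scheme \<Rightarrow> ('g, 'k::field, 'i) lin_rep \<Rightarrow> ('g, 'k, 'j) lin_rep \<Rightarrow> bool" where
  "lin_occurs_in G L M \<longleftrightarrow>
     (\<exists>T. lin_intertwiner G L M T \<and>
          inj_on (lin_map (lr_basis L) (lr_basis M) T) (coord_space (lr_basis L)))"

definition lin_iso :: "('g, 'b) monoid_scheme \<Rightarrow> ('g, 'k::field, 'i) lin_rep rel" where
  "lin_iso G =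
     {(M, M'). is_lin_rep G M \<and> is_lin_rep G M' \<and>
        (\<exists>T. lin_intertwiner G M M' T \<and>
             bij_betw (lin_map (lr_basis M) (lr_basis M') T)
               (coord_space (lr_basis M)) (coord_space (lr_basis M')))}"

text \<open>
  The symmetric group permutes the tensor factors with the sign rule:
  \<open>s \<cdot> (v\<^sub>1 \<otimes> \<dots> \<otimes> v\<^sub>r) = \<plusminus> v\<^sub>s\<^sub>'\<^sub>(\<^sub>1\<^sub>) \<otimes> \<dots> \<otimes> v\<^sub>s\<^sub>'\<^sub>(\<^sub>r\<^sub>)\<close> with \<open>s'\<close> the inverse of \<open>s\<close>, where the sign is
  \<open>-1\<close> to the number of pairs of odd factors whose order is reversed.  Position \<open>t \<in> {1..r}\<close> of
  a tensor is entry \<open>t - 1\<close> of the list.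
\<close>

definition perm_sign :: "nat \<Rightarrow> nat \<Rightarrow> (nat \<Rightarrow> nat) \<Rightarrow> nat list \<Rightarrow> 'k::field" where
  "perm_sign m r s is =
     (- 1) ^ card {(a, b). a \<in> {1..r} \<and> b \<in> {1..r} \<and> a < b \<and> s b < s a \<and>
                           par_V m (is ! (a - 1)) = 1 \<and> par_V m (is ! (b - 1)) = 1}"

definition sym_tensor_rep ::
  "nat \<Rightarrow> nat \<Rightarrow> nat \<Rightarrow> (nat \<Rightarrow> nat, 'k::field, nat list) lin_rep" where
  "sym_tensor_rep m n r =
     \<lparr>lr_basis = tensor_basis m n r,
      lr_act = (\<lambda>s. \<lambda>js\<in>tensor_basis m n r. \<lambda>is\<in>tensor_basis m n r.
        if \<forall>t\<in>{1..r}. js ! (s t - 1) = is ! (t - 1) then perm_sign m r s is else 0)\<rparr>"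


section \<open>Isomorphism classes of irreducible constituents\<close>

text \<open>
  A representation with finite basis is isomorphic to one whose basis is indexed by natural
  numbers, so taking these as representatives loses no isomorphism class.

  On both sides only the irreducible representations occurring in \<open>V\<^bsup>\<otimes>r\<^esup>\<close> are taken.  For \<open>S\<^sub>r\<close>
  this is a restriction in general: if \<open>m = 1\<close>, \<open>n = 0\<close> and \<open>r = 2\<close>, then \<open>V\<^bsup>\<otimes>r\<^esup>\<close> is
  one-dimensional and the sign representation of \<open>S\<^sub>2\<close> does not occur in it.
\<close>

definition sym_irreps_in_tensors ::
  "nat \<Rightarrow> nat \<Rightarrow> nat \<Rightarrow> (nat \<Rightarrow> nat, 'k::field, nat) lin_rep set set" where
  "sym_irreps_in_tensors m n r =
     {M. irreducible_lin_rep (sym_group r) M \<and>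
         lin_occurs_in (sym_group r) M (sym_tensor_rep m n r)} // lin_iso (sym_group r)"

definition gl_irreps_in_tensors ::
  "nat \<Rightarrow> nat \<Rightarrow> nat \<Rightarrow> ('k::field, 'u, nat) gl_rep set set" where
  "gl_irreps_in_tensors m n r =
     {L. irreducible_gl_rep m n L \<and> gl_occurs_in m n L (tensor_rep m n r)} // gl_iso m n"

end

theory Submission
  imports Defs "HOL-Library.Function_Algebras" "HOL-Library.Nat_Bijection"
begin

text \<open>
  Write \<open>T\<close> for the tensor space \<open>V\<^bsup>\<otimes>r\<^esup>\<close>, on which the symmetric group permutes the factors with the
  sign rule, and \<open>C\<close> for the commutant of this action.  The proof is a duality between the simple
  submodules of \<open>T\<close> over the symmetric group and the simple submodules of \<open>T\<close> over \<open>C\<close>, together with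
  the fact that the general linear supergroup has the same subrepresentations in \<open>T\<close> as \<open>C\<close>.

  The duality relates a simple submodule \<open>N\<close> for the group to a simple \<open>C\<close>-submodule \<open>U\<close> whenever
  \<open>N \<inter> U \<noteq> 0\<close>.  By Maschke's theorem every equivariant map out of a submodule extends to an element
  of \<open>C\<close>.  Hence \<open>C t\<close> is simple for every \<open>t \<noteq> 0\<close> in a simple \<open>N\<close> (\<open>simple_orbit_commutant\<close>), every
  simple \<open>U\<close> meets some simple \<open>N\<close> (\<open>simple_commutant_meets_simple\<close>), and related pairs \<open>(N, U)\<close> and
  \<open>(N', U')\<close> satisfy \<open>N \<cong> N'\<close> if and only if \<open>U \<cong> U'\<close> (\<open>commutant_iso_of_group_iso\<close>,
  \<open>group_iso_of_commutant_iso\<close>).  So the relation induces a bijection between isomorphism classes.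

  For the supergroup the point is that the entries \<open>\<rho>(g)\<^sub>I\<^sub>J\<close> of its action on \<open>T\<close> satisfy exactly the
  linear relations over the ground field that the entries of all matrices in \<open>C\<close> satisfy.
  In one direction, \<open>\<rho>(g)\<^sub>I\<^sub>J\<close> changes under a simultaneous permutation of \<open>I\<close> and \<open>J\<close> by the same sign
  as the entry of a matrix in \<open>C\<close> (\<open>tensor_coeff_equivariant\<close>).  A relation may therefore be averaged
  over the group, and the averaged coefficients are the values of the relation on the orbits of
  matrix units, which lie in \<open>C\<close> (\<open>tensor_coeff_relations\<close>).  In the other direction, let
  \<open>g = 1 + \<Sum> x\<^sub>t E(i\<^sub>t, j\<^sub>t)\<close> for two basis tensors \<open>I = (i\<^sub>1, ..., i\<^sub>r)\<close> and \<open>J = (j\<^sub>1, ..., j\<^sub>r)\<close>, where the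
  \<open>x\<^sub>t\<close> are supercommuting variables of square zero, of the parity of the matrix unit \<open>E(i\<^sub>t, j\<^sub>t)\<close>.
  The coefficient of \<open>x\<^sub>1 ... x\<^sub>r\<close> in \<open>\<rho>(g)\<^sub>X\<^sub>Y\<close> vanishes outside the orbit of \<open>(I, J)\<close>, and does not
  vanish on it unless an odd pair \<open>(i\<^sub>t, j\<^sub>t)\<close> is repeated; in that exceptional case the averaged
  coefficient of the relation is zero by antisymmetry.  Either way a relation between the \<open>\<rho>(g)\<^sub>X\<^sub>Y\<close>
  has averaged coefficient zero at \<open>(I, J)\<close> (\<open>orbit_sum_zero\<close>), so it holds on \<open>C\<close>
  (\<open>equivariant_relations\<close>).

  The properties of a constituent \<open>L\<close> of \<open>T\<close> that matter come down to such relations, once \<open>L\<close> is written as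
  \<open>p \<rho>(g) f\<close> with an embedding \<open>f\<close> and a linear left inverse \<open>p\<close>: invariance of a subspace, isomorphism
  of two constituents, and the possibility of restricting \<open>\<rho>\<close> to a subspace.  Thus the
  subrepresentations of \<open>L\<close> are the \<open>C\<close>-submodules of its image
  (\<open>irreducible_iff_simple_image\<close>), isomorphisms are isomorphisms over \<open>C\<close>
  (\<open>gl_iso_iff_images_iso\<close>), and every \<open>C\<close>-submodule of \<open>T\<close> carries a representation of the supergroup
  (\<open>invariant_is_image\<close>).  Parities take care of themselves because the projections of \<open>T\<close> to its
  even and odd parts lie in \<open>C\<close>.
\<close>

section \<open>A finite group acting on a vector space, and its commutant\<close>

text \<open>
  The action is only required to behave on the subspace \<open>T\<close> of an ambient vector
  space, so that spaces of different dimension can live in one function type.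
\<close>

locale linear_group_action =
  group G + vector_space_pair scale scale
  for G :: "('g, 'm) monoid_scheme" and scale :: "'k::field \<Rightarrow> 'v::ab_group_add \<Rightarrow> 'v" +
  fixes act :: "'g \<Rightarrow> 'v \<Rightarrow> 'v" and T :: "'v set"
  assumes finite_group: "finite (carrier G)"
    and order_nonzero: "of_nat (card (carrier G)) \<noteq> (0::'k)"
    and linear_act: "g \<in> carrier G \<Longrightarrow> Vector_Spaces.linear scale scale (act g)"
    and act_mult: "g \<in> carrier G \<Longrightarrow> h \<in> carrier G \<Longrightarrow> x \<in> T \<Longrightarrow> act (g \<otimes>\<^bsub>G\<^esub> h) x = act g (act h x)"
    and act_one: "x \<in> T \<Longrightarrow> act \<one>\<^bsub>G\<^esub> x = x"
    and act_closed: "g \<in> carrier G \<Longrightarrow> x \<in> T \<Longrightarrow> act g x \<in> T"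
    and subspace_T: "vs1.subspace T"
    and finite_dim: "\<exists>B. finite B \<and> T \<subseteq> vs1.span B"
begin

abbreviation linear_op :: "('v \<Rightarrow> 'v) \<Rightarrow> bool" where
  "linear_op \<equiv> Vector_Spaces.linear scale scale"

definition commutant :: "('v \<Rightarrow> 'v) set" where
  "commutant = {c. linear_op c \<and> c ` T \<subseteq> T \<and>
     (\<forall>g\<in>carrier G. \<forall>x\<in>T. c (act g x) = act g (c x))}"

text \<open>
  The bicommutant replaces the group algebra: it contains the group and commutes with the
  commutant by definition, which is what is required when the roles of group and commutant are
  exchanged.
\<close>

definition bicommutant :: "('v \<Rightarrow> 'v) set" where
  "bicommutant = {a. linear_op a \<and> a ` T \<subseteq> T \<and> (\<forall>c\<in>commutant. \<forall>x\<in>T. a (c x) = c (a x))}"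

definition invariant :: "('v \<Rightarrow> 'v) set \<Rightarrow> 'v set \<Rightarrow> bool" where
  "invariant F U \<longleftrightarrow> vs1.subspace U \<and> U \<subseteq> T \<and> (\<forall>f\<in>F. \<forall>x\<in>U. f x \<in> U)"

definition simple :: "('v \<Rightarrow> 'v) set \<Rightarrow> 'v set \<Rightarrow> bool" where
  "simple F U \<longleftrightarrow> invariant F U \<and> U \<noteq> {0} \<and> (\<forall>U'\<subseteq>U. invariant F U' \<longrightarrow> U' = {0} \<or> U' = U)"

definition intertwines :: "('v \<Rightarrow> 'v) set \<Rightarrow> 'v set \<Rightarrow> 'v set \<Rightarrow> ('v \<Rightarrow> 'v) \<Rightarrow> bool" where
  "intertwines F U U' \<phi> \<longleftrightarrow> linear_op \<phi> \<and> bij_betw \<phi> U U' \<and> (\<forall>f\<in>F. \<forall>x\<in>U. \<phi> (f x) = f (\<phi> x))"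

lemma invariantD:
  assumes "invariant F U"
  shows "vs1.subspace U" "x \<in> U \<Longrightarrow> x \<in> T" "f \<in> F \<Longrightarrow> x \<in> U \<Longrightarrow> f x \<in> U" "0 \<in> U"
  using assms by (auto simp: invariant_def vs1.subspace_0)

lemma simpleD:
  assumes "simple F U"
  shows "invariant F U" "U \<noteq> {0}" "invariant F U' \<Longrightarrow> U' \<subseteq> U \<Longrightarrow> U' \<noteq> {0} \<Longrightarrow> U' = U"
  using assms unfolding simple_def by blast+

lemma nonzero_common_element:
  assumes "invariant F U" "invariant F' U'" "U \<inter> U' \<noteq> {0}"
  obtains t where "t \<in> U" "t \<in> U'" "t \<noteq> 0"
  using assms invariantD(4) by blast

lemma commutantD:
  assumes "c \<in> commutant"
  shows "linear_op c" "x \<in> T \<Longrightarrow> c x \<in> T"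
    "g \<in> carrier G \<Longrightarrow> x \<in> T \<Longrightarrow> c (act g x) = act g (c x)"
  using assms by (auto simp: commutant_def)

lemma linear_op_simps:
  assumes "linear_op f"
  shows "f (x + y) = f x + f y" "f (scale c x) = scale c (f x)" "f 0 = 0" "f (x - y) = f x - f y"
proof -
  interpret f: Vector_Spaces.linear scale scale f by fact
  show "f (x + y) = f x + f y" "f (scale c x) = scale c (f x)" "f 0 = 0" "f (x - y) = f x - f y"
    by (simp_all add: f.add f.scale f.zero f.diff)
qed

lemma linear_opI:
  assumes "\<And>x y. f (x + y) = f x + f y" "\<And>c x. f (scale c x) = scale c (f x)"
  shows "linear_op f"
  using assms by unfold_locales auto

lemma linear_op_id: "linear_op (\<lambda>x. x)" by (rule linear_opI) auto

lemma linear_op_compose: "linear_op f \<Longrightarrow> linear_op g \<Longrightarrow> linear_op (\<lambda>x. f (g x))"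
  by (rule linear_opI) (simp_all add: linear_op_simps)

lemma linear_op_add: "linear_op f \<Longrightarrow> linear_op g \<Longrightarrow> linear_op (\<lambda>x. f x + g x)"
  by (rule linear_opI) (simp_all add: linear_op_simps vs1.scale_right_distrib algebra_simps)

lemma linear_op_scale: "linear_op f \<Longrightarrow> linear_op (\<lambda>x. scale c (f x))"
  by (rule linear_opI) (simp_all add: linear_op_simps vs1.scale_right_distrib mult.commute)

lemma commutant_id: "(\<lambda>x. x) \<in> commutant"
  by (auto simp: commutant_def linear_op_id)

lemma commutant_compose:
  assumes "c \<in> commutant" "d \<in> commutant"
  shows "(\<lambda>x. c (d x)) \<in> commutant"
  using commutantD[OF assms(1)] commutantD[OF assms(2)]
  by (auto simp: commutant_def linear_op_compose)

lemma commutant_add: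
  assumes "c \<in> commutant" "d \<in> commutant"
  shows "(\<lambda>x. c x + d x) \<in> commutant"
  using commutantD[OF assms(1)] commutantD[OF assms(2)] vs1.subspace_add[OF subspace_T]
  by (auto simp: commutant_def linear_op_add linear_op_simps[OF linear_act])

lemma commutant_scale:
  assumes "c \<in> commutant"
  shows "(\<lambda>x. scale s (c x)) \<in> commutant"
  using commutantD[OF assms(1)] vs1.subspace_scale[OF subspace_T]
  by (auto simp: commutant_def linear_op_scale linear_op_simps[OF linear_act])

lemma act_in_bicommutant: "g \<in> carrier G \<Longrightarrow> act g \<in> bicommutant"
  unfolding bicommutant_def using linear_act act_closed commutantD(3)[symmetric] by blast

lemma bicommutantD:
  assumes "a \<in> bicommutant"
  shows "linear_op a" "x \<in> T \<Longrightarrow> a x \<in> T" "c \<in> commutant \<Longrightarrow> x \<in> T \<Longrightarrow> a (c x) = c (a x)"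
  using assms by (auto simp: bicommutant_def)

lemma invariant_kernel:
  assumes U: "invariant F U" and f: "linear_op f"
    and eq: "\<And>h x. h \<in> F \<Longrightarrow> x \<in> U \<Longrightarrow> f (h x) = h (f x)"
    and F: "\<And>h. h \<in> F \<Longrightarrow> linear_op h"
  shows "invariant F {x\<in>U. f x = 0}"
proof -
  note S = invariantD(1)[OF U]
  have "vs1.subspace {x\<in>U. f x = 0}"
    by (rule vs1.subspaceI) (auto simp: linear_op_simps[OF f] vs1.subspace_0[OF S]
        vs1.subspace_add[OF S] vs1.subspace_scale[OF S])
  then show ?thesis
    using U linear_op_simps(3)[OF F] unfolding invariant_def by (auto simp: eq)
qed

lemma invariant_image:
  assumes U: "invariant F U" and f: "linear_op f" "f ` U \<subseteq> T"
    and eq: "\<And>h x. h \<in> F \<Longrightarrow> x \<in> U \<Longrightarrow> f (h x) = h (f x)"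
  shows "invariant F (f ` U)"
proof -
  have "vs1.subspace (f ` U)"
    using linear_subspace_image[OF f(1) invariantD(1)[OF U]] .
  moreover have "h (f x) \<in> f ` U" if "h \<in> F" "x \<in> U" for h x
    using that eq invariantD(3)[OF U] by (metis imageI)
  ultimately show ?thesis using f(2) by (auto simp: invariant_def)
qed

lemma invariant_Int: "invariant F U \<Longrightarrow> invariant F U' \<Longrightarrow> invariant F (U \<inter> U')"
  by (auto simp: invariant_def vs1.subspace_inter)

lemma invariant_preimage:
  assumes U: "invariant F U" and U': "invariant F U'" and f: "linear_op f"
    and eq: "\<And>h x. h \<in> F \<Longrightarrow> x \<in> U \<Longrightarrow> f (h x) = h (f x)"
  shows "invariant F {x\<in>U. f x \<in> U'}"
proof -
  note S = invariantD(1)[OF U] and S' = invariantD(1)[OF U']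
  have "vs1.subspace {x\<in>U. f x \<in> U'}"
    by (rule vs1.subspaceI) (auto simp: linear_op_simps[OF f] vs1.subspace_0[OF S] vs1.subspace_0[OF S']
        vs1.subspace_add[OF S] vs1.subspace_scale[OF S] vs1.subspace_add[OF S'] vs1.subspace_scale[OF S'])
  then show ?thesis
    using invariantD[OF U] invariantD[OF U'] unfolding invariant_def by (auto simp: eq)
qed

lemma inj_onI_kernel:
  assumes "linear_op f" "vs1.subspace U" "\<And>x. x \<in> U \<Longrightarrow> f x = 0 \<Longrightarrow> x = 0"
  shows "inj_on f U"
proof (rule inj_onI)
  fix x y assume "x \<in> U" "y \<in> U" "f x = f y"
  then have "x - y \<in> U" "f (x - y) = 0"
    using vs1.subspace_diff[OF assms(2)] linear_op_simps[OF assms(1)] by auto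
  then show "x = y" using assms(3) by force
qed

text \<open>Half of Schur's lemma: the kernel of an equivariant map is invariant.\<close>

lemma simple_injective:
  assumes U: "simple F U" and f: "linear_op f" and F: "\<And>h. h \<in> F \<Longrightarrow> linear_op h"
    and eq: "\<And>h x. h \<in> F \<Longrightarrow> x \<in> U \<Longrightarrow> f (h x) = h (f x)"
    and t: "t \<in> U" "f t \<noteq> 0"
  shows "inj_on f U"
proof -
  have inv: "invariant F U" by (rule simpleD(1)[OF U])
  have "invariant F {x\<in>U. f x = 0}" by (rule invariant_kernel[OF inv f eq F])
  moreover have "{x\<in>U. f x = 0} \<noteq> U" using t by blast
  ultimately have "{x\<in>U. f x = 0} = {0}"
    using simpleD(3)[OF U, of "{x\<in>U. f x = 0}"] by blast
  then have "x = 0" if "x \<in> U" "f x = 0" for x using that by blast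
  then show ?thesis by (rule inj_onI_kernel[OF f invariantD(1)[OF inv]])
qed

text \<open>The intersection is a nonzero invariant subspace of the simple one.\<close>

lemma simple_eqI:
  assumes "simple F U" "invariant F U'" "t \<in> U'" "t \<in> U" "t \<noteq> 0"
  shows "U \<subseteq> U'"
proof -
  have "U \<inter> U' = U"
    by (rule simpleD(3)[OF assms(1) invariant_Int[OF simpleD(1)[OF assms(1)] assms(2)]])
      (use assms(3-5) in auto)
  then show ?thesis by blast
qed

text \<open>
  Maschke's theorem: averaging the conjugates of an arbitrary linear projection onto
  \<open>N\<close> gives one that commutes with the group.
\<close>

lemma commutant_projection:
  assumes N: "invariant (act ` carrier G) N"
  obtains p where "p \<in> commutant" "\<And>x. p x \<in> N" "\<And>x. x \<in> N \<Longrightarrow> p x = x"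
proof -
  note S = invariantD(1)[OF N]
  obtain q where q: "range q \<subseteq> N" "linear_op q" "\<And>v. v \<in> N \<Longrightarrow> q v = v"
    using linear_exists_left_inverse_on[OF linear_op_id S] by (auto simp: inj_on_def)
  let ?c = "of_nat (card (carrier G)) :: 'k"
  define s where "s x = (\<Sum>g\<in>carrier G. act g (q (act (inv\<^bsub>G\<^esub> g) x)))" for x
  define p where "p x = scale (inverse ?c) (s x)" for x
  have lin_s: "linear_op s"
    unfolding s_def
    by (intro linear_compose_sum ballI
        linear_op_compose[OF linear_act linear_op_compose[OF q(2) linear_act]]) auto
  then have lin: "linear_op p" unfolding p_def by (rule linear_op_scale)
  have act_N: "act g x \<in> N" if "g \<in> carrier G" "x \<in> N" for g x
    using invariantD(3)[OF N, of "act g"] that by auto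
  have s_N: "s x \<in> N" for x
    unfolding s_def using q(1) by (intro vs1.subspace_sum[OF S] act_N) auto
  have p_N: "p x \<in> N" for x
    unfolding p_def by (intro vs1.subspace_scale[OF S] s_N)
  have p_id: "p x = x" if x: "x \<in> N" for x
  proof -
    have "act g (q (act (inv\<^bsub>G\<^esub> g) x)) = x" if g: "g \<in> carrier G" for g
    proof -
      have "act (inv\<^bsub>G\<^esub> g) x \<in> N" using g x by (intro act_N) auto
      then have "act g (q (act (inv\<^bsub>G\<^esub> g) x)) = act (g \<otimes>\<^bsub>G\<^esub> inv\<^bsub>G\<^esub> g) x"
        using g x invariantD(2)[OF N] q(3) act_mult[of g "inv\<^bsub>G\<^esub> g" x] by simp
      then show ?thesis using g x invariantD(2)[OF N] by (simp add: act_one)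
    qed
    then have "s x = scale ?c x" by (simp add: s_def vs1.sum_constant_scale)
    then show ?thesis using order_nonzero by (simp add: p_def)
  qed
  \<comment> \<open>reindexing the average by \<open>g \<mapsto> h g\<close>\<close>
  have comm: "s (act h x) = act h (s x)" if h: "h \<in> carrier G" and x: "x \<in> T" for h x
  proof -
    have "s (act h x) = (\<Sum>g\<in>carrier G. act (h \<otimes>\<^bsub>G\<^esub> g) (q (act (inv\<^bsub>G\<^esub> (h \<otimes>\<^bsub>G\<^esub> g)) (act h x))))"
      unfolding s_def
      by (rule sum.reindex_bij_witness[where i = "\<lambda>g. h \<otimes>\<^bsub>G\<^esub> g" and j = "\<lambda>g. inv\<^bsub>G\<^esub> h \<otimes>\<^bsub>G\<^esub> g"])
        (use h in \<open>auto simp: m_assoc[symmetric]\<close>)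
    also have "\<dots> = (\<Sum>g\<in>carrier G. act h (act g (q (act (inv\<^bsub>G\<^esub> g) x))))"
    proof (rule sum.cong[OF refl])
      fix g assume g: "g \<in> carrier G"
      have "act (inv\<^bsub>G\<^esub> (h \<otimes>\<^bsub>G\<^esub> g)) (act h x) = act (inv\<^bsub>G\<^esub> (h \<otimes>\<^bsub>G\<^esub> g) \<otimes>\<^bsub>G\<^esub> h) x"
        using g h x by (simp add: act_mult)
      also have "inv\<^bsub>G\<^esub> (h \<otimes>\<^bsub>G\<^esub> g) \<otimes>\<^bsub>G\<^esub> h = inv\<^bsub>G\<^esub> g"
        using g h by (simp add: inv_mult_group m_assoc)
      finally show "act (h \<otimes>\<^bsub>G\<^esub> g) (q (act (inv\<^bsub>G\<^esub> (h \<otimes>\<^bsub>G\<^esub> g)) (act h x))) =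
          act h (act g (q (act (inv\<^bsub>G\<^esub> g) x)))"
        using g h q(1) invariantD(2)[OF N] by (subst act_mult) auto
    qed
    also have "\<dots> = act h (s x)"
      unfolding s_def by (simp add: linear_sum[OF linear_act[OF h]])
    finally show ?thesis .
  qed
  have "p \<in> commutant"
    unfolding commutant_def
    using lin p_N invariantD(2)[OF N] comm linear_op_simps(2)[OF linear_act]
    by (auto simp: p_def)
  then show thesis using that p_N p_id by blast
qed

text \<open>
  Composing with the projection onto \<open>N\<close> turns a map that is equivariant on
  \<open>N\<close> into an element of the commutant.
\<close>

lemma commutant_extend:
  assumes N: "invariant (act ` carrier G) N" and f: "linear_op f" "f ` N \<subseteq> T"
    and eq: "\<And>g x. g \<in> carrier G \<Longrightarrow> x \<in> N \<Longrightarrow> f (act g x) = act g (f x)"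
  obtains c where "c \<in> commutant" "\<And>x. x \<in> N \<Longrightarrow> c x = f x"
proof -
  obtain p where p: "p \<in> commutant" "\<And>x. p x \<in> N" "\<And>x. x \<in> N \<Longrightarrow> p x = x"
    using commutant_projection[OF N] by blast
  have "(\<lambda>x. f (p x)) \<in> commutant"
    using commutantD[OF p(1)] f p(2) by (auto simp: commutant_def linear_op_compose eq)
  then show thesis using p(3) by (intro that[of "\<lambda>x. f (p x)"]) auto
qed

lemma invariant_orbit_commutant:
  assumes "t \<in> T"
  shows "invariant commutant ((\<lambda>c. c t) ` commutant)"
proof -
  have "vs1.subspace ((\<lambda>c. c t) ` commutant)"
  proof (rule vs1.subspaceI)
    show "0 \<in> (\<lambda>c. c t) ` commutant"
      using commutant_scale[OF commutant_id, of 0] by (force simp: image_iff)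
  next
    fix x y assume "x \<in> (\<lambda>c. c t) ` commutant" "y \<in> (\<lambda>c. c t) ` commutant"
    then show "x + y \<in> (\<lambda>c. c t) ` commutant" using commutant_add by (force simp: image_iff)
  next
    fix a x assume "x \<in> (\<lambda>c. c t) ` commutant"
    then show "scale a x \<in> (\<lambda>c. c t) ` commutant" using commutant_scale by (force simp: image_iff)
  qed
  moreover have "d (c t) \<in> (\<lambda>c. c t) ` commutant" if "c \<in> commutant" "d \<in> commutant" for c d
    using commutant_compose[OF that(2,1)] by (force simp: image_iff)
  ultimately show ?thesis using assms commutantD(2) by (auto simp: invariant_def)
qed

lemma simple_commutant_orbit:
  assumes "simple commutant U" "t \<in> U" "t \<noteq> 0"
  shows "U = (\<lambda>c. c t) ` commutant"
proof
  have inv: "invariant commutant U" using assms(1) by (rule simpleD(1))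
  show "U \<subseteq> (\<lambda>c. c t) ` commutant"
    using simple_eqI[OF assms(1) invariant_orbit_commutant] assms invariantD(2)[OF inv] commutant_id
    by (force simp: image_iff)
  show "(\<lambda>c. c t) ` commutant \<subseteq> U"
    using invariantD(3)[OF inv] assms by auto
qed

text \<open>
  If \<open>c t \<noteq> 0\<close>, then \<open>c\<close> is injective on the simple module
  \<open>N\<close>, and the inverse \<open>c ` N \<rightarrow> N\<close> extends to an element of
  the commutant. Thus every nonzero vector \<open>c t\<close> of the orbit generates
  \<open>t\<close>, hence the whole orbit.
\<close>

lemma simple_orbit_commutant:
  assumes N: "simple (act ` carrier G) N" and t: "t \<in> N" "t \<noteq> 0"
  shows "simple commutant ((\<lambda>c. c t) ` commutant)"
proof -
  have inv: "invariant (act ` carrier G) N" by (rule simpleD(1)[OF N])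
  have tT: "t \<in> T" using invariantD(2)[OF inv] t by auto
  have "U' = {0} \<or> U' = (\<lambda>c. c t) ` commutant"
    if U': "U' \<subseteq> (\<lambda>c. c t) ` commutant" "invariant commutant U'" for U'
  proof (cases "U' = {0}")
    case False
    then obtain c where c: "c \<in> commutant" "c t \<in> U'" "c t \<noteq> 0"
      using U' invariantD(4)[OF U'(2)] by blast
    note lin = commutantD(1)[OF c(1)]
    have eq: "c (h x) = h (c x)" if "h \<in> act ` carrier G" "x \<in> N" for h x
      using that commutantD(3)[OF c(1)] invariantD(2)[OF inv] by auto
    have inj: "inj_on c N"
      by (rule simple_injective[OF N lin _ eq t(1) c(3)]) (auto simp: linear_act)
    obtain d where d: "linear_op d" "\<And>x. d x \<in> N" "\<And>x. x \<in> N \<Longrightarrow> d (c x) = x"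
      using linear_exists_left_inverse_on[OF lin invariantD(1)[OF inv] inj] by auto
    have cN: "invariant (act ` carrier G) (c ` N)"
      by (rule invariant_image[OF inv lin _ eq]) (use commutantD(2)[OF c(1)] invariantD(2)[OF inv] in auto)
    have "d (act g x) = act g (d x)" if g: "g \<in> carrier G" and x: "x \<in> c ` N" for g x
    proof -
      obtain y where y: "y \<in> N" "x = c y" using x by auto
      have "act g y \<in> N" using invariantD(3)[OF inv] g y by auto
      then show ?thesis using y g d eq[of "act g" y] by (metis imageI)
    qed
    then obtain d' where d': "d' \<in> commutant" "\<And>x. x \<in> c ` N \<Longrightarrow> d' x = d x"
      using commutant_extend[OF cN d(1)] d(2) invariantD(2)[OF inv] by blast
    have "d' (c t) \<in> U'" using invariantD(3)[OF U'(2) d'(1)] c by auto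
    then have "t \<in> U'" using d' d t by auto
    then have "(\<lambda>c. c t) ` commutant \<subseteq> U'" using invariantD(3)[OF U'(2)] by auto
    then show ?thesis using U' by auto
  qed auto
  moreover have "(\<lambda>c. c t) ` commutant \<noteq> {0}" using commutant_id t by force
  ultimately show ?thesis using invariant_orbit_commutant[OF tT] by (simp add: simple_def)
qed

text \<open>A nonzero invariant subspace of least dimension is simple.\<close>

lemma exists_simple_subspace:
  assumes "invariant F N" "N \<noteq> {0}"
  shows "\<exists>N'\<subseteq>N. simple F N'"
  using assms
proof (induction "vs1.dim N" arbitrary: N rule: less_induct)
  case less
  show ?case
  proof (cases "simple F N")
    case False
    then obtain N' where N': "N' \<subseteq> N" "invariant F N'" "N' \<noteq> {0}" "N' \<noteq> N"
      using less.prems unfolding simple_def by blast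
    obtain B where B: "B \<subseteq> N'" "vs1.independent B" "N' \<subseteq> vs1.span B"
      using vs1.maximal_independent_subset .
    obtain B' where B': "B \<subseteq> B'" "B' \<subseteq> N" "vs1.independent B'" "N \<subseteq> vs1.span B'"
      using vs1.maximal_independent_subset_extend[of B N] B N'(1) by blast
    obtain E where E: "finite E" "T \<subseteq> vs1.span E" using finite_dim by blast
    have "B' \<subseteq> vs1.span E" using B' E less.prems(1) unfolding invariant_def by auto
    then have fin: "finite B'" using vs1.independent_span_bound[OF E(1) B'(3)] by auto
    have spB: "vs1.span B = N'"
      using B vs1.span_minimal[OF B(1) invariantD(1)[OF N'(2)]] by auto
    have spB': "vs1.span B' = N"
      using B' vs1.span_minimal[OF B'(2) invariantD(1)[OF less.prems(1)]] by auto
    have "B \<noteq> B'" using spB spB' N' by auto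
    then have "card B < card B'" using B' fin by (metis psubset_card_mono psubsetI)
    then have "vs1.dim N' < vs1.dim N"
      using vs1.dim_span_eq_card_independent B(2) B'(3) spB spB' by metis
    then show ?thesis using less.hyps N' by (meson order_trans)
  qed auto
qed

text \<open>
  Start from the group module generated by a nonzero \<open>t \<in> U\<close> and take a simple
  submodule \<open>N\<close> of it. The projection \<open>p\<close> onto \<open>N\<close> lies in
  the commutant, so \<open>p t \<in> N \<inter> U\<close>; if \<open>p t\<close> were zero, then
  \<open>p\<close> would vanish on the module generated by \<open>t\<close>, which contains
  \<open>N\<close>.
\<close>

lemma simple_commutant_meets_simple:
  assumes U: "simple commutant U"
  shows "\<exists>N. simple (act ` carrier G) N \<and> N \<inter> U \<noteq> {0}"
proof -
  have inv: "invariant commutant U" by (rule simpleD(1)[OF U])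
  obtain t where t: "t \<in> U" "t \<noteq> 0" using U invariantD(4)[OF inv] by (auto simp: simple_def)
  have tT: "t \<in> T" using invariantD(2)[OF inv] t by auto
  define N0 where "N0 = vs1.span ((\<lambda>g. act g t) ` carrier G)"
  have tN0: "t \<in> N0" unfolding N0_def
    by (rule vs1.span_base) (use act_one[OF tT] in \<open>auto intro!: image_eqI[where x = "\<one>\<^bsub>G\<^esub>"]\<close>)
  have "act h x \<in> N0" if h: "h \<in> carrier G" and x: "x \<in> N0" for h x
  proof -
    have "act h ` N0 = vs1.span (act h ` (\<lambda>g. act g t) ` carrier G)"
      unfolding N0_def using linear_span_image[OF linear_act[OF h]] by simp
    also have "act h ` (\<lambda>g. act g t) ` carrier G \<subseteq> (\<lambda>g. act g t) ` carrier G"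
      using h tT by (auto simp: act_mult[symmetric])
    finally show ?thesis using x vs1.span_mono unfolding N0_def by blast
  qed
  moreover have "N0 \<subseteq> T" unfolding N0_def
    by (rule vs1.span_minimal[OF _ subspace_T]) (use act_closed tT in auto)
  ultimately have "invariant (act ` carrier G) N0"
    by (auto simp: invariant_def N0_def vs1.subspace_span)
  moreover have "N0 \<noteq> {0}" using tN0 t by auto
  ultimately obtain N where N: "N \<subseteq> N0" "simple (act ` carrier G) N"
    using exists_simple_subspace by blast
  have invN: "invariant (act ` carrier G) N" by (rule simpleD(1)[OF N(2)])
  obtain p where p: "p \<in> commutant" "\<And>x. p x \<in> N" "\<And>x. x \<in> N \<Longrightarrow> p x = x"
    using commutant_projection[OF invN] by blast
  have "p t \<noteq> 0"
  proof
    assume "p t = 0"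
    then have "p x = 0" if "x \<in> (\<lambda>g. act g t) ` carrier G" for x
      using that commutantD(3)[OF p(1)] tT linear_op_simps(3)[OF linear_act] by auto
    then have "p x = 0" if "x \<in> N0" for x
      using that linear_eq_0_on_span[OF commutantD(1)[OF p(1)]] unfolding N0_def by blast
    then have "N = {0}" using N(1) p(3) invariantD(4)[OF invN] by force
    then show False using N(2) by (simp add: simple_def)
  qed
  moreover have "p t \<in> U" using invariantD(3)[OF inv p(1)] t by auto
  ultimately show ?thesis using N(2) p(2)[of t] by blast
qed

text \<open>
  The bicommutant is an algebra containing the group, so its orbit of \<open>t\<close> is a group
  submodule.
\<close>

lemma bicommutant_transitive:
  assumes N: "simple (act ` carrier G) N" and t: "t \<in> N" "t \<noteq> 0" and t': "t' \<in> N"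
  obtains a where "a \<in> bicommutant" "a t = t'"
proof -
  have inv: "invariant (act ` carrier G) N" by (rule simpleD(1)[OF N])
  have tT: "t \<in> T" using invariantD(2)[OF inv] t by auto
  let ?O = "(\<lambda>a. a t) ` bicommutant"
  note cl = linear_op_simps[OF commutantD(1)] and S = subspace_T
  have id: "(\<lambda>x. x) \<in> bicommutant" by (auto simp: bicommutant_def linear_op_id)
  have add: "(\<lambda>x. a x + b x) \<in> bicommutant" if "a \<in> bicommutant" "b \<in> bicommutant" for a b
    using bicommutantD[OF that(1)] bicommutantD[OF that(2)]
    by (auto simp: bicommutant_def linear_op_add cl vs1.subspace_add[OF S])
  have scale: "(\<lambda>x. scale s (a x)) \<in> bicommutant" if "a \<in> bicommutant" for a s
    using bicommutantD[OF that(1)]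
    by (auto simp: bicommutant_def linear_op_scale cl vs1.subspace_scale[OF S])
  have compose: "(\<lambda>x. a (b x)) \<in> bicommutant" if "a \<in> bicommutant" "b \<in> bicommutant" for a b
    using bicommutantD[OF that(1)] bicommutantD[OF that(2)]
    by (auto simp: bicommutant_def linear_op_compose)
  have "vs1.subspace ?O"
  proof (rule vs1.subspaceI)
    show "0 \<in> ?O" using scale[OF id, of 0] by (force simp: image_iff)
  next
    fix x y assume "x \<in> ?O" "y \<in> ?O"
    then show "x + y \<in> ?O" using add by (force simp: image_iff)
  next
    fix a x assume "x \<in> ?O"
    then show "scale a x \<in> ?O" using scale by (force simp: image_iff)
  qed
  moreover have "?O \<subseteq> T" using bicommutantD(2) tT by auto
  moreover have "act g (a t) \<in> ?O" if "g \<in> carrier G" "a \<in> bicommutant" for g a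
    using compose[OF act_in_bicommutant[OF that(1)] that(2)] by (force simp: image_iff)
  ultimately have "invariant (act ` carrier G) ?O" by (auto simp: invariant_def)
  moreover have "t \<in> ?O" using id by (force simp: image_iff)
  ultimately have "N \<subseteq> ?O" using simple_eqI[OF N] t by auto
  then show thesis using t' that by auto
qed

text \<open>
  An isomorphism \<open>N \<rightarrow> N'\<close> extends to some \<open>c\<close> in the
  commutant, and \<open>c t\<close> is a nonzero vector of \<open>U\<close> inside
  \<open>N'\<close>. An element \<open>a\<close> of the bicommutant moves \<open>c t\<close> to
  the chosen vector \<open>t'\<close> of \<open>N' \<inter> U'\<close>. Since \<open>a\<close>
  commutes with the commutant, and \<open>U\<close> and \<open>U'\<close> are the orbits of
  \<open>c t\<close> and \<open>t'\<close>, it restricts to an isomorphism \<open>U \<rightarrow>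
  U'\<close>.
\<close>

lemma commutant_iso_of_group_iso:
  assumes N: "simple (act ` carrier G) N" and N': "simple (act ` carrier G) N'"
    and U: "simple commutant U" and U': "simple commutant U'"
    and meet: "N \<inter> U \<noteq> {0}" "N' \<inter> U' \<noteq> {0}"
    and \<phi>: "intertwines (act ` carrier G) N N' \<phi>"
  shows "\<exists>\<psi>. intertwines commutant U U' \<psi>"
proof -
  have inv: "invariant (act ` carrier G) N" "invariant (act ` carrier G) N'"
    "invariant commutant U" "invariant commutant U'"
    by (rule simpleD(1)[OF N] simpleD(1)[OF N'] simpleD(1)[OF U] simpleD(1)[OF U'])+
  obtain t where t: "t \<in> N" "t \<in> U" "t \<noteq> 0"
    by (rule nonzero_common_element[OF inv(1,3) meet(1)])
  obtain t' where t': "t' \<in> N'" "t' \<in> U'" "t' \<noteq> 0"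
    by (rule nonzero_common_element[OF inv(2,4) meet(2)])
  have \<phi>': "linear_op \<phi>" "\<phi> ` N = N'" "inj_on \<phi> N"
    "\<And>g x. g \<in> carrier G \<Longrightarrow> x \<in> N \<Longrightarrow> \<phi> (act g x) = act g (\<phi> x)"
    using \<phi> by (auto simp: intertwines_def bij_betw_def)
  have "\<phi> ` N \<subseteq> T" using \<phi>'(2) invariantD(2)[OF inv(2)] by auto
  from commutant_extend[OF inv(1) \<phi>'(1) this \<phi>'(4)]
  obtain c where c: "c \<in> commutant" "\<And>x. x \<in> N \<Longrightarrow> c x = \<phi> x" by blast
  have ct: "c t \<in> U" "c t \<in> N'" "c t \<noteq> 0"
    using invariantD(3)[OF inv(3) c(1) t(2)] imageI[of t N \<phi>] t c(2) \<phi>'(2)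
      inj_onD[OF \<phi>'(3), of t 0] linear_op_simps(3)[OF \<phi>'(1)] invariantD(4)[OF inv(1)]
    by auto
  obtain a where a: "a \<in> bicommutant" "a (c t) = t'"
    using bicommutant_transitive[OF N' ct(2,3) t'(1)] .
  have ctT: "c t \<in> T" using ct invariantD(2)[OF inv(3)] by auto
  have Ueq: "U = (\<lambda>d. d (c t)) ` commutant" by (rule simple_commutant_orbit[OF U ct(1,3)])
  have U'eq: "U' = (\<lambda>d. d t') ` commutant" by (rule simple_commutant_orbit[OF U' t'(2,3)])
  have eq: "a (d x) = d (a x)" if "d \<in> commutant" "x \<in> U" for d x
    using bicommutantD(3)[OF a(1) that(1)] invariantD(2)[OF inv(3) that(2)] .
  have "inj_on a U"
    by (rule simple_injective[OF U bicommutantD(1)[OF a(1)] commutantD(1) eq ct(1)])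
      (use a t' in auto)
  moreover have "a ` U = U'"
    unfolding Ueq U'eq image_image using bicommutantD(3)[OF a(1) _ ctT] a(2) by auto
  ultimately have "intertwines commutant U U' a"
    unfolding intertwines_def bij_betw_def using eq bicommutantD(1)[OF a(1)] by blast
  then show ?thesis by blast
qed

text \<open>
  The isomorphism goes from \<open>N'\<close> to \<open>N\<close>: it is given by an element
  \<open>c\<close> of the commutant that maps \<open>t' \<in> N' \<inter> U'\<close> to
  \<open>\<psi> t\<close>, where \<open>t \<in> N \<inter> U\<close>. Such a \<open>c\<close>
  exists because \<open>U'\<close> is the orbit of \<open>t'\<close>.
\<close>

lemma group_iso_of_commutant_iso:
  assumes N: "simple (act ` carrier G) N" and N': "simple (act ` carrier G) N'"
    and U: "simple commutant U" and U': "simple commutant U'"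
    and meet: "N \<inter> U \<noteq> {0}" "N' \<inter> U' \<noteq> {0}"
    and \<psi>: "intertwines commutant U U' \<psi>"
  shows "\<exists>\<phi>. intertwines (act ` carrier G) N' N \<phi>"
proof -
  have inv: "invariant (act ` carrier G) N" "invariant (act ` carrier G) N'"
    "invariant commutant U" "invariant commutant U'"
    by (rule simpleD(1)[OF N] simpleD(1)[OF N'] simpleD(1)[OF U] simpleD(1)[OF U'])+
  obtain t where t: "t \<in> N" "t \<in> U" "t \<noteq> 0"
    by (rule nonzero_common_element[OF inv(1,3) meet(1)])
  obtain t' where t': "t' \<in> N'" "t' \<in> U'" "t' \<noteq> 0"
    by (rule nonzero_common_element[OF inv(2,4) meet(2)])
  have \<psi>': "linear_op \<psi>" "\<psi> ` U = U'" "inj_on \<psi> U"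
    "\<And>c x. c \<in> commutant \<Longrightarrow> x \<in> U \<Longrightarrow> \<psi> (c x) = c (\<psi> x)"
    using \<psi> by (auto simp: intertwines_def bij_betw_def)
  obtain p where p: "p \<in> commutant" "\<And>x. p x \<in> N" "\<And>x. x \<in> N \<Longrightarrow> p x = x"
    using commutant_projection[OF inv(1)] by blast
  \<comment> \<open>\<open>\<psi>\<close> commutes with the projection \<open>p\<close> onto \<open>N\<close>,
    which fixes \<open>t\<close>; hence \<open>\<psi> t\<close> again lies in \<open>N\<close>\<close>
  have "\<psi> t = p (\<psi> t)" using \<psi>'(4)[OF p(1) t(2)] unfolding p(3)[OF t(1)] .
  then have "\<psi> t \<in> N" using p(2)[of "\<psi> t"] by metis
  then have \<psi>t: "\<psi> t \<in> N" "\<psi> t \<in> U'" "\<psi> t \<noteq> 0"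
    using imageI[OF t(2), of \<psi>] \<psi>'(2) inj_onD[OF \<psi>'(3) _ t(2) invariantD(4)[OF inv(3)]] t(3)
      linear_op_simps(3)[OF \<psi>'(1)] by auto
  then obtain c where c: "c \<in> commutant" "c t' = \<psi> t"
    using simple_commutant_orbit[OF U' t'(2,3)] by auto
  have eq: "c (h x) = h (c x)" if "h \<in> act ` carrier G" "x \<in> N'" for h x
    using that commutantD(3)[OF c(1)] invariantD(2)[OF inv(2)] by auto
  note lin = commutantD(1)[OF c(1)]
  have "inj_on c N'"
    by (rule simple_injective[OF N' lin _ eq t'(1)]) (use c(2) \<psi>t(3) linear_act in auto)
  moreover have "c ` N' = N"
  proof
    have "invariant (act ` carrier G) (c ` N')"
      by (rule invariant_image[OF inv(2) lin _ eq]) (use commutantD(2)[OF c(1)] invariantD(2)[OF inv(2)] in auto)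
    moreover have "\<psi> t \<in> c ` N'" using imageI[OF t'(1), of c] c(2) by metis
    ultimately show "N \<subseteq> c ` N'" by (rule simple_eqI[OF N _ _ \<psi>t(1,3)])
    have "invariant (act ` carrier G) {x\<in>N'. c x \<in> N}"
      by (rule invariant_preimage[OF inv(2,1) lin eq])
    moreover have "t' \<in> {x\<in>N'. c x \<in> N}" using t'(1) \<psi>t(1) c(2) by simp
    ultimately have "N' \<subseteq> {x\<in>N'. c x \<in> N}" by (rule simple_eqI[OF N' _ _ t'(1,3)])
    then show "c ` N' \<subseteq> N" by auto
  qed
  ultimately have "intertwines (act ` carrier G) N' N c"
    unfolding intertwines_def bij_betw_def using eq lin by blast
  then show ?thesis by blast
qed

end

section \<open>Coordinate spaces and matrices\<close>

definition fscale :: "'k::field \<Rightarrow> ('i \<Rightarrow> 'k) \<Rightarrow> 'i \<Rightarrow> 'k" where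
  "fscale c u = (\<lambda>i. c * u i)"

interpretation fs: vector_space "fscale :: 'k::field \<Rightarrow> ('i \<Rightarrow> 'k) \<Rightarrow> 'i \<Rightarrow> 'k"
  by unfold_locales (auto simp: fscale_def algebra_simps)

interpretation fsp: vector_space_pair
  "fscale :: 'k::field \<Rightarrow> ('i \<Rightarrow> 'k) \<Rightarrow> 'i \<Rightarrow> 'k" "fscale :: 'k::field \<Rightarrow> ('j \<Rightarrow> 'k) \<Rightarrow> 'j \<Rightarrow> 'k"
  by unfold_locales

abbreviation flinear :: "(('i \<Rightarrow> 'k::field) \<Rightarrow> 'j \<Rightarrow> 'k) \<Rightarrow> bool" where
  "flinear \<equiv> Vector_Spaces.linear fscale fscale"

definition unit_vec :: "'i \<Rightarrow> 'i \<Rightarrow> 'k::field" where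
  "unit_vec i = (\<lambda>j. if j = i then 1 else 0)"

lemma flinearI:
  assumes "\<And>x y. f (x + y) = f x + f y" "\<And>c x. f (fscale c x) = fscale c (f x)"
  shows "flinear f"
  using assms by unfold_locales auto

lemma flinear_simps:
  assumes "flinear f"
  shows "f (x + y) = f x + f y" "f (fscale c x) = fscale c (f x)" "f 0 = 0" "f (x - y) = f x - f y"
    "f (\<Sum>a\<in>A. g a) = (\<Sum>a\<in>A. f (g a))"
proof -
  interpret f: Vector_Spaces.linear fscale fscale f by fact
  show "f (x + y) = f x + f y" "f (fscale c x) = fscale c (f x)" "f 0 = 0" "f (x - y) = f x - f y"
    "f (\<Sum>a\<in>A. g a) = (\<Sum>a\<in>A. f (g a))"
    by (simp_all add: f.add f.scale f.zero f.diff f.sum)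
qed

lemma flinear_compose: "flinear f \<Longrightarrow> flinear g \<Longrightarrow> flinear (\<lambda>x. f (g x))"
  by (rule flinearI) (metis flinear_simps(1), metis flinear_simps(2))

lemma sum_fun_apply: "(\<Sum>a\<in>A. f a) i = (\<Sum>a\<in>A. f a i)"
  by (induction A rule: infinite_finite_induct) auto

lemma is_subspace_iff: "is_subspace I U \<longleftrightarrow> fs.subspace U \<and> U \<subseteq> coord_space I"
  unfolding is_subspace_def fs.subspace_def by (auto simp: plus_fun_def fscale_def zero_fun_def)

lemma subspace_coord_space: "fs.subspace (coord_space I)"
  by (rule fs.subspaceI) (auto simp: coord_space_def fscale_def)

lemma zero_in_coord_space: "0 \<in> coord_space I"
  by (simp add: coord_space_def)

lemma unit_vec_in: "i \<in> I \<Longrightarrow> unit_vec i \<in> coord_space I"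
  by (auto simp: coord_space_def unit_vec_def)

lemma flinear_lin_map: "flinear (lin_map I J T)"
  by (rule flinearI)
    (auto simp: lin_map_def fun_eq_iff fscale_def algebra_simps sum.distrib sum_distrib_left)

lemma lin_map_in: "lin_map I J T u \<in> coord_space J"
  by (simp add: lin_map_def coord_space_def)

lemma lin_map_cong:
  "(\<And>i j. i \<in> I \<Longrightarrow> j \<in> J \<Longrightarrow> T j i = S j i) \<Longrightarrow> lin_map I J T = lin_map I J S"
  by (auto simp: lin_map_def fun_eq_iff intro!: sum.cong)

lemma lin_map_unit_vec:
  "finite I \<Longrightarrow> i \<in> I \<Longrightarrow> lin_map I J T (unit_vec i) = (\<lambda>j. if j \<in> J then T j i else 0)"
  by (auto simp: lin_map_def unit_vec_def fun_eq_iff if_distrib cong: if_cong)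

lemma lin_map_compose:
  "finite J \<Longrightarrow> lin_map J K S (lin_map I J T u) = lin_map I K (\<lambda>k i. \<Sum>j\<in>J. S k j * T j i) u"
  by (auto simp: lin_map_def fun_eq_iff sum_distrib_left sum_distrib_right mult.assoc intro: sum.swap)

lemma coord_space_expand:
  assumes "finite I" "u \<in> coord_space I"
  shows "u = (\<Sum>i\<in>I. fscale (u i) (unit_vec i))"
proof
  fix j
  have "(\<Sum>i\<in>I. fscale (u i) (unit_vec i)) j = (\<Sum>i\<in>I. if j = i then u i else 0)"
    by (auto simp: sum_fun_apply fscale_def unit_vec_def intro!: sum.cong)
  also have "\<dots> = u j" using assms by (simp add: coord_space_def)
  finally show "u j = (\<Sum>i\<in>I. fscale (u i) (unit_vec i)) j" ..
qed

lemma coord_space_span: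
  assumes "finite I" shows "coord_space I \<subseteq> fs.span (unit_vec ` I)"
proof
  fix u :: "'a \<Rightarrow> 'b" assume u: "u \<in> coord_space I"
  have "(\<Sum>i\<in>I. fscale (u i) (unit_vec i)) \<in> fs.span (unit_vec ` I)"
    by (intro fs.span_sum fs.span_scale fs.span_base) auto
  then show "u \<in> fs.span (unit_vec ` I)" using coord_space_expand[OF assms u] by simp
qed

lemma flinear_eq_on_coord_space:
  assumes "finite I" "flinear f" "flinear g" "\<And>i. i \<in> I \<Longrightarrow> f (unit_vec i) = g (unit_vec i)"
    and u: "u \<in> coord_space I"
  shows "f u = g u"
  using assms(2-4) by (subst (1 2) coord_space_expand[OF assms(1) u]) (simp add: flinear_simps)

lemma flinear_eq_lin_map:
  assumes "finite I" "flinear f" "\<And>i. i \<in> I \<Longrightarrow> f (unit_vec i) \<in> coord_space J"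
    and u: "u \<in> coord_space I"
  shows "f u = lin_map I J (\<lambda>j i. f (unit_vec i) j) u"
  by (rule flinear_eq_on_coord_space[OF assms(1,2) flinear_lin_map _ u])
    (use assms(3) in \<open>auto simp: lin_map_unit_vec[OF assms(1)] coord_space_def fun_eq_iff\<close>)

lemma lin_map_eq_iff:
  assumes "finite I"
  shows "(\<forall>u\<in>coord_space I. lin_map I J T u = lin_map I J S u) \<longleftrightarrow> (\<forall>i\<in>I. \<forall>j\<in>J. T j i = S j i)"
proof
  assume *: "\<forall>u\<in>coord_space I. lin_map I J T u = lin_map I J S u"
  show "\<forall>i\<in>I. \<forall>j\<in>J. T j i = S j i"
  proof (intro ballI)
    fix i j assume ij: "i \<in> I" "j \<in> J"
    have "lin_map I J T (unit_vec i) j = lin_map I J S (unit_vec i) j"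
      using bspec[OF * unit_vec_in[OF ij(1)]] by simp
    then show "T j i = S j i" using assms ij by (simp add: lin_map_unit_vec)
  qed
next
  assume "\<forall>i\<in>I. \<forall>j\<in>J. T j i = S j i"
  then show "\<forall>u\<in>coord_space I. lin_map I J T u = lin_map I J S u"
    using lin_map_cong[of I J T S] by auto
qed

lemma flinear_left_inverse:
  assumes "flinear f" "fs.subspace U" "inj_on f U"
  obtains p where "flinear p" "\<And>x. p x \<in> U" "\<And>u. u \<in> U \<Longrightarrow> p (f u) = u"
  using fsp.linear_exists_left_inverse_on[OF assms] by auto

lemma lin_map_left_inverse:
  assumes "finite I" "finite J" "inj_on (lin_map I J T) (coord_space I)"
  obtains P where "\<And>u. u \<in> coord_space I \<Longrightarrow> lin_map J I P (lin_map I J T u) = u"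
proof -
  obtain p where p: "flinear p" "\<And>x. p x \<in> coord_space I"
    "\<And>u. u \<in> coord_space I \<Longrightarrow> p (lin_map I J T u) = u"
    using flinear_left_inverse[OF flinear_lin_map subspace_coord_space assms(3)] by blast
  show thesis
    by (rule that[of "\<lambda>i j. p (unit_vec j) i"])
      (simp add: flinear_eq_lin_map[OF assms(2) p(1) p(2) lin_map_in, symmetric] p(3))
qed

text \<open>
  The basis is taken from a given spanning set \<open>H\<close>, so that it can be chosen
  homogeneous. Indexing it by numbers gives an isomorphic copy of \<open>U\<close> as a coordinate
  space over \<open>nat\<close>.
\<close>

lemma subspace_enumerated_basis:
  fixes U :: "('i \<Rightarrow> 'k::field) set"
  assumes I: "finite I" and U: "fs.subspace U" "U \<subseteq> coord_space I" and H: "H \<subseteq> U" "U \<subseteq> fs.span H"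
  obtains d :: nat and e :: "nat \<Rightarrow> 'i \<Rightarrow> 'k"
  where "\<And>j. j < d \<Longrightarrow> e j \<in> H" "inj_on e {..<d}"
    "inj_on (lin_map {..<d} I (\<lambda>i j. e j i)) (coord_space {..<d})"
    "lin_map {..<d} I (\<lambda>i j. e j i) ` coord_space {..<d} = U"
proof -
  obtain B where B: "B \<subseteq> H" "fs.independent B" "H \<subseteq> fs.span B"
    using fs.maximal_independent_subset .
  have "B \<subseteq> fs.span (unit_vec ` I)" using B H U coord_space_span[OF I] by blast
  then have fin: "finite B" using fs.independent_span_bound[OF _ B(2)] I by blast
  obtain e where e: "bij_betw e {..<card B} B"
    using ex_bij_betw_nat_finite[OF fin] by (auto simp: atLeast0LessThan)
  let ?d = "card B" and ?f = "lin_map {..<card B} I (\<lambda>i j. e j i)"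
  have eB: "e j \<in> B" if "j < ?d" for j using e that by (auto simp: bij_betw_def)
  have f: "?f u = (\<Sum>j<?d. fscale (u j) (e j))" for u
  proof
    fix i
    have "(\<Sum>j<?d. fscale (u j) (e j)) i = (\<Sum>j<?d. e j i * u j)"
      by (simp add: sum_fun_apply fscale_def mult.commute)
    also have "\<dots> = ?f u i"
    proof (cases "i \<in> I")
      case False
      then have "e j i = 0" if "j < ?d" for j
        using subsetD[OF U(2), of "e j"] eB[OF that] B(1) H(1) by (auto simp: coord_space_def)
      then show ?thesis using False by (simp add: lin_map_def)
    qed (simp add: lin_map_def)
    finally show "?f u i = (\<Sum>j<?d. fscale (u j) (e j)) i" ..
  qed
  have reindex: "(\<Sum>j<?d. fscale (u (e j)) (e j)) = (\<Sum>b\<in>B. fscale (u b) b)" for u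
    by (rule sum.reindex_bij_betw[OF e])
  define e' where "e' = the_inv_into {..<?d} e"
  have e': "e' (e j) = j" if "j < ?d" for j
    using that e by (auto simp: e'_def bij_betw_def the_inv_into_f_f)
  have inj: "inj_on ?f (coord_space {..<?d})"
  proof (rule inj_onI)
    fix u v :: "nat \<Rightarrow> 'k" assume uv: "u \<in> coord_space {..<?d}" "v \<in> coord_space {..<?d}" "?f u = ?f v"
    have "(\<Sum>j<?d. fscale (u j - v j) (e j)) = 0"
      using uv(3) by (simp add: f fs.scale_left_diff_distrib sum_subtractf)
    then have "(\<Sum>b\<in>B. fscale (u (e' b) - v (e' b)) b) = 0"
      using reindex[of "\<lambda>b. u (e' b) - v (e' b)"] by (simp add: e')
    then have "u (e' b) - v (e' b) = 0" if "b \<in> B" for b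
      using fs.independentD[OF B(2) fin, of "\<lambda>b. u (e' b) - v (e' b)"] that by blast
    then have "u j = v j" if "j < ?d" for j using eB[OF that] e'[OF that] by force
    then have "u j = v j" for j using uv(1,2) by (cases "j < ?d") (auto simp: coord_space_def)
    then show "u = v" by blast
  qed
  have "?f u \<in> U" for u
    unfolding f using eB B(1) H(1) by (intro fs.subspace_sum[OF U(1)] fs.subspace_scale[OF U(1)]) auto
  moreover have "x \<in> ?f ` coord_space {..<?d}" if x: "x \<in> U" for x
  proof -
    have "x \<in> fs.span B"
      using x H(2) fs.span_minimal[OF B(3) fs.subspace_span] by blast
    then obtain c where c: "x = (\<Sum>b\<in>B. fscale (c b) b)"
      using fs.span_finite[OF fin] by auto
    have "x = ?f (\<lambda>j. if j < ?d then c (e j) else 0)"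
      unfolding f c reindex[symmetric] by simp
    moreover have "(\<lambda>j. if j < ?d then c (e j) else 0) \<in> coord_space {..<?d}"
      by (simp add: coord_space_def)
    ultimately show ?thesis by blast
  qed
  ultimately have "?f ` coord_space {..<?d} = U" by auto
  then show thesis
    using that[of ?d e] eB B(1) inj e by (auto simp: bij_betw_def)
qed

section \<open>Linear representations as linear operators\<close>

definition lin_embedding ::
  "('g, 'b) monoid_scheme \<Rightarrow> ('g, 'k::field, 'i) lin_rep \<Rightarrow> ('g, 'k, 'j) lin_rep \<Rightarrow>
    ('j \<Rightarrow> 'i \<Rightarrow> 'k) \<Rightarrow> bool" where
  "lin_embedding G M M' T \<longleftrightarrow> lin_intertwiner G M M' T \<and>
     inj_on (lin_map (lr_basis M) (lr_basis M') T) (coord_space (lr_basis M))"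

text \<open>
  Matrices in the carrier of \<open>End_lin\<close> are functions that are undefined outside the
  basis. Passing to the linear operators that they induce on the coordinate space removes this
  dependence.
\<close>

definition rep_op :: "('g, 'k::field, 'i) lin_rep \<Rightarrow> 'g \<Rightarrow> ('i \<Rightarrow> 'k) \<Rightarrow> 'i \<Rightarrow> 'k" where
  "rep_op M g = lin_map (lr_basis M) (lr_basis M) (lr_act M g)"

lemma flinear_rep_op: "flinear (rep_op M g)"
  by (simp add: rep_op_def flinear_lin_map)

lemma rep_op_in: "rep_op M g u \<in> coord_space (lr_basis M)"
  by (simp add: rep_op_def lin_map_in)

lemma lin_intertwiner_iff:
  assumes "finite (lr_basis M)" "finite (lr_basis M')"
  shows "lin_intertwiner G M M' T \<longleftrightarrow>
    (\<forall>g\<in>carrier G. \<forall>u\<in>coord_space (lr_basis M).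
       lin_map (lr_basis M) (lr_basis M') T (rep_op M g u) =
       rep_op M' g (lin_map (lr_basis M) (lr_basis M') T u))"
  unfolding rep_op_def lin_map_compose[OF assms(1)] lin_map_compose[OF assms(2)]
    lin_map_eq_iff[OF assms(1)] lin_intertwiner_def
  by blast

lemma End_lin_eqI:
  assumes "X \<in> carrier (End_lin I)" "Y \<in> carrier (End_lin I)" "\<And>i j. i \<in> I \<Longrightarrow> j \<in> I \<Longrightarrow> X i j = Y i j"
  shows "X = Y"
proof (rule PiE_ext)
  show "X \<in> (\<Pi>\<^sub>E i\<in>I. \<Pi>\<^sub>E j\<in>I. UNIV)" "Y \<in> (\<Pi>\<^sub>E i\<in>I. \<Pi>\<^sub>E j\<in>I. UNIV)"
    using assms(1,2) by (simp_all add: End_lin_def)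
  fix i assume i: "i \<in> I"
  show "X i = Y i"
    by (rule PiE_ext[of _ I "\<lambda>_. UNIV"]) (use assms i in \<open>auto simp: End_lin_def PiE_iff\<close>)
qed

lemma End_lin_closed:
  "finite I \<Longrightarrow> X \<otimes>\<^bsub>End_lin I\<^esub> Y \<in> carrier (End_lin I)" "\<one>\<^bsub>End_lin I\<^esub> \<in> carrier (End_lin I)"
  by (auto simp: End_lin_def)

lemma (in monoid) is_lin_rep_iff:
  fixes M :: "('a, 'k::field, 'i) lin_rep"
  shows "is_lin_rep G M \<longleftrightarrow> finite (lr_basis M) \<and>
    (\<forall>g\<in>carrier G. lr_act M g \<in> carrier (End_lin (lr_basis M))) \<and>
    (\<forall>g\<in>carrier G. \<forall>h\<in>carrier G. \<forall>u\<in>coord_space (lr_basis M).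
        rep_op M (g \<otimes>\<^bsub>G\<^esub> h) u = rep_op M g (rep_op M h u)) \<and>
    lr_act M \<one>\<^bsub>G\<^esub> \<in> carrier (End_lin (lr_basis M)) \<and>
    (\<forall>u\<in>coord_space (lr_basis M). rep_op M \<one>\<^bsub>G\<^esub> u = u)"
    (is "?L \<longleftrightarrow> ?R")
proof (cases "finite (lr_basis M)")
  case fin: True
  let ?I = "lr_basis M" and ?E = "End_lin (lr_basis M) :: ('i \<Rightarrow> 'i \<Rightarrow> 'k) monoid"
  have mult: "(\<forall>u\<in>coord_space ?I. rep_op M (g \<otimes>\<^bsub>G\<^esub> h) u = rep_op M g (rep_op M h u)) \<longleftrightarrow>
      lr_act M (g \<otimes>\<^bsub>G\<^esub> h) = lr_act M g \<otimes>\<^bsub>?E\<^esub> lr_act M h"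
    if "g \<in> carrier G" "h \<in> carrier G" and cl: "\<And>g. g \<in> carrier G \<Longrightarrow> lr_act M g \<in> carrier ?E" for g h
  proof
    assume "\<forall>u\<in>coord_space ?I. rep_op M (g \<otimes>\<^bsub>G\<^esub> h) u = rep_op M g (rep_op M h u)"
    then have *: "\<forall>i\<in>?I. \<forall>j\<in>?I. lr_act M (g \<otimes>\<^bsub>G\<^esub> h) j i = (\<Sum>l\<in>?I. lr_act M g j l * lr_act M h l i)"
      unfolding rep_op_def lin_map_compose[OF fin] lin_map_eq_iff[OF fin] .
    show "lr_act M (g \<otimes>\<^bsub>G\<^esub> h) = lr_act M g \<otimes>\<^bsub>?E\<^esub> lr_act M h"
      by (rule End_lin_eqI[OF cl[OF m_closed] End_lin_closed(1)[OF fin]])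
        (use * that in \<open>auto simp: End_lin_def\<close>)
  next
    assume *: "lr_act M (g \<otimes>\<^bsub>G\<^esub> h) = lr_act M g \<otimes>\<^bsub>?E\<^esub> lr_act M h"
    show "\<forall>u\<in>coord_space ?I. rep_op M (g \<otimes>\<^bsub>G\<^esub> h) u = rep_op M g (rep_op M h u)"
      unfolding rep_op_def lin_map_compose[OF fin] lin_map_eq_iff[OF fin] *
      by (auto simp: End_lin_def)
  qed
  have one: "(\<forall>u\<in>coord_space ?I. rep_op M \<one>\<^bsub>G\<^esub> u = u) \<longleftrightarrow> lr_act M \<one>\<^bsub>G\<^esub> = \<one>\<^bsub>?E\<^esub>"
    if cl: "lr_act M \<one>\<^bsub>G\<^esub> \<in> carrier ?E"
  proof -
    have id: "u = lin_map ?I ?I (\<lambda>i j. if i = j then 1 else 0) u" if "u \<in> coord_space ?I" for u :: "'i \<Rightarrow> 'k"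
      using that fin by (auto simp: lin_map_def coord_space_def fun_eq_iff if_distrib[of "\<lambda>x. x * _"] cong: if_cong)
    have "(\<forall>u\<in>coord_space ?I. rep_op M \<one>\<^bsub>G\<^esub> u = u) \<longleftrightarrow>
        (\<forall>u\<in>coord_space ?I. rep_op M \<one>\<^bsub>G\<^esub> u = lin_map ?I ?I (\<lambda>i j. if i = j then 1 else 0) u)"
      using id by metis
    also have "\<dots> \<longleftrightarrow> (\<forall>i\<in>?I. \<forall>j\<in>?I. lr_act M \<one>\<^bsub>G\<^esub> j i = (if j = i then 1 else 0))"
      unfolding rep_op_def lin_map_eq_iff[OF fin] ..
    also have "\<dots> \<longleftrightarrow> lr_act M \<one>\<^bsub>G\<^esub> = \<one>\<^bsub>?E\<^esub>"
    proof
      assume *: "\<forall>i\<in>?I. \<forall>j\<in>?I. lr_act M \<one>\<^bsub>G\<^esub> j i = (if j = i then 1 else 0)"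
      show "lr_act M \<one>\<^bsub>G\<^esub> = \<one>\<^bsub>?E\<^esub>"
        by (rule End_lin_eqI[OF cl End_lin_closed(2)]) (use * in \<open>auto simp: End_lin_def\<close>)
    qed (auto simp: End_lin_def)
    finally show ?thesis .
  qed
  show ?thesis
  proof
    assume L: ?L
    then have cl: "lr_act M g \<in> carrier ?E" if "g \<in> carrier G" for g
      using that by (auto simp: is_lin_rep_def hom_def)
    have one': "lr_act M \<one>\<^bsub>G\<^esub> = \<one>\<^bsub>?E\<^esub>" using L by (simp add: is_lin_rep_def)
    then have cl1: "lr_act M \<one>\<^bsub>G\<^esub> \<in> carrier ?E" by (simp add: End_lin_closed)
    show ?R using fin cl mult cl1 one one' L by (auto simp: is_lin_rep_def hom_def)
  next
    assume R: ?R
    then have "lr_act M \<in> hom G ?E" using mult by (auto intro!: homI)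
    moreover have "lr_act M \<one>\<^bsub>G\<^esub> = \<one>\<^bsub>?E\<^esub>" using one R by blast
    ultimately show ?L using fin by (simp add: is_lin_rep_def)
  qed
qed (auto simp: is_lin_rep_def)

lemma is_lin_subrep_iff:
  "is_lin_subrep G M U \<longleftrightarrow> fs.subspace U \<and> U \<subseteq> coord_space (lr_basis M) \<and>
    (\<forall>g\<in>carrier G. \<forall>u\<in>U. rep_op M g u \<in> U)"
  by (auto simp: is_lin_subrep_def is_subspace_iff rep_op_def)

lemma lin_iso_iff:
  "(M, M') \<in> lin_iso G \<longleftrightarrow> is_lin_rep G M \<and> is_lin_rep G M' \<and>
    (\<exists>f. flinear f \<and> bij_betw f (coord_space (lr_basis M)) (coord_space (lr_basis M')) \<and>
      (\<forall>g\<in>carrier G. \<forall>u\<in>coord_space (lr_basis M). f (rep_op M g u) = rep_op M' g (f u)))"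
proof (cases "is_lin_rep G M \<and> is_lin_rep G M'")
  case True
  then have fin: "finite (lr_basis M)" "finite (lr_basis M')" by (auto simp: is_lin_rep_def)
  let ?I = "lr_basis M" and ?J = "lr_basis M'"
  have "(\<exists>T. lin_intertwiner G M M' T \<and>
             bij_betw (lin_map ?I ?J T) (coord_space ?I) (coord_space ?J)) \<longleftrightarrow>
    (\<exists>f. flinear f \<and> bij_betw f (coord_space ?I) (coord_space ?J) \<and>
      (\<forall>g\<in>carrier G. \<forall>u\<in>coord_space ?I. f (rep_op M g u) = rep_op M' g (f u)))" (is "?A \<longleftrightarrow> ?B")
  proof
    assume ?A
    then obtain T where "lin_intertwiner G M M' T"
      "bij_betw (lin_map ?I ?J T) (coord_space ?I) (coord_space ?J)" by blast
    then show ?B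
      unfolding lin_intertwiner_iff[OF fin] by (intro exI[of _ "lin_map ?I ?J T"] conjI flinear_lin_map)
  next
    assume ?B
    then obtain f where f: "flinear f" "bij_betw f (coord_space ?I) (coord_space ?J)"
      "\<And>g u. g \<in> carrier G \<Longrightarrow> u \<in> coord_space ?I \<Longrightarrow> f (rep_op M g u) = rep_op M' g (f u)"
      by blast
    let ?T = "\<lambda>j i. f (unit_vec i) j"
    have img: "f (unit_vec i) \<in> coord_space ?J" if "i \<in> ?I" for i
      by (rule bij_betw_apply[OF f(2) unit_vec_in[OF that]])
    have eq: "f u = lin_map ?I ?J ?T u" if "u \<in> coord_space ?I" for u
      by (rule flinear_eq_lin_map[OF fin(1) f(1) img that])
    have "bij_betw (lin_map ?I ?J ?T) (coord_space ?I) (coord_space ?J)"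
      by (rule bij_betw_cong[THEN iffD1, OF eq f(2)])
    moreover have "lin_intertwiner G M M' ?T"
      unfolding lin_intertwiner_iff[OF fin] using f(3) by (simp add: eq[symmetric] rep_op_in)
    ultimately show ?A by blast
  qed
  then show ?thesis unfolding lin_iso_def using True by blast
qed (auto simp: lin_iso_def)

lemma equiv_lin_iso: "equiv {M :: ('g, 'k::field, 'i) lin_rep. is_lin_rep G M} (lin_iso G)"
  (is "equiv ?A _")
proof (rule equivI)
  show "lin_iso G \<subseteq> ?A \<times> ?A" by (auto simp: lin_iso_def)
  show "refl_on ?A (lin_iso G)"
  proof (rule refl_onI)
    fix M :: "('g, 'k, 'i) lin_rep" assume "M \<in> ?A"
    moreover have "flinear (\<lambda>x. x :: 'i \<Rightarrow> 'k)" by (rule flinearI) auto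
    ultimately show "(M, M) \<in> lin_iso G"
      unfolding lin_iso_iff by (auto intro!: exI[of _ "\<lambda>x. x"] simp: bij_betw_def)
  qed
  show "sym (lin_iso G :: ('g, 'k, 'i) lin_rep rel)"
  proof (rule symI)
    fix M M' :: "('g, 'k, 'i) lin_rep" assume "(M, M') \<in> lin_iso G"
    then obtain f where M: "is_lin_rep G M" "is_lin_rep G M'" and
      f: "flinear f" "bij_betw f (coord_space (lr_basis M)) (coord_space (lr_basis M'))"
      "\<And>g u. g \<in> carrier G \<Longrightarrow> u \<in> coord_space (lr_basis M) \<Longrightarrow> f (rep_op M g u) = rep_op M' g (f u)"
      unfolding lin_iso_iff by blast
    obtain p where p: "flinear p" "\<And>x. p x \<in> coord_space (lr_basis M)"
      "\<And>u. u \<in> coord_space (lr_basis M) \<Longrightarrow> p (f u) = u"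
      using flinear_left_inverse[OF f(1) subspace_coord_space] f(2) by (metis bij_betw_def)
    have fp: "f (p v) = v" if "v \<in> coord_space (lr_basis M')" for v
      using that f(2) p(3) unfolding bij_betw_def by (metis imageE)
    have "bij_betw p (coord_space (lr_basis M')) (coord_space (lr_basis M))"
      by (rule bij_betwI[of _ _ _ f]) (use f(2) p fp in \<open>auto simp: bij_betw_def\<close>)
    moreover have "p (rep_op M' g v) = rep_op M g (p v)"
      if "g \<in> carrier G" "v \<in> coord_space (lr_basis M')" for g v
      using f(3)[OF that(1) p(2)[of v]] fp[OF that(2)] p(3)[OF rep_op_in] by metis
    ultimately show "(M', M) \<in> lin_iso G" unfolding lin_iso_iff using M p(1) by blast
  qed
  show "trans (lin_iso G :: ('g, 'k, 'i) lin_rep rel)"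
  proof (rule transI)
    fix M M' M'' :: "('g, 'k, 'i) lin_rep" assume "(M, M') \<in> lin_iso G" "(M', M'') \<in> lin_iso G"
    then obtain f f' where M: "is_lin_rep G M" "is_lin_rep G M''" and
      f: "flinear f" "bij_betw f (coord_space (lr_basis M)) (coord_space (lr_basis M'))"
      "\<And>g u. g \<in> carrier G \<Longrightarrow> u \<in> coord_space (lr_basis M) \<Longrightarrow> f (rep_op M g u) = rep_op M' g (f u)"
      and f': "flinear f'" "bij_betw f' (coord_space (lr_basis M')) (coord_space (lr_basis M''))"
      "\<And>g u. g \<in> carrier G \<Longrightarrow> u \<in> coord_space (lr_basis M') \<Longrightarrow> f' (rep_op M' g u) = rep_op M'' g (f' u)"
      unfolding lin_iso_iff by blast
    have "bij_betw (\<lambda>x. f' (f x)) (coord_space (lr_basis M)) (coord_space (lr_basis M''))"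
      using bij_betw_trans[OF f(2) f'(2)] by (simp add: comp_def)
    moreover have "f' (f (rep_op M g u)) = rep_op M'' g (f' (f u))"
      if "g \<in> carrier G" "u \<in> coord_space (lr_basis M)" for g u
      using f(3)[OF that] f'(3)[OF that(1)] f(2) that(2) by (auto simp: bij_betw_def)
    ultimately show "(M, M'') \<in> lin_iso G"
      unfolding lin_iso_iff using M flinear_compose[OF f'(1) f(1)] by blast
  qed
qed

locale finite_group_rep = group G for G :: "('g, 'm) monoid_scheme" +
  fixes M0 :: "('g, 'k::field, 'j) lin_rep"
  assumes finite_carrier: "finite (carrier G)"
    and order_nonzero': "of_nat (card (carrier G)) \<noteq> (0::'k)"
    and rep: "is_lin_rep G M0"

sublocale finite_group_rep \<subseteq> linear_group_action G fscale "rep_op M0" "coord_space (lr_basis M0)"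
proof -
  note R = rep[unfolded is_lin_rep_iff]
  note fin = R[THEN conjunct1]
    and mult = R[THEN conjunct2, THEN conjunct2, THEN conjunct1, rule_format]
    and one = R[THEN conjunct2, THEN conjunct2, THEN conjunct2, THEN conjunct2, rule_format]
  have "linear_group_action_axioms G fscale (rep_op M0) (coord_space (lr_basis M0))"
  proof (rule linear_group_action_axioms.intro)
    show "finite (carrier G)" by (rule finite_carrier)
    show "of_nat (card (carrier G)) \<noteq> (0::'k)" by (rule order_nonzero')
    show "flinear (rep_op M0 g)" for g by (rule flinear_rep_op)
    show "rep_op M0 (g \<otimes>\<^bsub>G\<^esub> h) x = rep_op M0 g (rep_op M0 h x)"
      if "g \<in> carrier G" "h \<in> carrier G" "x \<in> coord_space (lr_basis M0)" for g h x
      by (rule mult[OF that])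
    show "rep_op M0 \<one>\<^bsub>G\<^esub> x = x" if "x \<in> coord_space (lr_basis M0)" for x
      by (rule one[OF that])
    show "rep_op M0 g x \<in> coord_space (lr_basis M0)" for g x by (rule rep_op_in)
    show "fs.subspace (coord_space (lr_basis M0))" by (rule subspace_coord_space)
    show "\<exists>B. finite B \<and> coord_space (lr_basis M0) \<subseteq> fs.span B"
      using coord_space_span[OF fin] fin by blast
  qed
  then show "linear_group_action G fscale (rep_op M0) (coord_space (lr_basis M0))"
    by (rule linear_group_action.intro[OF is_group fsp.vector_space_pair_axioms])
qed

context finite_group_rep
begin

lemma finite_basis: "finite (lr_basis M0)"
  using rep by (simp add: is_lin_rep_def)

abbreviation group_ops where "group_ops \<equiv> rep_op M0 ` carrier G"

text \<open>The preimage in \<open>M\<close> of an invariant subspace of the image is a subrepresentation.\<close>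

lemma simple_image:
  assumes M: "irreducible_lin_rep G M" and T: "lin_embedding G M M0 T"
  shows "simple group_ops (lin_map (lr_basis M) (lr_basis M0) T ` coord_space (lr_basis M))"
proof -
  let ?I = "lr_basis M" and ?f = "lin_map (lr_basis M) (lr_basis M0) T"
  have finI: "finite ?I" using M by (simp add: irreducible_lin_rep_def is_lin_rep_def)
  have eq: "?f (rep_op M g u) = rep_op M0 g (?f u)" if "g \<in> carrier G" "u \<in> coord_space ?I" for g u
    using T that unfolding lin_embedding_def lin_intertwiner_iff[OF finI finite_basis] by blast
  have inj: "inj_on ?f (coord_space ?I)" using T by (simp add: lin_embedding_def)
  have sub: "fs.subspace (?f ` coord_space ?I)"
    by (rule fsp.linear_subspace_image[OF flinear_lin_map subspace_coord_space])
  have "invariant group_ops (?f ` coord_space ?I)"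
    unfolding invariant_def using sub lin_map_in eq[symmetric] rep_op_in[of M] by auto
  moreover obtain i where i: "i \<in> ?I" using M by (auto simp: irreducible_lin_rep_def)
  have "?f (unit_vec i) \<noteq> 0"
  proof
    assume "?f (unit_vec i) = 0"
    then have "(unit_vec i :: _ \<Rightarrow> 'k) = 0"
      using inj_onD[OF inj _ unit_vec_in[OF i] zero_in_coord_space]
      by (simp add: flinear_simps(3)[OF flinear_lin_map])
    then have "unit_vec i i = (0 :: 'k)" by simp
    then show False by (simp add: unit_vec_def)
  qed
  then have "?f ` coord_space ?I \<noteq> {0}" using unit_vec_in[OF i] by blast
  moreover have "N = {0} \<or> N = ?f ` coord_space ?I"
    if N: "N \<subseteq> ?f ` coord_space ?I" "invariant group_ops N" for N
  proof -
    let ?W = "{u\<in>coord_space ?I. ?f u \<in> N}"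
    note S = invariantD(1)[OF N(2)]
    have "fs.subspace ?W"
      by (rule fs.subspaceI) (auto simp: flinear_simps[OF flinear_lin_map] zero_in_coord_space
          fs.subspace_0[OF S] fs.subspace_add[OF S] fs.subspace_scale[OF S]
          fs.subspace_add[OF subspace_coord_space] fs.subspace_scale[OF subspace_coord_space])
    moreover have "rep_op M g u \<in> ?W" if "g \<in> carrier G" "u \<in> ?W" for g u
      using that eq[of g u] rep_op_in[of M g u] invariantD(3)[OF N(2), of "rep_op M0 g"] by auto
    ultimately have "is_lin_subrep G M ?W" unfolding is_lin_subrep_iff by blast
    then have "?W = {0} \<or> ?W = coord_space ?I"
      using M unfolding irreducible_lin_rep_def zero_fun_def by blast
    moreover have "?f ` {0} = {0}" using flinear_simps(3)[OF flinear_lin_map] by simp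
    moreover have "N = ?f ` ?W" using N(1) by blast
    ultimately show ?thesis by (elim disjE) simp_all
  qed
  ultimately show ?thesis by (simp add: simple_def)
qed

text \<open>
  With \<open>f\<close> a parametrisation of \<open>N\<close> by a coordinate space over
  \<open>nat\<close> and \<open>p\<close> a linear left inverse of \<open>f\<close>, the operators
  \<open>p g f\<close> form a representation because \<open>f p\<close> is the identity on the
  invariant subspace \<open>N\<close>.
\<close>

lemma simple_is_image:
  assumes N: "simple group_ops N"
  obtains M :: "('g, 'k, nat) lin_rep" and T where "irreducible_lin_rep G M" "lin_embedding G M M0 T"
    "lin_map (lr_basis M) (lr_basis M0) T ` coord_space (lr_basis M) = N"
proof -
  have inv: "invariant group_ops N" by (rule simpleD(1)[OF N])
  have NT: "N \<subseteq> coord_space (lr_basis M0)" using inv by (auto simp: invariant_def)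
  obtain d :: nat and e where
    inj: "inj_on (lin_map {..<d} (lr_basis M0) (\<lambda>i j. e j i)) (coord_space {..<d})" and
    img: "lin_map {..<d} (lr_basis M0) (\<lambda>i j. e j i) ` coord_space {..<d} = N"
    using subspace_enumerated_basis[OF finite_basis invariantD(1)[OF inv] NT subset_refl fs.span_superset] .
  let ?f = "lin_map {..<d} (lr_basis M0) (\<lambda>i j. e j i)" and ?I = "{..<d}"
  obtain p where p: "flinear p" "\<And>x. p x \<in> coord_space ?I" "\<And>u. u \<in> coord_space ?I \<Longrightarrow> p (?f u) = u"
    using flinear_left_inverse[OF flinear_lin_map subspace_coord_space inj] by blast
  have fT: "?f u \<in> coord_space (lr_basis M0)" for u by (rule lin_map_in)
  have fp: "?f (p x) = x" if "x \<in> N" for x using that img p(3) by auto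
  define M where "M = \<lparr>lr_basis = ?I,
    lr_act = (\<lambda>g. \<lambda>i\<in>?I. \<lambda>j\<in>?I. p (rep_op M0 g (?f (unit_vec j))) i)\<rparr>"
  have I: "lr_basis M = ?I" by (simp add: M_def)
  have cl: "lr_act M g \<in> carrier (End_lin ?I)" for g by (auto simp: M_def End_lin_def)
  have op: "rep_op M g u = p (rep_op M0 g (?f u))" if u: "u \<in> coord_space ?I" for g u
  proof -
    have "p (rep_op M0 g (?f u)) = lin_map ?I ?I (\<lambda>i j. p (rep_op M0 g (?f (unit_vec j))) i) u"
      by (rule flinear_eq_lin_map[OF _ flinear_compose[OF p(1) flinear_compose[OF flinear_rep_op flinear_lin_map]] p(2) u])
        simp
    also have "\<dots> = rep_op M g u"
      unfolding rep_op_def[of M] I by (rule fun_cong[OF lin_map_cong]) (simp add: M_def)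
    finally show ?thesis ..
  qed
  have inN: "?f u \<in> N" if "u \<in> coord_space ?I" for u using img that by blast
  have eq: "?f (rep_op M g u) = rep_op M0 g (?f u)" if "g \<in> carrier G" "u \<in> coord_space ?I" for g u
    unfolding op[OF that(2)]
    by (rule fp) (use that inN invariantD(3)[OF inv, of "rep_op M0 g"] in auto)
  have rep_M: "is_lin_rep G M"
    unfolding is_lin_rep_iff[of M] I
  proof (intro conjI ballI)
    fix g h and u :: "nat \<Rightarrow> 'k" assume gh: "g \<in> carrier G" "h \<in> carrier G" and u: "u \<in> coord_space ?I"
    have "rep_op M (g \<otimes>\<^bsub>G\<^esub> h) u = p (rep_op M0 g (rep_op M0 h (?f u)))"
      unfolding op[OF u] act_mult[OF gh fT] ..
    also have "\<dots> = rep_op M g (rep_op M h u)"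
      using op[of "rep_op M h u" g] rep_op_in[of M h u] eq[OF gh(2) u] by (simp add: I)
    finally show "rep_op M (g \<otimes>\<^bsub>G\<^esub> h) u = rep_op M g (rep_op M h u)" .
  next
    fix u :: "nat \<Rightarrow> 'k" assume u: "u \<in> coord_space ?I"
    show "rep_op M \<one>\<^bsub>G\<^esub> u = u" by (simp add: op[OF u] p(3)[OF u] act_one[OF fT])
  qed (auto simp: cl)
  have emb: "lin_embedding G M M0 (\<lambda>i j. e j i)"
  proof -
    have "lin_intertwiner G M M0 (\<lambda>i j. e j i)"
      by (subst lin_intertwiner_iff) (use eq in \<open>simp_all add: I finite_basis\<close>)
    then show ?thesis using inj by (simp add: lin_embedding_def I)
  qed
  have "d \<noteq> 0"
  proof
    assume "d = 0"
    then have "coord_space ?I = {0 :: nat \<Rightarrow> 'k}" by (auto simp: coord_space_def)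
    then have "N = {0}" unfolding img[symmetric] by (simp add: flinear_simps(3)[OF flinear_lin_map])
    then show False using simpleD(2)[OF N] by simp
  qed
  moreover have "U = {\<lambda>_. 0} \<or> U = coord_space ?I" if U: "is_lin_subrep G M U" for U
  proof -
    have U': "fs.subspace U" "U \<subseteq> coord_space ?I" "\<And>g u. g \<in> carrier G \<Longrightarrow> u \<in> U \<Longrightarrow> rep_op M g u \<in> U"
      using U by (auto simp: is_lin_subrep_iff I)
    have "rep_op M0 g (?f u) \<in> ?f ` U" if "g \<in> carrier G" "u \<in> U" for g u
      using imageI[OF U'(3)[OF that], of ?f] eq[OF that(1) subsetD[OF U'(2) that(2)]] by simp
    then have "invariant group_ops (?f ` U)"
      unfolding invariant_def using fsp.linear_subspace_image[OF flinear_lin_map U'(1)] lin_map_in by auto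
    moreover have "?f ` U \<subseteq> N" using img U'(2) by blast
    ultimately have *: "?f ` U = {0} \<or> ?f ` U = N" using simpleD(3)[OF N] by blast
    have "p (?f u) = u" if "u \<in> U" for u using p(3) U'(2) that by blast
    then have pU: "U = p ` ?f ` U" by (simp add: image_image)
    have "p ` {0} = {0}" using flinear_simps(3)[OF p(1)] by simp
    moreover have "p ` N = coord_space ?I" unfolding img[symmetric] by (simp add: image_image p(3))
    ultimately have "U = {0} \<or> U = coord_space ?I"
      using * pU by metis
    then show ?thesis by (simp add: zero_fun_def)
  qed
  ultimately have "irreducible_lin_rep G M"
    using rep_M by (auto simp: irreducible_lin_rep_def I)
  then show thesis by (rule that[OF _ emb]) (simp add: I img)
qed

lemma lin_iso_iff_images_iso:
  assumes M: "is_lin_rep G M" "lin_embedding G M M0 T" and M': "is_lin_rep G M'" "lin_embedding G M' M0 T'"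
  shows "(M, M') \<in> lin_iso G \<longleftrightarrow>
    (\<exists>\<phi>. intertwines group_ops (lin_map (lr_basis M) (lr_basis M0) T ` coord_space (lr_basis M))
       (lin_map (lr_basis M') (lr_basis M0) T' ` coord_space (lr_basis M')) \<phi>)"
proof -
  let ?I = "lr_basis M" and ?J = "lr_basis M'"
  let ?f = "lin_map ?I (lr_basis M0) T" and ?f' = "lin_map ?J (lr_basis M0) T'"
  have fin: "finite ?I" "finite ?J" using M M' by (auto simp: is_lin_rep_def)
  have eq: "?f (rep_op M g u) = rep_op M0 g (?f u)" if "g \<in> carrier G" "u \<in> coord_space ?I" for g u
    using M(2) that unfolding lin_embedding_def lin_intertwiner_iff[OF fin(1) finite_basis] by blast
  have eq': "?f' (rep_op M' g u) = rep_op M0 g (?f' u)" if "g \<in> carrier G" "u \<in> coord_space ?J" for g u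
    using M'(2) that unfolding lin_embedding_def lin_intertwiner_iff[OF fin(2) finite_basis] by blast
  have inj: "inj_on ?f (coord_space ?I)" and inj': "inj_on ?f' (coord_space ?J)"
    using M(2) M'(2) by (simp_all add: lin_embedding_def)
  obtain p where p: "flinear p" "\<And>x. p x \<in> coord_space ?I" "\<And>u. u \<in> coord_space ?I \<Longrightarrow> p (?f u) = u"
    using flinear_left_inverse[OF flinear_lin_map subspace_coord_space inj] by blast
  obtain p' where p': "flinear p'" "\<And>x. p' x \<in> coord_space ?J" "\<And>u. u \<in> coord_space ?J \<Longrightarrow> p' (?f' u) = u"
    using flinear_left_inverse[OF flinear_lin_map subspace_coord_space inj'] by blast
  show ?thesis
  proof
    assume "(M, M') \<in> lin_iso G"
    then obtain h where h: "flinear h" "bij_betw h (coord_space ?I) (coord_space ?J)"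
      "\<And>g u. g \<in> carrier G \<Longrightarrow> u \<in> coord_space ?I \<Longrightarrow> h (rep_op M g u) = rep_op M' g (h u)"
      unfolding lin_iso_iff by blast
    have hJ: "h u \<in> coord_space ?J" if "u \<in> coord_space ?I" for u using h(2) that by (auto simp: bij_betw_def)
    let ?\<phi> = "\<lambda>x. ?f' (h (p x))"
    have "bij_betw p (?f ` coord_space ?I) (coord_space ?I)"
      by (rule bij_betwI[of _ _ _ ?f]) (use p in auto)
    from bij_betw_trans[OF bij_betw_trans[OF this h(2)] inj_on_imp_bij_betw[OF inj']]
    have "bij_betw ?\<phi> (?f ` coord_space ?I) (?f' ` coord_space ?J)" by (simp add: comp_def)
    moreover have "?\<phi> (rep_op M0 g (?f u)) = rep_op M0 g (?\<phi> (?f u))"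
      if "g \<in> carrier G" "u \<in> coord_space ?I" for g u
      using eq[OF that, symmetric] p(3)[OF rep_op_in] p(3)[OF that(2)] h(3)[OF that]
        eq'[OF that(1) hJ[OF that(2)]] by simp
    ultimately have "intertwines group_ops (?f ` coord_space ?I) (?f' ` coord_space ?J) ?\<phi>"
      unfolding intertwines_def using flinear_compose[OF flinear_lin_map flinear_compose[OF h(1) p(1)]] by blast
    then show "\<exists>\<phi>. intertwines group_ops (?f ` coord_space ?I) (?f' ` coord_space ?J) \<phi>" by blast
  next
    assume "\<exists>\<phi>. intertwines group_ops (?f ` coord_space ?I) (?f' ` coord_space ?J) \<phi>"
    then obtain \<phi> where \<phi>: "flinear \<phi>" "bij_betw \<phi> (?f ` coord_space ?I) (?f' ` coord_space ?J)"
      "\<And>g x. g \<in> carrier G \<Longrightarrow> x \<in> ?f ` coord_space ?I \<Longrightarrow> \<phi> (rep_op M0 g x) = rep_op M0 g (\<phi> x)"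
      unfolding intertwines_def by blast
    let ?h = "\<lambda>u. p' (\<phi> (?f u))"
    have "bij_betw p' (?f' ` coord_space ?J) (coord_space ?J)"
      by (rule bij_betwI[of _ _ _ ?f']) (use p' in auto)
    from bij_betw_trans[OF bij_betw_trans[OF inj_on_imp_bij_betw[OF inj] \<phi>(2)] this]
    have "bij_betw ?h (coord_space ?I) (coord_space ?J)" by (simp add: comp_def)
    moreover have "?h (rep_op M g u) = rep_op M' g (?h u)" if "g \<in> carrier G" "u \<in> coord_space ?I" for g u
    proof -
      have "\<phi> (?f u) \<in> ?f' ` coord_space ?J" using \<phi>(2) that by (auto simp: bij_betw_def)
      then obtain v where v: "v \<in> coord_space ?J" "\<phi> (?f u) = ?f' v" by blast
      have "?h (rep_op M g u) = p' (rep_op M0 g (\<phi> (?f u)))" using eq[OF that] \<phi>(3) that by simp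
      also have "\<dots> = p' (?f' (rep_op M' g v))" using eq'[OF that(1) v(1)] v(2) by simp
      also have "\<dots> = rep_op M' g (?h u)" using p'(3)[OF rep_op_in] p'(3)[OF v(1)] v(2) by simp
      finally show ?thesis .
    qed
    moreover have "flinear ?h"
      by (rule flinear_compose[OF p'(1) flinear_compose[OF \<phi>(1) flinear_lin_map]])
    ultimately show "(M, M') \<in> lin_iso G" unfolding lin_iso_iff using M(1) M'(1) by blast
  qed
qed

end

section \<open>Linear combinations in a superalgebra\<close>

lemma bit_add_self: "x + x = (0 :: bit)"
  by (cases "x = 0") auto

lemma koszul_0 [simp]: "koszul 0 = 1"
  by (simp add: koszul_def)

lemma koszul_add: "koszul (p + q) = koszul p * koszul q"
  by (cases "p = 0"; cases "q = 0") (auto simp: koszul_def)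

lemma koszul_square [simp]: "koszul p * koszul p = 1"
  by (simp add: koszul_def)

lemma koszul_nonzero [simp]: "koszul p \<noteq> (0 :: 'k::field)"
  by (simp add: koszul_def)

text \<open>
  Linear combinations with scalar coefficients of elements of a superalgebra. All identities
  between the matrix entries of representations are between such sums.
\<close>

definition lincomb :: "('k::field, 'u) superalgebra \<Rightarrow> 'z set \<Rightarrow> ('z \<Rightarrow> 'k) \<Rightarrow> ('z \<Rightarrow> 'u) \<Rightarrow> 'u" where
  "lincomb A Z t X = (\<Oplus>\<^bsub>A\<^esub>z\<in>Z. t z \<odot>\<^bsub>A\<^esub> X z)"

context comm_superalgebra
begin

lemma zero_smult: "x \<in> carrier A \<Longrightarrow> 0 \<odot> x = \<zero>"
  using smult_l_distr[of x 0 0] smult_closed[of x 0] add.l_cancel_one'[of "0 \<odot> x" "0 \<odot> x"] by simp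

lemma smult_zero: "c \<odot> \<zero> = \<zero>"
proof -
  have "c \<odot> \<zero> = c \<odot> (0 \<odot> \<zero>)" by (simp add: zero_smult)
  also have "\<dots> = (c * 0) \<odot> \<zero>" by (rule smult_assoc[symmetric]) simp
  finally show ?thesis by (simp add: zero_smult)
qed

lemma smult_minus_one: "x \<in> carrier A \<Longrightarrow> (- 1) \<odot> x = \<ominus> x"
proof -
  assume x: "x \<in> carrier A"
  have "(- 1) \<odot> x \<oplus> x = (- 1) \<odot> x \<oplus> 1 \<odot> x" using x by (simp add: smult_one)
  also have "\<dots> = (- 1 + 1) \<odot> x" by (rule smult_l_distr[OF x, symmetric])
  finally show ?thesis using x by (simp add: zero_smult smult_closed minus_equality)
qed

lemma grade_closed: "x \<in> grade A p \<Longrightarrow> x \<in> carrier A"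
  using grade_subset by blast

lemma finsum_in_grade: "(\<And>z. z \<in> Z \<Longrightarrow> f z \<in> grade A p) \<Longrightarrow> (\<Oplus>z\<in>Z. f z) \<in> grade A p"
proof (induction Z rule: infinite_finite_induct)
  case (insert z Z)
  then have "(\<Oplus>z\<in>insert z Z. f z) = f z \<oplus> (\<Oplus>z\<in>Z. f z)"
    by (intro finsum_insert) (auto intro: grade_closed)
  then show ?case using insert by (simp add: grade_add)
qed (auto simp: grade_zero)

lemma smult_finsum:
  "(\<And>z. z \<in> Z \<Longrightarrow> f z \<in> carrier A) \<Longrightarrow> c \<odot> (\<Oplus>z\<in>Z. f z) = (\<Oplus>z\<in>Z. c \<odot> f z)"
proof (induction Z rule: infinite_finite_induct)
  case (insert z Z)
  have "(\<Oplus>z\<in>insert z Z. f z) = f z \<oplus> (\<Oplus>z\<in>Z. f z)"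
    using insert by (intro finsum_insert) auto
  moreover have "(\<Oplus>z\<in>insert z Z. c \<odot> f z) = c \<odot> f z \<oplus> (\<Oplus>z\<in>Z. c \<odot> f z)"
    using insert by (intro finsum_insert) (auto simp: smult_closed)
  moreover have "(\<Oplus>z\<in>Z. f z) \<in> carrier A" using insert by (intro finsum_closed) auto
  ultimately show ?case using insert by (simp add: smult_r_distr)
qed (auto simp: smult_zero)

lemma sum_smult: "x \<in> carrier A \<Longrightarrow> (\<Sum>z\<in>Z. t z) \<odot> x = (\<Oplus>z\<in>Z. t z \<odot> x)"
proof (induction Z rule: infinite_finite_induct)
  case (insert z Z)
  have "(\<Oplus>z\<in>insert z Z. t z \<odot> x) = t z \<odot> x \<oplus> (\<Oplus>z\<in>Z. t z \<odot> x)"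
    using insert by (intro finsum_insert) (auto simp: smult_closed)
  then show ?case using insert by (simp add: smult_l_distr)
qed (auto simp: zero_smult)

lemma finsum_insert':
  assumes "finite Z" "z \<notin> Z" "\<And>y. y \<in> insert z Z \<Longrightarrow> f y \<in> carrier A"
  shows "(\<Oplus>y\<in>insert z Z. f y) = f z \<oplus> (\<Oplus>y\<in>Z. f y)"
  using assms by (intro finsum_insert) auto

lemma finsum_cong_simple:
  assumes "\<And>z. z \<in> Z \<Longrightarrow> f z = g z" "\<And>z. z \<in> Z \<Longrightarrow> g z \<in> carrier A"
  shows "(\<Oplus>z\<in>Z. f z) = (\<Oplus>z\<in>Z. g z)"
  using assms by (intro finsum_cong') auto

lemma finsum_all_zero: "(\<And>z. z \<in> Z \<Longrightarrow> f z = \<zero>) \<Longrightarrow> (\<Oplus>z\<in>Z. f z) = \<zero>"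
  by (rule add.finprod_one_eqI)

lemma finsum_single:
  assumes "finite Z" "z0 \<in> Z" "\<And>z. z \<in> Z \<Longrightarrow> z \<noteq> z0 \<Longrightarrow> f z = \<zero>" "f z0 \<in> carrier A"
  shows "(\<Oplus>z\<in>Z. f z) = f z0"
proof -
  have cl: "f z \<in> carrier A" if "z \<in> Z" for z using assms(3,4) that by (cases "z = z0") auto
  have Z: "Z = insert z0 (Z - {z0})" using assms(2) by auto
  have "(\<Oplus>z\<in>Z. f z) = f z0 \<oplus> (\<Oplus>z\<in>Z - {z0}. f z)"
    by (subst Z, rule finsum_insert') (use assms(1,2) cl in auto)
  also have "(\<Oplus>z\<in>Z - {z0}. f z) = \<zero>" by (rule finsum_all_zero) (use assms(3) in auto)
  finally show ?thesis using assms(4) by simp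
qed

lemma finsum_swap:
  assumes "finite I" "finite J" "\<And>i j. i \<in> I \<Longrightarrow> j \<in> J \<Longrightarrow> f i j \<in> carrier A"
  shows "(\<Oplus>i\<in>I. \<Oplus>j\<in>J. f i j) = (\<Oplus>j\<in>J. \<Oplus>i\<in>I. f i j)"
  using assms(1,3)
proof (induction I)
  case (insert i I)
  have "(\<Oplus>i\<in>insert i I. \<Oplus>j\<in>J. f i j) = (\<Oplus>j\<in>J. f i j) \<oplus> (\<Oplus>i\<in>I. \<Oplus>j\<in>J. f i j)"
    using insert by (intro finsum_insert' finsum_closed) auto
  also have "\<dots> = (\<Oplus>j\<in>J. f i j) \<oplus> (\<Oplus>j\<in>J. \<Oplus>i\<in>I. f i j)" using insert by simp
  also have "\<dots> = (\<Oplus>j\<in>J. f i j \<oplus> (\<Oplus>i\<in>I. f i j))"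
    using insert by (intro finsum_addf[symmetric]) (auto intro!: finsum_closed)
  also have "\<dots> = (\<Oplus>j\<in>J. \<Oplus>i\<in>insert i I. f i j)"
    using insert by (intro finsum_cong_simple finsum_insert'[symmetric] finsum_closed) auto
  finally show ?case .
qed (simp add: finsum_all_zero)

lemma finsum_product:
  assumes "finite I" "finite J" "\<And>i j. i \<in> I \<Longrightarrow> j \<in> J \<Longrightarrow> f (i, j) \<in> carrier A"
  shows "(\<Oplus>z\<in>I \<times> J. f z) = (\<Oplus>i\<in>I. \<Oplus>j\<in>J. f (i, j))"
  using assms(1,3)
proof (induction I)
  case (insert i I)
  have "insert i I \<times> J = Pair i ` J \<union> I \<times> J" by auto
  then have "(\<Oplus>z\<in>insert i I \<times> J. f z) = (\<Oplus>z\<in>Pair i ` J. f z) \<oplus> (\<Oplus>z\<in>I \<times> J. f z)"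
    using insert assms(2) by (simp only:) (intro finsum_Un_disjoint, auto)
  also have "(\<Oplus>z\<in>Pair i ` J. f z) = (\<Oplus>j\<in>J. f (i, j))"
    using insert by (intro finsum_reindex) (auto simp: inj_on_def)
  also have "(\<Oplus>z\<in>I \<times> J. f z) = (\<Oplus>i\<in>I. \<Oplus>j\<in>J. f (i, j))" using insert by auto
  also have "(\<Oplus>j\<in>J. f (i, j)) \<oplus> \<dots> = (\<Oplus>i\<in>insert i I. \<Oplus>j\<in>J. f (i, j))"
    using insert by (intro finsum_insert'[symmetric] finsum_closed) auto
  finally show ?case .
qed simp

lemma finsum_bij:
  assumes "bij_betw h I J" "\<And>j. j \<in> J \<Longrightarrow> f j \<in> carrier A"
  shows "(\<Oplus>j\<in>J. f j) = (\<Oplus>i\<in>I. f (h i))"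
proof -
  have "J = h ` I" "inj_on h I" using assms(1) by (auto simp: bij_betw_def)
  then show ?thesis using assms(2) finsum_reindex[of f h I] by auto
qed

lemma lincomb_closed [simp, intro]:
  "(\<And>z. z \<in> Z \<Longrightarrow> X z \<in> carrier A) \<Longrightarrow> lincomb A Z t X \<in> carrier A"
  unfolding lincomb_def by (intro finsum_closed) (auto simp: smult_closed)

lemma lincomb_cong:
  assumes "\<And>z. z \<in> Z \<Longrightarrow> s z = t z" "\<And>z. z \<in> Z \<Longrightarrow> X z = Y z" "\<And>z. z \<in> Z \<Longrightarrow> Y z \<in> carrier A"
  shows "lincomb A Z s X = lincomb A Z t Y"
  unfolding lincomb_def using assms by (intro finsum_cong_simple) (auto simp: smult_closed)

lemma lincomb_in_grade:
  "(\<And>z. z \<in> Z \<Longrightarrow> X z \<in> carrier A \<and> (t z \<noteq> 0 \<longrightarrow> X z \<in> grade A p)) \<Longrightarrow> lincomb A Z t X \<in> grade A p"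
  unfolding lincomb_def by (rule finsum_in_grade) (metis grade_smult grade_zero zero_smult)

lemma lincomb_swap:
  assumes "finite L" "finite Z" "\<And>l z. l \<in> L \<Longrightarrow> z \<in> Z \<Longrightarrow> X l z \<in> carrier A"
  shows "lincomb A L s (\<lambda>l. lincomb A Z t (X l)) = lincomb A Z t (\<lambda>z. lincomb A L s (\<lambda>l. X l z))"
proof -
  have "lincomb A L s (\<lambda>l. lincomb A Z t (X l)) = (\<Oplus>l\<in>L. \<Oplus>z\<in>Z. s l \<odot> (t z \<odot> X l z))"
    unfolding lincomb_def
    by (intro finsum_cong_simple smult_finsum finsum_closed) (auto simp: smult_closed assms)
  also have "\<dots> = (\<Oplus>z\<in>Z. \<Oplus>l\<in>L. s l \<odot> (t z \<odot> X l z))"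
    by (intro finsum_swap assms smult_closed)
  also have "\<dots> = (\<Oplus>z\<in>Z. \<Oplus>l\<in>L. t z \<odot> (s l \<odot> X l z))"
    by (intro finsum_cong_simple finsum_closed)
      (auto simp: smult_closed assms smult_assoc[symmetric] mult.commute)
  also have "\<dots> = lincomb A Z t (\<lambda>z. lincomb A L s (\<lambda>l. X l z))"
    unfolding lincomb_def
    by (intro finsum_cong_simple smult_finsum[symmetric] smult_closed finsum_closed)
      (auto simp: smult_closed assms)
  finally show ?thesis .
qed

text \<open>Exchange of summation that collects the scalars in the coefficients of the inner family.\<close>

lemma lincomb_scalars:
  assumes "finite L" "finite Z" "\<And>z. z \<in> Z \<Longrightarrow> X z \<in> carrier A"
  shows "lincomb A L s (\<lambda>l. lincomb A Z (t l) X) = lincomb A Z (\<lambda>z. \<Sum>l\<in>L. s l * t l z) X"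
proof -
  have "lincomb A L s (\<lambda>l. lincomb A Z (t l) X) = (\<Oplus>l\<in>L. \<Oplus>z\<in>Z. (s l * t l z) \<odot> X z)"
    unfolding lincomb_def
    by (intro finsum_cong_simple finsum_closed)
      (auto simp: smult_closed assms smult_finsum smult_assoc intro!: finsum_cong_simple)
  also have "\<dots> = (\<Oplus>z\<in>Z. \<Oplus>l\<in>L. (s l * t l z) \<odot> X z)"
    by (intro finsum_swap assms smult_closed)
  also have "\<dots> = lincomb A Z (\<lambda>z. \<Sum>l\<in>L. s l * t l z) X"
    unfolding lincomb_def
    by (intro finsum_cong_simple) (auto simp: smult_closed assms sum_smult)
  finally show ?thesis .
qed

lemma lincomb_unit_vec:
  assumes "finite Z" "z0 \<in> Z" "\<And>z. z \<in> Z \<Longrightarrow> X z \<in> carrier A"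
  shows "lincomb A Z (unit_vec z0) X = X z0"
proof -
  have "lincomb A Z (unit_vec z0) X = unit_vec z0 z0 \<odot> X z0"
    unfolding lincomb_def
    by (rule finsum_single) (auto simp: assms unit_vec_def zero_smult smult_closed)
  then show ?thesis by (simp add: unit_vec_def smult_one assms)
qed

lemma lincomb_mult_right:
  assumes "finite Z" "\<And>z. z \<in> Z \<Longrightarrow> X z \<in> carrier A" "y \<in> carrier A"
  shows "lincomb A Z t X \<otimes> y = lincomb A Z t (\<lambda>z. X z \<otimes> y)"
proof -
  have "lincomb A Z t X \<otimes> y = (\<Oplus>z\<in>Z. (t z \<odot> X z) \<otimes> y)"
    unfolding lincomb_def using assms by (intro finsum_ldistr) (auto simp: smult_closed)
  also have "\<dots> = lincomb A Z t (\<lambda>z. X z \<otimes> y)"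
    unfolding lincomb_def using assms by (intro finsum_cong_simple) (auto simp: smult_closed smult_mult_l)
  finally show ?thesis .
qed

lemma lincomb_mult_left:
  assumes "finite Z" "\<And>z. z \<in> Z \<Longrightarrow> X z \<in> carrier A" "y \<in> carrier A"
  shows "y \<otimes> lincomb A Z t X = lincomb A Z t (\<lambda>z. y \<otimes> X z)"
proof -
  have "y \<otimes> lincomb A Z t X = (\<Oplus>z\<in>Z. y \<otimes> (t z \<odot> X z))"
    unfolding lincomb_def using assms by (intro finsum_rdistr) (auto simp: smult_closed)
  also have "\<dots> = lincomb A Z t (\<lambda>z. y \<otimes> X z)"
    unfolding lincomb_def using assms by (intro finsum_cong_simple) (auto simp: smult_closed smult_mult_r)
  finally show ?thesis .
qed

lemma lincomb_product:
  assumes "finite I" "finite J" "\<And>i j. i \<in> I \<Longrightarrow> j \<in> J \<Longrightarrow> X i j \<in> carrier A"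
  shows "lincomb A I s (\<lambda>i. lincomb A J t (X i)) = lincomb A (I \<times> J) (\<lambda>(i, j). s i * t j) (\<lambda>(i, j). X i j)"
proof -
  have "lincomb A (I \<times> J) (\<lambda>(i, j). s i * t j) (\<lambda>(i, j). X i j) = (\<Oplus>i\<in>I. \<Oplus>j\<in>J. (s i * t j) \<odot> X i j)"
    unfolding lincomb_def by (subst finsum_product) (auto simp: assms smult_closed)
  also have "\<dots> = (\<Oplus>i\<in>I. s i \<odot> (\<Oplus>j\<in>J. t j \<odot> X i j))"
    by (intro finsum_cong_simple smult_closed finsum_closed)
      (auto simp: assms smult_closed smult_finsum smult_assoc intro!: finsum_cong_simple)
  finally show ?thesis by (simp add: lincomb_def)
qed

end

lemma superalgebra_hom_lincomb:
  assumes A: "comm_superalgebra A" and B: "comm_superalgebra B" and \<phi>: "\<phi> \<in> superalgebra_hom A B"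
    and X: "\<And>z. z \<in> Z \<Longrightarrow> X z \<in> carrier A"
  shows "\<phi> (lincomb A Z t X) = lincomb B Z t (\<lambda>z. \<phi> (X z))"
proof -
  interpret A: comm_superalgebra A by fact
  interpret B: comm_superalgebra B by fact
  have h: "\<phi> \<in> ring_hom A B" "\<And>c x. x \<in> carrier A \<Longrightarrow> \<phi> (c \<odot>\<^bsub>A\<^esub> x) = c \<odot>\<^bsub>B\<^esub> \<phi> x"
    using \<phi> by (auto simp: superalgebra_hom_def)
  have cl: "\<phi> x \<in> carrier B" if "x \<in> carrier A" for x using ring_hom_closed[OF h(1) that] .
  have zero: "\<phi> \<zero>\<^bsub>A\<^esub> = \<zero>\<^bsub>B\<^esub>"
    using h(2)[of "\<zero>\<^bsub>A\<^esub>" 0] cl[of "\<zero>\<^bsub>A\<^esub>"] by (simp add: A.zero_smult B.zero_smult)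
  show ?thesis
    unfolding lincomb_def using X
  proof (induction Z rule: infinite_finite_induct)
    case (insert z Z)
    have "(\<Oplus>\<^bsub>A\<^esub>z\<in>insert z Z. t z \<odot>\<^bsub>A\<^esub> X z) = t z \<odot>\<^bsub>A\<^esub> X z \<oplus>\<^bsub>A\<^esub> (\<Oplus>\<^bsub>A\<^esub>z\<in>Z. t z \<odot>\<^bsub>A\<^esub> X z)"
      using insert by (intro A.finsum_insert') (auto simp: A.smult_closed)
    moreover have "(\<Oplus>\<^bsub>B\<^esub>z\<in>insert z Z. t z \<odot>\<^bsub>B\<^esub> \<phi> (X z)) =
        t z \<odot>\<^bsub>B\<^esub> \<phi> (X z) \<oplus>\<^bsub>B\<^esub> (\<Oplus>\<^bsub>B\<^esub>z\<in>Z. t z \<odot>\<^bsub>B\<^esub> \<phi> (X z))"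
      using insert cl by (intro B.finsum_insert') (auto simp: B.smult_closed)
    moreover have "t z \<odot>\<^bsub>A\<^esub> X z \<in> carrier A" "(\<Oplus>\<^bsub>A\<^esub>z\<in>Z. t z \<odot>\<^bsub>A\<^esub> X z) \<in> carrier A"
      using insert by (auto simp: A.smult_closed intro!: A.finsum_closed)
    ultimately show ?case using insert h(2) by (simp add: ring_hom_add[OF h(1)])
  qed (auto simp: zero)
qed

section \<open>The matrix entries of the tensor representation\<close>

lemma tensor_par_simps [simp]:
  "tensor_par m [] = 0" "tensor_par m (i # is) = par_V m i + tensor_par m is"
  by (simp_all add: tensor_par_def)

lemma tensor_basis_0: "tensor_basis m n 0 = {[]}"
  by (auto simp: tensor_basis_def)

lemma tensor_basis_Suc: "tensor_basis m n (Suc r) = (\<lambda>(l, L). l # L) ` ({..<m + n} \<times> tensor_basis m n r)"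
  by (auto simp: tensor_basis_def length_Suc_conv image_iff)

lemma finite_tensor_basis: "finite (tensor_basis m n r)"
  by (induction r) (auto simp: tensor_basis_0 tensor_basis_Suc)

lemma Cons_in_tensor_basis: "i # I \<in> tensor_basis m n (Suc r) \<longleftrightarrow> i < m + n \<and> I \<in> tensor_basis m n r"
  by (auto simp: tensor_basis_def)

context comm_superalgebra
begin

abbreviation even_matrices :: "nat \<Rightarrow> nat \<Rightarrow> (nat \<Rightarrow> nat \<Rightarrow> 'u) set" where
  "even_matrices m n \<equiv> carrier (End_super {..<m + n} (par_V m) A)"

lemma even_matrix_entry:
  "g \<in> even_matrices m n \<Longrightarrow> i < m + n \<Longrightarrow> j < m + n \<Longrightarrow> g i j \<in> grade A (par_V m i + par_V m j)"
proof -
  assume g: "g \<in> even_matrices m n" and ij: "i < m + n" "j < m + n"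
  have "g \<in> (\<Pi>\<^sub>E i\<in>{..<m + n}. \<Pi>\<^sub>E j\<in>{..<m + n}. grade A (par_V m i + par_V m j))"
    using g unfolding End_super_def partial_object.simps .
  from PiE_mem[OF PiE_mem[OF this, of i], of j] show ?thesis using ij by blast
qed

lemma GL_even_matrix: "g \<in> carrier (GL m n A) \<Longrightarrow> g \<in> even_matrices m n"
  unfolding GL_def units_of_def Units_def partial_object.simps by blast

lemma tensor_coeff_grade:
  assumes g: "g \<in> even_matrices m n"
  shows "I \<in> tensor_basis m n r \<Longrightarrow> J \<in> tensor_basis m n r \<Longrightarrow>
    tensor_coeff m A g I J \<in> grade A (tensor_par m I + tensor_par m J)"
proof (induction r arbitrary: I J)
  case (Suc r)
  obtain i I' where I: "I = i # I'" "i < m + n" "I' \<in> tensor_basis m n r"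
    using Suc.prems(1) by (cases I) (auto simp: tensor_basis_def)
  obtain j J' where J: "J = j # J'" "j < m + n" "J' \<in> tensor_basis m n r"
    using Suc.prems(2) by (cases J) (auto simp: tensor_basis_def)
  have "g i j \<otimes> tensor_coeff m A g I' J' \<in>
      grade A ((par_V m i + par_V m j) + (tensor_par m I' + tensor_par m J'))"
    by (intro grade_mult even_matrix_entry[OF g] I J Suc.IH)
  also have "(par_V m i + par_V m j) + (tensor_par m I' + tensor_par m J') =
      tensor_par m I + tensor_par m J"
    by (simp only: I J tensor_par_simps ac_simps)
  finally show ?case unfolding I(1) J(1) tensor_coeff.simps by (rule grade_smult)
next
  case 0
  then have "I = []" "J = []" by (simp_all add: tensor_basis_0)
  moreover have "tensor_par m [] + tensor_par m [] = 0" by (simp only: tensor_par_simps bit_add_self)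
  ultimately show ?case by (simp only: tensor_coeff.simps grade_one)
qed

lemma tensor_coeff_closed:
  assumes "g \<in> even_matrices m n" "I \<in> tensor_basis m n r" "J \<in> tensor_basis m n r"
  shows "tensor_coeff m A g I J \<in> carrier A"
  using tensor_coeff_grade[OF assms] grade_closed by blast

lemma tensor_coeff_one:
  assumes "g = \<one>\<^bsub>End_super {..<m + n} (par_V m) A\<^esub>"
  shows "I \<in> tensor_basis m n r \<Longrightarrow> J \<in> tensor_basis m n r \<Longrightarrow>
    tensor_coeff m A g I J = (if I = J then \<one> else \<zero>)"
proof (induction r arbitrary: I J)
  case (Suc r)
  obtain i I' where I: "I = i # I'" "i < m + n" "I' \<in> tensor_basis m n r"
    using Suc.prems(1) by (cases I) (auto simp: tensor_basis_def)
  obtain j J' where J: "J = j # J'" "j < m + n" "J' \<in> tensor_basis m n r"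
    using Suc.prems(2) by (cases J) (auto simp: tensor_basis_def)
  have g: "g i j = (if i = j then \<one> else \<zero>)" using assms I J by (simp add: End_super_def)
  have "koszul ((par_V m i + par_V m j) * tensor_par m I') = (1 :: 'k)" if "i = j"
    by (simp only: that bit_add_self mult_zero_left koszul_0)
  moreover have "tensor_coeff m A g I J = koszul ((par_V m i + par_V m j) * tensor_par m I') \<odot>
      ((if i = j then \<one> else \<zero>) \<otimes> (if I' = J' then \<one> else \<zero>))"
    by (simp only: I(1) J(1) tensor_coeff.simps Suc.IH[OF I(3) J(3)] g)
  ultimately show ?case
    by (cases "i = j"; cases "I' = J'")
      (simp_all only: I(1) J(1) if_True if_False l_one l_null one_closed zero_closed smult_one smult_zero
        list.inject simp_thms)
qed (auto simp: tensor_basis_0)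

text \<open>The sign comes from moving \<open>h\<close> to the left past \<open>x\<close>.\<close>

lemma supercomm_mult_interchange:
  assumes "a \<in> carrier A" "x \<in> grade A p" "h \<in> grade A q" "y \<in> carrier A"
  shows "(a \<otimes> x) \<otimes> (h \<otimes> y) = koszul (q * p) \<odot> ((a \<otimes> h) \<otimes> (x \<otimes> y))"
proof -
  note cl = assms(1,4) grade_closed[OF assms(2)] grade_closed[OF assms(3)]
  have "(a \<otimes> x) \<otimes> (h \<otimes> y) = a \<otimes> ((x \<otimes> h) \<otimes> y)" using cl by (simp add: m_assoc)
  also have "x \<otimes> h = koszul (q * p) \<odot> (h \<otimes> x)"
    using supercomm[OF assms(2,3)] by (simp only: mult.commute)
  also have "a \<otimes> (\<dots> \<otimes> y) = koszul (q * p) \<odot> ((a \<otimes> h) \<otimes> (x \<otimes> y))"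
    using cl by (simp add: smult_mult_l smult_mult_r m_assoc)
  finally show ?thesis .
qed

text \<open>
  With \<open>x, y, z\<close> the parities of the three indices \<open>i, l, j\<close> of a
  product of entries and \<open>u, v\<close> those of the remaining tensors, this collects the
  signs of the two tensor coefficients and of the interchange.
\<close>

lemma koszul_mult_identity:
  fixes x y z u v :: bit
  shows "(x + y) * u + ((y + z) * v + (y + z) * (u + v)) = (x + z) * u"
  by (cases "x = 0"; cases "y = 0"; cases "z = 0"; cases "u = 0"; cases "v = 0") simp_all

text \<open>
  In a product of two tensor coefficients the entry \<open>h l j\<close> has to pass the tensor
  coefficient of \<open>g\<close> in the remaining factors. The resulting sign turns the product
  of the signs in \<open>tensor_coeff\<close> for \<open>g\<close> and for \<open>h\<close> into
  the sign for \<open>g h\<close>, independently of the intermediate basis tensor.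
\<close>

lemma tensor_coeff_mult:
  assumes g: "g \<in> even_matrices m n" and h: "h \<in> even_matrices m n"
    and gh: "gh = g \<otimes>\<^bsub>End_super {..<m + n} (par_V m) A\<^esub> h"
  shows "I \<in> tensor_basis m n r \<Longrightarrow> J \<in> tensor_basis m n r \<Longrightarrow>
    tensor_coeff m A gh I J = (\<Oplus>L\<in>tensor_basis m n r. tensor_coeff m A g I L \<otimes> tensor_coeff m A h L J)"
proof (induction r arbitrary: I J)
  case 0
  then show ?case by (simp add: tensor_basis_0)
next
  case (Suc r)
  let ?N = "{..<m + n}" and ?B = "tensor_basis m n r" and ?p = "par_V m" and ?P = "tensor_par m"
  obtain i I' where I: "I = i # I'" "i < m + n" "I' \<in> ?B"
    using Suc.prems(1) by (cases I) (auto simp: tensor_basis_def)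
  obtain j J' where J: "J = j # J'" "j < m + n" "J' \<in> ?B"
    using Suc.prems(2) by (cases J) (auto simp: tensor_basis_def)
  note fin = finite_tensor_basis[of m n r]
  have gcl: "g i l \<in> carrier A" "h l j \<in> carrier A" if "l < m + n" for l
    using even_matrix_entry[OF g I(2) that] even_matrix_entry[OF h that J(2)] grade_closed by auto
  have tcl: "tensor_coeff m A g I' L \<in> carrier A" "tensor_coeff m A h L J' \<in> carrier A" if "L \<in> ?B" for L
    using tensor_coeff_closed[OF g I(3) that] tensor_coeff_closed[OF h that J(3)] by auto
  define t where "t l L = (g i l \<otimes> h l j) \<otimes> (tensor_coeff m A g I' L \<otimes> tensor_coeff m A h L J')" for l L
  have t_cl: "t l L \<in> carrier A" if "l < m + n" "L \<in> ?B" for l L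
    using gcl[OF that(1)] tcl[OF that(2)] by (simp add: t_def)
  let ?c = "koszul ((?p i + ?p j) * ?P I') :: 'k"
  have summand: "tensor_coeff m A g I (l # L) \<otimes> tensor_coeff m A h (l # L) J = ?c \<odot> t l L"
    if l: "l < m + n" and L: "L \<in> ?B" for l L
  proof -
    have "tensor_coeff m A g I (l # L) \<otimes> tensor_coeff m A h (l # L) J =
        (koszul ((?p l + ?p j) * ?P L) * koszul ((?p i + ?p l) * ?P I')) \<odot>
          ((g i l \<otimes> tensor_coeff m A g I' L) \<otimes> (h l j \<otimes> tensor_coeff m A h L J'))"
      using gcl[OF l] tcl[OF L]
      by (simp add: I(1) J(1) smult_mult_l smult_mult_r smult_closed smult_assoc
          del: add_bit_eq_xor mult_bit_eq_and)
    also have "(g i l \<otimes> tensor_coeff m A g I' L) \<otimes> (h l j \<otimes> tensor_coeff m A h L J') =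
        koszul ((?p l + ?p j) * (?P I' + ?P L)) \<odot> t l L"
      unfolding t_def
      by (rule supercomm_mult_interchange[OF gcl(1)[OF l] tensor_coeff_grade[OF g I(3) L] even_matrix_entry[OF h l J(2)] tcl(2)[OF L]])
    also have "(koszul ((?p l + ?p j) * ?P L) * koszul ((?p i + ?p l) * ?P I')) \<odot> \<dots> =
        (koszul ((?p i + ?p l) * ?P I') * (koszul ((?p l + ?p j) * ?P L) *
          koszul ((?p l + ?p j) * (?P I' + ?P L)))) \<odot> t l L"
      using t_cl[OF l L] by (simp only: smult_assoc[symmetric] mult.assoc mult.left_commute)
    also have "\<dots> = ?c \<odot> t l L"
      by (simp only: koszul_add[symmetric] koszul_mult_identity)
    finally show ?thesis .
  qed
  have "(\<Oplus>L\<in>tensor_basis m n (Suc r). tensor_coeff m A g I L \<otimes> tensor_coeff m A h L J) =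
      (\<Oplus>z\<in>?N \<times> ?B. tensor_coeff m A g I ((\<lambda>(l, L). l # L) z) \<otimes> tensor_coeff m A h ((\<lambda>(l, L). l # L) z) J)"
    unfolding tensor_basis_Suc
    by (rule finsum_reindex) (auto simp: inj_on_def summand smult_closed t_cl)
  also have "\<dots> = (\<Oplus>l\<in>?N. \<Oplus>L\<in>?B. ?c \<odot> t l L)"
    by (subst finsum_product) (auto simp: fin summand smult_closed t_cl intro!: finsum_cong_simple finsum_closed)
  also have "\<dots> = ?c \<odot> (\<Oplus>l\<in>?N. \<Oplus>L\<in>?B. t l L)"
    by (subst smult_finsum) (auto simp: smult_finsum t_cl smult_closed intro!: finsum_cong_simple finsum_closed)
  also have "(\<Oplus>l\<in>?N. \<Oplus>L\<in>?B. t l L) =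
      (\<Oplus>l\<in>?N. (g i l \<otimes> h l j) \<otimes> (\<Oplus>L\<in>?B. tensor_coeff m A g I' L \<otimes> tensor_coeff m A h L J'))"
    unfolding t_def using fin gcl tcl
    by (intro finsum_cong_simple finsum_rdistr[symmetric]) (auto intro!: finsum_closed)
  also have "\<dots> = (\<Oplus>l\<in>?N. g i l \<otimes> h l j) \<otimes> (\<Oplus>L\<in>?B. tensor_coeff m A g I' L \<otimes> tensor_coeff m A h L J')"
    using gcl tcl by (intro finsum_ldistr[symmetric]) (auto intro!: finsum_closed)
  also have "(\<Oplus>l\<in>?N. g i l \<otimes> h l j) = gh i j"
    using I(2) J(2) by (simp add: gh End_super_def)
  also have "(\<Oplus>L\<in>?B. tensor_coeff m A g I' L \<otimes> tensor_coeff m A h L J') = tensor_coeff m A gh I' J'"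
    by (rule Suc.IH[OF I(3) J(3), symmetric])
  finally show ?case by (simp add: I(1) J(1))
qed

end

lemma tensor_coeff_hom:
  assumes A: "comm_superalgebra A" and \<phi>: "\<phi> \<in> superalgebra_hom A B"
    and g: "g \<in> carrier (End_super {..<m + n} (par_V m) A)"
  shows "I \<in> tensor_basis m n r \<Longrightarrow> J \<in> tensor_basis m n r \<Longrightarrow>
    tensor_coeff m B (map_matrix {..<m + n} \<phi> g) I J = \<phi> (tensor_coeff m A g I J)"
proof (induction r arbitrary: I J)
  case 0
  then show ?case using \<phi> ring_hom_one[of \<phi> A B] by (simp add: tensor_basis_0 superalgebra_hom_def)
next
  case (Suc r)
  interpret A: comm_superalgebra A by fact
  have h: "\<phi> \<in> ring_hom A B" "\<And>c x. x \<in> carrier A \<Longrightarrow> \<phi> (c \<odot>\<^bsub>A\<^esub> x) = c \<odot>\<^bsub>B\<^esub> \<phi> x"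
    using \<phi> by (auto simp: superalgebra_hom_def)
  obtain i I' where I: "I = i # I'" "i < m + n" "I' \<in> tensor_basis m n r"
    using Suc.prems(1) by (cases I) (auto simp: tensor_basis_def)
  obtain j J' where J: "J = j # J'" "j < m + n" "J' \<in> tensor_basis m n r"
    using Suc.prems(2) by (cases J) (auto simp: tensor_basis_def)
  have cl: "g i j \<in> carrier A" "tensor_coeff m A g I' J' \<in> carrier A"
    using A.even_matrix_entry[OF g I(2) J(2)] A.grade_closed A.tensor_coeff_closed[OF g I(3) J(3)] by auto
  have "map_matrix {..<m + n} \<phi> g i j = \<phi> (g i j)" using I J by (simp add: map_matrix_def)
  then show ?case
    using cl Suc.IH[OF I(3) J(3)] by (simp add: I(1) J(1) h(2) ring_hom_mult[OF h(1)])
qed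

section \<open>The symmetric group on basis tensors\<close>

text \<open>
  Position \<open>s a\<close> of the result holds the entry at position \<open>a\<close>;
  positions run from \<open>1\<close>, list indices from \<open>0\<close>.
\<close>

definition perm_list :: "(nat \<Rightarrow> nat) \<Rightarrow> nat list \<Rightarrow> nat list" where
  "perm_list s I = map (\<lambda>t. I ! (inv' s (Suc t) - 1)) [0..<length I]"

lemma length_perm_list [simp]: "length (perm_list s I) = length I"
  by (simp add: perm_list_def)

lemma permutes_range:
  assumes "s permutes {1..r::nat}" "t \<in> {1..r}"
  shows "s t \<in> {1..r}"
  using permutes_in_image[OF assms(1)] assms(2) by blast

lemma perm_list_nth:
  assumes s: "s permutes {1..r}" and I: "length I = r" and t: "t \<in> {1..r}"
  shows "perm_list s I ! (s t - 1) = I ! (t - 1)"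
proof -
  have st: "1 \<le> s t" "s t \<le> r" using permutes_range[OF s t] by auto
  then have "perm_list s I ! (s t - 1) = I ! (inv' s (Suc (s t - 1)) - 1)"
    using I unfolding perm_list_def by (subst nth_map) auto
  also have "Suc (s t - 1) = s t" using st by simp
  also have "inv' s (s t) = t" by (rule permutes_inverses(2)[OF s])
  finally show ?thesis .
qed

lemma perm_list_unique:
  assumes s: "s permutes {1..r}" and I: "length I = r" "length J = r"
    and nth: "\<And>t. t \<in> {1..r} \<Longrightarrow> J ! (s t - 1) = I ! (t - 1)"
  shows "J = perm_list s I"
proof (rule nth_equalityI)
  show "length J = length (perm_list s I)" using I by simp
  fix k assume k: "k < length J"
  then have "inv' s (Suc k) \<in> {1..r}"
    using I by (intro permutes_range[OF permutes_inv[OF s]]) auto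
  from nth[OF this] perm_list_nth[OF s I(1) this] show "J ! k = perm_list s I ! k"
    by (simp add: permutes_inverses(1)[OF s])
qed

lemma perm_list_comp:
  assumes s: "s permutes {1..r}" and t: "t permutes {1..r}" and I: "length I = r"
  shows "perm_list (s \<circ> t) I = perm_list s (perm_list t I)"
proof (rule perm_list_unique[symmetric, OF permutes_compose[OF t s]])
  fix a assume a: "a \<in> {1..r}"
  show "perm_list s (perm_list t I) ! ((s \<circ> t) a - 1) = I ! (a - 1)"
    using perm_list_nth[OF s _ permutes_range[OF t a], of "perm_list t I"] perm_list_nth[OF t I a] I
    by simp
qed (use I in auto)

lemma perm_list_id: "perm_list id I = I"
  by (rule perm_list_unique[symmetric, of _ "length I"]) (auto simp: permutes_id)

lemma set_perm_list:
  assumes s: "s permutes {1..r}" and I: "length I = r"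
  shows "set (perm_list s I) \<subseteq> set I"
proof
  fix x assume "x \<in> set (perm_list s I)"
  then obtain k where k: "k < r" "x = I ! (inv' s (Suc k) - 1)"
    using I by (auto simp: perm_list_def)
  then have "inv' s (Suc k) \<in> {1..r}" by (intro permutes_range[OF permutes_inv[OF s]]) auto
  then show "x \<in> set I" using k I by (auto intro!: nth_mem)
qed

lemma perm_list_in_basis:
  "s permutes {1..r} \<Longrightarrow> I \<in> tensor_basis m n r \<Longrightarrow> perm_list s I \<in> tensor_basis m n r"
  using set_perm_list[of s r I] by (auto simp: tensor_basis_def)

lemma perm_list_inverse:
  assumes s: "s permutes {1..r}" and I: "length I = r"
  shows "perm_list (inv' s) (perm_list s I) = I" "perm_list s (perm_list (inv' s) I) = I"
  using perm_list_comp[OF permutes_inv[OF s] s I] perm_list_comp[OF s permutes_inv[OF s] I]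
  by (simp_all add: permutes_inv_o[OF s] perm_list_id)

lemma bij_perm_list:
  assumes s: "s permutes {1..r}"
  shows "bij_betw (perm_list s) (tensor_basis m n r) (tensor_basis m n r)"
proof (rule bij_betwI[of _ _ _ "perm_list (inv' s)"])
  show "perm_list s \<in> tensor_basis m n r \<rightarrow> tensor_basis m n r"
    "perm_list (inv' s) \<in> tensor_basis m n r \<rightarrow> tensor_basis m n r"
    using perm_list_in_basis[OF s] perm_list_in_basis[OF permutes_inv[OF s]] by auto
qed (use perm_list_inverse[OF s] in \<open>auto simp: tensor_basis_def\<close>)

definition position_pairs :: "nat \<Rightarrow> (nat \<times> nat) set" where
  "position_pairs r = {(a, b). a \<in> {1..r} \<and> b \<in> {1..r} \<and> a < b}"

text \<open>
  The contribution of one pair of positions to \<open>perm_sign\<close>, written symmetrically in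
  the two positions, so that a product over pairs can be reindexed by a permutation without regard
  to order.
\<close>

definition inversion_sign :: "nat \<Rightarrow> (nat \<Rightarrow> nat) \<Rightarrow> nat list \<Rightarrow> nat \<Rightarrow> nat \<Rightarrow> 'k::field" where
  "inversion_sign m s I a b =
     (if (a < b) \<noteq> (s a < s b) \<and> par_V m (I ! (a - 1)) = 1 \<and> par_V m (I ! (b - 1)) = 1 then - 1 else 1)"

lemma finite_position_pairs: "finite (position_pairs r)"
  by (rule finite_subset[of _ "{1..r} \<times> {1..r}"]) (auto simp: position_pairs_def)

lemma permutes_eq_iff: "s permutes S \<Longrightarrow> s a = s b \<longleftrightarrow> a = b"
  using permutes_inj[of s S] by (auto simp: inj_def)

lemma inversion_sign_commute:
  assumes "s permutes S" "a \<noteq> b"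
  shows "inversion_sign m s I a b = (inversion_sign m s I b a :: 'k::field)"
proof -
  have "s a \<noteq> s b" using permutes_eq_iff[OF assms(1)] assms(2) by blast
  then have "(a < b) \<noteq> (s a < s b) \<longleftrightarrow> (b < a) \<noteq> (s b < s a)" using assms(2) by linarith
  then show ?thesis unfolding inversion_sign_def by (intro if_cong) auto
qed

lemma perm_sign_eq_prod:
  assumes s: "s permutes {1..r}"
  shows "perm_sign m r s I = (\<Prod>(a, b)\<in>position_pairs r. inversion_sign m s I a b :: 'k::field)"
proof -
  let ?Q = "\<lambda>(a, b). (a < b) \<noteq> (s a < s b) \<and> par_V m (I ! (a - 1)) = 1 \<and> par_V m (I ! (b - 1)) = 1"
  have "(\<Prod>(a, b)\<in>position_pairs r. inversion_sign m s I a b) =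
      (\<Prod>z\<in>position_pairs r. if ?Q z then - 1 else (1 :: 'k))"
    by (rule prod.cong[OF refl]) (simp only: split_beta inversion_sign_def)
  also have "\<dots> = (- 1) ^ card {z \<in> position_pairs r. ?Q z}"
    using prod.inter_filter[OF finite_position_pairs, where g = "\<lambda>_. - 1 :: 'k" and P = ?Q] by simp
  also have "{z \<in> position_pairs r. ?Q z} =
      {(a, b). a \<in> {1..r} \<and> b \<in> {1..r} \<and> a < b \<and> s b < s a \<and>
               par_V m (I ! (a - 1)) = 1 \<and> par_V m (I ! (b - 1)) = 1}" (is "?X = ?Y")
  proof -
    have "s b < s a \<longleftrightarrow> \<not> s a < s b" if "a < b" for a b
      using permutes_eq_iff[OF s, of a b] that by linarith
    then show ?thesis unfolding position_pairs_def by blast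
  qed
  finally show ?thesis unfolding perm_sign_def by (rule sym)
qed

lemma prod_position_pairs_permute:
  assumes t: "t permutes {1..r}" and sym: "\<And>a b. a \<noteq> b \<Longrightarrow> H a b = (H b a :: 'k::field)"
  shows "(\<Prod>(a, b)\<in>position_pairs r. H (t a) (t b)) = (\<Prod>(a, b)\<in>position_pairs r. H a b)"
proof -
  note t' = permutes_inv[OF t]
  have mem: "(if t a < t b then (t a, t b) else (t b, t a)) \<in> position_pairs r"
    if "(a, b) \<in> position_pairs r" "t permutes {1..r}" for a b t
    using that(1) permutes_range[OF that(2), of a] permutes_range[OF that(2), of b]
      permutes_eq_iff[OF that(2), of a b]
    by (auto simp: position_pairs_def)
  show ?thesis
  proof (rule prod.reindex_bij_witness[where
        j = "\<lambda>(a, b). if t a < t b then (t a, t b) else (t b, t a)" and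
        i = "\<lambda>(a, b). if inv' t a < inv' t b then (inv' t a, inv' t b) else (inv' t b, inv' t a)"])
    fix z assume z: "z \<in> position_pairs r"
    obtain a b where ab: "z = (a, b)" by (cases z)
    have lt: "a < b" using z by (simp add: ab position_pairs_def)
    have ne: "t a \<noteq> t b" using permutes_eq_iff[OF t, of a b] lt by simp
    show "(case case z of (a, b) \<Rightarrow> if t a < t b then (t a, t b) else (t b, t a) of
        (a, b) \<Rightarrow> if inv' t a < inv' t b then (inv' t a, inv' t b) else (inv' t b, inv' t a)) = z"
      using lt by (simp add: ab permutes_inverses[OF t])
    show "(case z of (a, b) \<Rightarrow> if t a < t b then (t a, t b) else (t b, t a)) \<in> position_pairs r"
      using mem[OF _ t, of a b] z by (simp add: ab)
    show "(case case z of (a, b) \<Rightarrow> if t a < t b then (t a, t b) else (t b, t a) of (a, b) \<Rightarrow> H a b) =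
        (case z of (a, b) \<Rightarrow> H (t a) (t b))"
      using sym[OF ne] by (simp add: ab)
  next
    fix z assume z: "z \<in> position_pairs r"
    obtain a b where ab: "z = (a, b)" by (cases z)
    have lt: "a < b" using z by (simp add: ab position_pairs_def)
    show "(case case z of (a, b) \<Rightarrow> if inv' t a < inv' t b then (inv' t a, inv' t b) else (inv' t b, inv' t a) of
        (a, b) \<Rightarrow> if t a < t b then (t a, t b) else (t b, t a)) = z"
      using lt by (simp add: ab permutes_inverses[OF t])
    show "(case z of (a, b) \<Rightarrow> if inv' t a < inv' t b then (inv' t a, inv' t b) else (inv' t b, inv' t a))
        \<in> position_pairs r"
      using mem[OF _ t', of a b] z by (simp add: ab)
  qed
qed

text \<open>
  A pair of positions is inverted by \<open>s \<circ> t\<close> if and only if exactly one of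
  \<open>t\<close>, applied to the pair, and \<open>s\<close>, applied to its image, inverts it.
\<close>

lemma perm_sign_comp:
  assumes s: "s permutes {1..r}" and t: "t permutes {1..r}" and I: "length I = r"
  shows "perm_sign m r (s \<circ> t) I = (perm_sign m r s (perm_list t I) * perm_sign m r t I :: 'k::field)"
proof -
  let ?H = "inversion_sign m s (perm_list t I) :: nat \<Rightarrow> nat \<Rightarrow> 'k"
  have "perm_sign m r s (perm_list t I) = (\<Prod>(a, b)\<in>position_pairs r. ?H (t a) (t b))"
    unfolding perm_sign_eq_prod[OF s]
    by (rule prod_position_pairs_permute[OF t, symmetric]) (rule inversion_sign_commute[OF s])
  then have "perm_sign m r s (perm_list t I) * perm_sign m r t I =
      (\<Prod>z\<in>position_pairs r. (case z of (a, b) \<Rightarrow> ?H (t a) (t b)) * (case z of (a, b) \<Rightarrow> inversion_sign m t I a b))"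
    by (simp only: perm_sign_eq_prod[OF t] prod.distrib)
  also have "\<dots> = (\<Prod>(a, b)\<in>position_pairs r. inversion_sign m (s \<circ> t) I a b)"
  proof (rule prod.cong[OF refl])
    fix z assume "z \<in> position_pairs r"
    then obtain a b where z: "z = (a, b)" and ab: "a \<in> {1..r}" "b \<in> {1..r}" "a < b"
      by (auto simp: position_pairs_def)
    show "(case z of (a, b) \<Rightarrow> ?H (t a) (t b)) * (case z of (a, b) \<Rightarrow> inversion_sign m t I a b) =
        (case z of (a, b) \<Rightarrow> inversion_sign m (s \<circ> t) I a b)"
      unfolding z prod.case inversion_sign_def perm_list_nth[OF t I ab(1)] perm_list_nth[OF t I ab(2)]
      by auto
  qed
  finally show ?thesis unfolding perm_sign_eq_prod[OF permutes_compose[OF t s]] by (rule sym)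
qed

lemma perm_sign_square: "perm_sign m r s I * perm_sign m r s I = (1 :: 'k::field)"
  by (simp add: perm_sign_def power_mult_distrib[symmetric])

lemma perm_sign_nonzero: "perm_sign m r s I \<noteq> (0 :: 'k::field)"
  by (simp add: perm_sign_def)

lemma perm_sign_id: "perm_sign m r id I = (1 :: 'k::field)"
proof -
  have "{(a, b). a \<in> {1..r} \<and> b \<in> {1..r} \<and> a < b \<and> id b < id a \<and>
      par_V m (I ! (a - 1)) = 1 \<and> par_V m (I ! (b - 1)) = 1} = {}" by auto
  then show ?thesis unfolding perm_sign_def by (simp only: card.empty power_0)
qed

abbreviation adjacent_swap :: "nat \<Rightarrow> nat \<Rightarrow> nat" where
  "adjacent_swap k \<equiv> Transposition.transpose (Suc k) (Suc (Suc k))"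

lemma adjacent_swap_permutes: "Suc k < r \<Longrightarrow> adjacent_swap k permutes {1..r}"
  by (rule permutes_swap_id) auto

lemma perm_list_adjacent:
  assumes "length us = k"
  shows "perm_list (adjacent_swap k) (us @ x # y # vs) = us @ y # x # vs"
proof -
  let ?r = "length (us @ x # y # vs)"
  show ?thesis
  proof (rule perm_list_unique[symmetric, where r = ?r])
    show "adjacent_swap k permutes {1..?r}" using assms by (intro adjacent_swap_permutes) simp
    fix t assume t: "t \<in> {1..?r}"
    consider "t = Suc k" | "t = Suc (Suc k)" | "t \<noteq> Suc k" "t \<noteq> Suc (Suc k)" by blast
    then show "(us @ y # x # vs) ! (adjacent_swap k t - 1) = (us @ x # y # vs) ! (t - 1)"
    proof cases
      case 1
      then show ?thesis using assms by (simp add: nth_append)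
    next
      case 2
      then show ?thesis using assms by (simp add: nth_append)
    next
      case 3
      then have "adjacent_swap k t = t" by simp
      moreover have "t - 1 < k \<or> (\<exists>c. t - 1 = k + Suc (Suc c))"
      proof (cases "t - 1 < k")
        case False
        moreover have "1 \<le> t" using t by simp
        ultimately have "t - 1 = k + Suc (Suc (t - 1 - k - 2))" using 3 by arith
        then show ?thesis by blast
      qed simp
      ultimately show ?thesis using assms by (auto simp: nth_append)
    qed
  qed auto
qed

lemma perm_sign_adjacent:
  assumes "length us = k" "r = length (us @ x # y # vs)"
  shows "perm_sign m r (adjacent_swap k) (us @ x # y # vs) = (koszul (par_V m x * par_V m y) :: 'k::field)"
proof -
  let ?I = "us @ x # y # vs" and ?s = "adjacent_swap k"
  have inv: "a < b \<and> ?s b < ?s a \<longleftrightarrow> a = Suc k \<and> b = Suc (Suc k)" for a b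
    by (auto simp: Transposition.transpose_def)
  have nth: "?I ! (Suc k - 1) = x" "?I ! (Suc (Suc k) - 1) = y" using assms(1) by (simp_all add: nth_append)
  have range: "Suc k \<in> {1..r}" "Suc (Suc k) \<in> {1..r}" using assms by simp_all
  have "{(a, b). a \<in> {1..r} \<and> b \<in> {1..r} \<and> a < b \<and> ?s b < ?s a \<and>
      par_V m (?I ! (a - 1)) = 1 \<and> par_V m (?I ! (b - 1)) = 1} =
    (if par_V m x = 1 \<and> par_V m y = 1 then {(Suc k, Suc (Suc k))} else {})" (is "?L = ?R")
  proof (rule Set.set_eqI)
    fix z :: "nat \<times> nat"
    obtain a b where z: "z = (a, b)" by (cases z)
    have "z \<in> ?L \<longleftrightarrow> a \<in> {1..r} \<and> b \<in> {1..r} \<and> (a < b \<and> ?s b < ?s a) \<and>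
      par_V m (?I ! (a - 1)) = 1 \<and> par_V m (?I ! (b - 1)) = 1" unfolding z by blast
    also have "\<dots> \<longleftrightarrow> a = Suc k \<and> b = Suc (Suc k) \<and> par_V m x = 1 \<and> par_V m y = 1"
      unfolding inv by (auto simp only: nth range)
    also have "\<dots> \<longleftrightarrow> z \<in> ?R" by (auto simp: z)
    finally show "z \<in> ?L \<longleftrightarrow> z \<in> ?R" .
  qed
  then have "perm_sign m r ?s ?I = ((- 1) ^ card ?R :: 'k)" unfolding perm_sign_def by (rule arg_cong)
  then show ?thesis
    by (cases "par_V m x = 0"; cases "par_V m y = 0") (simp_all add: koszul_def)
qed

text \<open>
  Adjacent transpositions suffice because \<open>(a b) = (c b) (a c) (c b)\<close> with \<open>c =
  b - 1\<close>.
\<close>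

lemma permutes_adjacent_induct [consumes 1, case_names id swap comp]:
  assumes "s permutes {1..r::nat}" and id: "P id" and swap: "\<And>k. Suc k < r \<Longrightarrow> P (adjacent_swap k)"
    and comp: "\<And>s t. s permutes {1..r} \<Longrightarrow> t permutes {1..r} \<Longrightarrow> P s \<Longrightarrow> P t \<Longrightarrow> P (s \<circ> t)"
  shows "P s"
proof -
  have transp: "P (Transposition.transpose a b)" if "1 \<le> a" "b = a + Suc d" "b \<le> r" for a b d
    using that
  proof (induction d arbitrary: b)
    case 0
    then obtain k where "a = Suc k" by (cases a) auto
    then show ?case using swap[of k] 0 by simp
  next
    case (Suc d)
    let ?c = "a + Suc d"
    obtain k where k: "?c = Suc k" "b = Suc (Suc k)" using Suc by simp
    have t1: "Transposition.transpose a ?c permutes {1..r}" using Suc.prems by (intro permutes_swap_id) auto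
    have t2: "Transposition.transpose ?c b permutes {1..r}" using Suc.prems by (intro permutes_swap_id) auto
    have P1: "P (Transposition.transpose a ?c)" using Suc by (intro Suc.IH) auto
    have P2: "P (Transposition.transpose ?c b)" using swap[of k] Suc.prems k by simp
    have "P (Transposition.transpose ?c b \<circ> Transposition.transpose a ?c \<circ> Transposition.transpose ?c b)"
      by (intro comp permutes_compose t1 t2 P1 P2)
    also have "Transposition.transpose ?c b \<circ> Transposition.transpose a ?c \<circ> Transposition.transpose ?c b =
        Transposition.transpose a b"
      using Suc.prems transpose_comp_triple[of b a ?c] by (simp add: transpose_commute)
    finally show ?case .
  qed
  have transp': "P (Transposition.transpose a b)" if "a \<in> {1..r}" "b \<in> {1..r}" "a \<noteq> b" for a b
  proof (cases "a < b")
    case True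
    then obtain d where "b = a + Suc d" using less_imp_Suc_add by fastforce
    then show ?thesis using transp that by auto
  next
    case False
    then have "b < a" using that by simp
    then obtain d where "a = b + Suc d" using less_imp_Suc_add by fastforce
    then have "P (Transposition.transpose b a)" using transp that by auto
    then show ?thesis by (simp add: transpose_commute)
  qed
  show ?thesis
    using assms(1) finite_atLeastAtMost
  proof (induction rule: permutes_induct)
    case (swap a b p)
    then show ?case by (intro comp transp' permutes_swap_id) auto
  qed (rule id)
qed

lemma tensor_par_append: "tensor_par m (us @ vs) = tensor_par m us + tensor_par m vs"
  by (simp add: tensor_par_def)

lemma split_at_adjacent:
  assumes "length I = r" "Suc k < r"
  obtains us x y vs where "I = us @ x # y # vs" "length us = k"
proof
  have "I = take k I @ I ! k # drop (Suc k) I" by (rule id_take_nth_drop) (use assms in simp)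
  also have "drop (Suc k) I = I ! Suc k # drop (Suc (Suc k)) I"
    by (rule Cons_nth_drop_Suc[symmetric]) (use assms in simp)
  finally show "I = take k I @ I ! k # I ! Suc k # drop (Suc (Suc k)) I" .
  show "length (take k I) = k" using assms by simp
qed

lemma tensor_par_perm_list:
  assumes "s permutes {1..r}" "length I = r"
  shows "tensor_par m (perm_list s I) = tensor_par m I"
  using assms
proof (induction arbitrary: I rule: permutes_adjacent_induct)
  case id
  show ?case by (simp only: perm_list_id)
next
  case (swap k)
  from split_at_adjacent[OF swap(2,1)] obtain us x y vs where I: "I = us @ x # y # vs" "length us = k" .
  show ?case unfolding I(1) perm_list_adjacent[OF I(2)]
    by (simp only: tensor_par_append tensor_par_simps add.left_commute)
next
  case (comp s t)
  have len: "length (perm_list t I) = r" using comp.prems by simp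
  show ?case
    unfolding perm_list_comp[OF comp.hyps(1,2) comp.prems] comp.IH(1)[OF len] by (rule comp.IH(2)[OF comp.prems])
qed

section \<open>Matrices commuting with the symmetric group\<close>

text \<open>
  The sign by which a matrix unit changes when the symmetric group permutes the row and the column
  tensor simultaneously.
\<close>

definition pair_sign :: "nat \<Rightarrow> nat \<Rightarrow> (nat \<Rightarrow> nat) \<Rightarrow> nat list \<Rightarrow> nat list \<Rightarrow> 'k::field" where
  "pair_sign m r s I J = perm_sign m r s I * perm_sign m r s J"

lemma pair_sign_comp:
  assumes "s permutes {1..r}" "t permutes {1..r}" "length I = r" "length J = r"
  shows "pair_sign m r (s \<circ> t) I J =
    (pair_sign m r s (perm_list t I) (perm_list t J) * pair_sign m r t I J :: 'k::field)"
  unfolding pair_sign_def perm_sign_comp[OF assms(1,2,3)] perm_sign_comp[OF assms(1,2,4)]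
  by (simp only: mult.assoc mult.commute mult.left_commute)

lemma pair_sign_square: "pair_sign m r s I J * pair_sign m r s I J = (1 :: 'k::field)"
proof -
  have "pair_sign m r s I J * pair_sign m r s I J =
      (perm_sign m r s I * perm_sign m r s I) * (perm_sign m r s J * perm_sign m r s J :: 'k)"
    by (simp only: pair_sign_def mult.assoc mult.commute mult.left_commute)
  then show ?thesis by (simp only: perm_sign_square mult_1)
qed

lemma pair_sign_id: "pair_sign m r id I J = (1 :: 'k::field)"
  by (simp add: pair_sign_def perm_sign_id)

text \<open>
  These are the matrices of the maps commuting with the symmetric group; each
  \<open>perm_sign\<close> is its own inverse.
\<close>

definition equivariant_matrices :: "nat \<Rightarrow> nat \<Rightarrow> nat \<Rightarrow> (nat list \<Rightarrow> nat list \<Rightarrow> 'k::field) set" where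
  "equivariant_matrices m n r = {c. \<forall>s. s permutes {1..r} \<longrightarrow>
     (\<forall>I\<in>tensor_basis m n r. \<forall>J\<in>tensor_basis m n r.
        c (perm_list s I) (perm_list s J) = pair_sign m r s I J * c I J)}"

text \<open>
  A relation \<open>l\<close> between matrix entries, averaged over the symmetric group up to the
  factor \<open>r!\<close>.
\<close>

definition orbit_sum ::
  "nat \<Rightarrow> nat \<Rightarrow> (nat list \<times> nat list \<Rightarrow> 'k::field) \<Rightarrow> nat list \<times> nat list \<Rightarrow> 'k" where
  "orbit_sum m r l = (\<lambda>(I, J). \<Sum>s | s permutes {1..r}. pair_sign m r s I J * l (perm_list s I, perm_list s J))"

abbreviation tensor_basis2 :: "nat \<Rightarrow> nat \<Rightarrow> nat \<Rightarrow> (nat list \<times> nat list) set" where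
  "tensor_basis2 m n r \<equiv> tensor_basis m n r \<times> tensor_basis m n r"

lemma tensor_basisD: "I \<in> tensor_basis m n r \<Longrightarrow> length I = r"
  by (simp add: tensor_basis_def)

lemma finite_perms: "finite {s. s permutes {1..r::nat}}"
  by (rule finite_permutations) simp

lemma card_perms: "card {s. s permutes {1..r::nat}} = fact r"
  by (rule card_permutations) auto

lemma bij_perm_list_pair:
  assumes s: "s permutes {1..r}"
  shows "bij_betw (map_prod (perm_list s) (perm_list s)) (tensor_basis2 m n r) (tensor_basis2 m n r)"
  by (rule bij_betw_map_prod[OF bij_perm_list[OF s] bij_perm_list[OF s]])

text \<open>
  Each permutation allows the sum to be reindexed, and equivariance of \<open>X\<close> then moves
  the permutation over to the coefficients.
\<close>

lemma (in comm_superalgebra) lincomb_orbit_sum: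
  assumes X: "\<And>I J. I \<in> tensor_basis m n r \<Longrightarrow> J \<in> tensor_basis m n r \<Longrightarrow> X (I, J) \<in> carrier A"
    and eq: "\<And>s I J. s permutes {1..r} \<Longrightarrow> I \<in> tensor_basis m n r \<Longrightarrow> J \<in> tensor_basis m n r \<Longrightarrow>
      X (perm_list s I, perm_list s J) = pair_sign m r s I J \<odot> X (I, J)"
  shows "of_nat (fact r) \<odot> lincomb A (tensor_basis2 m n r) l X =
    lincomb A (tensor_basis2 m n r) (orbit_sum m r l) X"
proof -
  let ?Z = "tensor_basis2 m n r" and ?S = "{s. s permutes {1..r}}"
  have fin: "finite ?Z" by (simp add: finite_tensor_basis)
  have cl: "X z \<in> carrier A" if "z \<in> ?Z" for z using X that by auto
  define t where "t s = (\<lambda>(I, J). pair_sign m r s I J * l (perm_list s I, perm_list s J))" for s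
  have each: "lincomb A ?Z l X = lincomb A ?Z (t s) X" if s: "s \<in> ?S" for s
  proof -
    have s': "s permutes {1..r}" using s by simp
    have "lincomb A ?Z l X =
        (\<Oplus>z\<in>?Z. l (map_prod (perm_list s) (perm_list s) z) \<odot> X (map_prod (perm_list s) (perm_list s) z))"
      unfolding lincomb_def
      by (rule finsum_bij[OF bij_perm_list_pair[OF s']]) (simp add: cl smult_closed)
    also have "\<dots> = lincomb A ?Z (t s) X"
      unfolding lincomb_def
    proof (rule finsum_cong_simple)
      fix z assume z: "z \<in> ?Z"
      obtain I J where IJ: "z = (I, J)" "I \<in> tensor_basis m n r" "J \<in> tensor_basis m n r" using z by auto
      show "l (map_prod (perm_list s) (perm_list s) z) \<odot> X (map_prod (perm_list s) (perm_list s) z) =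
          t s z \<odot> X z"
        unfolding IJ(1) map_prod_simp eq[OF s' IJ(2,3)] t_def prod.case
        using X[OF IJ(2,3)] by (simp only: smult_assoc[symmetric] mult.commute)
      show "t s z \<odot> X z \<in> carrier A" using cl[OF z] by (rule smult_closed)
    qed
    finally show ?thesis .
  qed
  have "lincomb A ?Z (orbit_sum m r l) X = lincomb A ?Z (\<lambda>z. \<Sum>s\<in>?S. 1 * t s z) X"
    by (rule lincomb_cong) (auto simp: orbit_sum_def t_def cl)
  also have "\<dots> = lincomb A ?S (\<lambda>_. 1) (\<lambda>s. lincomb A ?Z (t s) X)"
    by (rule lincomb_scalars[OF finite_perms fin cl, symmetric])
  also have "\<dots> = lincomb A ?S (\<lambda>_. 1) (\<lambda>_. lincomb A ?Z l X)"
    by (rule lincomb_cong[OF refl each[symmetric]]) (auto simp: cl)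
  also have "\<dots> = (\<Sum>s\<in>?S. 1) \<odot> lincomb A ?Z l X"
    unfolding lincomb_def[of A ?S] by (rule sum_smult[symmetric]) (auto simp: cl)
  also have "(\<Sum>s\<in>?S. 1 :: 'k) = of_nat (fact r)"
    by (simp only: sum_constant card_perms mult_1_right)
  finally show ?thesis by (rule sym)
qed

lemma sum_orbit_sum:
  fixes c :: "nat list \<Rightarrow> nat list \<Rightarrow> 'k::field"
  assumes c: "c \<in> equivariant_matrices m n r"
  shows "of_nat (fact r) * (\<Sum>(I, J)\<in>tensor_basis2 m n r. l (I, J) * c I J) =
    (\<Sum>(I, J)\<in>tensor_basis2 m n r. orbit_sum m r l (I, J) * c I J)"
proof -
  let ?Z = "tensor_basis2 m n r" and ?S = "{s. s permutes {1..r}}"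
  let ?t = "\<lambda>s (I, J). pair_sign m r s I J * l (perm_list s I, perm_list s J) * c I J"
  have each: "(\<Sum>(I, J)\<in>?Z. l (I, J) * c I J) = (\<Sum>z\<in>?Z. ?t s z)" if s: "s \<in> ?S" for s
  proof -
    have s': "s permutes {1..r}" using s by simp
    have "(\<Sum>(I, J)\<in>?Z. l (I, J) * c I J) =
        (\<Sum>z\<in>?Z. case map_prod (perm_list s) (perm_list s) z of (I, J) \<Rightarrow> l (I, J) * c I J)"
      by (rule sum.reindex_bij_betw[OF bij_perm_list_pair[OF s'], symmetric])
    also have "\<dots> = (\<Sum>z\<in>?Z. ?t s z)"
    proof (rule sum.cong[OF refl])
      fix z assume z: "z \<in> ?Z"
      obtain I J where IJ: "z = (I, J)" "I \<in> tensor_basis m n r" "J \<in> tensor_basis m n r" using z by auto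
      have "c (perm_list s I) (perm_list s J) = pair_sign m r s I J * c I J"
        using c s' IJ unfolding equivariant_matrices_def by blast
      then show "(case map_prod (perm_list s) (perm_list s) z of (I, J) \<Rightarrow> l (I, J) * c I J) = ?t s z"
        unfolding IJ(1) map_prod_simp prod.case by (simp only: mult.assoc mult.commute mult.left_commute)
    qed
    finally show ?thesis .
  qed
  have "of_nat (fact r) * (\<Sum>(I, J)\<in>?Z. l (I, J) * c I J) = (\<Sum>s\<in>?S. \<Sum>(I, J)\<in>?Z. l (I, J) * c I J)"
    by (simp only: sum_constant card_perms)
  also have "\<dots> = (\<Sum>s\<in>?S. \<Sum>z\<in>?Z. ?t s z)" by (rule sum.cong[OF refl each])
  also have "\<dots> = (\<Sum>z\<in>?Z. \<Sum>s\<in>?S. ?t s z)" by (rule sum.swap)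
  also have "\<dots> = (\<Sum>(I, J)\<in>?Z. orbit_sum m r l (I, J) * c I J)"
    by (rule sum.cong) (auto simp: orbit_sum_def sum_distrib_right)
  finally show ?thesis .
qed

text \<open>The sum over the symmetric group of the translates of the matrix unit at \<open>(I, J)\<close>.\<close>

definition orbit_matrix :: "nat \<Rightarrow> nat \<Rightarrow> nat list \<Rightarrow> nat list \<Rightarrow> nat list \<Rightarrow> nat list \<Rightarrow> 'k::field" where
  "orbit_matrix m r I J X Y =
     (\<Sum>s | s permutes {1..r}. if X = perm_list s I \<and> Y = perm_list s J then pair_sign m r s I J else 0)"

lemma orbit_matrix_equivariant:
  assumes I: "I \<in> tensor_basis m n r" and J: "J \<in> tensor_basis m n r"
  shows "(orbit_matrix m r I J :: _ \<Rightarrow> _ \<Rightarrow> 'k::field) \<in> equivariant_matrices m n r"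
  unfolding equivariant_matrices_def
proof (intro CollectI allI impI ballI)
  fix t X Y assume t: "t permutes {1..r}" and X: "X \<in> tensor_basis m n r" and Y: "Y \<in> tensor_basis m n r"
  note len = tensor_basisD[OF I] tensor_basisD[OF J] tensor_basisD[OF X] tensor_basisD[OF Y]
  let ?S = "{s. s permutes {1..r}}"
  let ?f = "\<lambda>X Y s. if X = perm_list s I \<and> Y = perm_list s J then pair_sign m r s I J else 0 :: 'k"
  have inj: "perm_list t V = perm_list t W \<longleftrightarrow> V = W" if "length V = r" "length W = r" for V W
    using perm_list_inverse(1)[OF t] that by metis
  have "(\<Sum>s\<in>?S. ?f (perm_list t X) (perm_list t Y) s) = (\<Sum>s\<in>?S. ?f (perm_list t X) (perm_list t Y) (t \<circ> s))"
  proof (rule sum.reindex_bij_witness[where i = "\<lambda>s. t \<circ> s" and j = "\<lambda>s. inv' t \<circ> s"])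
    fix s assume "s \<in> ?S"
    then have s: "s permutes {1..r}" by simp
    have 1: "t \<circ> (inv' t \<circ> s) = s" "inv' t \<circ> (t \<circ> s) = s"
      by (simp_all only: o_assoc permutes_inv_o[OF t] id_o)
    then show "t \<circ> (inv' t \<circ> s) = s" "inv' t \<circ> (t \<circ> s) = s" by blast+
    show "inv' t \<circ> s \<in> ?S" "t \<circ> s \<in> ?S"
      using permutes_compose[OF s permutes_inv[OF t]] permutes_compose[OF s t] by auto
    show "?f (perm_list t X) (perm_list t Y) (t \<circ> (inv' t \<circ> s)) = ?f (perm_list t X) (perm_list t Y) s"
      by (simp only: 1)
  qed
  also have "\<dots> = (\<Sum>s\<in>?S. pair_sign m r t X Y * ?f X Y s)"
  proof (rule sum.cong[OF refl])
    fix s assume "s \<in> ?S"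
    then have s: "s permutes {1..r}" by simp
    show "?f (perm_list t X) (perm_list t Y) (t \<circ> s) = pair_sign m r t X Y * ?f X Y s"
      unfolding perm_list_comp[OF t s len(1)] perm_list_comp[OF t s len(2)]
      using inj[OF len(3), of "perm_list s I"] inj[OF len(4), of "perm_list s J"]
        pair_sign_comp[OF t s len(1,2)] len(1,2)
      by auto
  qed
  finally show "orbit_matrix m r I J (perm_list t X) (perm_list t Y) =
      pair_sign m r t X Y * (orbit_matrix m r I J X Y :: 'k)"
    by (simp only: orbit_matrix_def sum_distrib_left)
qed

text \<open>
  Evaluating a relation on the orbit of a matrix unit gives the averaged relation; this makes the
  averaged coefficients visible on equivariant matrices.
\<close>

lemma sum_orbit_matrix:
  assumes I: "I \<in> tensor_basis m n r" and J: "J \<in> tensor_basis m n r"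
  shows "(\<Sum>(X, Y)\<in>tensor_basis2 m n r. l (X, Y) * orbit_matrix m r I J X Y) = (orbit_sum m r l (I, J) :: 'k::field)"
proof -
  let ?Z = "tensor_basis2 m n r" and ?S = "{s. s permutes {1..r}}"
  have fin: "finite ?Z" by (simp add: finite_tensor_basis)
  have "(\<Sum>(X, Y)\<in>?Z. l (X, Y) * orbit_matrix m r I J X Y) =
      (\<Sum>z\<in>?Z. \<Sum>s\<in>?S. if z = (perm_list s I, perm_list s J) then l z * pair_sign m r s I J else 0)"
    by (intro sum.cong refl) (auto simp: orbit_matrix_def sum_distrib_left intro!: sum.cong)
  also have "\<dots> = (\<Sum>s\<in>?S. \<Sum>z\<in>?Z. if z = (perm_list s I, perm_list s J) then l z * pair_sign m r s I J else 0)"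
    by (rule sum.swap)
  also have "\<dots> = (\<Sum>s\<in>?S. l (perm_list s I, perm_list s J) * pair_sign m r s I J)"
  proof (rule sum.cong[OF refl])
    fix s assume "s \<in> ?S"
    then have s: "s permutes {1..r}" by simp
    have "(perm_list s I, perm_list s J) \<in> ?Z" using perm_list_in_basis[OF s] I J by simp
    then show "(\<Sum>z\<in>?Z. if z = (perm_list s I, perm_list s J) then l z * pair_sign m r s I J else 0) =
        l (perm_list s I, perm_list s J) * pair_sign m r s I J"
      using fin by (simp only: sum.delta if_True)
  qed
  finally show ?thesis by (simp add: orbit_sum_def mult.commute)
qed

lemma orbit_sum_perm:
  assumes t: "t permutes {1..r}" and I: "length I = r" and J: "length J = r"
  shows "orbit_sum m r l (perm_list t I, perm_list t J) = pair_sign m r t I J * (orbit_sum m r l (I, J) :: 'k::field)"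
proof -
  let ?S = "{s. s permutes {1..r}}"
  let ?f = "\<lambda>s. pair_sign m r s I J * l (perm_list s I, perm_list s J) :: 'k"
  have "orbit_sum m r l (I, J) = (\<Sum>s\<in>?S. ?f s)" by (simp add: orbit_sum_def)
  also have "\<dots> = (\<Sum>s\<in>?S. ?f (s \<circ> t))"
  proof (rule sum.reindex_bij_witness[where i = "\<lambda>s. s \<circ> t" and j = "\<lambda>s. s \<circ> inv' t"])
    fix s assume "s \<in> ?S"
    then have s: "s permutes {1..r}" by simp
    have 1: "(s \<circ> inv' t) \<circ> t = s" "(s \<circ> t) \<circ> inv' t = s"
      by (simp_all only: o_assoc[symmetric] permutes_inv_o[OF t] o_id)
    then show "(s \<circ> inv' t) \<circ> t = s" "(s \<circ> t) \<circ> inv' t = s" by blast+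
    show "s \<circ> inv' t \<in> ?S" "s \<circ> t \<in> ?S"
      using permutes_compose[OF permutes_inv[OF t] s] permutes_compose[OF t s] by auto
    show "?f ((s \<circ> inv' t) \<circ> t) = ?f s" by (simp only: 1)
  qed
  also have "\<dots> = (\<Sum>s\<in>?S. pair_sign m r t I J *
      (pair_sign m r s (perm_list t I) (perm_list t J) *
        l (perm_list s (perm_list t I), perm_list s (perm_list t J))))"
    by (rule sum.cong) (auto simp: pair_sign_comp[OF _ t I J] perm_list_comp[OF _ t I] perm_list_comp[OF _ t J])
  finally have "orbit_sum m r l (I, J) = pair_sign m r t I J * orbit_sum m r l (perm_list t I, perm_list t J)"
    by (simp add: orbit_sum_def sum_distrib_left)
  then have "pair_sign m r t I J * orbit_sum m r l (I, J) =
      (pair_sign m r t I J * pair_sign m r t I J) * orbit_sum m r l (perm_list t I, perm_list t J)"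
    by (simp only: mult.assoc)
  then show ?thesis by (simp only: pair_sign_square mult_1)
qed

text \<open>
  Two entries \<open>g x x'\<close> and \<open>g y y'\<close> are interchanged by
  supercommutativity. Together with the signs in \<open>tensor_coeff\<close> this leaves the
  product of the signs for interchanging \<open>x, y\<close> and for interchanging \<open>x',
  y'\<close>.
\<close>

lemma (in comm_superalgebra) tensor_coeff_swap:
  assumes g: "g \<in> even_matrices m n"
  shows "length us = length us' \<Longrightarrow> us @ x # y # vs \<in> tensor_basis m n r \<Longrightarrow>
    us' @ x' # y' # vs' \<in> tensor_basis m n r \<Longrightarrow>
    tensor_coeff m A g (us @ y # x # vs) (us' @ y' # x' # vs') =
      (koszul (par_V m x * par_V m y) * koszul (par_V m x' * par_V m y')) \<odot>
        tensor_coeff m A g (us @ x # y # vs) (us' @ x' # y' # vs')"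
proof (induction us us' arbitrary: r rule: list_induct2)
  case Nil
  let ?p = "par_V m" and ?P = "tensor_par m vs" and ?R = "tensor_coeff m A g vs vs'"
  obtain r' where r: "r = Suc (Suc r')" using Nil by (auto simp: tensor_basis_def)
  have B: "vs \<in> tensor_basis m n r'" "vs' \<in> tensor_basis m n r'"
    and lt: "x < m + n" "y < m + n" "x' < m + n" "y' < m + n"
    using Nil by (auto simp: r Cons_in_tensor_basis)
  note gx = even_matrix_entry[OF g lt(1,3)] and gy = even_matrix_entry[OF g lt(2,4)]
  have cl: "g x x' \<in> carrier A" "g y y' \<in> carrier A" "?R \<in> carrier A"
    using grade_closed[OF gx] grade_closed[OF gy] tensor_coeff_closed[OF g B] by auto
  let ?qx = "?p x + ?p x'" and ?qy = "?p y + ?p y'"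
  have expand: "tensor_coeff m A g (a # b # vs) (a' # b' # vs') =
      (koszul ((?p a + ?p a') * (?p b + ?P)) * koszul ((?p b + ?p b') * ?P)) \<odot> ((g a a' \<otimes> g b b') \<otimes> ?R)"
    if "g a a' \<in> carrier A" "g b b' \<in> carrier A" for a b a' b'
    using that cl(3)
    by (simp add: smult_mult_r smult_closed smult_assoc m_assoc del: add_bit_eq_xor mult_bit_eq_and)
  have swap: "g y y' \<otimes> g x x' = koszul (?qy * ?qx) \<odot> (g x x' \<otimes> g y y')"
    by (rule supercomm[OF gy gx])
  have sign: "?qy * (?p x + ?P) + (?qx * ?P + ?qy * ?qx) =
      (?p x * ?p y + ?p x' * ?p y') + (?qx * (?p y + ?P) + ?qy * ?P)"
    by (cases "?p x = 0"; cases "?p y = 0"; cases "?p x' = 0"; cases "?p y' = 0"; cases "?P = 0") simp_all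
  have "tensor_coeff m A g (y # x # vs) (y' # x' # vs') =
      (koszul (?qy * (?p x + ?P)) * koszul (?qx * ?P)) \<odot> ((g y y' \<otimes> g x x') \<otimes> ?R)"
    by (rule expand[OF cl(2,1)])
  also have "\<dots> = (koszul (?qy * (?p x + ?P)) * (koszul (?qx * ?P) * koszul (?qy * ?qx))) \<odot>
      ((g x x' \<otimes> g y y') \<otimes> ?R)"
    unfolding swap using cl by (simp only: smult_mult_l smult_assoc m_closed smult_closed)
  also have "koszul (?qy * (?p x + ?P)) * (koszul (?qx * ?P) * koszul (?qy * ?qx)) =
      (koszul (?p x * ?p y) * koszul (?p x' * ?p y')) * (koszul (?qx * (?p y + ?P)) * koszul (?qy * ?P) :: 'k)"
    by (simp only: koszul_add[symmetric] sign)
  also have "\<dots> \<odot> ((g x x' \<otimes> g y y') \<otimes> ?R) = (koszul (?p x * ?p y) * koszul (?p x' * ?p y')) \<odot>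
      tensor_coeff m A g (x # y # vs) (x' # y' # vs')"
    unfolding expand[OF cl(1,2)] using cl by (intro smult_assoc) auto
  finally show ?case by (simp only: append_Nil)
next
  case (Cons u us u' us')
  let ?k = "koszul (par_V m x * par_V m y) * koszul (par_V m x' * par_V m y') :: 'k"
  obtain r' where r: "r = Suc r'" using Cons.prems by (auto simp: tensor_basis_def)
  have B: "us @ x # y # vs \<in> tensor_basis m n r'" "us' @ x' # y' # vs' \<in> tensor_basis m n r'"
    and lt: "u < m + n" "u' < m + n"
    using Cons.prems by (auto simp: r Cons_in_tensor_basis)
  have cl: "g u u' \<in> carrier A" "tensor_coeff m A g (us @ x # y # vs) (us' @ x' # y' # vs') \<in> carrier A"
    using grade_closed[OF even_matrix_entry[OF g lt]] tensor_coeff_closed[OF g B] by auto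
  have par: "tensor_par m (us @ y # x # vs) = tensor_par m (us @ x # y # vs)"
    by (simp only: tensor_par_append tensor_par_simps add.left_commute)
  show ?case
    unfolding append_Cons tensor_coeff.simps par Cons.IH[OF B]
    using cl by (simp only: smult_mult_r smult_assoc[symmetric] m_closed mult.commute)
qed

text \<open>
  Both sides are compatible with composition of permutations, the signs by
  \<open>perm_sign_comp\<close>, so adjacent transpositions suffice.
\<close>

lemma (in comm_superalgebra) tensor_coeff_equivariant:
  assumes g: "g \<in> even_matrices m n"
  shows "s permutes {1..r} \<Longrightarrow> I \<in> tensor_basis m n r \<Longrightarrow> J \<in> tensor_basis m n r \<Longrightarrow>
    tensor_coeff m A g (perm_list s I) (perm_list s J) = pair_sign m r s I J \<odot> tensor_coeff m A g I J"
proof (induction arbitrary: I J rule: permutes_adjacent_induct)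
  case id
  show ?case
    unfolding perm_list_id pair_sign_id by (rule smult_one[OF tensor_coeff_closed[OF g id], symmetric])
next
  case (swap k)
  note len = tensor_basisD[OF swap(2)] tensor_basisD[OF swap(3)]
  from split_at_adjacent[OF len(1) swap(1)] obtain us x y vs where I: "I = us @ x # y # vs" "length us = k" .
  from split_at_adjacent[OF len(2) swap(1)] obtain us' x' y' vs' where J: "J = us' @ x' # y' # vs'" "length us' = k" .
  have r: "r = length (us @ x # y # vs)" "r = length (us' @ x' # y' # vs')" using I J len by auto
  have eq: "length us = length us'" using I J by simp
  show ?case
    unfolding I(1) J(1) perm_list_adjacent[OF I(2)] perm_list_adjacent[OF J(2)] pair_sign_def
      perm_sign_adjacent[OF I(2) r(1)] perm_sign_adjacent[OF J(2) r(2)]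
    by (rule tensor_coeff_swap[OF g eq swap(2)[unfolded I(1)] swap(3)[unfolded J(1)]])
next
  case (comp s t)
  note len = tensor_basisD[OF comp.prems(1)] tensor_basisD[OF comp.prems(2)]
  have B: "perm_list t I \<in> tensor_basis m n r" "perm_list t J \<in> tensor_basis m n r"
    using perm_list_in_basis[OF comp.hyps(2)] comp.prems by auto
  show ?case
    unfolding perm_list_comp[OF comp.hyps len(1)] perm_list_comp[OF comp.hyps len(2)]
      comp.IH(1)[OF B] comp.IH(2)[OF comp.prems] pair_sign_comp[OF comp.hyps len]
    by (rule smult_assoc[OF tensor_coeff_closed[OF g comp.prems], symmetric])
qed

text \<open>
  Relations that agree on all equivariant matrices have the same averages, as the orbits of matrix
  units show. Averaging does not change a relation between tensor coefficients except for the
  factor \<open>r!\<close>.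
\<close>

lemma (in comm_superalgebra) tensor_coeff_relations:
  fixes l l' :: "nat list \<times> nat list \<Rightarrow> 'k"
  assumes g: "g \<in> even_matrices m n" and char: "of_nat (fact r) \<noteq> (0 :: 'k)"
    and eq: "\<And>c. c \<in> equivariant_matrices m n r \<Longrightarrow>
      (\<Sum>(I, J)\<in>tensor_basis2 m n r. l (I, J) * c I J) = (\<Sum>(I, J)\<in>tensor_basis2 m n r. l' (I, J) * c I J)"
  shows "lincomb A (tensor_basis2 m n r) l (\<lambda>(I, J). tensor_coeff m A g I J) =
    lincomb A (tensor_basis2 m n r) l' (\<lambda>(I, J). tensor_coeff m A g I J)"
proof -
  let ?Z = "tensor_basis2 m n r" and ?X = "\<lambda>(I, J). tensor_coeff m A g I J"
  have cl: "?X z \<in> carrier A" if "z \<in> ?Z" for z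
    using tensor_coeff_closed[OF g, of "fst z" r "snd z"] that by (simp add: split_beta mem_Times_iff)
  have orbit: "of_nat (fact r) \<odot> lincomb A ?Z l ?X = lincomb A ?Z (orbit_sum m r l) ?X" for l
    by (rule lincomb_orbit_sum; unfold prod.case)
      (rule tensor_coeff_closed[OF g] tensor_coeff_equivariant[OF g]; assumption)+
  have "orbit_sum m r l z = orbit_sum m r l' z" if zZ: "z \<in> ?Z" for z
  proof -
    obtain I J where z: "z = (I, J)" "I \<in> tensor_basis m n r" "J \<in> tensor_basis m n r" using zZ by auto
    show ?thesis
      unfolding z(1) sum_orbit_matrix[OF z(2,3), symmetric] by (rule eq[OF orbit_matrix_equivariant[OF z(2,3)]])
  qed
  then have "lincomb A ?Z (orbit_sum m r l) ?X = lincomb A ?Z (orbit_sum m r l') ?X"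
    by (rule lincomb_cong[OF _ refl cl])
  then have "inverse (of_nat (fact r)) \<odot> (of_nat (fact r) \<odot> lincomb A ?Z l ?X) =
      inverse (of_nat (fact r)) \<odot> (of_nat (fact r) \<odot> lincomb A ?Z l' ?X)"
    by (simp only: orbit)
  moreover have "inverse (of_nat (fact r)) \<odot> (of_nat (fact r) \<odot> lincomb A ?Z l ?X) = lincomb A ?Z l ?X" for l
  proof -
    have L: "lincomb A ?Z l ?X \<in> carrier A" by (rule lincomb_closed) (rule cl)
    show ?thesis by (simp only: smult_assoc[OF L, symmetric] field_class.field_inverse[OF char] smult_one[OF L])
  qed
  ultimately show ?thesis by simp
qed

section \<open>The representation of the symmetric group on tensors\<close>

lemma lr_basis_sym_tensor_rep [simp]: "lr_basis (sym_tensor_rep m n r) = tensor_basis m n r"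
  by (simp add: sym_tensor_rep_def)

lemma sym_tensor_op_unit_vec:
  assumes s: "s permutes {1..r}" and I: "I \<in> tensor_basis m n r"
  shows "rep_op (sym_tensor_rep m n r) s (unit_vec I) =
    fscale (perm_sign m r s I) (unit_vec (perm_list s I) :: _ \<Rightarrow> 'k::field)"
proof
  fix J
  let ?B = "tensor_basis m n r"
  have "rep_op (sym_tensor_rep m n r) s (unit_vec I) J =
      (if J \<in> ?B then lr_act (sym_tensor_rep m n r :: (_, 'k, _) lin_rep) s J I else 0)"
    by (simp only: rep_op_def lr_basis_sym_tensor_rep lin_map_unit_vec[OF finite_tensor_basis I])
  also have "\<dots> = (if J = perm_list s I then perm_sign m r s I else 0)"
  proof (cases "J \<in> ?B")
    case True
    have "(\<forall>t\<in>{1..r}. J ! (s t - 1) = I ! (t - 1)) \<longleftrightarrow> J = perm_list s I"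
      using perm_list_unique[OF s tensor_basisD[OF I] tensor_basisD[OF True]]
        perm_list_nth[OF s tensor_basisD[OF I]] by blast
    then show ?thesis using True I by (simp add: sym_tensor_rep_def)
  next
    case False
    then have "J \<noteq> perm_list s I" using perm_list_in_basis[OF s I] by blast
    then show ?thesis using False by simp
  qed
  also have "\<dots> = fscale (perm_sign m r s I) (unit_vec (perm_list s I)) J"
    by (simp add: fscale_def unit_vec_def)
  finally show "rep_op (sym_tensor_rep m n r) s (unit_vec I) J =
      fscale (perm_sign m r s I) (unit_vec (perm_list s I) :: _ \<Rightarrow> 'k) J" .
qed

lemma sym_tensor_op_apply:
  fixes u :: "nat list \<Rightarrow> 'k::field"
  assumes s: "s permutes {1..r}" and J: "J \<in> tensor_basis m n r"
  shows "rep_op (sym_tensor_rep m n r) s u (perm_list s J) = perm_sign m r s J * u J"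
proof -
  let ?B = "tensor_basis m n r"
  have "rep_op (sym_tensor_rep m n r) s u (perm_list s J) =
      (\<Sum>I\<in>?B. lr_act (sym_tensor_rep m n r) s (perm_list s J) I * u I)"
    using perm_list_in_basis[OF s J] by (simp add: rep_op_def lin_map_def)
  also have "\<dots> = (\<Sum>I\<in>?B. if I = J then perm_sign m r s J * u J else 0)"
  proof (rule sum.cong[OF refl])
    fix I assume I: "I \<in> ?B"
    have "lr_act (sym_tensor_rep m n r) s (perm_list s J) I =
        rep_op (sym_tensor_rep m n r) s (unit_vec I) (perm_list s J :: nat list) "
      unfolding rep_op_def lr_basis_sym_tensor_rep lin_map_unit_vec[OF finite_tensor_basis I]
      using perm_list_in_basis[OF s J] by simp
    also have "\<dots> = (if perm_list s J = perm_list s I then perm_sign m r s I else 0)"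
      unfolding sym_tensor_op_unit_vec[OF s I] by (simp add: fscale_def unit_vec_def)
    also have "perm_list s J = perm_list s I \<longleftrightarrow> I = J"
      using perm_list_inverse(1)[OF s] tensor_basisD[OF I] tensor_basisD[OF J] by metis
    finally have act: "lr_act (sym_tensor_rep m n r) s (perm_list s J) I = (if I = J then perm_sign m r s I else 0)" .
    show "lr_act (sym_tensor_rep m n r) s (perm_list s J) I * u I =
        (if I = J then perm_sign m r s J * u J else 0)" unfolding act by simp
  qed
  also have "\<dots> = perm_sign m r s J * u J" using J by (simp add: finite_tensor_basis)
  finally show ?thesis .
qed

lemma sym_tensor_rep_is_rep: "is_lin_rep (sym_group r) (sym_tensor_rep m n r :: (_, 'k::field, _) lin_rep)"
proof -
  interpret group "sym_group r" by (rule sym_group_is_group)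
  let ?M = "sym_tensor_rep m n r :: (nat \<Rightarrow> nat, 'k, nat list) lin_rep" and ?B = "tensor_basis m n r"
  have cl: "lr_act ?M s \<in> carrier (End_lin ?B)" for s
    by (auto simp: sym_tensor_rep_def End_lin_def)
  show ?thesis
    unfolding is_lin_rep_iff lr_basis_sym_tensor_rep
  proof (intro conjI ballI)
    fix s t and u :: "nat list \<Rightarrow> 'k"
    assume st: "s \<in> carrier (sym_group r)" "t \<in> carrier (sym_group r)" and u: "u \<in> coord_space ?B"
    then have s: "s permutes {1..r}" and t: "t permutes {1..r}" by (simp_all add: sym_group_carrier)
    have "rep_op ?M (s \<circ> t) u = rep_op ?M s (rep_op ?M t u)"
    proof (rule flinear_eq_on_coord_space[OF finite_tensor_basis flinear_rep_op
          flinear_compose[OF flinear_rep_op flinear_rep_op] _ u])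
      fix I assume I: "I \<in> ?B"
      show "rep_op ?M (s \<circ> t) (unit_vec I) = rep_op ?M s (rep_op ?M t (unit_vec I))"
        unfolding sym_tensor_op_unit_vec[OF permutes_compose[OF t s] I] sym_tensor_op_unit_vec[OF t I]
          flinear_simps(2)[OF flinear_rep_op] sym_tensor_op_unit_vec[OF s perm_list_in_basis[OF t I]]
          perm_sign_comp[OF s t tensor_basisD[OF I]] perm_list_comp[OF s t tensor_basisD[OF I]]
        by (simp add: fscale_def mult_ac)
    qed
    then show "rep_op ?M (s \<otimes>\<^bsub>sym_group r\<^esub> t) u = rep_op ?M s (rep_op ?M t u)" by (simp add: sym_group_mult)
  next
    fix u :: "nat list \<Rightarrow> 'k" assume u: "u \<in> coord_space ?B"
    have "flinear (\<lambda>x. x :: nat list \<Rightarrow> 'k)" by (rule flinearI) auto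
    from flinear_eq_on_coord_space[OF finite_tensor_basis flinear_rep_op this _ u, of ?M id]
    have "rep_op ?M id u = u"
      by (simp add: sym_tensor_op_unit_vec[OF permutes_id] perm_sign_id perm_list_id fscale_def)
    then show "rep_op ?M \<one>\<^bsub>sym_group r\<^esub> u = u" by (simp add: sym_group_one)
  qed (auto simp: finite_tensor_basis cl)
qed

lemma finite_group_rep_sym_tensor:
  "finite_group_rep (sym_group r) (sym_tensor_rep m n r :: (_, 'k::field_char_0, _) lin_rep)"
proof (intro finite_group_rep.intro finite_group_rep_axioms.intro)
  show "group (sym_group r)" by (rule sym_group_is_group)
  have c: "carrier (sym_group r) = {s. s permutes {1..r}}" by (simp add: sym_group_def)
  show "finite (carrier (sym_group r))" unfolding c by (rule finite_perms)
  show "of_nat (card (carrier (sym_group r))) \<noteq> (0 :: 'k)" unfolding c card_perms by simp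
qed (rule sym_tensor_rep_is_rep)

section \<open>Perturbing an invertible matrix by a square-zero entry\<close>

lemma restrict2_eq_iff:
  "(\<lambda>i\<in>I. \<lambda>j\<in>J. f i j) = (\<lambda>i\<in>I. \<lambda>j\<in>J. h i j) \<longleftrightarrow> (\<forall>i\<in>I. \<forall>j\<in>J. f i j = h i j)"
proof
  assume eq: "(\<lambda>i\<in>I. \<lambda>j\<in>J. f i j) = (\<lambda>i\<in>I. \<lambda>j\<in>J. h i j)"
  show "\<forall>i\<in>I. \<forall>j\<in>J. f i j = h i j"
  proof (intro ballI)
    fix i j assume "i \<in> I" "j \<in> J"
    then show "f i j = h i j" using fun_cong[OF fun_cong[OF eq, of i], of j] by simp
  qed
next
  assume eq: "\<forall>i\<in>I. \<forall>j\<in>J. f i j = h i j"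
  show "(\<lambda>i\<in>I. \<lambda>j\<in>J. f i j) = (\<lambda>i\<in>I. \<lambda>j\<in>J. h i j)"
  proof (rule restrict_ext)
    fix i assume "i \<in> I"
    then show "(\<lambda>j\<in>J. f i j) = (\<lambda>j\<in>J. h i j)" using eq by (intro restrict_ext) blast
  qed
qed

lemma End_superI:
  assumes "\<And>i j. i \<in> I \<Longrightarrow> j \<in> I \<Longrightarrow> f i j \<in> grade A (p i + p j)"
  shows "(\<lambda>i\<in>I. \<lambda>j\<in>I. f i j) \<in> carrier (End_super I p A)"
  unfolding End_super_def partial_object.simps
  by (intro restrict_PiE_iff[THEN iffD2] ballI) (rule assms)

context comm_superalgebra
begin

lemma grade_a_inv: "x \<in> grade A p \<Longrightarrow> \<ominus> x \<in> grade A p"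
  using smult_minus_one[OF grade_closed[of x p]] grade_smult[of x p "- 1"] by metis

definition is_inverse_matrix :: "nat \<Rightarrow> (nat \<Rightarrow> nat \<Rightarrow> 'u) \<Rightarrow> (nat \<Rightarrow> nat \<Rightarrow> 'u) \<Rightarrow> bool" where
  "is_inverse_matrix d g h \<longleftrightarrow> (\<forall>i<d. \<forall>j<d.
     (\<Oplus>l\<in>{..<d}. g i l \<otimes> h l j) = (if i = j then \<one> else \<zero>) \<and>
     (\<Oplus>l\<in>{..<d}. h i l \<otimes> g l j) = (if i = j then \<one> else \<zero>))"

lemma even_matrixI:
  assumes "\<And>i j. i < m + n \<Longrightarrow> j < m + n \<Longrightarrow> f i j \<in> grade A (par_V m i + par_V m j)"
  shows "(\<lambda>i\<in>{..<m + n}. \<lambda>j\<in>{..<m + n}. f i j) \<in> even_matrices m n"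
  by (rule End_superI) (use assms in simp)

lemma GL_iff:
  "g \<in> carrier (GL m n A) \<longleftrightarrow> g \<in> even_matrices m n \<and> (\<exists>h\<in>even_matrices m n. is_inverse_matrix (m + n) g h)"
proof -
  have "h \<otimes>\<^bsub>End_super {..<m + n} (par_V m) A\<^esub> g = \<one>\<^bsub>End_super {..<m + n} (par_V m) A\<^esub> \<and>
      g \<otimes>\<^bsub>End_super {..<m + n} (par_V m) A\<^esub> h = \<one>\<^bsub>End_super {..<m + n} (par_V m) A\<^esub> \<longleftrightarrow>
    is_inverse_matrix (m + n) g h" for g h
    unfolding End_super_def monoid.simps restrict2_eq_iff is_inverse_matrix_def by auto
  then show ?thesis unfolding GL_def units_of_def Units_def partial_object.simps by blast
qed

text \<open>The two factors \<open>x\<close> are brought together by supercommutativity.\<close>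

lemma square_zero_sandwich:
  assumes x: "x \<in> grade A p" and h: "h \<in> grade A q" and sq: "x \<otimes> x = \<zero>"
  shows "x \<otimes> (h \<otimes> x) = \<zero>"
proof -
  have cl: "x \<in> carrier A" "h \<in> carrier A" using grade_closed x h by auto
  have "h \<otimes> x = koszul (q * p) \<odot> (x \<otimes> h)" by (rule supercomm[OF h x])
  then have "x \<otimes> (h \<otimes> x) = koszul (q * p) \<odot> ((x \<otimes> x) \<otimes> h)"
    using cl by (simp add: smult_mult_r m_assoc)
  then show ?thesis using cl by (simp add: sq smult_zero)
qed

text \<open>
  For \<open>E\<close> the matrix unit at \<open>(a, b)\<close> and \<open>h\<close> the inverse
  of \<open>g\<close>, the inverse of \<open>g + x E\<close> is \<open>h - h x E h\<close>: the
  term of second order contains the factor \<open>x (h b a) x\<close>, which vanishes.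
\<close>

lemma GL_add_elementary:
  assumes g: "g \<in> carrier (GL m n A)" and ab: "a < m + n" "b < m + n"
    and x: "x \<in> grade A (par_V m a + par_V m b)" and sq: "x \<otimes> x = \<zero>"
  shows "(\<lambda>i\<in>{..<m + n}. \<lambda>j\<in>{..<m + n}. g i j \<oplus> (if i = a \<and> j = b then x else \<zero>)) \<in> carrier (GL m n A)"
    (is "?g \<in> _")
proof -
  let ?d = "m + n" and ?p = "par_V m"
  from g obtain h where ge: "g \<in> even_matrices m n" and he: "h \<in> even_matrices m n"
    and inv: "is_inverse_matrix ?d g h" unfolding GL_iff by blast
  have gcl: "g i j \<in> carrier A" and hcl: "h i j \<in> carrier A" if "i < ?d" "j < ?d" for i j
    using grade_closed[OF even_matrix_entry[OF ge that]] grade_closed[OF even_matrix_entry[OF he that]] .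
  have xcl: "x \<in> carrier A" by (rule grade_closed[OF x])
  have sand: "x \<otimes> (h b a \<otimes> x) = \<zero>"
    by (rule square_zero_sandwich[OF x even_matrix_entry[OF he ab(2,1)] sq])
  define h' where "h' i j = h i j \<oplus> \<ominus> ((h i a \<otimes> x) \<otimes> h b j)" for i j
  have h'cl: "h' i j \<in> carrier A" if "i < ?d" "j < ?d" for i j
    unfolding h'_def using hcl ab that xcl by simp
  have ge': "?g \<in> even_matrices m n"
  proof (rule even_matrixI)
    fix i j assume ij: "i < ?d" "j < ?d"
    show "g i j \<oplus> (if i = a \<and> j = b then x else \<zero>) \<in> grade A (?p i + ?p j)"
      by (intro grade_add even_matrix_entry[OF ge ij]) (use x grade_zero in auto)
  qed
  have he': "(\<lambda>i\<in>{..<?d}. \<lambda>j\<in>{..<?d}. h' i j) \<in> even_matrices m n"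
  proof (rule even_matrixI)
    fix i j assume ij: "i < ?d" "j < ?d"
    have "(h i a \<otimes> x) \<otimes> h b j \<in> grade A (((?p i + ?p a) + (?p a + ?p b)) + (?p b + ?p j))"
      by (intro grade_mult x even_matrix_entry[OF he] ij ab)
    also have "((?p i + ?p a) + (?p a + ?p b)) + (?p b + ?p j) = ?p i + ?p j"
      by (cases "?p i = 0"; cases "?p a = 0"; cases "?p b = 0"; cases "?p j = 0") simp_all
    finally show "h' i j \<in> grade A (?p i + ?p j)"
      unfolding h'_def by (intro grade_add grade_a_inv even_matrix_entry[OF he ij])
  qed
  have inv1: "(\<Oplus>l\<in>{..<?d}. g i l \<otimes> h l j) = (if i = j then \<one> else \<zero>)"
    and inv2: "(\<Oplus>l\<in>{..<?d}. h i l \<otimes> g l j) = (if i = j then \<one> else \<zero>)" if "i < ?d" "j < ?d" for i j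
    using inv that unfolding is_inverse_matrix_def by auto
  have "is_inverse_matrix ?d ?g (\<lambda>i\<in>{..<?d}. \<lambda>j\<in>{..<?d}. h' i j)"
    unfolding is_inverse_matrix_def
  proof (intro allI impI conjI)
    fix i j assume ij: "i < ?d" "j < ?d"
    let ?y = "x \<otimes> h b j"
    have ycl: "?y \<in> carrier A" using xcl hcl ab ij by simp
    have xh': "x \<otimes> h' b j = ?y"
    proof -
      have "x \<otimes> h' b j = ?y \<oplus> \<ominus> ((x \<otimes> (h b a \<otimes> x)) \<otimes> h b j)"
        unfolding h'_def using xcl hcl ab ij by (simp add: r_distr r_minus m_assoc)
      then show ?thesis using hcl ab ij ycl by (simp add: sand)
    qed
    have "(\<Oplus>l\<in>{..<?d}. ?g i l \<otimes> (\<lambda>i\<in>{..<?d}. \<lambda>j\<in>{..<?d}. h' i j) l j) =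
        (\<Oplus>l\<in>{..<?d}. (g i l \<otimes> h l j \<oplus> (g i l \<otimes> h l a) \<otimes> (\<ominus> ?y)) \<oplus> (if i = a \<and> l = b then ?y else \<zero>))"
    proof (rule finsum_cong_simple)
      fix l assume "l \<in> {..<?d}"
      then have l: "l < ?d" by simp
      have "g i l \<otimes> h' l j = g i l \<otimes> h l j \<oplus> (g i l \<otimes> h l a) \<otimes> (\<ominus> ?y)"
        unfolding h'_def using gcl hcl l ij ab xcl by (simp add: r_distr r_minus m_assoc)
      moreover have "(g i l \<oplus> (if i = a \<and> l = b then x else \<zero>)) \<otimes> h' l j =
          g i l \<otimes> h' l j \<oplus> (if i = a \<and> l = b then ?y else \<zero>)"
        using gcl[OF ij(1) l] h'cl[OF l ij(2)] xcl xh' by (auto simp: l_distr)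
      ultimately show "?g i l \<otimes> (\<lambda>i\<in>{..<?d}. \<lambda>j\<in>{..<?d}. h' i j) l j =
          (g i l \<otimes> h l j \<oplus> (g i l \<otimes> h l a) \<otimes> (\<ominus> ?y)) \<oplus> (if i = a \<and> l = b then ?y else \<zero>)"
        using ij l by simp
      show "(g i l \<otimes> h l j \<oplus> (g i l \<otimes> h l a) \<otimes> (\<ominus> ?y)) \<oplus> (if i = a \<and> l = b then ?y else \<zero>) \<in> carrier A"
        using gcl hcl l ij ab ycl by auto
    qed
    also have "\<dots> = ((\<Oplus>l\<in>{..<?d}. g i l \<otimes> h l j) \<oplus> (\<Oplus>l\<in>{..<?d}. (g i l \<otimes> h l a) \<otimes> (\<ominus> ?y))) \<oplus>
        (\<Oplus>l\<in>{..<?d}. if i = a \<and> l = b then ?y else \<zero>)"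
      using gcl hcl ij ab ycl by (subst finsum_addf; auto)+
    also have "(\<Oplus>l\<in>{..<?d}. (g i l \<otimes> h l a) \<otimes> (\<ominus> ?y)) = (\<Oplus>l\<in>{..<?d}. g i l \<otimes> h l a) \<otimes> (\<ominus> ?y)"
      using gcl hcl ij ab ycl by (intro finsum_ldistr[symmetric]) auto
    also have "(\<Oplus>l\<in>{..<?d}. if i = a \<and> l = b then ?y else \<zero>) = (if i = a then ?y else \<zero>)"
      using finsum_single[of "{..<?d}" b "\<lambda>l. if i = a \<and> l = b then ?y else \<zero>"] ab ycl by simp
    also have "((\<Oplus>l\<in>{..<?d}. g i l \<otimes> h l j) \<oplus> (\<Oplus>l\<in>{..<?d}. g i l \<otimes> h l a) \<otimes> (\<ominus> ?y)) \<oplus>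
        (if i = a then ?y else \<zero>) = (if i = j then \<one> else \<zero>)"
      using ycl by (simp add: inv1[OF ij] inv1[OF ij(1) ab(1)] a_assoc l_neg)
    finally show "(\<Oplus>l\<in>{..<?d}. ?g i l \<otimes> (\<lambda>i\<in>{..<?d}. \<lambda>j\<in>{..<?d}. h' i j) l j) = (if i = j then \<one> else \<zero>)" .
  next
    fix i j assume ij: "i < ?d" "j < ?d"
    let ?y = "h i a \<otimes> x"
    have ycl: "?y \<in> carrier A" using xcl hcl ab ij by simp
    have h'x: "h' i a \<otimes> x = ?y"
    proof -
      have "h' i a \<otimes> x = ?y \<oplus> \<ominus> (h i a \<otimes> (x \<otimes> (h b a \<otimes> x)))"
        unfolding h'_def using xcl hcl ab ij by (simp add: l_distr l_minus m_assoc)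
      then show ?thesis using hcl ab ij ycl by (simp add: sand)
    qed
    have "(\<Oplus>l\<in>{..<?d}. (\<lambda>i\<in>{..<?d}. \<lambda>j\<in>{..<?d}. h' i j) i l \<otimes> ?g l j) =
        (\<Oplus>l\<in>{..<?d}. (h i l \<otimes> g l j \<oplus> (\<ominus> ?y) \<otimes> (h b l \<otimes> g l j)) \<oplus> (if l = a \<and> j = b then ?y else \<zero>))"
    proof (rule finsum_cong_simple)
      fix l assume "l \<in> {..<?d}"
      then have l: "l < ?d" by simp
      have "h' i l \<otimes> g l j = h i l \<otimes> g l j \<oplus> (\<ominus> ?y) \<otimes> (h b l \<otimes> g l j)"
        unfolding h'_def using gcl hcl l ij ab xcl by (simp add: l_distr l_minus m_assoc)
      moreover have "h' i l \<otimes> (g l j \<oplus> (if l = a \<and> j = b then x else \<zero>)) =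
          h' i l \<otimes> g l j \<oplus> (if l = a \<and> j = b then ?y else \<zero>)"
        using gcl[OF l ij(2)] h'cl[OF ij(1) l] xcl h'x by (auto simp: r_distr)
      ultimately show "(\<lambda>i\<in>{..<?d}. \<lambda>j\<in>{..<?d}. h' i j) i l \<otimes> ?g l j =
          (h i l \<otimes> g l j \<oplus> (\<ominus> ?y) \<otimes> (h b l \<otimes> g l j)) \<oplus> (if l = a \<and> j = b then ?y else \<zero>)"
        using ij l by simp
      show "(h i l \<otimes> g l j \<oplus> (\<ominus> ?y) \<otimes> (h b l \<otimes> g l j)) \<oplus> (if l = a \<and> j = b then ?y else \<zero>) \<in> carrier A"
        using gcl hcl l ij ab ycl by auto
    qed
    also have "\<dots> = ((\<Oplus>l\<in>{..<?d}. h i l \<otimes> g l j) \<oplus> (\<Oplus>l\<in>{..<?d}. (\<ominus> ?y) \<otimes> (h b l \<otimes> g l j))) \<oplus>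
        (\<Oplus>l\<in>{..<?d}. if l = a \<and> j = b then ?y else \<zero>)"
      using gcl hcl ij ab ycl by (subst finsum_addf; auto)+
    also have "(\<Oplus>l\<in>{..<?d}. (\<ominus> ?y) \<otimes> (h b l \<otimes> g l j)) = (\<ominus> ?y) \<otimes> (\<Oplus>l\<in>{..<?d}. h b l \<otimes> g l j)"
      using gcl hcl ij ab ycl by (intro finsum_rdistr[symmetric]) auto
    also have "(\<Oplus>l\<in>{..<?d}. if l = a \<and> j = b then ?y else \<zero>) = (if j = b then ?y else \<zero>)"
      using finsum_single[of "{..<?d}" a "\<lambda>l. if l = a \<and> j = b then ?y else \<zero>"] ab ycl by simp
    also have "((\<Oplus>l\<in>{..<?d}. h i l \<otimes> g l j) \<oplus> (\<ominus> ?y) \<otimes> (\<Oplus>l\<in>{..<?d}. h b l \<otimes> g l j)) \<oplus>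
        (if j = b then ?y else \<zero>) = (if i = j then \<one> else \<zero>)"
      using ycl by (simp add: inv2[OF ij] inv2[OF ab(2) ij(2)] a_assoc l_neg)
    finally show "(\<Oplus>l\<in>{..<?d}. (\<lambda>i\<in>{..<?d}. \<lambda>j\<in>{..<?d}. h' i j) i l \<otimes> ?g l j) = (if i = j then \<one> else \<zero>)" .
  qed
  then show ?thesis unfolding GL_iff using ge' he' by blast
qed

lemma GL_one: "(\<lambda>i\<in>{..<m + n}. \<lambda>j\<in>{..<m + n}. if i = j then \<one> else \<zero>) \<in> carrier (GL m n A)"
    (is "?e \<in> _")
proof -
  let ?d = "m + n"
  have "?e \<in> even_matrices m n"
  proof (rule even_matrixI)
    fix i j
    show "(if i = j then \<one> else \<zero>) \<in> grade A (par_V m i + par_V m j)"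
      using grade_one grade_zero bit_add_self[of "par_V m i"] by (cases "i = j") simp_all
  qed
  moreover have "is_inverse_matrix ?d ?e ?e"
    unfolding is_inverse_matrix_def
  proof (intro allI impI)
    fix i j assume ij: "i < ?d" "j < ?d"
    have "(\<Oplus>l\<in>{..<?d}. ?e i l \<otimes> ?e l j) = ?e i i \<otimes> ?e i j"
      by (rule finsum_single) (use ij in auto)
    then show "(\<Oplus>l\<in>{..<?d}. ?e i l \<otimes> ?e l j) = (if i = j then \<one> else \<zero>) \<and>
        (\<Oplus>l\<in>{..<?d}. ?e i l \<otimes> ?e l j) = (if i = j then \<one> else \<zero>)"
      using ij by auto
  qed
  ultimately show ?thesis unfolding GL_iff by blast
qed

end

section \<open>A supercommutative algebra with square-zero generators\<close>

text \<open>
  The sign of sorting the product of the increasing monomials in the generators from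
  \<open>S\<close> and from \<open>T\<close>, where \<open>q\<close> gives the parities of the
  generators.
\<close>

definition monomial_sign :: "(nat \<Rightarrow> bit) \<Rightarrow> nat set \<Rightarrow> nat set \<Rightarrow> 'k::field" where
  "monomial_sign q S T = (\<Prod>s\<in>S. \<Prod>t\<in>T. if t < s then koszul (q s * q t) else 1)"

text \<open>
  An element of the algebra is given by its coefficients at the monomials, which are indexed by
  finite sets of generators. Each generator has square zero, so only decompositions of
  \<open>S\<close> into disjoint parts contribute. All families of coefficients are allowed, since
  each coefficient of a product is a finite sum.
\<close>

definition sq_mult :: "(nat \<Rightarrow> bit) \<Rightarrow> (nat set \<Rightarrow> 'k::field) \<Rightarrow> (nat set \<Rightarrow> 'k) \<Rightarrow> nat set \<Rightarrow> 'k" where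
  "sq_mult q f g S = (if finite S then \<Sum>T\<in>Pow S. monomial_sign q T (S - T) * f T * g (S - T) else 0)"

text \<open>Infinite sets index no monomial; the coefficient there is zero by convention.\<close>

definition finitary :: "(nat set \<Rightarrow> 'k::field) set" where
  "finitary = {f. \<forall>S. infinite S \<longrightarrow> f S = 0}"

definition homogeneous_part :: "(nat \<Rightarrow> bit) \<Rightarrow> bit \<Rightarrow> (nat set \<Rightarrow> 'k::field) set" where
  "homogeneous_part q p = {f \<in> finitary. \<forall>S. f S \<noteq> 0 \<longrightarrow> sum q S = p}"

abbreviation monomial :: "nat set \<Rightarrow> nat set \<Rightarrow> 'k::field" where
  "monomial \<equiv> unit_vec"

lemma monomial_sign_empty [simp]: "monomial_sign q {} S = 1" "monomial_sign q S {} = 1"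
  by (simp_all add: monomial_sign_def)

lemma monomial_sign_Un_left:
  assumes "finite R" "finite Q" "R \<inter> Q = {}"
  shows "monomial_sign q (R \<union> Q) S = monomial_sign q R S * monomial_sign q Q S"
  unfolding monomial_sign_def by (rule prod.union_disjoint[OF assms])

lemma monomial_sign_Un_right:
  assumes "finite R" "finite Q" "R \<inter> Q = {}"
  shows "monomial_sign q S (R \<union> Q) = monomial_sign q S R * monomial_sign q S Q"
  unfolding monomial_sign_def by (simp only: prod.union_disjoint[OF assms] prod.distrib)

lemma koszul_sum: "(koszul (sum f S) :: 'k::field) = (\<Prod>s\<in>S. koszul (f s))"
  by (induction S rule: infinite_finite_induct) (simp_all add: koszul_add del: add_bit_eq_xor)

text \<open>
  For \<open>s \<noteq> t\<close> exactly one of the two products contains the sign of the pair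
  \<open>(s, t)\<close>.
\<close>

lemma monomial_sign_swap:
  assumes "finite S" "finite T" "S \<inter> T = {}"
  shows "monomial_sign q S T = (koszul (sum q S * sum q T) * monomial_sign q T S :: 'k::field)"
proof -
  let ?a = "\<lambda>s t. if t < s then koszul (q s * q t) else 1 :: 'k"
  have square: "monomial_sign q T S * monomial_sign q T S = (1 :: 'k)"
    unfolding monomial_sign_def prod.distrib[symmetric] by (intro prod.neutral ballI) simp
  have "monomial_sign q T S = (\<Prod>s\<in>S. \<Prod>t\<in>T. ?a t s)"
    unfolding monomial_sign_def by (rule prod.swap)
  then have "monomial_sign q S T * monomial_sign q T S = (\<Prod>s\<in>S. \<Prod>t\<in>T. ?a s t * ?a t s)"
    by (simp only: monomial_sign_def[of q S T] prod.distrib)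
  also have "\<dots> = (\<Prod>s\<in>S. \<Prod>t\<in>T. koszul (q s * q t))"
  proof (intro prod.cong refl)
    fix s t assume "s \<in> S" "t \<in> T"
    then have "s \<noteq> t" using assms by blast
    then show "?a s t * ?a t s = koszul (q s * q t)"
      by (cases "t < s") (auto simp: mult.commute simp del: mult_bit_eq_and)
  qed
  also have "\<dots> = koszul (sum q S * sum q T)"
    by (simp only: koszul_sum[symmetric] sum_product)
  finally have *: "monomial_sign q S T * monomial_sign q T S = (koszul (sum q S * sum q T) :: 'k)" .
  have "monomial_sign q S T = (monomial_sign q S T * monomial_sign q T S) * (monomial_sign q T S :: 'k)"
    by (simp only: mult.assoc square mult_1_right)
  then show ?thesis by (simp only: *)
qed

lemma sq_mult_finitary: "sq_mult q f g \<in> finitary"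
  by (simp add: sq_mult_def finitary_def)

text \<open>Both sides are sums over the decompositions of \<open>S\<close> into three disjoint parts.\<close>

lemma sq_mult_assoc: "sq_mult q (sq_mult q f g) h = sq_mult q f (sq_mult q g h)"
proof
  fix S
  show "sq_mult q (sq_mult q f g) h S = sq_mult q f (sq_mult q g h) S"
  proof (cases "finite S")
    case fin: True
    note finsub = finite_subset[OF _ fin]
    let ?e = "monomial_sign q"
    have "sq_mult q (sq_mult q f g) h S =
        (\<Sum>T\<in>Pow S. \<Sum>R\<in>Pow T. ?e T (S - T) * (?e R (T - R) * f R * g (T - R)) * h (S - T))"
      unfolding sq_mult_def using fin finsub
      by (auto intro!: sum.cong simp: sum_distrib_left sum_distrib_right)
    also have "\<dots> = (\<Sum>(T, R)\<in>(SIGMA T:Pow S. Pow T). ?e T (S - T) * (?e R (T - R) * f R * g (T - R)) * h (S - T))"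
      by (rule sum.Sigma) (use fin finsub in auto)
    also have "\<dots> = (\<Sum>(R, Q)\<in>(SIGMA R:Pow S. Pow (S - R)).
        ?e R (S - R) * f R * (?e Q (S - R - Q) * g Q * h (S - R - Q)))"
    proof (rule sum.reindex_bij_witness[where i = "\<lambda>(R, Q). (R \<union> Q, R)" and j = "\<lambda>(T, R). (R, T - R)"])
      fix z assume "z \<in> (SIGMA T:Pow S. Pow T)"
      then obtain T R where z: "z = (T, R)" and TS: "T \<subseteq> S" and RT: "R \<subseteq> T" by blast
      let ?Q = "T - R" and ?U = "S - T"
      have fins: "finite R" "finite ?Q" "finite ?U" using TS RT finsub by auto
      have T: "T = R \<union> ?Q" and SR: "S - R = ?Q \<union> ?U" and SRQ: "S - R - ?Q = ?U" using TS RT by auto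
      have e1: "?e T ?U = ?e R ?U * ?e ?Q ?U"
        by (subst T, rule monomial_sign_Un_left) (use fins in auto)
      have e2: "?e R (S - R) = ?e R ?Q * ?e R ?U"
        unfolding SR by (rule monomial_sign_Un_right) (use fins in auto)
      show "(case case z of (T, R) \<Rightarrow> (R, T - R) of (R, Q) \<Rightarrow>
          ?e R (S - R) * f R * (?e Q (S - R - Q) * g Q * h (S - R - Q))) =
        (case z of (T, R) \<Rightarrow> ?e T (S - T) * (?e R (T - R) * f R * g (T - R)) * h (S - T))"
        unfolding z prod.case SRQ e1 e2 by (simp only: mult.assoc mult.commute mult.left_commute)
    qed auto
    also have "\<dots> = (\<Sum>R\<in>Pow S. \<Sum>Q\<in>Pow (S - R). ?e R (S - R) * f R * (?e Q (S - R - Q) * g Q * h (S - R - Q)))"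
      by (rule sum.Sigma[symmetric]) (use fin in auto)
    also have "\<dots> = sq_mult q f (sq_mult q g h) S"
      unfolding sq_mult_def using fin by (auto intro!: sum.cong simp: sum_distrib_left)
    finally show ?thesis .
  qed (simp add: sq_mult_def)
qed

lemma sq_mult_add_left: "sq_mult q (\<lambda>S. f S + f' S) g = (\<lambda>S. sq_mult q f g S + sq_mult q f' g S)"
  by (rule ext) (simp add: sq_mult_def algebra_simps sum.distrib)

lemma sq_mult_add_right: "sq_mult q f (\<lambda>S. g S + g' S) = (\<lambda>S. sq_mult q f g S + sq_mult q f g' S)"
  by (rule ext) (simp add: sq_mult_def algebra_simps sum.distrib)

lemma sq_mult_scale_left: "sq_mult q (\<lambda>S. c * f S) g = (\<lambda>S. c * sq_mult q f g S)"
  by (rule ext) (simp add: sq_mult_def sum_distrib_left mult_ac)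

lemma sq_mult_scale_right: "sq_mult q f (\<lambda>S. c * g S) = (\<lambda>S. c * sq_mult q f g S)"
  by (rule ext) (simp add: sq_mult_def sum_distrib_left mult_ac)

lemma sq_mult_one_left: "f \<in> finitary \<Longrightarrow> sq_mult q (monomial {}) f = f"
proof
  fix S assume f: "f \<in> finitary"
  show "sq_mult q (monomial {}) f S = f S"
  proof (cases "finite S")
    case True
    have "sq_mult q (monomial {}) f S = (\<Sum>T\<in>Pow S. if T = {} then f S else 0)"
      unfolding sq_mult_def if_P[OF True] by (rule sum.cong) (auto simp: unit_vec_def)
    then show ?thesis using True by simp
  qed (use f in \<open>simp add: sq_mult_def finitary_def\<close>)
qed

lemma sq_mult_one_right: "f \<in> finitary \<Longrightarrow> sq_mult q f (monomial {}) = f"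
proof
  fix S assume f: "f \<in> finitary"
  show "sq_mult q f (monomial {}) S = f S"
  proof (cases "finite S")
    case True
    have "sq_mult q f (monomial {}) S = (\<Sum>T\<in>Pow S. if T = S then f S else 0)"
      unfolding sq_mult_def if_P[OF True] by (rule sum.cong) (auto simp: unit_vec_def)
    then show ?thesis using True by simp
  qed (use f in \<open>simp add: sq_mult_def finitary_def\<close>)
qed

lemma sq_mult_homogeneous:
  assumes f: "f \<in> homogeneous_part q p" and g: "g \<in> homogeneous_part q p'"
  shows "sq_mult q f g \<in> homogeneous_part q (p + p')"
  unfolding homogeneous_part_def
proof (intro CollectI conjI allI impI)
  fix S assume nz: "sq_mult q f g S \<noteq> 0"
  then have fin: "finite S" by (rule contrapos_np) (simp add: sq_mult_def)
  then have "(\<Sum>T\<in>Pow S. monomial_sign q T (S - T) * f T * g (S - T)) \<noteq> 0"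
    using nz by (simp add: sq_mult_def)
  then obtain T where T: "T \<in> Pow S" "monomial_sign q T (S - T) * f T * g (S - T) \<noteq> 0"
    by (rule sum.not_neutral_contains_not_neutral)
  then have "sum q T = p" "sum q (S - T) = p'" using f g by (auto simp: homogeneous_part_def)
  moreover have "sum q S = sum q T + sum q (S - T)"
    using sum.subset_diff[of T S q] T fin by (simp only: add.commute Pow_iff)
  ultimately show "sum q S = p + p'" by simp
qed (rule sq_mult_finitary)

lemma sq_mult_supercomm:
  assumes f: "f \<in> (homogeneous_part q p :: (nat set \<Rightarrow> 'k::field) set)" and g: "g \<in> homogeneous_part q p'"
  shows "sq_mult q f g = (\<lambda>S. koszul (p * p') * sq_mult q g f S)"
proof
  fix S
  show "sq_mult q f g S = koszul (p * p') * sq_mult q g f S"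
  proof (cases "finite S")
    case fin: True
    have "sq_mult q g f S = (\<Sum>T\<in>Pow S. monomial_sign q T (S - T) * g T * f (S - T))"
      using fin by (simp add: sq_mult_def)
    also have "\<dots> = (\<Sum>T\<in>Pow S. monomial_sign q (S - T) T * g (S - T) * f T)"
      by (rule sum.reindex_bij_witness[where i = "\<lambda>T. S - T" and j = "\<lambda>T. S - T"]) (auto simp: double_diff)
    finally have "koszul (p * p') * sq_mult q g f S =
        (\<Sum>T\<in>Pow S. koszul (p * p') * (monomial_sign q (S - T) T * g (S - T) * f T))"
      by (simp only: sum_distrib_left)
    also have "\<dots> = (\<Sum>T\<in>Pow S. monomial_sign q T (S - T) * f T * g (S - T))"
    proof (rule sum.cong[OF refl])
      fix T assume "T \<in> Pow S"
      then have fins: "finite T" "finite (S - T)" using finite_subset[OF _ fin] by auto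
      show "koszul (p * p') * (monomial_sign q (S - T) T * g (S - T) * f T) =
          monomial_sign q T (S - T) * f T * g (S - T)"
      proof (cases "f T = 0 \<or> g (S - T) = 0")
        case False
        then have par: "sum q T = p" "sum q (S - T) = p'" using f g by (auto simp: homogeneous_part_def)
        have "monomial_sign q T (S - T) = koszul (p * p') * (monomial_sign q (S - T) T :: 'k)"
          using monomial_sign_swap[OF fins Diff_disjoint, of q] unfolding par .
        then show ?thesis by (simp only: mult.assoc mult.commute mult.left_commute)
      qed auto
    qed
    finally show ?thesis using fin by (simp add: sq_mult_def)
  qed (simp add: sq_mult_def)
qed

text \<open>
  Coefficient families are sequences, through the enumeration of finite sets of numbers by binary
  expansion, and the injection \<open>emb\<close> places sequences in the universe over which
  superalgebras range.
\<close>

definition encode :: "((nat \<Rightarrow> 'k) \<Rightarrow> 'u) \<Rightarrow> (nat set \<Rightarrow> 'k::field) \<Rightarrow> 'u" where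
  "encode emb f = emb (\<lambda>a. f (set_decode a))"

definition decode :: "((nat \<Rightarrow> 'k) \<Rightarrow> 'u) \<Rightarrow> 'u \<Rightarrow> nat set \<Rightarrow> 'k::field" where
  "decode emb x = (\<lambda>S. if finite S then inv' emb x (set_encode S) else 0)"

lemma decode_encode: "inj emb \<Longrightarrow> f \<in> finitary \<Longrightarrow> decode emb (encode emb f) = f"
  by (auto simp: decode_def encode_def finitary_def fun_eq_iff set_encode_inverse)

definition sq_algebra ::
  "((nat \<Rightarrow> 'k::field) \<Rightarrow> 'u) \<Rightarrow> (nat \<Rightarrow> bit) \<Rightarrow> ('k, 'u) superalgebra" where
  "sq_algebra emb q =
     \<lparr>carrier = encode emb ` finitary,
      monoid.mult = (\<lambda>x y. encode emb (sq_mult q (decode emb x) (decode emb y))),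
      one = encode emb (monomial {}),
      zero = encode emb (\<lambda>_. 0),
      add = (\<lambda>x y. encode emb (\<lambda>S. decode emb x S + decode emb y S)),
      smult = (\<lambda>c x. encode emb (\<lambda>S. c * decode emb x S)),
      grade = (\<lambda>p. encode emb ` homogeneous_part q p)\<rparr>"

lemma finitary_closed:
  "monomial {} \<in> finitary" "(\<lambda>_. 0) \<in> finitary"
  "f \<in> finitary \<Longrightarrow> g \<in> finitary \<Longrightarrow> (\<lambda>S. f S + g S) \<in> finitary"
  "f \<in> finitary \<Longrightarrow> (\<lambda>S. c * f S) \<in> finitary"
  "f \<in> finitary \<Longrightarrow> (\<lambda>S. - f S) \<in> finitary"
  "f \<in> homogeneous_part q p \<Longrightarrow> f \<in> finitary"
  by (auto simp: finitary_def unit_vec_def homogeneous_part_def)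

context
  fixes emb :: "(nat \<Rightarrow> 'k::field) \<Rightarrow> 'u" and q :: "nat \<Rightarrow> bit"
  assumes inj: "inj emb"
begin

lemma sq_algebra_sel:
  "carrier (sq_algebra emb q) = encode emb ` finitary"
  "grade (sq_algebra emb q) p = encode emb ` homogeneous_part q p"
  "\<one>\<^bsub>sq_algebra emb q\<^esub> = encode emb (monomial {})"
  "\<zero>\<^bsub>sq_algebra emb q\<^esub> = encode emb (\<lambda>_. 0)"
  by (simp_all add: sq_algebra_def)

lemma sq_algebra_ops:
  assumes "f \<in> finitary" "g \<in> finitary"
  shows "encode emb f \<otimes>\<^bsub>sq_algebra emb q\<^esub> encode emb g = encode emb (sq_mult q f g)"
    "encode emb f \<oplus>\<^bsub>sq_algebra emb q\<^esub> encode emb g = encode emb (\<lambda>S. f S + g S)"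
  using assms by (simp_all add: sq_algebra_def decode_encode[OF inj])

lemma sq_algebra_smult:
  "f \<in> finitary \<Longrightarrow> c \<odot>\<^bsub>sq_algebra emb q\<^esub> encode emb f = encode emb (\<lambda>S. c * f S)"
  by (simp add: sq_algebra_def decode_encode[OF inj])

lemma sq_algebra_ring: "ring (sq_algebra emb q)"
proof (rule ringI)
  let ?A = "sq_algebra emb q"
  note simps = sq_algebra_sel sq_algebra_ops sq_algebra_smult finitary_closed(1-5) sq_mult_finitary
  show "abelian_group ?A"
  proof (rule abelian_groupI)
    fix x y z assume "x \<in> carrier ?A" "y \<in> carrier ?A" "z \<in> carrier ?A"
    then obtain f g h where fgh: "x = encode emb f" "f \<in> finitary" "y = encode emb g" "g \<in> finitary"
      "z = encode emb h" "h \<in> finitary" by (auto simp: sq_algebra_sel)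
    show "x \<oplus>\<^bsub>?A\<^esub> y \<oplus>\<^bsub>?A\<^esub> z = x \<oplus>\<^bsub>?A\<^esub> (y \<oplus>\<^bsub>?A\<^esub> z)" by (simp add: fgh simps add.assoc)
    show "x \<oplus>\<^bsub>?A\<^esub> y = y \<oplus>\<^bsub>?A\<^esub> x" by (simp add: fgh simps add.commute)
  next
    fix x y assume "x \<in> carrier ?A" "y \<in> carrier ?A"
    then obtain f g where fg: "x = encode emb f" "f \<in> finitary" "y = encode emb g" "g \<in> finitary"
      by (auto simp: sq_algebra_sel)
    show "x \<oplus>\<^bsub>?A\<^esub> y \<in> carrier ?A" by (simp add: fg simps)
  next
    fix x assume "x \<in> carrier ?A"
    then obtain f where f: "x = encode emb f" "f \<in> finitary" by (auto simp: sq_algebra_sel)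
    show "\<zero>\<^bsub>?A\<^esub> \<oplus>\<^bsub>?A\<^esub> x = x" by (simp add: f simps)
    show "\<exists>y\<in>carrier ?A. y \<oplus>\<^bsub>?A\<^esub> x = \<zero>\<^bsub>?A\<^esub>"
      by (rule bexI[of _ "encode emb (\<lambda>S. - f S)"]) (simp_all add: f simps)
  qed (simp add: simps)
  show "Group.monoid ?A"
  proof (rule monoidI)
    fix x y z assume "x \<in> carrier ?A" "y \<in> carrier ?A" "z \<in> carrier ?A"
    then obtain f g h where fgh: "x = encode emb f" "f \<in> finitary" "y = encode emb g" "g \<in> finitary"
      "z = encode emb h" "h \<in> finitary" by (auto simp: sq_algebra_sel)
    show "x \<otimes>\<^bsub>?A\<^esub> y \<otimes>\<^bsub>?A\<^esub> z = x \<otimes>\<^bsub>?A\<^esub> (y \<otimes>\<^bsub>?A\<^esub> z)" by (simp add: fgh simps sq_mult_assoc)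
  next
    fix x y assume "x \<in> carrier ?A" "y \<in> carrier ?A"
    then obtain f g where fg: "x = encode emb f" "f \<in> finitary" "y = encode emb g" "g \<in> finitary"
      by (auto simp: sq_algebra_sel)
    show "x \<otimes>\<^bsub>?A\<^esub> y \<in> carrier ?A" by (simp add: fg simps)
  next
    fix x assume "x \<in> carrier ?A"
    then obtain f where f: "x = encode emb f" "f \<in> finitary" by (auto simp: sq_algebra_sel)
    show "\<one>\<^bsub>?A\<^esub> \<otimes>\<^bsub>?A\<^esub> x = x" by (simp add: f simps sq_mult_one_left)
    show "x \<otimes>\<^bsub>?A\<^esub> \<one>\<^bsub>?A\<^esub> = x" by (simp add: f simps sq_mult_one_right)
  qed (simp add: simps)
  fix x y z assume "x \<in> carrier ?A" "y \<in> carrier ?A" "z \<in> carrier ?A"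
  then obtain f g h where fgh: "x = encode emb f" "f \<in> finitary" "y = encode emb g" "g \<in> finitary"
    "z = encode emb h" "h \<in> finitary" by (auto simp: sq_algebra_sel)
  show "(x \<oplus>\<^bsub>?A\<^esub> y) \<otimes>\<^bsub>?A\<^esub> z = x \<otimes>\<^bsub>?A\<^esub> z \<oplus>\<^bsub>?A\<^esub> y \<otimes>\<^bsub>?A\<^esub> z"
    by (simp add: fgh simps sq_mult_add_left)
  show "z \<otimes>\<^bsub>?A\<^esub> (x \<oplus>\<^bsub>?A\<^esub> y) = z \<otimes>\<^bsub>?A\<^esub> x \<oplus>\<^bsub>?A\<^esub> z \<otimes>\<^bsub>?A\<^esub> y"
    by (simp add: fgh simps sq_mult_add_right)
qed

lemma sq_algebra_superalgebra: "comm_superalgebra (sq_algebra emb q)"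
proof (intro comm_superalgebra.intro comm_superalgebra_axioms.intro sq_algebra_ring)
  let ?A = "sq_algebra emb q"
  note simps = sq_algebra_sel sq_algebra_ops sq_algebra_smult finitary_closed(1-5) sq_mult_finitary
  have carE: "\<exists>f\<in>finitary. x = encode emb f" if "x \<in> carrier ?A" for x using that by (auto simp: sq_algebra_sel)
  have gradeE: "\<exists>f\<in>homogeneous_part q p. x = encode emb f" if "x \<in> grade ?A p" for x p
    using that by (auto simp: sq_algebra_sel)
  fix x y c d p p'
  show "c \<odot>\<^bsub>?A\<^esub> x \<in> carrier ?A" if "x \<in> carrier ?A"
    using carE[OF that] by (auto simp: simps)
  show "(c + d) \<odot>\<^bsub>?A\<^esub> x = c \<odot>\<^bsub>?A\<^esub> x \<oplus>\<^bsub>?A\<^esub> d \<odot>\<^bsub>?A\<^esub> x" if "x \<in> carrier ?A"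
    using carE[OF that] by (auto simp: simps distrib_right)
  show "c \<odot>\<^bsub>?A\<^esub> (x \<oplus>\<^bsub>?A\<^esub> y) = c \<odot>\<^bsub>?A\<^esub> x \<oplus>\<^bsub>?A\<^esub> c \<odot>\<^bsub>?A\<^esub> y" if "x \<in> carrier ?A" "y \<in> carrier ?A"
    using carE[OF that(1)] carE[OF that(2)] by (auto simp: simps distrib_left)
  show "(c * d) \<odot>\<^bsub>?A\<^esub> x = c \<odot>\<^bsub>?A\<^esub> (d \<odot>\<^bsub>?A\<^esub> x)" if "x \<in> carrier ?A"
    using carE[OF that] by (auto simp: simps mult.assoc)
  show "1 \<odot>\<^bsub>?A\<^esub> x = x" if "x \<in> carrier ?A"
    using carE[OF that] by (auto simp: simps)
  show "(c \<odot>\<^bsub>?A\<^esub> x) \<otimes>\<^bsub>?A\<^esub> y = c \<odot>\<^bsub>?A\<^esub> (x \<otimes>\<^bsub>?A\<^esub> y)" if "x \<in> carrier ?A" "y \<in> carrier ?A"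
    using carE[OF that(1)] carE[OF that(2)] by (auto simp: simps sq_mult_scale_left)
  show "x \<otimes>\<^bsub>?A\<^esub> (c \<odot>\<^bsub>?A\<^esub> y) = c \<odot>\<^bsub>?A\<^esub> (x \<otimes>\<^bsub>?A\<^esub> y)" if "x \<in> carrier ?A" "y \<in> carrier ?A"
    using carE[OF that(1)] carE[OF that(2)] by (auto simp: simps sq_mult_scale_right)
  show "grade ?A p \<subseteq> carrier ?A"
    unfolding sq_algebra_sel by (intro image_mono subsetI) (rule finitary_closed(6))
  show "\<zero>\<^bsub>?A\<^esub> \<in> grade ?A p" by (auto simp: simps homogeneous_part_def)
  show "x \<oplus>\<^bsub>?A\<^esub> y \<in> grade ?A p" if xy: "x \<in> grade ?A p" "y \<in> grade ?A p"
  proof -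
    obtain f g where fg: "f \<in> homogeneous_part q p" "x = encode emb f"
      "g \<in> homogeneous_part q p" "y = encode emb g" using gradeE[OF xy(1)] gradeE[OF xy(2)] by blast
    have "f S + g S \<noteq> 0 \<longrightarrow> sum q S = p" for S
      using fg unfolding homogeneous_part_def by (cases "f S = 0") auto
    then have "(\<lambda>S. f S + g S) \<in> homogeneous_part q p"
      using finitary_closed(3)[of f g] fg unfolding homogeneous_part_def by blast
    then show ?thesis using fg by (simp add: sq_algebra_ops finitary_closed(6) sq_algebra_sel(2))
  qed
  show "c \<odot>\<^bsub>?A\<^esub> x \<in> grade ?A p" if "x \<in> grade ?A p"
    using gradeE[OF that] by (force simp: simps(2) sq_algebra_smult finitary_closed(4) homogeneous_part_def)
  show "\<exists>y\<in>grade ?A 0. \<exists>z\<in>grade ?A 1. x = y \<oplus>\<^bsub>?A\<^esub> z" if x: "x \<in> carrier ?A"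
  proof -
    obtain f where f: "f \<in> finitary" "x = encode emb f" using carE[OF x] by blast
    define part where "part p = (\<lambda>S. if sum q S = p then f S else 0)" for p :: bit
    have part: "part p \<in> homogeneous_part q p" for p
      using f(1) by (auto simp: part_def homogeneous_part_def finitary_def)
    have "f = (\<lambda>S. part 0 S + part 1 S)"
      by (rule ext) (auto simp: part_def)
    then have "x = encode emb (part 0) \<oplus>\<^bsub>?A\<^esub> encode emb (part 1)"
      using f(2) sq_algebra_ops(2)[OF finitary_closed(6)[OF part[of 0]] finitary_closed(6)[OF part[of 1]]] by metis
    then show ?thesis using part unfolding sq_algebra_sel(2) by blast
  qed
  show "grade ?A 0 \<inter> grade ?A 1 = {\<zero>\<^bsub>?A\<^esub>}"
  proof
    show "grade ?A 0 \<inter> grade ?A 1 \<subseteq> {\<zero>\<^bsub>?A\<^esub>}"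
    proof
      fix x assume x: "x \<in> grade ?A 0 \<inter> grade ?A 1"
      obtain f g where fg: "f \<in> homogeneous_part q 0" "x = encode emb f"
        "g \<in> homogeneous_part q 1" "x = encode emb g"
        using gradeE[of x 0] gradeE[of x 1] x by blast
      have "f = g" using fg decode_encode[OF inj finitary_closed(6)[OF fg(1)]]
          decode_encode[OF inj finitary_closed(6)[OF fg(3)]] by simp
      then have "f = (\<lambda>_. 0)" using fg by (auto simp: homogeneous_part_def fun_eq_iff)
      then show "x \<in> {\<zero>\<^bsub>?A\<^esub>}" using fg by (simp add: sq_algebra_sel)
    qed
    show "{\<zero>\<^bsub>?A\<^esub>} \<subseteq> grade ?A 0 \<inter> grade ?A 1"
      by (auto simp: simps homogeneous_part_def)
  qed
  have "(monomial {} :: nat set \<Rightarrow> 'k) \<in> homogeneous_part q 0"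
    using finitary_closed(1) unfolding homogeneous_part_def by (simp add: unit_vec_def)
  then show "\<one>\<^bsub>?A\<^esub> \<in> grade ?A 0" unfolding sq_algebra_sel by (rule imageI)
  show "x \<otimes>\<^bsub>?A\<^esub> y \<in> grade ?A (p + p')" if xy: "x \<in> grade ?A p" "y \<in> grade ?A p'"
  proof -
    obtain f g where fg: "f \<in> homogeneous_part q p" "x = encode emb f"
      "g \<in> homogeneous_part q p'" "y = encode emb g" using gradeE[OF xy(1)] gradeE[OF xy(2)] by blast
    have "x \<otimes>\<^bsub>?A\<^esub> y = encode emb (sq_mult q f g)"
      using fg by (simp add: sq_algebra_ops finitary_closed(6))
    then show ?thesis
      unfolding sq_algebra_sel(2) using sq_mult_homogeneous[OF fg(1,3)] by blast
  qed
  show "x \<otimes>\<^bsub>?A\<^esub> y = koszul (p * p') \<odot>\<^bsub>?A\<^esub> (y \<otimes>\<^bsub>?A\<^esub> x)" if xy: "x \<in> grade ?A p" "y \<in> grade ?A p'"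
  proof -
    obtain f g where fg: "f \<in> homogeneous_part q p" "x = encode emb f"
      "g \<in> homogeneous_part q p'" "y = encode emb g" using gradeE[OF xy(1)] gradeE[OF xy(2)] by blast
    note cl = finitary_closed(6)[OF fg(1)] finitary_closed(6)[OF fg(3)]
    show ?thesis
      unfolding fg(2,4) sq_algebra_ops(1)[OF cl] sq_algebra_ops(1)[OF cl(2,1)]
        sq_algebra_smult[OF sq_mult_finitary] sq_mult_supercomm[OF fg(1,3)] ..
  qed
qed

end

section \<open>The relations satisfied by the general linear supergroup\<close>

text \<open>
  The entry at position \<open>zs ! k\<close> is to be moved to position \<open>k\<close>, so the
  permutation is the inverse of the enumeration.
\<close>

lemma perm_of_enumeration:
  assumes zs: "distinct zs" "set zs = {..<r}"
  obtains s where "s permutes {1..r}" "\<And>I :: nat list. length I = r \<Longrightarrow> perm_list s I = map (\<lambda>t. I ! t) zs"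
proof -
  have len: "length zs = r" using distinct_card[OF zs(1)] zs(2) by simp
  define h where "h x = (if x \<in> {1..r} then Suc (zs ! (x - 1)) else x)" for x
  have mem: "zs ! k < r" if "k < r" for k using nth_mem[of k zs] that len zs(2) by auto
  have h: "h permutes {1..r}"
  proof (rule bij_imp_permutes)
    have inj: "inj_on h {1..r}"
    proof (rule inj_onI)
      fix x y assume xy: "x \<in> {1..r}" "y \<in> {1..r}" "h x = h y"
      then have "zs ! (x - 1) = zs ! (y - 1)" by (simp add: h_def)
      then have "x - 1 = y - 1"
        using nth_eq_iff_index_eq[OF zs(1), of "x - 1" "y - 1"] xy(1,2) len by auto
      then show "x = y" using xy(1,2) by auto
    qed
    have "h ` {1..r} \<subseteq> {1..r}"
    proof
      fix y assume "y \<in> h ` {1..r}"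
      then obtain x where x: "x \<in> {1..r}" "y = Suc (zs ! (x - 1))" by (auto simp: h_def)
      have "zs ! (x - 1) < r" using x(1) by (intro mem) auto
      then show "y \<in> {1..r}" using x(2) by simp
    qed
    then have "h ` {1..r} = {1..r}" using inj by (simp add: endo_inj_surj)
    with inj show "bij_betw h {1..r} {1..r}" by (simp add: bij_betw_def)
  qed (auto simp: h_def)
  show thesis
  proof (rule that[OF permutes_inv[OF h]])
    fix I :: "nat list" assume I: "length I = r"
    show "perm_list (inv' h) I = map (\<lambda>t. I ! t) zs"
    proof (rule nth_equalityI)
      fix k assume "k < length (perm_list (inv' h) I)"
      then have k: "k < r" using I by simp
      have "perm_list (inv' h) I ! k = I ! (h (Suc k) - 1)"
        using k I by (simp add: perm_list_def permutes_inv_inv[OF h])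
      also have "h (Suc k) - 1 = zs ! k" using k by (simp add: h_def)
      finally show "perm_list (inv' h) I ! k = map (\<lambda>t. I ! t) zs ! k" using k len by simp
    qed (use I len in simp)
  qed
qed

definition pair_par :: "nat \<Rightarrow> nat list \<Rightarrow> nat list \<Rightarrow> nat \<Rightarrow> bit" where
  "pair_par m I J t = par_V m (I ! t) + par_V m (J ! t)"

text \<open>
  Entries of \<open>1 + \<Sum> x\<^sub>t E(I ! t, J ! t)\<close>, the sum being over \<open>t <
  k\<close>, as coefficient families.
\<close>

definition gen_entry :: "nat list \<Rightarrow> nat list \<Rightarrow> nat \<Rightarrow> nat \<Rightarrow> nat \<Rightarrow> nat set \<Rightarrow> 'k::field" where
  "gen_entry I J k i j = (\<lambda>S. (if i = j then monomial {} S else 0) +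
     (\<Sum>t<k. if I ! t = i \<and> J ! t = j then monomial {t} S else 0))"

lemma gen_entry_0: "gen_entry I J 0 i j = (if i = j then monomial {} else (\<lambda>_. 0))"
  by (simp add: gen_entry_def fun_eq_iff)

lemma gen_entry_Suc: "gen_entry I J (Suc k) i j =
    (\<lambda>S. gen_entry I J k i j S + (if i = I ! k \<and> j = J ! k then monomial {k} else (\<lambda>_. 0)) S)"
  by (auto simp: gen_entry_def fun_eq_iff)

lemma monomial_finitary: "finite S \<Longrightarrow> monomial S \<in> finitary"
  by (auto simp: finitary_def unit_vec_def)

lemma gen_entry_finitary: "gen_entry I J k i j \<in> (finitary :: (nat set \<Rightarrow> 'k::field) set)"
proof (induction k)
  case 0
  then show ?case by (simp add: gen_entry_0 finitary_closed(1,2))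
next
  case (Suc k)
  have "(if i = I ! k \<and> j = J ! k then monomial {k} else (\<lambda>_. 0)) \<in> (finitary :: (nat set \<Rightarrow> 'k) set)"
    using monomial_finitary[of "{k}"] finitary_closed(2) by auto
  from finitary_closed(3)[OF Suc this] show ?case unfolding gen_entry_Suc .
qed

lemma gen_entry_singleton:
  "gen_entry I J k i j {t} = (if t < k \<and> I ! t = i \<and> J ! t = j then 1 else (0 :: 'k::field))"
proof -
  have "(\<Sum>t'<k. if I ! t' = i \<and> J ! t' = j then monomial {t'} {t} else 0) =
      (\<Sum>t'<k. if t' = t then (if I ! t = i \<and> J ! t = j then 1 else 0) else (0 :: 'k))"
    by (rule sum.cong) (auto simp: unit_vec_def)
  also have "\<dots> = (if t < k then (if I ! t = i \<and> J ! t = j then 1 else 0) else 0)" by simp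
  finally show ?thesis by (simp add: gen_entry_def unit_vec_def)
qed

lemma gen_entry_support:
  assumes "gen_entry I J k i j S \<noteq> (0 :: 'k::field)"
  shows "S = {} \<or> (\<exists>t. S = {t})"
proof (rule ccontr)
  assume S: "\<not> (S = {} \<or> (\<exists>t. S = {t}))"
  then have "(\<Sum>t<k. if I ! t = i \<and> J ! t = j then monomial {t} S else 0) = (0 :: 'k)"
    by (intro sum.neutral) (auto simp: unit_vec_def)
  moreover have "(if i = j then monomial {} S else 0) = (0 :: 'k)" using S by (simp add: unit_vec_def)
  ultimately show False using assms by (simp only: gen_entry_def) simp
qed

text \<open>
  The partial sums in \<open>k\<close> allow the matrix to be built up one square-zero entry at a
  time.
\<close>

definition gen_matrix ::
  "((nat \<Rightarrow> 'k::field) \<Rightarrow> 'u) \<Rightarrow> nat \<Rightarrow> nat list \<Rightarrow> nat list \<Rightarrow> nat \<Rightarrow> nat \<Rightarrow> nat \<Rightarrow> 'u" where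
  "gen_matrix emb d I J k = (\<lambda>i\<in>{..<d}. \<lambda>j\<in>{..<d}. encode emb (gen_entry I J k i j))"

text \<open>
  \<open>expansion_coeff m I J X Y S\<close> is the coefficient at the monomial \<open>S\<close>
  of the tensor coefficient of \<open>gen_matrix\<close> at \<open>(X, Y)\<close>; the recursion
  is that of \<open>tensor_coeff\<close>.
\<close>

fun expansion_coeff :: "nat \<Rightarrow> nat list \<Rightarrow> nat list \<Rightarrow> nat list \<Rightarrow> nat list \<Rightarrow> nat set \<Rightarrow> 'k::field" where
  "expansion_coeff m I J (x # X) (y # Y) = (\<lambda>S. koszul ((par_V m x + par_V m y) * tensor_par m X) *
     sq_mult (pair_par m I J) (gen_entry I J (length I) x y) (expansion_coeff m I J X Y) S)"
| "expansion_coeff m I J _ _ = monomial {}"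

lemma expansion_coeff_finitary: "expansion_coeff m I J X Y \<in> finitary"
  by (cases X; cases Y)
    (auto simp only: expansion_coeff.simps intro!: finitary_closed(1) finitary_closed(4)[OF sq_mult_finitary])

lemma gen_matrix_in_GL:
  fixes emb :: "(nat \<Rightarrow> 'k::field) \<Rightarrow> 'u"
  assumes inj: "inj emb" and I: "I \<in> tensor_basis m n r" and J: "J \<in> tensor_basis m n r"
  shows "k \<le> r \<Longrightarrow> gen_matrix emb (m + n) I J k \<in> carrier (GL m n (sq_algebra emb (pair_par m I J)))"
proof (induction k)
  let ?A = "sq_algebra emb (pair_par m I J)"
  interpret comm_superalgebra ?A by (rule sq_algebra_superalgebra[OF inj])
  {
    case 0
    have "gen_matrix emb (m + n) I J 0 = (\<lambda>i\<in>{..<m + n}. \<lambda>j\<in>{..<m + n}. if i = j then \<one>\<^bsub>?A\<^esub> else \<zero>\<^bsub>?A\<^esub>)"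
      unfolding gen_matrix_def restrict2_eq_iff by (auto simp: gen_entry_0 sq_algebra_sel[OF inj])
    then show ?case using GL_one[of m n] by (simp only:)
  next
    case (Suc k)
    let ?x = "encode emb (monomial {k}) :: 'u"
    have "set I \<subseteq> {..<m + n}" "set J \<subseteq> {..<m + n}" "length I = r" "length J = r"
      using I J by (auto simp: tensor_basis_def)
    moreover from this have "I ! k \<in> set I" "J ! k \<in> set J" using Suc.prems by (auto intro!: nth_mem)
    ultimately have ab: "I ! k < m + n" "J ! k < m + n" by auto
    have fin: "(monomial {k} :: nat set \<Rightarrow> 'k) \<in> finitary" by (rule monomial_finitary) simp
    have "(monomial {k} :: nat set \<Rightarrow> 'k) \<in> homogeneous_part (pair_par m I J) (pair_par m I J k)"
      unfolding homogeneous_part_def using fin by (simp add: unit_vec_def)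
    then have x: "?x \<in> grade ?A (par_V m (I ! k) + par_V m (J ! k))"
      unfolding sq_algebra_sel[OF inj] pair_par_def[symmetric] by (rule imageI)
    have "sq_mult (pair_par m I J) (monomial {k}) (monomial {k}) = (\<lambda>_. 0 :: 'k)"
    proof
      fix S
      have "monomial_sign (pair_par m I J) T (S - T) * monomial {k} T * monomial {k} (S - T) = (0 :: 'k)" for T
        by (cases "T = {k}") (auto simp: unit_vec_def)
      then show "sq_mult (pair_par m I J) (monomial {k}) (monomial {k}) S = (0 :: 'k)"
        unfolding sq_mult_def by (simp only: sum.neutral_const if_cancel)
    qed
    then have sq: "?x \<otimes>\<^bsub>?A\<^esub> ?x = \<zero>\<^bsub>?A\<^esub>"
      by (simp only: sq_algebra_ops[OF inj fin fin] sq_algebra_sel[OF inj])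
    have "gen_matrix emb (m + n) I J k \<in> carrier (GL m n ?A)" using Suc by simp
    from GL_add_elementary[OF this ab x sq]
    have "(\<lambda>i\<in>{..<m + n}. \<lambda>j\<in>{..<m + n}. gen_matrix emb (m + n) I J k i j \<oplus>\<^bsub>?A\<^esub>
        (if i = I ! k \<and> j = J ! k then ?x else \<zero>\<^bsub>?A\<^esub>)) \<in> carrier (GL m n ?A)" .
    also have "(\<lambda>i\<in>{..<m + n}. \<lambda>j\<in>{..<m + n}. gen_matrix emb (m + n) I J k i j \<oplus>\<^bsub>?A\<^esub>
        (if i = I ! k \<and> j = J ! k then ?x else \<zero>\<^bsub>?A\<^esub>)) = gen_matrix emb (m + n) I J (Suc k)"
      unfolding gen_matrix_def restrict2_eq_iff
    proof (intro ballI)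
      fix i j assume ij: "i \<in> {..<m + n}" "j \<in> {..<m + n}"
      let ?f = "if i = I ! k \<and> j = J ! k then monomial {k} else (\<lambda>_. 0) :: nat set \<Rightarrow> 'k"
      have f: "?f \<in> finitary" using fin finitary_closed(2) by auto
      have "(if i = I ! k \<and> j = J ! k then ?x else \<zero>\<^bsub>?A\<^esub>) = encode emb ?f"
        by (simp add: sq_algebra_sel[OF inj])
      then show "(\<lambda>i\<in>{..<m + n}. \<lambda>j\<in>{..<m + n}. encode emb (gen_entry I J k i j)) i j \<oplus>\<^bsub>?A\<^esub>
          (if i = I ! k \<and> j = J ! k then ?x else \<zero>\<^bsub>?A\<^esub>) = encode emb (gen_entry I J (Suc k) i j)"
        using ij sq_algebra_ops(2)[OF inj gen_entry_finitary f] by (simp add: gen_entry_Suc)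
    qed
    finally show ?case .
  }
qed

lemma tensor_coeff_gen_matrix:
  fixes emb :: "(nat \<Rightarrow> 'k::field) \<Rightarrow> 'u"
  assumes inj: "inj emb"
  shows "X \<in> tensor_basis m n r \<Longrightarrow> Y \<in> tensor_basis m n r \<Longrightarrow>
    tensor_coeff m (sq_algebra emb (pair_par m I J)) (gen_matrix emb (m + n) I J (length I)) X Y =
      encode emb (expansion_coeff m I J X Y)"
proof (induction r arbitrary: X Y)
  case 0
  then show ?case by (simp add: tensor_basis_0 sq_algebra_sel[OF inj])
next
  case (Suc r)
  obtain x X' where X: "X = x # X'" "x < m + n" "X' \<in> tensor_basis m n r"
    using Suc.prems(1) by (cases X) (auto simp: tensor_basis_def)
  obtain y Y' where Y: "Y = y # Y'" "y < m + n" "Y' \<in> tensor_basis m n r"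
    using Suc.prems(2) by (cases Y) (auto simp: tensor_basis_def)
  have g: "gen_matrix emb (m + n) I J (length I) x y = encode emb (gen_entry I J (length I) x y)"
    using X Y by (simp add: gen_matrix_def)
  show ?case
    unfolding X(1) Y(1) tensor_coeff.simps Suc.IH[OF X(3) Y(3)] g expansion_coeff.simps
      sq_algebra_ops(1)[OF inj gen_entry_finitary expansion_coeff_finitary]
      sq_algebra_smult[OF inj sq_mult_finitary] ..
qed

lemma expansion_coeff_support:
  "length X = length Y \<Longrightarrow> expansion_coeff m I J X Y S \<noteq> (0 :: 'k::field) \<Longrightarrow> finite S \<and> card S \<le> length X"
proof (induction X Y arbitrary: S rule: list_induct2)
  case Nil
  then have "S = {}" by (simp add: unit_vec_def split: if_splits)
  then show ?case by simp
next
  case (Cons x X y Y)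
  let ?q = "pair_par m I J" and ?g = "gen_entry I J (length I) x y :: nat set \<Rightarrow> 'k"
  have nz: "sq_mult ?q ?g (expansion_coeff m I J X Y) S \<noteq> 0" using Cons.prems by auto
  then have fin: "finite S" by (rule contrapos_np) (simp add: sq_mult_def)
  then have "(\<Sum>T\<in>Pow S. monomial_sign ?q T (S - T) * ?g T * expansion_coeff m I J X Y (S - T)) \<noteq> 0"
    using nz by (simp add: sq_mult_def)
  then obtain T where T: "T \<in> Pow S" "monomial_sign ?q T (S - T) * ?g T * expansion_coeff m I J X Y (S - T) \<noteq> 0"
    by (rule sum.not_neutral_contains_not_neutral)
  have "expansion_coeff m I J X Y (S - T) \<noteq> (0 :: 'k)" using T(2) by auto
  then have le: "card (S - T) \<le> length X" using Cons.IH by blast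
  have "?g T \<noteq> 0" using T(2) by auto
  from gen_entry_support[OF this] have cT: "card T \<le> 1" by (elim disjE exE) simp_all
  have "card S = card T + card (S - T)"
    using T(1) fin by (metis PowD card_Diff_subset card_mono finite_subset le_add_diff_inverse)
  then have "card S \<le> Suc (length X)" using cT le by linarith
  then show ?case using fin by simp
qed

text \<open>
  At a monomial of the maximal degree each of the factors has to contribute one generator, so that
  the constant term of the first factor drops out.
\<close>

lemma expansion_coeff_Cons:
  assumes len: "length X = length Y" and fin: "finite S" and card: "card S = Suc (length X)"
  shows "expansion_coeff m I J (x # X) (y # Y) S = (koszul ((par_V m x + par_V m y) * tensor_par m X) *
    (\<Sum>t\<in>{t\<in>S. t < length I \<and> I ! t = x \<and> J ! t = y}.
      monomial_sign (pair_par m I J) {t} (S - {t}) * expansion_coeff m I J X Y (S - {t})) :: 'k::field)"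
proof -
  let ?q = "pair_par m I J" and ?g = "gen_entry I J (length I) x y :: nat set \<Rightarrow> 'k"
  let ?S = "{t\<in>S. t < length I \<and> I ! t = x \<and> J ! t = y}"
  let ?f = "\<lambda>T. monomial_sign ?q T (S - T) * ?g T * expansion_coeff m I J X Y (S - T)"
  have "sq_mult ?q ?g (expansion_coeff m I J X Y) S = (\<Sum>T\<in>Pow S. ?f T)"
    using fin by (simp add: sq_mult_def)
  also have "\<dots> = (\<Sum>T\<in>(\<lambda>t. {t}) ` ?S. ?f T)"
  proof (rule sum.mono_neutral_right)
    show "\<forall>T\<in>Pow S - (\<lambda>t. {t}) ` ?S. ?f T = 0"
    proof (intro ballI, rule ccontr)
      fix T assume T: "T \<in> Pow S - (\<lambda>t. {t}) ` ?S" and nz: "?f T \<noteq> 0"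
      then have g: "?g T \<noteq> 0" and c: "expansion_coeff m I J X Y (S - T) \<noteq> (0 :: 'k)" by auto
      have "card (S - T) \<le> length X" using expansion_coeff_support[OF len c] by blast
      then have "T \<noteq> {}" using card by auto
      then obtain t where t: "T = {t}" using gen_entry_support[OF g] by blast
      have "t < length I \<and> I ! t = x \<and> J ! t = y"
        by (rule ccontr) (use g in \<open>auto simp: t gen_entry_singleton\<close>)
      then show False using T t by blast
    qed
  qed (use fin in auto)
  also have "\<dots> = (\<Sum>t\<in>?S. ?f {t})" by (subst sum.reindex) (auto simp: inj_on_def)
  also have "\<dots> = (\<Sum>t\<in>?S. monomial_sign ?q {t} (S - {t}) * expansion_coeff m I J X Y (S - {t}))"
    by (rule sum.cong) (auto simp: gen_entry_singleton)
  finally show ?thesis by (simp only: expansion_coeff.simps)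
qed

text \<open>
  A monomial of maximal degree arises by choosing the generators of \<open>S\<close> one after the
  other for the factors of the tensor coefficient; the generator chosen for a factor determines
  its indices.
\<close>

lemma expansion_coeff_enumeration:
  "length X = length Y \<Longrightarrow> finite S \<Longrightarrow> card S = length X \<Longrightarrow> expansion_coeff m I J X Y S \<noteq> (0 :: 'k::field) \<Longrightarrow>
    \<exists>zs. distinct zs \<and> set zs = S \<and> X = map (\<lambda>t. I ! t) zs \<and> Y = map (\<lambda>t. J ! t) zs"
proof (induction X Y arbitrary: S rule: list_induct2)
  case Nil
  then show ?case by (intro exI[of _ "[]"]) simp
next
  case (Cons x X y Y)
  let ?S = "{t\<in>S. t < length I \<and> I ! t = x \<and> J ! t = y}"
  have card: "card S = Suc (length X)" using Cons.prems by simp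
  have "(\<Sum>t\<in>?S. monomial_sign (pair_par m I J) {t} (S - {t}) * expansion_coeff m I J X Y (S - {t})) \<noteq> (0 :: 'k)"
    using Cons.prems(3) unfolding expansion_coeff_Cons[OF Cons.hyps Cons.prems(1) card] by auto
  then obtain t where t: "t \<in> ?S"
    "monomial_sign (pair_par m I J) {t} (S - {t}) * expansion_coeff m I J X Y (S - {t}) \<noteq> (0 :: 'k)"
    by (rule sum.not_neutral_contains_not_neutral)
  have nz: "expansion_coeff m I J X Y (S - {t}) \<noteq> (0 :: 'k)" using t(2) by auto
  have "finite (S - {t})" "card (S - {t}) = length X" using Cons.prems(1) card t(1) by auto
  from Cons.IH[OF this nz] obtain zs where zs: "distinct zs" "set zs = S - {t}"
    "X = map (\<lambda>t. I ! t) zs" "Y = map (\<lambda>t. J ! t) zs" by blast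
  show ?case
    by (rule exI[of _ "t # zs"]) (use zs t(1) in auto)
qed

lemma monomial_sign_even: "q t = 0 \<Longrightarrow> monomial_sign q {t} S = (1 :: 'k::field)"
  by (auto simp: monomial_sign_def intro!: prod.neutral)

lemma monomial_sign_nonzero: "finite T \<Longrightarrow> monomial_sign q {t} T \<noteq> (0 :: 'k::field)"
  by (simp add: monomial_sign_def)

lemma pair_par_even: "pair_par m I J t = 0 \<longleftrightarrow> par_V m (I ! t) = par_V m (J ! t)"
  by (cases "par_V m (I ! t) = 0"; cases "par_V m (J ! t) = 0") (simp_all add: pair_par_def)

text \<open>
  If the entries involved are even, then all signs are \<open>1\<close> and the coefficient counts
  the enumerations of \<open>S\<close> that match \<open>X\<close> and \<open>Y\<close>.
\<close>

lemma expansion_coeff_even: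
  "length X = length Y \<Longrightarrow> map (par_V m) X = map (par_V m) Y \<Longrightarrow> finite S \<Longrightarrow> card S = length X \<Longrightarrow>
    \<exists>N. expansion_coeff m I J X Y S = (of_nat N :: 'k::field) \<and>
      (\<forall>zs. distinct zs \<longrightarrow> set zs = S \<longrightarrow> S \<subseteq> {..<length I} \<longrightarrow>
         X = map (\<lambda>t. I ! t) zs \<longrightarrow> Y = map (\<lambda>t. J ! t) zs \<longrightarrow> N > 0)"
proof (induction X Y arbitrary: S rule: list_induct2)
  case Nil
  then show ?case by (intro exI[of _ 1]) (simp add: unit_vec_def)
next
  case (Cons x X y Y)
  let ?S = "{t\<in>S. t < length I \<and> I ! t = x \<and> J ! t = y}"
  have card: "card S = Suc (length X)" and fin: "finite S" using Cons.prems by simp_all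
  have par: "par_V m x = par_V m y" "map (par_V m) X = map (par_V m) Y" using Cons.prems by simp_all
  define P where "P t N \<longleftrightarrow> expansion_coeff m I J X Y (S - {t}) = (of_nat N :: 'k) \<and>
      (\<forall>zs. distinct zs \<longrightarrow> set zs = S - {t} \<longrightarrow> S - {t} \<subseteq> {..<length I} \<longrightarrow>
         X = map (\<lambda>t. I ! t) zs \<longrightarrow> Y = map (\<lambda>t. J ! t) zs \<longrightarrow> N > 0)" for t N
  have "\<forall>t\<in>?S. \<exists>N. P t N"
  proof
    fix t assume "t \<in> ?S"
    then have "finite (S - {t})" "card (S - {t}) = length X" using fin card by auto
    from Cons.IH[OF par(2) this] show "\<exists>N. P t N" unfolding P_def .
  qed
  from bchoice[OF this] obtain N where N: "\<And>t. t \<in> ?S \<Longrightarrow> P t (N t)" by blast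
  have "koszul ((par_V m x + par_V m y) * tensor_par m X) = (1 :: 'k)"
    unfolding par(1) bit_add_self by simp
  then have "expansion_coeff m I J (x # X) (y # Y) S =
      (\<Sum>t\<in>?S. monomial_sign (pair_par m I J) {t} (S - {t}) * expansion_coeff m I J X Y (S - {t}) :: 'k)"
    unfolding expansion_coeff_Cons[OF Cons.hyps fin card] by (simp only: mult_1)
  also have "\<dots> = (\<Sum>t\<in>?S. of_nat (N t))"
  proof (rule sum.cong[OF refl])
    fix t assume t: "t \<in> ?S"
    then have "pair_par m I J t = 0" using par(1) by (simp only: pair_par_even mem_Collect_eq)
    then show "monomial_sign (pair_par m I J) {t} (S - {t}) * expansion_coeff m I J X Y (S - {t}) = (of_nat (N t) :: 'k)"
      using N[OF t] unfolding P_def by (simp only: monomial_sign_even mult_1)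
  qed
  finally have eq: "expansion_coeff m I J (x # X) (y # Y) S = (of_nat (\<Sum>t\<in>?S. N t) :: 'k)" by simp
  have "(\<Sum>t\<in>?S. N t) > 0" if zs: "distinct zs" "set zs = S" "S \<subseteq> {..<length I}"
    "x # X = map (\<lambda>t. I ! t) zs" "y # Y = map (\<lambda>t. J ! t) zs" for zs
  proof -
    obtain t zs' where t: "zs = t # zs'" using zs(4) by (cases zs) auto
    have tS: "t \<in> ?S" using zs t by auto
    have "set zs' = S - {t}" "distinct zs'" "X = map (\<lambda>t. I ! t) zs'" "Y = map (\<lambda>t. J ! t) zs'"
      using zs t by auto
    moreover have "S - {t} \<subseteq> {..<length I}" using zs(3) by blast
    ultimately have "N t > 0" using N[OF tS] unfolding P_def by blast
    then show ?thesis using tS fin by (intro sum_pos2[of _ t]) auto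
  qed
  then show ?case using eq by blast
qed

text \<open>
  The odd generators are placed first. They belong to distinct matrix units, so that each of them
  has only one choice and contributes a sign; what remains is the positive count of the even case.
\<close>

lemma expansion_coeff_nonzero:
  assumes "distinct (os @ es)" "set (os @ es) \<subseteq> {..<length I}"
    and odd: "\<And>t. t \<in> set os \<Longrightarrow> pair_par m I J t = 1" and even: "\<And>t. t \<in> set es \<Longrightarrow> pair_par m I J t = 0"
    and inj: "inj_on (\<lambda>t. (I ! t, J ! t)) (set os)"
  shows "expansion_coeff m I J (map (\<lambda>t. I ! t) (os @ es)) (map (\<lambda>t. J ! t) (os @ es)) (set (os @ es)) \<noteq>
    (0 :: 'k::field_char_0)"
  using assms
proof (induction os)
  case Nil
  have "map (par_V m) (map (\<lambda>t. I ! t) es) = map (par_V m) (map (\<lambda>t. J ! t) es)"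
    using Nil.prems(4) by (simp add: pair_par_even)
  then obtain N where N: "expansion_coeff m I J (map (\<lambda>t. I ! t) es) (map (\<lambda>t. J ! t) es) (set es) = (of_nat N :: 'k)"
    "N > 0"
    using expansion_coeff_even[of "map (\<lambda>t. I ! t) es" "map (\<lambda>t. J ! t) es" m "set es" I J] Nil.prems(1,2)
    by (auto simp: distinct_card)
  then show ?case by simp
next
  case (Cons a os)
  let ?zs = "os @ es" and ?S = "set ((a # os) @ es)"
  let ?X = "map (\<lambda>t. I ! t) ?zs" and ?Y = "map (\<lambda>t. J ! t) ?zs"
  have a: "a \<notin> set ?zs" "a < length I" and dist: "distinct ?zs" using Cons.prems(1,2) by auto
  have card: "card ?S = Suc (length ?X)" using Cons.prems(1) distinct_card[of "(a # os) @ es"] by simp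
  \<comment> \<open>a generator matching the odd pair at \<open>a\<close> is odd itself, hence equal to
    \<open>a\<close> by injectivity\<close>
  have single: "{t\<in>?S. t < length I \<and> I ! t = I ! a \<and> J ! t = J ! a} = {a}"
  proof
    show "{t\<in>?S. t < length I \<and> I ! t = I ! a \<and> J ! t = J ! a} \<subseteq> {a}"
    proof
      fix t assume t: "t \<in> {t\<in>?S. t < length I \<and> I ! t = I ! a \<and> J ! t = J ! a}"
      then have "pair_par m I J t = pair_par m I J a" by (simp only: pair_par_def mem_Collect_eq)
      then have "pair_par m I J t = 1" using Cons.prems(3)[of a] by simp
      then have "t \<notin> set es" using Cons.prems(4)[of t] by auto
      then have "t \<in> set (a # os)" using t by auto
      then show "t \<in> {a}" using inj_onD[OF Cons.prems(5), of t a] t by simp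
    qed
  qed (use a in auto)
  have diff: "?S - {a} = set ?zs" using a by auto
  have len: "length ?X = length ?Y" by simp
  have sum1: "(\<Sum>t\<in>{a}. F t) = F a" for F :: "nat \<Rightarrow> 'k" by simp
  have nz: "expansion_coeff m I J ?X ?Y (set ?zs) \<noteq> (0 :: 'k)"
    by (rule Cons.IH) (use Cons.prems in \<open>auto simp: inj_on_def\<close>)
  have "expansion_coeff m I J (I ! a # ?X) (J ! a # ?Y) ?S \<noteq> (0 :: 'k)"
    unfolding expansion_coeff_Cons[OF len finite_set card] single sum1 diff
    using nz monomial_sign_nonzero[OF finite_set] by (simp only: mult_eq_0_iff koszul_nonzero) blast
  then show ?case unfolding append_Cons list.map .
qed

lemma decode_lincomb:
  fixes emb :: "(nat \<Rightarrow> 'k::field) \<Rightarrow> 'u"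
  assumes inj: "inj emb"
  shows "finite Z \<Longrightarrow> (\<And>z. z \<in> Z \<Longrightarrow> F z \<in> finitary) \<Longrightarrow>
    lincomb (sq_algebra emb q) Z t (\<lambda>z. encode emb (F z)) = encode emb (\<lambda>S. \<Sum>z\<in>Z. t z * F z S) \<and>
    (\<lambda>S. \<Sum>z\<in>Z. t z * F z S) \<in> finitary"
proof (induction Z rule: finite_induct)
  let ?A = "sq_algebra emb q"
  interpret comm_superalgebra ?A by (rule sq_algebra_superalgebra[OF inj])
  {
    case empty
    show ?case by (simp add: lincomb_def sq_algebra_sel[OF inj] finitary_closed(2))
  next
    case (insert z Z)
    have F: "F z \<in> finitary" "(\<lambda>S. t z * F z S) \<in> finitary" using insert.prems finitary_closed(4) by auto
    have IH: "lincomb ?A Z t (\<lambda>z. encode emb (F z)) = encode emb (\<lambda>S. \<Sum>z\<in>Z. t z * F z S)"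
      "(\<lambda>S. \<Sum>z\<in>Z. t z * F z S) \<in> finitary" using insert by auto
    have "lincomb ?A (insert z Z) t (\<lambda>z. encode emb (F z)) =
        t z \<odot>\<^bsub>?A\<^esub> encode emb (F z) \<oplus>\<^bsub>?A\<^esub> lincomb ?A Z t (\<lambda>z. encode emb (F z))"
      unfolding lincomb_def
    proof (rule finsum_insert')
      fix y assume "y \<in> insert z Z"
      then show "t y \<odot>\<^bsub>?A\<^esub> encode emb (F y) \<in> carrier ?A"
        using insert.prems by (intro smult_closed) (simp add: sq_algebra_sel[OF inj])
    qed (use insert in auto)
    also have "\<dots> = encode emb (\<lambda>S. t z * F z S + (\<Sum>z\<in>Z. t z * F z S))"
      unfolding IH(1) sq_algebra_smult[OF inj F(1)] by (rule sq_algebra_ops(2)[OF inj F(2) IH(2)])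
    finally show ?case
      using insert.hyps finitary_closed(3)[OF F(2) IH(2)] by simp
  }
qed

text \<open>
  After moving the two equal pairs to the front, their transposition fixes both tensors but has
  sign \<open>-1\<close>, as exactly one of the two repeated indices is odd.
\<close>

lemma orbit_sum_zero_repeated_odd:
  fixes l :: "nat list \<times> nat list \<Rightarrow> 'k::field_char_0"
  assumes I: "length I = r" and J: "length J = r"
    and ab: "a < r" "b < r" "a \<noteq> b" "I ! a = I ! b" "J ! a = J ! b" and odd: "pair_par m I J a = 1"
  shows "orbit_sum m r l (I, J) = 0"
proof -
  define zs where "zs = a # b # filter (\<lambda>t. t \<noteq> a \<and> t \<noteq> b) [0..<r]"
  have zs: "distinct zs" "set zs = {..<r}" using ab by (auto simp: zs_def)
  obtain s where s: "s permutes {1..r}"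
    "\<And>I :: nat list. length I = r \<Longrightarrow> perm_list s I = map (\<lambda>t. I ! t) zs"
    using perm_of_enumeration[OF zs] by blast
  let ?x = "I ! a" and ?y = "J ! a"
  define vs where "vs = map (\<lambda>t. I ! t) (filter (\<lambda>t. t \<noteq> a \<and> t \<noteq> b) [0..<r])"
  define ws where "ws = map (\<lambda>t. J ! t) (filter (\<lambda>t. t \<noteq> a \<and> t \<noteq> b) [0..<r])"
  have X: "perm_list s I = [] @ ?x # ?x # vs" and Y: "perm_list s J = [] @ ?y # ?y # ws"
    using s(2)[OF I] s(2)[OF J] ab(4,5) by (simp_all add: zs_def vs_def ws_def)
  have len: "length ([] @ ?x # ?x # vs) = r" "length ([] @ ?y # ?y # ws) = r"
    using X Y I J by (metis length_perm_list)+
  have r: "Suc 0 < r" using len(1) by simp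
  have fix1: "perm_list (adjacent_swap 0) ([] @ ?x # ?x # vs) = [] @ ?x # ?x # vs"
    and fix2: "perm_list (adjacent_swap 0) ([] @ ?y # ?y # ws) = [] @ ?y # ?y # ws"
    by (rule perm_list_adjacent, simp)+
  have sign: "pair_sign m r (adjacent_swap 0) ([] @ ?x # ?x # vs) ([] @ ?y # ?y # ws) = (- 1 :: 'k)"
  proof -
    have "pair_sign m r (adjacent_swap 0) ([] @ ?x # ?x # vs) ([] @ ?y # ?y # ws) =
        (koszul (par_V m ?x * par_V m ?x) * koszul (par_V m ?y * par_V m ?y) :: 'k)"
      unfolding pair_sign_def perm_sign_adjacent[OF list.size(3) len(1)[symmetric]]
        perm_sign_adjacent[OF list.size(3) len(2)[symmetric]] ..
    also have "\<dots> = - 1"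
      using odd unfolding pair_par_def
      by (cases "par_V m ?x = 0"; cases "par_V m ?y = 0") (simp_all add: koszul_def)
    finally show ?thesis .
  qed
  let ?o = "orbit_sum m r l ([] @ ?x # ?x # vs, [] @ ?y # ?y # ws)"
  have "?o = - ?o"
    using orbit_sum_perm[OF adjacent_swap_permutes[OF r] len, of m l] unfolding fix1 fix2 sign by simp
  then have "?o = 0" by simp
  then have "pair_sign m r s I J * orbit_sum m r l (I, J) = 0"
    using orbit_sum_perm[OF s(1) I J, of m l] unfolding X Y by simp
  moreover have "pair_sign m r s I J \<noteq> (0 :: 'k)" by (simp add: pair_sign_def perm_sign_nonzero)
  ultimately show ?thesis by simp
qed

text \<open>
  The relation is evaluated on \<open>gen_matrix\<close> for \<open>(I, J)\<close>, and
  coefficients at the full monomial \<open>{..<r}\<close> are compared. The matrix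
  \<open>K\<close> of these coefficients is equivariant and supported on the orbit of \<open>(I,
  J)\<close>. The averaged relation therefore takes on \<open>K\<close> the value \<open>orbit_sum
  (I, J) * K I J\<close> times the number of elements of the orbit. Apart from the case of a
  repeated odd pair, \<open>K\<close> does not vanish on the orbit.
\<close>

lemma orbit_sum_zero:
  fixes emb :: "(nat \<Rightarrow> 'k::field_char_0) \<Rightarrow> 'u" and l l' :: "nat list \<times> nat list \<Rightarrow> 'k"
  assumes inj: "inj emb" and I: "I \<in> tensor_basis m n r" and J: "J \<in> tensor_basis m n r"
    and eq: "\<And>(A :: ('k, 'u) superalgebra) g. comm_superalgebra A \<Longrightarrow> g \<in> carrier (GL m n A) \<Longrightarrow>
      lincomb A (tensor_basis2 m n r) l (\<lambda>(I, J). tensor_coeff m A g I J) =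
      lincomb A (tensor_basis2 m n r) l' (\<lambda>(I, J). tensor_coeff m A g I J)"
  shows "orbit_sum m r (\<lambda>z. l z - l' z) (I, J) = 0"
proof (cases "\<exists>a b. a < r \<and> b < r \<and> a \<noteq> b \<and> I ! a = I ! b \<and> J ! a = J ! b \<and> pair_par m I J a = 1")
  case True
  then show ?thesis
    using orbit_sum_zero_repeated_odd[OF tensor_basisD[OF I] tensor_basisD[OF J]] by blast
next
  case False
  note len = tensor_basisD[OF I] tensor_basisD[OF J]
  let ?q = "pair_par m I J" and ?Z = "tensor_basis2 m n r" and ?d = "\<lambda>z. l z - l' z"
  let ?A = "sq_algebra emb ?q" and ?g = "gen_matrix emb (m + n) I J r"
  interpret comm_superalgebra ?A by (rule sq_algebra_superalgebra[OF inj])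
  have g: "?g \<in> carrier (GL m n ?A)" by (rule gen_matrix_in_GL[OF inj I J order_refl])
  have finZ: "finite ?Z" by (simp add: finite_tensor_basis)
  define K :: "nat list \<Rightarrow> nat list \<Rightarrow> 'k" where "K X Y = expansion_coeff m I J X Y {..<r}" for X Y
  have tc: "tensor_coeff m ?A ?g X Y = encode emb (expansion_coeff m I J X Y)"
    if "X \<in> tensor_basis m n r" "Y \<in> tensor_basis m n r" for X Y
    using tensor_coeff_gen_matrix[OF inj that, of I J] len(1) by simp
  have KE: "K \<in> equivariant_matrices m n r"
    unfolding equivariant_matrices_def
  proof (intro CollectI allI impI ballI)
    fix s X Y assume s: "s permutes {1..r}" and XY: "X \<in> tensor_basis m n r" "Y \<in> tensor_basis m n r"
    have "encode emb (expansion_coeff m I J (perm_list s X) (perm_list s Y)) =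
        encode emb (\<lambda>S. pair_sign m r s X Y * expansion_coeff m I J X Y S)"
      using tensor_coeff_equivariant[OF GL_even_matrix[OF g] s XY]
      unfolding tc[OF XY] tc[OF perm_list_in_basis[OF s XY(1)] perm_list_in_basis[OF s XY(2)]]
        sq_algebra_smult[OF inj expansion_coeff_finitary] .
    then have "decode emb (encode emb (expansion_coeff m I J (perm_list s X) (perm_list s Y))) =
        decode emb (encode emb (\<lambda>S. pair_sign m r s X Y * expansion_coeff m I J X Y S))" by (rule arg_cong)
    then have "expansion_coeff m I J (perm_list s X) (perm_list s Y) =
        ((\<lambda>S. pair_sign m r s X Y * expansion_coeff m I J X Y S) :: nat set \<Rightarrow> 'k)"
      unfolding decode_encode[OF inj expansion_coeff_finitary]
        decode_encode[OF inj finitary_closed(4)[OF expansion_coeff_finitary]] .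
    then show "K (perm_list s X) (perm_list s Y) = pair_sign m r s X Y * K X Y" by (simp add: K_def)
  qed
  have coeff: "lincomb ?A ?Z t (\<lambda>(X, Y). tensor_coeff m ?A ?g X Y) =
      encode emb (\<lambda>S. \<Sum>(X, Y)\<in>?Z. t (X, Y) * expansion_coeff m I J X Y S) \<and>
      (\<lambda>S. \<Sum>(X, Y)\<in>?Z. t (X, Y) * expansion_coeff m I J X Y S) \<in> finitary" for t
  proof -
    have "lincomb ?A ?Z t (\<lambda>(X, Y). tensor_coeff m ?A ?g X Y) =
        lincomb ?A ?Z t (\<lambda>z. encode emb (case z of (X, Y) \<Rightarrow> expansion_coeff m I J X Y))"
    proof (rule lincomb_cong[OF refl])
      fix z assume "z \<in> ?Z"
      then obtain X Y where z: "z = (X, Y)" "X \<in> tensor_basis m n r" "Y \<in> tensor_basis m n r" by auto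
      show "(case z of (X, Y) \<Rightarrow> tensor_coeff m ?A ?g X Y) = encode emb (case z of (X, Y) \<Rightarrow> expansion_coeff m I J X Y)"
        unfolding z(1) prod.case by (rule tc[OF z(2,3)])
      show "encode emb (case z of (X, Y) \<Rightarrow> expansion_coeff m I J X Y) \<in> carrier ?A"
        unfolding z(1) prod.case sq_algebra_sel[OF inj] by (rule imageI[OF expansion_coeff_finitary])
    qed
    moreover have "lincomb ?A ?Z t (\<lambda>z. encode emb (case z of (X, Y) \<Rightarrow> expansion_coeff m I J X Y)) =
        encode emb (\<lambda>S. \<Sum>z\<in>?Z. t z * (case z of (X, Y) \<Rightarrow> expansion_coeff m I J X Y) S) \<and>
        (\<lambda>S. \<Sum>z\<in>?Z. t z * (case z of (X, Y) \<Rightarrow> expansion_coeff m I J X Y) S) \<in> finitary"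
      by (rule decode_lincomb[OF inj finZ]) (auto simp: expansion_coeff_finitary)
    ultimately show ?thesis by (simp add: split_beta)
  qed
  have "encode emb (\<lambda>S. \<Sum>(X, Y)\<in>?Z. l (X, Y) * expansion_coeff m I J X Y S) =
      encode emb (\<lambda>S. \<Sum>(X, Y)\<in>?Z. l' (X, Y) * expansion_coeff m I J X Y S)"
    using eq[OF comm_superalgebra_axioms g] coeff[of l] coeff[of l'] by metis
  then have "decode emb (encode emb (\<lambda>S. \<Sum>(X, Y)\<in>?Z. l (X, Y) * expansion_coeff m I J X Y S)) =
      decode emb (encode emb (\<lambda>S. \<Sum>(X, Y)\<in>?Z. l' (X, Y) * expansion_coeff m I J X Y S))" by (rule arg_cong)
  then have "(\<lambda>S. \<Sum>(X, Y)\<in>?Z. l (X, Y) * expansion_coeff m I J X Y S) =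
      (\<lambda>S. \<Sum>(X, Y)\<in>?Z. l' (X, Y) * expansion_coeff m I J X Y S)"
    using decode_encode[OF inj conjunct2[OF coeff[of l]]] decode_encode[OF inj conjunct2[OF coeff[of l']]] by metis
  then have eqK: "(\<Sum>(X, Y)\<in>?Z. l (X, Y) * K X Y) = (\<Sum>(X, Y)\<in>?Z. l' (X, Y) * K X Y)"
    unfolding K_def by (rule fun_cong)
  have "(\<Sum>(X, Y)\<in>?Z. ?d (X, Y) * K X Y) = 0"
    using eqK by (simp add: split_beta left_diff_distrib sum_subtractf)
  then have sum0: "(\<Sum>(X, Y)\<in>?Z. orbit_sum m r ?d (X, Y) * K X Y) = 0"
    using sum_orbit_sum[OF KE, of ?d] by simp
  let ?v = "orbit_sum m r ?d (I, J) * K I J"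
  define Orb where "Orb = {z\<in>?Z. K (fst z) (snd z) \<noteq> 0}"
  have orbit: "\<exists>s. s permutes {1..r} \<and> X = perm_list s I \<and> Y = perm_list s J"
    if XY: "X \<in> tensor_basis m n r" "Y \<in> tensor_basis m n r" and nz: "K X Y \<noteq> 0" for X Y
  proof -
    have "length X = length Y" "card {..<r} = length X" using XY by (simp_all add: tensor_basis_def)
    from expansion_coeff_enumeration[OF this(1) finite_lessThan this(2) nz[unfolded K_def]]
    obtain zs where zs: "distinct zs" "set zs = {..<r}" "X = map (\<lambda>t. I ! t) zs" "Y = map (\<lambda>t. J ! t) zs" by blast
    obtain s where "s permutes {1..r}" "\<And>I :: nat list. length I = r \<Longrightarrow> perm_list s I = map (\<lambda>t. I ! t) zs"
      using perm_of_enumeration[OF zs(1,2)] by blast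
    then show ?thesis using zs(3,4) len by metis
  qed
  \<comment> \<open>the two signs cancel, so all elements of the orbit contribute equally\<close>
  have orbit_value: "orbit_sum m r ?d (perm_list s I, perm_list s J) * K (perm_list s I) (perm_list s J) = ?v"
    if s: "s permutes {1..r}" for s
  proof -
    have "K (perm_list s I) (perm_list s J) = pair_sign m r s I J * K I J"
      using KE s I J unfolding equivariant_matrices_def by blast
    then have "orbit_sum m r ?d (perm_list s I, perm_list s J) * K (perm_list s I) (perm_list s J) =
        (pair_sign m r s I J * pair_sign m r s I J) * ?v"
      unfolding orbit_sum_perm[OF s len] by (simp only: mult.assoc mult.left_commute)
    then show ?thesis by (simp only: pair_sign_square mult_1)
  qed
  have "(\<Sum>(X, Y)\<in>?Z. orbit_sum m r ?d (X, Y) * K X Y) = (\<Sum>z\<in>Orb. ?v)"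
  proof (rule sum.mono_neutral_cong_right[OF finZ])
    show "\<forall>z\<in>?Z - Orb. (case z of (X, Y) \<Rightarrow> orbit_sum m r ?d (X, Y) * K X Y) = 0"
      by (auto simp: Orb_def)
    fix z assume z: "z \<in> Orb"
    obtain X Y where zXY: "z = (X, Y)" by (cases z)
    then have "X \<in> tensor_basis m n r" "Y \<in> tensor_basis m n r" "K X Y \<noteq> 0" using z by (auto simp: Orb_def)
    from orbit[OF this] obtain s where s: "s permutes {1..r}" "X = perm_list s I" "Y = perm_list s J" by blast
    show "(case z of (X, Y) \<Rightarrow> orbit_sum m r ?d (X, Y) * K X Y) = ?v"
      unfolding zXY prod.case s(2,3) by (rule orbit_value[OF s(1)])
  qed (auto simp: Orb_def)
  then have "of_nat (card Orb) * ?v = 0" using sum0 by simp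
  \<comment> \<open>odd pairs come first in the representative of the orbit at which \<open>K\<close> is
    computed\<close>
  define os where "os = filter (\<lambda>t. ?q t = 1) [0..<r]"
  define es where "es = filter (\<lambda>t. ?q t = 0) [0..<r]"
  have zs: "distinct (os @ es)" "set (os @ es) = {..<r}"
    by (auto simp: os_def es_def)
  obtain s where s: "s permutes {1..r}" "\<And>I :: nat list. length I = r \<Longrightarrow> perm_list s I = map (\<lambda>t. I ! t) (os @ es)"
    using perm_of_enumeration[OF zs] by blast
  have "inj_on (\<lambda>t. (I ! t, J ! t)) (set os)"
  proof (rule inj_onI)
    fix a b assume ab: "a \<in> set os" "b \<in> set os" "(I ! a, J ! a) = (I ! b, J ! b)"
    then have "a < r" "b < r" "?q a = 1" "I ! a = I ! b" "J ! a = J ! b" by (auto simp: os_def)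
    then show "a = b" using False by blast
  qed
  then have "expansion_coeff m I J (map (\<lambda>t. I ! t) (os @ es)) (map (\<lambda>t. J ! t) (os @ es)) (set (os @ es)) \<noteq> (0 :: 'k)"
    using zs len(1) by (intro expansion_coeff_nonzero) (auto simp: os_def es_def)
  then have nz: "K (perm_list s I) (perm_list s J) \<noteq> 0"
    unfolding K_def s(2)[OF len(1)] s(2)[OF len(2)] zs(2) .
  then have "(perm_list s I, perm_list s J) \<in> Orb"
    using perm_list_in_basis[OF s(1) I] perm_list_in_basis[OF s(1) J] by (simp add: Orb_def)
  moreover have "finite Orb" using finZ by (simp add: Orb_def)
  ultimately have "card Orb \<noteq> 0" by auto
  then have "?v = 0" using \<open>of_nat (card Orb) * ?v = 0\<close> by simp
  moreover have "K I J \<noteq> 0"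
  proof
    assume "K I J = 0"
    moreover have "K (perm_list s I) (perm_list s J) = pair_sign m r s I J * K I J"
      using KE s(1) I J unfolding equivariant_matrices_def by blast
    ultimately show False using nz by simp
  qed
  ultimately show ?thesis by simp
qed

lemma equivariant_relations:
  fixes emb :: "(nat \<Rightarrow> 'k::field_char_0) \<Rightarrow> 'u" and l l' :: "nat list \<times> nat list \<Rightarrow> 'k"
  assumes inj: "inj emb" and c: "c \<in> equivariant_matrices m n r"
    and eq: "\<And>(A :: ('k, 'u) superalgebra) g. comm_superalgebra A \<Longrightarrow> g \<in> carrier (GL m n A) \<Longrightarrow>
      lincomb A (tensor_basis2 m n r) l (\<lambda>(I, J). tensor_coeff m A g I J) =
      lincomb A (tensor_basis2 m n r) l' (\<lambda>(I, J). tensor_coeff m A g I J)"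
  shows "(\<Sum>(I, J)\<in>tensor_basis2 m n r. l (I, J) * c I J) = (\<Sum>(I, J)\<in>tensor_basis2 m n r. l' (I, J) * c I J)"
proof -
  let ?Z = "tensor_basis2 m n r" and ?d = "\<lambda>z. l z - l' z"
  have "(\<Sum>(I, J)\<in>?Z. orbit_sum m r ?d (I, J) * c I J) = 0"
  proof (rule sum.neutral, rule ballI)
    fix z assume "z \<in> ?Z"
    then obtain I J where z: "z = (I, J)" "I \<in> tensor_basis m n r" "J \<in> tensor_basis m n r" by auto
    have "orbit_sum m r ?d (I, J) = 0"
      by (rule orbit_sum_zero[OF inj z(2,3)]) (rule eq)
    then show "(case z of (I, J) \<Rightarrow> orbit_sum m r ?d (I, J) * c I J) = 0" by (simp add: z(1))
  qed
  then have "(\<Sum>(I, J)\<in>?Z. ?d (I, J) * c I J) = 0"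
    using sum_orbit_sum[OF c, of ?d] by simp
  then show ?thesis by (simp add: split_beta left_diff_distrib sum_subtractf)
qed

section \<open>Representations of the supergroup as families of matrices\<close>

text \<open>
  The scalar combination of matrix entries given by a row \<open>p\<close> and a column
  \<open>u\<close>, that is \<open>p \<rho>(g) u\<close>. All linear conditions on representations
  are stated with it.
\<close>

definition rep_form ::
  "('k::field, 'u, 'i) gl_rep \<Rightarrow> ('k, 'u) superalgebra \<Rightarrow> (nat \<Rightarrow> nat \<Rightarrow> 'u) \<Rightarrow>
    ('i \<Rightarrow> 'k) \<Rightarrow> ('i \<Rightarrow> 'k) \<Rightarrow> 'u" where
  "rep_form W A g p u =
     lincomb A (gl_basis W) p (\<lambda>i. lincomb A (gl_basis W) u (\<lambda>j. gl_act W A g i j))"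

definition row_mult :: "'i set \<Rightarrow> ('i \<Rightarrow> 'k::field) \<Rightarrow> ('i \<Rightarrow> 'j \<Rightarrow> 'k) \<Rightarrow> 'j \<Rightarrow> 'k" where
  "row_mult I p S j = (\<Sum>i\<in>I. p i * S i j)"

text \<open>
  What manipulations of \<open>rep_form\<close> require of a representation: finitely many
  entries, all in the algebra.
\<close>

definition has_matrix_entries :: "nat \<Rightarrow> nat \<Rightarrow> ('k::field, 'u, 'i) gl_rep \<Rightarrow> bool" where
  "has_matrix_entries m n W \<longleftrightarrow> finite (gl_basis W) \<and>
     (\<forall>A. comm_superalgebra A \<longrightarrow> (\<forall>g\<in>carrier (GL m n A). \<forall>i\<in>gl_basis W. \<forall>j\<in>gl_basis W.
        gl_act W A g i j \<in> carrier A))"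

lemma has_matrix_entriesD:
  assumes "has_matrix_entries m n W"
  shows "finite (gl_basis W)"
    "comm_superalgebra A \<Longrightarrow> g \<in> carrier (GL m n A) \<Longrightarrow> i \<in> gl_basis W \<Longrightarrow> j \<in> gl_basis W \<Longrightarrow>
      gl_act W A g i j \<in> carrier A"
  using assms unfolding has_matrix_entries_def by blast+

lemma End_super_entry:
  assumes "X \<in> carrier (End_super I p A)" "i \<in> I" "j \<in> I"
  shows "X i j \<in> grade A (p i + p j)"
proof -
  have "X \<in> (\<Pi>\<^sub>E i\<in>I. \<Pi>\<^sub>E j\<in>I. grade A (p i + p j))"
    using assms(1) unfolding End_super_def partial_object.simps .
  from PiE_mem[OF PiE_mem[OF this assms(2)] assms(3)] show ?thesis .
qed

lemma gl_rep_has_matrix_entries: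
  fixes W :: "('k::field, 'u, 'i) gl_rep"
  assumes W: "is_gl_rep m n W"
  shows "has_matrix_entries m n W"
  unfolding has_matrix_entries_def
proof (intro conjI allI impI ballI)
  show "finite (gl_basis W)" using W by (simp add: is_gl_rep_def)
  fix A :: "('k, 'u) superalgebra" and g i j
  assume A: "comm_superalgebra A" and g: "g \<in> carrier (GL m n A)" and ij: "i \<in> gl_basis W" "j \<in> gl_basis W"
  have "gl_act W A \<in> hom (GL m n A) (End_super (gl_basis W) (gl_par W) A)"
    using W A unfolding is_gl_rep_def by blast
  then have "gl_act W A g \<in> carrier (End_super (gl_basis W) (gl_par W) A)"
    using g unfolding hom_def by blast
  from End_super_entry[OF this ij] show "gl_act W A g i j \<in> carrier A"
    by (rule comm_superalgebra.grade_closed[OF A])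
qed

lemma tensor_rep_sel [simp]:
  "gl_basis (tensor_rep m n r) = tensor_basis m n r"
  "gl_par (tensor_rep m n r) = tensor_par m"
  "I \<in> tensor_basis m n r \<Longrightarrow> J \<in> tensor_basis m n r \<Longrightarrow>
    gl_act (tensor_rep m n r) A g I J = tensor_coeff m A g I J"
  by (simp_all add: tensor_rep_def)

lemma tensor_rep_has_matrix_entries: "has_matrix_entries m n (tensor_rep m n r)"
  unfolding has_matrix_entries_def
proof (intro conjI allI impI ballI)
  show "finite (gl_basis (tensor_rep m n r))" by (simp add: finite_tensor_basis)
  fix A :: "('a, 'b) superalgebra" and g I J
  assume A: "comm_superalgebra A" and g: "g \<in> carrier (GL m n A)"
    and "I \<in> gl_basis (tensor_rep m n r)" "J \<in> gl_basis (tensor_rep m n r)"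
  then have IJ: "I \<in> tensor_basis m n r" "J \<in> tensor_basis m n r" by (simp_all only: tensor_rep_sel)
  show "gl_act (tensor_rep m n r) A g I J \<in> carrier A"
    unfolding tensor_rep_sel(3)[OF IJ]
    by (rule comm_superalgebra.tensor_coeff_closed[OF A comm_superalgebra.GL_even_matrix[OF A g] IJ])
qed

definition even_matrix :: "('k::field, 'u, 'i) gl_rep \<Rightarrow> ('k, 'u, 'j) gl_rep \<Rightarrow> ('j \<Rightarrow> 'i \<Rightarrow> 'k) \<Rightarrow> bool" where
  "even_matrix W W' T \<longleftrightarrow>
     (\<forall>j\<in>gl_basis W'. \<forall>i\<in>gl_basis W. gl_par W' j \<noteq> gl_par W i \<longrightarrow> T j i = 0)"

lemma rep_form_cong:
  assumes W: "has_matrix_entries m n W" and A: "comm_superalgebra A" and g: "g \<in> carrier (GL m n A)"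
    and "\<And>i. i \<in> gl_basis W \<Longrightarrow> p i = p' i" "\<And>i. i \<in> gl_basis W \<Longrightarrow> u i = u' i"
  shows "rep_form W A g p u = rep_form W A g p' u'"
proof -
  interpret comm_superalgebra A by fact
  note cl = has_matrix_entriesD(2)[OF W A g]
  show ?thesis
    unfolding rep_form_def
  proof (rule lincomb_cong[OF assms(4)])
    fix i assume i: "i \<in> gl_basis W"
    show "lincomb A (gl_basis W) u (\<lambda>j. gl_act W A g i j) = lincomb A (gl_basis W) u' (\<lambda>j. gl_act W A g i j)"
      by (rule lincomb_cong[OF assms(5) refl cl[OF i]])
    show "lincomb A (gl_basis W) u' (\<lambda>j. gl_act W A g i j) \<in> carrier A"
      by (rule lincomb_closed[OF cl[OF i]])
  qed
qed

lemma rep_form_unit: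
  assumes W: "has_matrix_entries m n W" and A: "comm_superalgebra A" and g: "g \<in> carrier (GL m n A)"
    and i: "i \<in> gl_basis W"
  shows "rep_form W A g (unit_vec i) u = lincomb A (gl_basis W) u (\<lambda>j. gl_act W A g i j)"
    "j \<in> gl_basis W \<Longrightarrow> rep_form W A g p (unit_vec j) = lincomb A (gl_basis W) p (\<lambda>i. gl_act W A g i j)"
proof -
  interpret comm_superalgebra A by fact
  note cl = has_matrix_entriesD(2)[OF W A g] and fin = has_matrix_entriesD(1)[OF W]
  show "rep_form W A g (unit_vec i) u = lincomb A (gl_basis W) u (\<lambda>j. gl_act W A g i j)"
    unfolding rep_form_def by (rule lincomb_unit_vec[OF fin i lincomb_closed[OF cl]])
  assume j: "j \<in> gl_basis W"
  show "rep_form W A g p (unit_vec j) = lincomb A (gl_basis W) p (\<lambda>i. gl_act W A g i j)"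
    unfolding rep_form_def
    by (rule lincomb_cong[OF refl]) (rule lincomb_unit_vec[OF fin j cl], assumption+, rule cl[OF _ j])
qed

lemma intertwiner_rep_form:
  assumes W: "has_matrix_entries m n W" and W': "has_matrix_entries m n W'"
    and S: "gl_intertwiner m n W W' S"
    and A: "comm_superalgebra A" and g: "g \<in> carrier (GL m n A)"
  shows "rep_form W' A g p (lin_map (gl_basis W) (gl_basis W') S u) =
    rep_form W A g (row_mult (gl_basis W') p S) u"
proof -
  interpret comm_superalgebra A by fact
  let ?I = "gl_basis W" and ?J = "gl_basis W'"
  note cl = has_matrix_entriesD(2)[OF W A g] and fin = has_matrix_entriesD(1)[OF W]
  note cl' = has_matrix_entriesD(2)[OF W' A g] and fin' = has_matrix_entriesD(1)[OF W']
  have inner: "lincomb A ?J (lin_map ?I ?J S u) (\<lambda>j. gl_act W' A g a j) =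
      lincomb A ?I (S a) (\<lambda>l. lincomb A ?I u (\<lambda>i. gl_act W A g l i))" if a: "a \<in> ?J" for a
  proof -
    have "lincomb A ?J (lin_map ?I ?J S u) (\<lambda>j. gl_act W' A g a j) =
        lincomb A ?J (\<lambda>j. \<Sum>i\<in>?I. u i * S j i) (\<lambda>j. gl_act W' A g a j)"
      by (rule lincomb_cong[OF _ refl cl'[OF a]]) (simp add: lin_map_def mult.commute)
    also have "\<dots> = lincomb A ?I u (\<lambda>i. lincomb A ?J (\<lambda>j. S j i) (\<lambda>j. gl_act W' A g a j))"
      by (rule lincomb_scalars[OF fin fin' cl'[OF a], symmetric])
    also have "\<dots> = lincomb A ?I u (\<lambda>i. lincomb A ?I (S a) (\<lambda>l. gl_act W A g l i))"
    proof (rule lincomb_cong[OF refl])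
      fix i assume i: "i \<in> ?I"
      show "lincomb A ?J (\<lambda>j. S j i) (\<lambda>j. gl_act W' A g a j) = lincomb A ?I (S a) (\<lambda>l. gl_act W A g l i)"
        using S A g a i unfolding gl_intertwiner_def lincomb_def by simp
      show "lincomb A ?I (S a) (\<lambda>l. gl_act W A g l i) \<in> carrier A" by (rule lincomb_closed[OF cl[OF _ i]])
    qed
    also have "\<dots> = lincomb A ?I (S a) (\<lambda>l. lincomb A ?I u (\<lambda>i. gl_act W A g l i))"
      by (rule lincomb_swap[OF fin fin]) (rule cl, assumption+)
    finally show ?thesis .
  qed
  have closed: "lincomb A ?I u (\<lambda>i. gl_act W A g l i) \<in> carrier A" if "l \<in> ?I" for l
    by (rule lincomb_closed[OF cl[OF that]])
  have "rep_form W' A g p (lin_map ?I ?J S u) =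
      lincomb A ?J p (\<lambda>a. lincomb A ?I (S a) (\<lambda>l. lincomb A ?I u (\<lambda>i. gl_act W A g l i)))"
    unfolding rep_form_def by (rule lincomb_cong[OF refl inner lincomb_closed[OF closed]])
  also have "\<dots> = lincomb A ?I (\<lambda>l. \<Sum>a\<in>?J. p a * S a l) (\<lambda>l. lincomb A ?I u (\<lambda>i. gl_act W A g l i))"
    by (rule lincomb_scalars[OF fin' fin closed])
  finally show ?thesis by (simp only: rep_form_def row_mult_def[abs_def])
qed

lemma intertwinerI:
  fixes W :: "('k::field, 'u, 'i) gl_rep"
  assumes W: "has_matrix_entries m n W" and W': "has_matrix_entries m n W'"
    and even: "even_matrix W W' S"
    and eq: "\<And>(A :: ('k, 'u) superalgebra) g a i. comm_superalgebra A \<Longrightarrow> g \<in> carrier (GL m n A) \<Longrightarrow>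
      a \<in> gl_basis W' \<Longrightarrow> i \<in> gl_basis W \<Longrightarrow>
      rep_form W' A g (unit_vec a) (lin_map (gl_basis W) (gl_basis W') S (unit_vec i)) =
      rep_form W A g (S a) (unit_vec i)"
  shows "gl_intertwiner m n W W' S"
  unfolding gl_intertwiner_def
proof (intro conjI allI impI ballI)
  let ?I = "gl_basis W" and ?J = "gl_basis W'"
  show "S j i = 0" if "j \<in> ?J" "i \<in> ?I" "gl_par W' j \<noteq> gl_par W i" for i j
    using even that unfolding even_matrix_def by blast
  fix A :: "('k, 'u) superalgebra" and g a i
  assume A: "comm_superalgebra A" and g: "g \<in> carrier (GL m n A)" and a: "a \<in> ?J" and i: "i \<in> ?I"
  interpret comm_superalgebra A by fact
  note cl' = has_matrix_entriesD(2)[OF W' A g]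
  have "lincomb A ?J (lin_map ?I ?J S (unit_vec i)) (\<lambda>j. gl_act W' A g a j) =
      lincomb A ?J (\<lambda>j. S j i) (\<lambda>j. gl_act W' A g a j)"
    unfolding lin_map_unit_vec[OF has_matrix_entriesD(1)[OF W] i]
    by (rule lincomb_cong[OF _ refl cl'[OF a]]) simp
  then show "(\<Oplus>\<^bsub>A\<^esub>l\<in>?I. S a l \<odot>\<^bsub>A\<^esub> gl_act W A g l i) = (\<Oplus>\<^bsub>A\<^esub>l\<in>?J. S l i \<odot>\<^bsub>A\<^esub> gl_act W' A g a l)"
    using eq[OF A g a i] unfolding rep_form_unit(1)[OF W' A g a] rep_form_unit(2)[OF W A g i i]
    by (simp only: lincomb_def)
qed

lemma intertwiner_even: "gl_intertwiner m n W W' S \<Longrightarrow> even_matrix W W' S"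
  by (simp add: gl_intertwiner_def even_matrix_def)

definition parity_part :: "('i \<Rightarrow> bit) \<Rightarrow> bit \<Rightarrow> ('i \<Rightarrow> 'k::field) \<Rightarrow> 'i \<Rightarrow> 'k" where
  "parity_part p q u = (\<lambda>i. if p i = q then u i else 0)"

lemma parity_part_in: "u \<in> coord_space I \<Longrightarrow> parity_part p q u \<in> coord_space I"
  by (auto simp: parity_part_def coord_space_def)

lemma flinear_parity_part: "flinear (parity_part p q)"
  by (rule flinearI) (auto simp: parity_part_def fscale_def fun_eq_iff)

lemma parity_part_unit_vec: "parity_part p (p i) (unit_vec i) = unit_vec i"
  by (auto simp: parity_part_def unit_vec_def)

text \<open>
  Evenness of a matrix enters proofs as compatibility with the projections to the homogeneous
  parts.
\<close>

lemma even_matrix_parity_part: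
  assumes "even_matrix W W' T"
  shows "lin_map (gl_basis W) (gl_basis W') T (parity_part (gl_par W) q u) =
    parity_part (gl_par W') q (lin_map (gl_basis W) (gl_basis W') T u)"
proof
  fix j
  have "T j i * parity_part (gl_par W) q u i = (if gl_par W' j = q then T j i * u i else 0)"
    if "j \<in> gl_basis W'" "i \<in> gl_basis W" for i
    using assms that unfolding even_matrix_def parity_part_def by (cases "T j i = 0") auto
  then show "lin_map (gl_basis W) (gl_basis W') T (parity_part (gl_par W) q u) j =
      parity_part (gl_par W') q (lin_map (gl_basis W) (gl_basis W') T u) j"
    by (auto simp: lin_map_def parity_part_def)
qed

lemma even_matrixI_columns:
  fixes W :: "('k::field, 'u, 'i) gl_rep" and W' :: "('k, 'u, 'j) gl_rep"
  assumes "\<And>i. i \<in> gl_basis W \<Longrightarrow> parity_part (gl_par W') (gl_par W i) (f (unit_vec i)) = f (unit_vec i)"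
  shows "even_matrix W W' (\<lambda>j i. f (unit_vec i) j)"
  unfolding even_matrix_def
proof (intro ballI impI)
  fix j i assume "j \<in> gl_basis W'" "i \<in> gl_basis W" "gl_par W' j \<noteq> gl_par W i"
  then show "f (unit_vec i) j = 0"
    using fun_cong[OF assms, of i j] by (simp add: parity_part_def)
qed

lemma gl_iso_refl:
  fixes W :: "('k::field, 'u, 'i) gl_rep"
  assumes W: "is_gl_rep m n W"
  shows "(W, W) \<in> gl_iso m n"
proof -
  let ?I = "gl_basis W" and ?S = "\<lambda>j i. (unit_vec i :: _ \<Rightarrow> _) j"
  note M = gl_rep_has_matrix_entries[OF W] and fin = has_matrix_entriesD(1)[OF gl_rep_has_matrix_entries[OF W]]
  have id: "lin_map ?I ?I ?S u = u" if "u \<in> coord_space ?I" for u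
    using flinear_eq_lin_map[OF fin flinearI[of "\<lambda>x. x"] unit_vec_in that] by simp
  have "gl_intertwiner m n W W ?S"
  proof (rule intertwinerI[OF M M even_matrixI_columns])
    fix A :: "('k, 'u) superalgebra" and g a i assume A: "comm_superalgebra A" and g: "g \<in> carrier (GL m n A)" and "a \<in> ?I" "i \<in> ?I"
    then show "rep_form W A g (unit_vec a) (lin_map ?I ?I ?S (unit_vec i)) = rep_form W A g (?S a) (unit_vec i)"
      unfolding id[OF unit_vec_in[OF \<open>i \<in> ?I\<close>]]
      by (intro rep_form_cong[OF M A g]) (auto simp: unit_vec_def)
  qed (rule parity_part_unit_vec)
  moreover have "bij_betw (lin_map ?I ?I ?S) (coord_space ?I) (coord_space ?I)"
    by (rule bij_betw_cong[THEN iffD2, OF _ bij_betw_id]) (simp only: id id_apply)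
  ultimately show ?thesis unfolding gl_iso_def using W by blast
qed

lemma intertwiner_compose:
  fixes W :: "('k::field, 'u, 'i) gl_rep" and W' :: "('k, 'u, 'j) gl_rep" and W'' :: "('k, 'u, 'l) gl_rep"
  assumes W: "has_matrix_entries m n W" and W': "has_matrix_entries m n W'" and W'': "has_matrix_entries m n W''"
    and S: "gl_intertwiner m n W W' S" and S': "gl_intertwiner m n W' W'' S'"
  shows "gl_intertwiner m n W W'' (\<lambda>k i. \<Sum>j\<in>gl_basis W'. S' k j * S j i)"
    (is "gl_intertwiner m n W W'' ?T")
proof (rule intertwinerI[OF W W''])
  let ?I = "gl_basis W" and ?J = "gl_basis W'" and ?K = "gl_basis W''"
  note fin' = has_matrix_entriesD(1)[OF W']
  show "even_matrix W W'' ?T"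
    unfolding even_matrix_def
  proof (intro ballI impI sum.neutral)
    fix k i j assume "k \<in> ?K" "i \<in> ?I" "gl_par W'' k \<noteq> gl_par W i" "j \<in> ?J"
    then show "S' k j * S j i = 0"
      using intertwiner_even[OF S] intertwiner_even[OF S'] unfolding even_matrix_def
      by (cases "gl_par W' j = gl_par W i") auto
  qed
  fix A :: "('k, 'u) superalgebra" and g a i assume A: "comm_superalgebra A" and g: "g \<in> carrier (GL m n A)" and a: "a \<in> ?K" and i: "i \<in> ?I"
  have "rep_form W'' A g (unit_vec a) (lin_map ?I ?K ?T (unit_vec i)) =
      rep_form W'' A g (unit_vec a) (lin_map ?J ?K S' (lin_map ?I ?J S (unit_vec i)))"
    by (simp only: lin_map_compose[OF fin'])
  also have "\<dots> = rep_form W A g (row_mult ?J (row_mult ?K (unit_vec a) S') S) (unit_vec i)"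
    by (simp only: intertwiner_rep_form[OF W' W'' S' A g] intertwiner_rep_form[OF W W' S A g])
  also have "\<dots> = rep_form W A g (?T a) (unit_vec i)"
  proof (rule rep_form_cong[OF W A g _ refl])
    fix l
    have "row_mult ?K (unit_vec a) S' j = S' a j" for j
      using a has_matrix_entriesD(1)[OF W''] by (simp add: row_mult_def unit_vec_def if_distrib[of "\<lambda>x. x * _"] cong: if_cong)
    then show "row_mult ?J (row_mult ?K (unit_vec a) S') S l = ?T a l" by (simp add: row_mult_def[of ?J])
  qed
  finally show "rep_form W'' A g (unit_vec a) (lin_map ?I ?K ?T (unit_vec i)) = rep_form W A g (?T a) (unit_vec i)" .
qed

lemma gl_iso_trans:
  assumes "(W, W') \<in> gl_iso m n" "(W', W'') \<in> gl_iso m n"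
  shows "(W, W'') \<in> gl_iso m n"
proof -
  let ?I = "gl_basis W" and ?J = "gl_basis W'" and ?K = "gl_basis W''"
  obtain S where W: "is_gl_rep m n W" "is_gl_rep m n W'" and S: "gl_intertwiner m n W W' S"
    "bij_betw (lin_map ?I ?J S) (coord_space ?I) (coord_space ?J)"
    using assms(1) unfolding gl_iso_def by blast
  obtain S' where W'': "is_gl_rep m n W''" and S': "gl_intertwiner m n W' W'' S'"
    "bij_betw (lin_map ?J ?K S') (coord_space ?J) (coord_space ?K)"
    using assms(2) unfolding gl_iso_def by blast
  note M = gl_rep_has_matrix_entries[OF W(1)] gl_rep_has_matrix_entries[OF W(2)] gl_rep_has_matrix_entries[OF W'']
  have "bij_betw (lin_map ?I ?K (\<lambda>k i. \<Sum>j\<in>?J. S' k j * S j i)) (coord_space ?I) (coord_space ?K)"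
    using bij_betw_trans[OF S(2) S'(2)] unfolding comp_def lin_map_compose[OF has_matrix_entriesD(1)[OF M(2)]] .
  then show ?thesis
    unfolding gl_iso_def using W(1) W'' intertwiner_compose[OF M S(1) S'(1)] by blast
qed

text \<open>
  The inverse of an even bijection is even, and pulling an identity of matrix entries back along
  the bijection inverts the intertwining relation.
\<close>

lemma gl_iso_sym:
  fixes W W' :: "('k::field, 'u, 'i) gl_rep"
  assumes "(W, W') \<in> gl_iso m n"
  shows "(W', W) \<in> gl_iso m n"
proof -
  let ?I = "gl_basis W" and ?J = "gl_basis W'"
  obtain S where W: "is_gl_rep m n W" "is_gl_rep m n W'" and S: "gl_intertwiner m n W W' S"
    "bij_betw (lin_map ?I ?J S) (coord_space ?I) (coord_space ?J)"
    using assms unfolding gl_iso_def by blast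
  note M = gl_rep_has_matrix_entries[OF W(1)] gl_rep_has_matrix_entries[OF W(2)]
  note fin = has_matrix_entriesD(1)[OF M(1)] has_matrix_entriesD(1)[OF M(2)]
  let ?f = "lin_map ?I ?J S"
  have inj: "inj_on ?f (coord_space ?I)" and img: "?f ` coord_space ?I = coord_space ?J"
    using S(2) by (auto simp: bij_betw_def)
  obtain p where p: "flinear p" "\<And>x. p x \<in> coord_space ?I" "\<And>u. u \<in> coord_space ?I \<Longrightarrow> p (?f u) = u"
    using flinear_left_inverse[OF flinear_lin_map subspace_coord_space inj] by blast
  have fp: "?f (p v) = v" if "v \<in> coord_space ?J" for v
  proof -
    have "v \<in> ?f ` coord_space ?I" using that img by simp
    then obtain u where u: "u \<in> coord_space ?I" "v = ?f u" by (rule imageE)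
    show ?thesis unfolding u(2) p(3)[OF u(1)] ..
  qed
  let ?P = "\<lambda>i j. p (unit_vec j) i"
  have P: "lin_map ?J ?I ?P v = p v" if "v \<in> coord_space ?J" for v
    by (rule flinear_eq_lin_map[OF fin(2) p(1) p(2) that, symmetric])
  have "gl_intertwiner m n W' W ?P"
  proof (rule intertwinerI[OF M(2,1) even_matrixI_columns])
    fix j assume j: "j \<in> ?J"
    let ?w = "p (unit_vec j)"
    have "?f (parity_part (gl_par W) (gl_par W' j) ?w) = ?f ?w"
      unfolding even_matrix_parity_part[OF intertwiner_even[OF S(1)]] fp[OF unit_vec_in[OF j]]
      by (rule parity_part_unit_vec)
    then show "parity_part (gl_par W) (gl_par W' j) ?w = ?w"
      using inj_onD[OF inj _ parity_part_in[OF p(2)] p(2)] by blast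
  next
    fix A :: "('k, 'u) superalgebra" and g a i assume A: "comm_superalgebra A" and g: "g \<in> carrier (GL m n A)" and a: "a \<in> ?I" and i: "i \<in> ?J"
    have "rep_form W A g (unit_vec a) (lin_map ?J ?I ?P (unit_vec i)) = rep_form W A g (unit_vec a) (p (unit_vec i))"
      by (simp only: P[OF unit_vec_in[OF i]])
    also have "\<dots> = rep_form W A g (row_mult ?J (?P a) S) (p (unit_vec i))"
    proof (rule rep_form_cong[OF M(1) A g _ refl])
      fix l assume l: "l \<in> ?I"
      have "row_mult ?J (?P a) S l = lin_map ?J ?I ?P (?f (unit_vec l)) a"
        unfolding lin_map_unit_vec[OF fin(1) l] unfolding lin_map_def row_mult_def using a by (simp cong: sum.cong)
      also have "\<dots> = unit_vec l a"
        unfolding P[OF lin_map_in] p(3)[OF unit_vec_in[OF l]] ..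
      finally show "unit_vec a l = row_mult ?J (?P a) S l" by (simp add: unit_vec_def)
    qed
    also have "\<dots> = rep_form W' A g (?P a) (?f (p (unit_vec i)))"
      by (rule intertwiner_rep_form[OF M S(1) A g, symmetric])
    also have "\<dots> = rep_form W' A g (?P a) (unit_vec i)" by (simp only: fp[OF unit_vec_in[OF i]])
    finally show "rep_form W A g (unit_vec a) (lin_map ?J ?I ?P (unit_vec i)) = rep_form W' A g (?P a) (unit_vec i)" .
  qed
  moreover have "bij_betw (lin_map ?J ?I ?P) (coord_space ?J) (coord_space ?I)"
  proof (rule bij_betwI[of _ _ _ ?f])
    show "lin_map ?J ?I ?P \<in> coord_space ?J \<rightarrow> coord_space ?I" "?f \<in> coord_space ?I \<rightarrow> coord_space ?J"
      using lin_map_in by auto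
    show "?f (lin_map ?J ?I ?P v) = v" if "v \<in> coord_space ?J" for v
      unfolding P[OF that] by (rule fp[OF that])
    show "lin_map ?J ?I ?P (?f u) = u" if "u \<in> coord_space ?I" for u
      unfolding P[OF lin_map_in] by (rule p(3)[OF that])
  qed
  ultimately show ?thesis unfolding gl_iso_def using W by blast
qed

lemma equiv_gl_iso: "equiv {W. is_gl_rep m n W} (gl_iso m n :: ('k::field, 'u, 'i) gl_rep rel)"
  (is "equiv ?X _")
proof (rule equivI)
  show "gl_iso m n \<subseteq> ?X \<times> ?X" by (auto simp: gl_iso_def)
  show "refl_on ?X (gl_iso m n)" by (rule refl_onI) (rule gl_iso_refl, simp)
  show "sym (gl_iso m n :: ('k, 'u, 'i) gl_rep rel)" by (rule symI) (rule gl_iso_sym)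
  show "trans (gl_iso m n :: ('k, 'u, 'i) gl_rep rel)" by (rule transI) (rule gl_iso_trans)
qed

section \<open>Base change of subspaces\<close>

lemma (in comm_superalgebra) base_change_iff:
  "x \<in> base_change A I U \<longleftrightarrow>
    (\<exists>F c. finite F \<and> F \<subseteq> U \<and> c \<in> F \<rightarrow> carrier A \<and> x = (\<lambda>i\<in>I. lincomb A F (\<lambda>u. u i) c))"
  unfolding base_change_def lincomb_def mem_Collect_eq
  by (intro iffI; elim exE conjE; intro exI conjI; assumption)

lemma (in comm_superalgebra) base_changeI:
  fixes e :: "nat \<Rightarrow> 'i \<Rightarrow> 'k"
  assumes e: "\<And>l. l < d \<Longrightarrow> e l \<in> U" "inj_on e {..<d}" and y: "\<And>l. l < d \<Longrightarrow> y l \<in> carrier A"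
  shows "(\<lambda>i\<in>I. lincomb A {..<d} (\<lambda>l. e l i) y) \<in> base_change A I U"
  unfolding base_change_iff
proof (intro exI conjI)
  let ?c = "\<lambda>u. y (the_inv_into {..<d} e u)"
  have c: "?c (e l) = y l" if "l < d" for l using the_inv_into_f_f[OF e(2)] that by simp
  show "finite (e ` {..<d})" "e ` {..<d} \<subseteq> U" using e by auto
  show cl: "?c \<in> e ` {..<d} \<rightarrow> carrier A" using c y by auto
  show "(\<lambda>i\<in>I. lincomb A {..<d} (\<lambda>l. e l i) y) = (\<lambda>i\<in>I. lincomb A (e ` {..<d}) (\<lambda>u. u i) ?c)"
  proof (rule restrict_ext)
    fix i
    have "lincomb A (e ` {..<d}) (\<lambda>u. u i) ?c = (\<Oplus>l\<in>{..<d}. e l i \<odot> ?c (e l))"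
      unfolding lincomb_def by (rule finsum_reindex[OF _ e(2)]) (use cl in \<open>auto intro!: smult_closed\<close>)
    also have "\<dots> = lincomb A {..<d} (\<lambda>l. e l i) y"
      unfolding lincomb_def by (rule finsum_cong_simple) (auto simp: c y smult_closed)
    finally show "lincomb A {..<d} (\<lambda>l. e l i) y = lincomb A (e ` {..<d}) (\<lambda>u. u i) ?c" by (rule sym)
  qed
qed

text \<open>
  A functional with scalar coefficients is determined on \<open>A \<otimes> U\<close> by its
  values on \<open>U\<close>. This is how membership in \<open>A \<otimes> U\<close> is exploited.
\<close>

lemma (in comm_superalgebra) base_change_functional_cong:
  assumes I: "finite I" and x: "x \<in> base_change A I U"
    and E: "\<And>u. u \<in> U \<Longrightarrow> (\<Sum>b\<in>I. p b * u b) = (\<Sum>b\<in>I. p' b * u b)"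
  shows "lincomb A I p x = lincomb A I p' x"
proof -
  obtain F c where F: "finite F" "F \<subseteq> U" "c \<in> F \<rightarrow> carrier A" and x: "x = (\<lambda>i\<in>I. lincomb A F (\<lambda>u. u i) c)"
    using x unfolding base_change_iff by blast
  have c: "c u \<in> carrier A" if "u \<in> F" for u using F(3) that by auto
  have "lincomb A I p x = lincomb A F (\<lambda>u. \<Sum>b\<in>I. p b * u b) c" for p
  proof -
    have "lincomb A I p x = lincomb A I p (\<lambda>i. lincomb A F (\<lambda>u. u i) c)"
      by (rule lincomb_cong[OF refl]) (auto simp: x c)
    also have "\<dots> = lincomb A F (\<lambda>u. \<Sum>b\<in>I. p b * u b) c" by (rule lincomb_scalars[OF I F(1) c])
    finally show ?thesis .
  qed
  then show ?thesis using lincomb_cong[of F "\<lambda>u. \<Sum>b\<in>I. p b * u b" "\<lambda>u. \<Sum>b\<in>I. p' b * u b" c c] E F(2) c by auto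
qed

text \<open>
  The coefficients \<open>c u\<close> stand on the right of the matrix entries, in accordance with
  the convention for \<open>A \<otimes> U\<close>.
\<close>

lemma (in comm_superalgebra) base_change_act:
  assumes I: "finite I" and X: "\<And>i j. i \<in> I \<Longrightarrow> j \<in> I \<Longrightarrow> X i j \<in> carrier A"
    and F: "finite F" and c: "\<And>u. u \<in> F \<Longrightarrow> c u \<in> carrier A" and i: "i \<in> I"
  shows "(\<Oplus>j\<in>I. X i j \<otimes> (\<lambda>i\<in>I. lincomb A F (\<lambda>u. u i) c) j) =
    lincomb A F (\<lambda>_. 1) (\<lambda>u. lincomb A I u (X i) \<otimes> c u)"
proof -
  have "(\<Oplus>j\<in>I. X i j \<otimes> (\<lambda>i\<in>I. lincomb A F (\<lambda>u. u i) c) j) =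
      (\<Oplus>j\<in>I. \<Oplus>u\<in>F. u j \<odot> (X i j \<otimes> c u))"
  proof (rule finsum_cong_simple)
    fix j assume j: "j \<in> I"
    have "X i j \<otimes> lincomb A F (\<lambda>u. u j) c = lincomb A F (\<lambda>u. u j) (\<lambda>u. X i j \<otimes> c u)"
      by (rule lincomb_mult_left[OF F c X[OF i j]])
    then show "X i j \<otimes> (\<lambda>i\<in>I. lincomb A F (\<lambda>u. u i) c) j = (\<Oplus>u\<in>F. u j \<odot> (X i j \<otimes> c u))"
      using j by (simp add: lincomb_def)
    show "(\<Oplus>u\<in>F. u j \<odot> (X i j \<otimes> c u)) \<in> carrier A"
      using X[OF i j] c by (intro finsum_closed) (auto simp: smult_closed)
  qed
  also have "\<dots> = (\<Oplus>u\<in>F. \<Oplus>j\<in>I. u j \<odot> (X i j \<otimes> c u))"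
    using X[OF i] c by (intro finsum_swap[OF I F] smult_closed) auto
  also have "\<dots> = (\<Oplus>u\<in>F. 1 \<odot> (lincomb A I u (X i) \<otimes> c u))"
  proof (rule finsum_cong_simple)
    fix u assume u: "u \<in> F"
    have cl: "lincomb A I u (X i) \<otimes> c u \<in> carrier A" using X[OF i] c[OF u] by (intro m_closed lincomb_closed)
    have "lincomb A I u (X i) \<otimes> c u = lincomb A I u (\<lambda>j. X i j \<otimes> c u)"
      by (rule lincomb_mult_right[OF I X[OF i] c[OF u]])
    then show "(\<Oplus>j\<in>I. u j \<odot> (X i j \<otimes> c u)) = 1 \<odot> (lincomb A I u (X i) \<otimes> c u)"
      unfolding smult_one[OF cl] by (simp add: lincomb_def)
    show "1 \<odot> (lincomb A I u (X i) \<otimes> c u) \<in> carrier A" using cl by (rule smult_closed)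
  qed
  finally show ?thesis by (simp only: lincomb_def[of A F])
qed

section \<open>Irreducible constituents of the tensor representation of the supergroup\<close>

definition pairing :: "'i set \<Rightarrow> ('i \<Rightarrow> 'k::field) \<Rightarrow> ('i \<Rightarrow> 'k) \<Rightarrow> 'k" where
  "pairing I p v = (\<Sum>i\<in>I. p i * v i)"

lemma pairing_unit_vec:
  assumes "finite I" "i \<in> I"
  shows "pairing I (unit_vec i) v = v i" "pairing I p (unit_vec i) = p i"
  using assms by (simp_all add: pairing_def unit_vec_def if_distrib if_distribR cong: if_cong)

lemma pairing_row_mult: "finite I \<Longrightarrow> pairing J p (lin_map I J S u) = pairing I (row_mult J p S) u"
  unfolding pairing_def row_mult_def lin_map_def
  by (simp add: sum_distrib_left sum_distrib_right mult.assoc cong: sum.cong) (rule sum.swap)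

lemma row_mult_eq_pairing:
  "finite I \<Longrightarrow> b \<in> I \<Longrightarrow> row_mult J p S b = pairing J p (lin_map I J S (unit_vec b))"
  by (simp only: pairing_row_mult pairing_unit_vec(2))

text \<open>
  The row representing the functional \<open>q \<circ> f\<close> has the values at the unit
  vectors as entries.
\<close>

lemma pairing_pullback:
  assumes I: "finite I" and f: "flinear f" and v: "v \<in> coord_space I"
  shows "pairing I (\<lambda>i. pairing J q (f (unit_vec i))) v = pairing J q (f v)"
proof -
  have "f v = (\<Sum>i\<in>I. fscale (v i) (f (unit_vec i)))"
    by (subst coord_space_expand[OF I v]) (simp only: flinear_simps(2,5)[OF f])
  then have "f v j = (\<Sum>i\<in>I. v i * f (unit_vec i) j)" for j by (simp add: sum_fun_apply fscale_def)
  then have "pairing J q (f v) = (\<Sum>j\<in>J. \<Sum>i\<in>I. q j * (v i * f (unit_vec i) j))"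
    by (simp only: pairing_def sum_distrib_left)
  also have "\<dots> = (\<Sum>i\<in>I. \<Sum>j\<in>J. q j * (v i * f (unit_vec i) j))" by (rule sum.swap)
  also have "\<dots> = pairing I (\<lambda>i. pairing J q (f (unit_vec i))) v"
    unfolding pairing_def sum_distrib_right by (intro sum.cong refl) (simp only: mult.assoc mult.commute mult.left_commute)
  finally show ?thesis by (rule sym)
qed

lemma flinear_id: "flinear (\<lambda>x. x)"
  by (rule flinearI) auto

definition gl_embedding ::
  "nat \<Rightarrow> nat \<Rightarrow> ('k::field, 'u, 'i) gl_rep \<Rightarrow> ('k, 'u, 'j) gl_rep \<Rightarrow> ('j \<Rightarrow> 'i \<Rightarrow> 'k) \<Rightarrow> bool" where
  "gl_embedding m n L W T \<longleftrightarrow> gl_intertwiner m n L W T \<and>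
     inj_on (lin_map (gl_basis L) (gl_basis W) T) (coord_space (gl_basis L))"

locale tensor_setting =
  fixes emb :: "(nat \<Rightarrow> 'k::field_char_0) \<Rightarrow> 'u" and m n r :: nat
  assumes inj_emb: "inj emb"

sublocale tensor_setting \<subseteq> finite_group_rep "sym_group r" "sym_tensor_rep m n r :: (nat \<Rightarrow> nat, 'k, nat list) lin_rep"
  by (rule finite_group_rep_sym_tensor)

context tensor_setting
begin

abbreviation B :: "nat list set" where "B \<equiv> tensor_basis m n r"

abbreviation V :: "(nat list \<Rightarrow> 'k) set" where "V \<equiv> coord_space B"

abbreviation tensors :: "('k, 'u, nat list) gl_rep" where "tensors \<equiv> tensor_rep m n r"

lemma finite_B: "finite B" by (rule finite_tensor_basis)

lemma commutant_closed: "f \<in> commutant \<Longrightarrow> v \<in> V \<Longrightarrow> f v \<in> V"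
  using commutantD(2)[of f v] by simp

text \<open>
  Compare the entries of both sides of \<open>f s = s f\<close> at a pair of permuted basis
  tensors.
\<close>

lemma commutant_matrix:
  assumes f: "f \<in> commutant"
  shows "(\<lambda>I J. f (unit_vec J) I) \<in> equivariant_matrices m n r"
  unfolding equivariant_matrices_def
proof (intro CollectI allI impI ballI)
  fix s I J assume s: "s permutes {1..r}" and I: "I \<in> B" and J: "J \<in> B"
  let ?M = "sym_tensor_rep m n r :: (nat \<Rightarrow> nat, 'k, nat list) lin_rep"
  have "f (rep_op ?M s (unit_vec J)) = rep_op ?M s (f (unit_vec J))"
    by (rule commutantD(3)[OF f]) (use s unit_vec_in[OF J] in \<open>simp_all add: sym_group_carrier\<close>)
  then have "fscale (perm_sign m r s J) (f (unit_vec (perm_list s J))) (perm_list s I) =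
      rep_op ?M s (f (unit_vec J)) (perm_list s I)"
    by (simp only: sym_tensor_op_unit_vec[OF s J] flinear_simps(2)[OF commutantD(1)[OF f]])
  then have "perm_sign m r s J * f (unit_vec (perm_list s J)) (perm_list s I) =
      perm_sign m r s I * f (unit_vec J) I"
    unfolding sym_tensor_op_apply[OF s I] by (simp only: fscale_def)
  then have "perm_sign m r s J * (perm_sign m r s J * f (unit_vec (perm_list s J)) (perm_list s I)) =
      perm_sign m r s J * (perm_sign m r s I * f (unit_vec J) I)" by (rule arg_cong)
  then show "f (unit_vec (perm_list s J)) (perm_list s I) = pair_sign m r s I J * f (unit_vec J) I"
    unfolding mult.assoc[symmetric] perm_sign_square pair_sign_def
    by (simp only: mult_1 mult.commute[of "perm_sign m r s J"])
qed

lemma matrix_commutant: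
  assumes c: "c \<in> equivariant_matrices m n r"
  shows "lin_map B B c \<in> commutant"
proof -
  let ?M = "sym_tensor_rep m n r :: (nat \<Rightarrow> nat, 'k, nat list) lin_rep" and ?f = "lin_map B B c"
  have "?f (rep_op ?M s x) = rep_op ?M s (?f x)" if s: "s permutes {1..r}" and x: "x \<in> V" for s x
  proof (rule flinear_eq_on_coord_space[OF finite_B flinear_compose[OF flinear_lin_map flinear_rep_op]
        flinear_compose[OF flinear_rep_op flinear_lin_map] _ x])
    fix J assume J: "J \<in> B"
    show "?f (rep_op ?M s (unit_vec J)) = rep_op ?M s (?f (unit_vec J))"
    proof
      fix K
      show "?f (rep_op ?M s (unit_vec J)) K = rep_op ?M s (?f (unit_vec J)) K"
      proof (cases "K \<in> B")
        case True
        then obtain I where I: "I \<in> B" "K = perm_list s I"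
          using bij_perm_list[OF s, of m n] by (metis bij_betw_def imageE)
        have sJ: "perm_list s J \<in> B" and sI: "perm_list s I \<in> B" using perm_list_in_basis[OF s] I(1) J by auto
        have "c (perm_list s I) (perm_list s J) = pair_sign m r s I J * c I J"
          using c s I(1) J unfolding equivariant_matrices_def by blast
        then have "perm_sign m r s J * c (perm_list s I) (perm_list s J) =
            (perm_sign m r s J * perm_sign m r s J) * (perm_sign m r s I * c I J)"
          unfolding pair_sign_def by (simp only: mult.assoc mult.commute mult.left_commute)
        then have "perm_sign m r s J * c (perm_list s I) (perm_list s J) = perm_sign m r s I * c I J"
          by (simp only: perm_sign_square mult_1)
        then show ?thesis
          unfolding I(2) sym_tensor_op_apply[OF s I(1)] sym_tensor_op_unit_vec[OF s J]
            flinear_simps(2)[OF flinear_lin_map] lin_map_unit_vec[OF finite_B J] lin_map_unit_vec[OF finite_B sJ]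
          using I(1) sI by (simp add: fscale_def)
      next
        case False
        then show ?thesis
          using lin_map_in[of B B c "rep_op ?M s (unit_vec J)"] rep_op_in[of ?M s "?f (unit_vec J)"]
          by (simp add: coord_space_def)
      qed
    qed
  qed
  then show ?thesis
    unfolding commutant_def using flinear_lin_map lin_map_in by (auto simp: sym_group_carrier)
qed

lemma pairing_matrix:
  "pairing B p (lin_map B B c t) = (\<Sum>(I, J)\<in>tensor_basis2 m n r. (p I * t J) * c I J)"
proof -
  have "pairing B p (lin_map B B c t) = (\<Sum>I\<in>B. \<Sum>J\<in>B. (p I * t J) * c I J)"
    unfolding pairing_def lin_map_def by (auto simp: sum_distrib_left mult_ac intro!: sum.cong)
  then show ?thesis by (simp only: sum.cartesian_product)
qed

lemma commutant_eq_matrix: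
  assumes f: "f \<in> commutant" and v: "v \<in> V"
  shows "f v = lin_map B B (\<lambda>I J. f (unit_vec J) I) v"
  by (rule flinear_eq_lin_map[OF finite_B commutantD(1)[OF f] commutant_closed[OF f unit_vec_in] v])

lemma rep_form_tensors:
  assumes A: "comm_superalgebra A" and g: "g \<in> carrier (End_super {..<m + n} (par_V m) A)"
  shows "rep_form tensors A g p t =
    lincomb A (tensor_basis2 m n r) (\<lambda>(I, J). p I * t J) (\<lambda>(I, J). tensor_coeff m A g I J)"
proof -
  interpret comm_superalgebra A by fact
  note cl = tensor_coeff_closed[OF g]
  have "rep_form tensors A g p t = lincomb A B p (\<lambda>I. lincomb A B t (\<lambda>J. tensor_coeff m A g I J))"
    unfolding rep_form_def tensor_rep_sel(1)
  proof (rule lincomb_cong[OF refl])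
    fix I assume I: "I \<in> B"
    show "lincomb A B t (\<lambda>J. gl_act tensors A g I J) = lincomb A B t (\<lambda>J. tensor_coeff m A g I J)"
      by (rule lincomb_cong[OF refl tensor_rep_sel(3)[OF I] cl[OF I]])
    show "lincomb A B t (\<lambda>J. tensor_coeff m A g I J) \<in> carrier A" by (rule lincomb_closed[OF cl[OF I]])
  qed
  also have "\<dots> = lincomb A (tensor_basis2 m n r) (\<lambda>(I, J). p I * t J) (\<lambda>(I, J). tensor_coeff m A g I J)"
    by (rule lincomb_product[OF finite_B finite_B cl])
  finally show ?thesis .
qed

text \<open>Relations between the entries of the commutant hold for the supergroup.\<close>

lemma tensors_form_eqI:
  assumes eq: "\<And>f. f \<in> commutant \<Longrightarrow> pairing B p (f t) = pairing B p' (f t')"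
    and A: "comm_superalgebra A" and g: "g \<in> carrier (GL m n A)"
  shows "rep_form tensors A g p t = rep_form tensors A g p' t'"
  unfolding rep_form_tensors[OF A comm_superalgebra.GL_even_matrix[OF A g]]
proof (rule comm_superalgebra.tensor_coeff_relations[OF A comm_superalgebra.GL_even_matrix[OF A g]])
  show "of_nat (fact r) \<noteq> (0 :: 'k)" by simp
  fix c :: "nat list \<Rightarrow> nat list \<Rightarrow> 'k" assume "c \<in> equivariant_matrices m n r"
  then have "pairing B p (lin_map B B c t) = pairing B p' (lin_map B B c t')" by (rule eq[OF matrix_commutant])
  then show "(\<Sum>(I, J)\<in>tensor_basis2 m n r. (case (I, J) of (I, J) \<Rightarrow> p I * t J) * c I J) =
      (\<Sum>(I, J)\<in>tensor_basis2 m n r. (case (I, J) of (I, J) \<Rightarrow> p' I * t' J) * c I J)"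
    unfolding pairing_matrix prod.case .
qed

text \<open>Relations that hold for the supergroup over all superalgebras hold for the commutant.\<close>

lemma tensors_form_eqD:
  assumes eq: "\<And>(A :: ('k, 'u) superalgebra) g. comm_superalgebra A \<Longrightarrow> g \<in> carrier (GL m n A) \<Longrightarrow>
      rep_form tensors A g p t = rep_form tensors A g p' t'"
    and f: "f \<in> commutant" and t: "t \<in> V" "t' \<in> V"
  shows "pairing B p (f t) = pairing B p' (f t')"
proof -
  have "(\<Sum>(I, J)\<in>tensor_basis2 m n r. (\<lambda>(I, J). p I * t J) (I, J) * f (unit_vec J) I) =
      (\<Sum>(I, J)\<in>tensor_basis2 m n r. (\<lambda>(I, J). p' I * t' J) (I, J) * f (unit_vec J) I)"
  proof (rule equivariant_relations[OF inj_emb commutant_matrix[OF f]])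
    fix A :: "('k, 'u) superalgebra" and g assume A: "comm_superalgebra A" and g: "g \<in> carrier (GL m n A)"
    show "lincomb A (tensor_basis2 m n r) (\<lambda>(I, J). p I * t J) (\<lambda>(I, J). tensor_coeff m A g I J) =
        lincomb A (tensor_basis2 m n r) (\<lambda>(I, J). p' I * t' J) (\<lambda>(I, J). tensor_coeff m A g I J)"
      using eq[OF A g] unfolding rep_form_tensors[OF A comm_superalgebra.GL_even_matrix[OF A g]] .
  qed
  then show ?thesis
    unfolding commutant_eq_matrix[OF f t(1)] commutant_eq_matrix[OF f t(2)] pairing_matrix prod.case .
qed

text \<open>
  A constituent of the tensor representation, as an embedding together with a left inverse
  \<open>p\<close> of it that is merely linear.
\<close>

definition retract :: "('k, 'u, 'i) gl_rep \<Rightarrow> (nat list \<Rightarrow> 'i \<Rightarrow> 'k) \<Rightarrow> ((nat list \<Rightarrow> 'k) \<Rightarrow> 'i \<Rightarrow> 'k) \<Rightarrow> bool" where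
  "retract L T p \<longleftrightarrow> has_matrix_entries m n L \<and> gl_intertwiner m n L tensors T \<and> flinear p \<and>
     (\<forall>x. p x \<in> coord_space (gl_basis L)) \<and>
     (\<forall>u\<in>coord_space (gl_basis L). p (lin_map (gl_basis L) B T u) = u)"

lemma retractD:
  assumes "retract L T p"
  shows "has_matrix_entries m n L" "gl_intertwiner m n L tensors T" "flinear p"
    "p x \<in> coord_space (gl_basis L)"
    "u \<in> coord_space (gl_basis L) \<Longrightarrow> p (lin_map (gl_basis L) B T u) = u"
    "finite (gl_basis L)"
  using assms has_matrix_entriesD(1)[of m n L] by (auto simp: retract_def)

lemma exists_retract:
  assumes L: "has_matrix_entries m n L" and T: "gl_embedding m n L tensors T"
  obtains p where "retract L T p"
proof -
  have inj: "inj_on (lin_map (gl_basis L) B T) (coord_space (gl_basis L))" and i: "gl_intertwiner m n L tensors T"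
    using T by (simp_all add: gl_embedding_def)
  obtain p where "flinear p" "\<And>x. p x \<in> coord_space (gl_basis L)"
    "\<And>u. u \<in> coord_space (gl_basis L) \<Longrightarrow> p (lin_map (gl_basis L) B T u) = u"
    using flinear_left_inverse[OF flinear_lin_map subspace_coord_space inj] by blast
  then show thesis using that[of p] L i by (simp add: retract_def)
qed

text \<open>In operator form this says that the action on \<open>L\<close> is \<open>p \<rho>(g) T\<close>.\<close>

lemma rep_form_pullback:
  assumes R: "retract L T p" and A: "comm_superalgebra A" and g: "g \<in> carrier (GL m n A)"
  shows "rep_form L A g q u =
    rep_form tensors A g (\<lambda>I. pairing (gl_basis L) q (p (unit_vec I))) (lin_map (gl_basis L) B T u)"
proof -
  let ?K = "gl_basis L"
  note L = retractD(1)[OF R] and fin = retractD(6)[OF R]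
  have "rep_form tensors A g (\<lambda>I. pairing ?K q (p (unit_vec I))) (lin_map ?K B T u) =
      rep_form L A g (row_mult B (\<lambda>I. pairing ?K q (p (unit_vec I))) T) u"
    using intertwiner_rep_form[OF L tensor_rep_has_matrix_entries retractD(2)[OF R] A g] by simp
  also have "\<dots> = rep_form L A g q u"
  proof (rule rep_form_cong[OF L A g _ refl])
    fix b assume b: "b \<in> ?K"
    have "row_mult B (\<lambda>I. pairing ?K q (p (unit_vec I))) T b =
        pairing B (\<lambda>I. pairing ?K q (p (unit_vec I))) (lin_map ?K B T (unit_vec b))"
      by (rule row_mult_eq_pairing[OF fin b])
    also have "\<dots> = pairing ?K q (p (lin_map ?K B T (unit_vec b)))"
      by (rule pairing_pullback[OF finite_B retractD(3)[OF R] lin_map_in])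
    also have "\<dots> = q b"
      unfolding retractD(5)[OF R unit_vec_in[OF b]] by (rule pairing_unit_vec(2)[OF fin b])
    finally show "row_mult B (\<lambda>I. pairing ?K q (p (unit_vec I))) T b = q b" .
  qed
  finally show ?thesis by (rule sym)
qed

text \<open>
  The commutant acts on \<open>L\<close> by \<open>p f T\<close>; together with its converse below
  this transfers relations between matrix entries from the tensor space to its constituents.
\<close>

lemma rep_form_eqI:
  assumes R: "retract L T p" and R': "retract L' T' p'"
    and A: "comm_superalgebra A" and g: "g \<in> carrier (GL m n A)"
    and eq: "\<And>f. f \<in> commutant \<Longrightarrow>
      pairing (gl_basis L) q (p (f (lin_map (gl_basis L) B T u))) =
      pairing (gl_basis L') q' (p' (f (lin_map (gl_basis L') B T' u')))"
  shows "rep_form L A g q u = rep_form L' A g q' u'"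
  unfolding rep_form_pullback[OF R A g] rep_form_pullback[OF R' A g]
proof (rule tensors_form_eqI[OF _ A g])
  fix f assume f: "f \<in> commutant"
  show "pairing B (\<lambda>I. pairing (gl_basis L) q (p (unit_vec I))) (f (lin_map (gl_basis L) B T u)) =
      pairing B (\<lambda>I. pairing (gl_basis L') q' (p' (unit_vec I))) (f (lin_map (gl_basis L') B T' u'))"
    unfolding pairing_pullback[OF finite_B retractD(3)[OF R] commutant_closed[OF f lin_map_in]]
      pairing_pullback[OF finite_B retractD(3)[OF R'] commutant_closed[OF f lin_map_in]]
    by (rule eq[OF f])
qed

lemma rep_form_eqD:
  assumes R: "retract L T p" and f: "f \<in> commutant"
    and eq: "\<And>(A :: ('k, 'u) superalgebra) g. comm_superalgebra A \<Longrightarrow> g \<in> carrier (GL m n A) \<Longrightarrow>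
      rep_form L A g q u = rep_form L A g q' u'"
  shows "pairing (gl_basis L) q (p (f (lin_map (gl_basis L) B T u))) =
    pairing (gl_basis L) q' (p (f (lin_map (gl_basis L) B T u')))"
proof -
  have "pairing B (\<lambda>I. pairing (gl_basis L) q (p (unit_vec I))) (f (lin_map (gl_basis L) B T u)) =
      pairing B (\<lambda>I. pairing (gl_basis L) q' (p (unit_vec I))) (f (lin_map (gl_basis L) B T u'))"
  proof (rule tensors_form_eqD[OF _ f lin_map_in lin_map_in])
    fix A :: "('k, 'u) superalgebra" and g assume A: "comm_superalgebra A" and g: "g \<in> carrier (GL m n A)"
    show "rep_form tensors A g (\<lambda>I. pairing (gl_basis L) q (p (unit_vec I))) (lin_map (gl_basis L) B T u) =
        rep_form tensors A g (\<lambda>I. pairing (gl_basis L) q' (p (unit_vec I))) (lin_map (gl_basis L) B T u')"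
      unfolding rep_form_pullback[OF R A g, symmetric] by (rule eq[OF A g])
  qed
  then show ?thesis
    unfolding pairing_pullback[OF finite_B retractD(3)[OF R] commutant_closed[OF f lin_map_in]] .
qed

text \<open>
  If two intertwiners agree after composition with linear maps \<open>h\<close> and
  \<open>h'\<close>, then the entries of \<open>h \<rho>(g) T\<close> and \<open>h' \<rho>(g)
  T'\<close> agree, and this relation passes to the commutant.
\<close>

lemma intertwiner_transport:
  fixes L :: "('k, 'u, 'i) gl_rep"
  assumes L: "has_matrix_entries m n L"
    and T: "gl_intertwiner m n L tensors T" and T': "gl_intertwiner m n L tensors T'"
    and h: "flinear h" "flinear h'"
    and eq: "\<And>u. u \<in> coord_space (gl_basis L) \<Longrightarrow>
      h (lin_map (gl_basis L) B T u) = h' (lin_map (gl_basis L) B T' u)"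
    and f: "f \<in> commutant"
  shows "h (f (lin_map (gl_basis L) B T u)) = h' (f (lin_map (gl_basis L) B T' u))"
proof
  fix a
  let ?K = "gl_basis L"
  note fin = has_matrix_entriesD(1)[OF L]
  define p where "p = (\<lambda>I. pairing {a} (\<lambda>_. 1) (h (unit_vec I)))"
  define p' where "p' = (\<lambda>I. pairing {a} (\<lambda>_. 1) (h' (unit_vec I)))"
  have p: "pairing B p v = h v a" "pairing B p' v = h' v a" if "v \<in> V" for v
    unfolding p_def p'_def pairing_pullback[OF finite_B h(1) that] pairing_pullback[OF finite_B h(2) that]
    by (simp_all add: pairing_def)
  have "pairing B p (f (lin_map ?K B T u)) = pairing B p' (f (lin_map ?K B T' u))"
  proof (rule tensors_form_eqD[OF _ f lin_map_in lin_map_in])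
    fix A :: "('k, 'u) superalgebra" and g assume A: "comm_superalgebra A" and g: "g \<in> carrier (GL m n A)"
    have "rep_form L A g (row_mult B p T) u = rep_form L A g (row_mult B p' T') u"
    proof (rule rep_form_cong[OF L A g _ refl])
      fix b assume b: "b \<in> ?K"
      show "row_mult B p T b = row_mult B p' T' b"
        by (simp only: row_mult_eq_pairing[OF fin b] p lin_map_in eq[OF unit_vec_in[OF b]])
    qed
    then show "rep_form tensors A g p (lin_map ?K B T u) = rep_form tensors A g p' (lin_map ?K B T' u)"
      using intertwiner_rep_form[OF L tensor_rep_has_matrix_entries T A g, of p u]
        intertwiner_rep_form[OF L tensor_rep_has_matrix_entries T' A g, of p' u] by simp
  qed
  then show "h (f (lin_map ?K B T u)) a = h' (f (lin_map ?K B T' u)) a"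
    by (simp only: p commutant_closed[OF f lin_map_in])
qed

text \<open>
  Although \<open>p\<close> is only linear, the image of the embedding is stable under the
  supergroup, hence under the commutant.
\<close>

lemma retract_image:
  assumes R: "retract L T p" and f: "f \<in> commutant"
  shows "lin_map (gl_basis L) B T (p (f (lin_map (gl_basis L) B T u))) = f (lin_map (gl_basis L) B T u)"
  by (rule intertwiner_transport[OF retractD(1)[OF R] retractD(2)[OF R] retractD(2)[OF R]
        flinear_compose[OF flinear_lin_map retractD(3)[OF R]] flinear_id _ f])
    (simp only: retractD(5)[OF R])

text \<open>Permuting the factors of a basis tensor does not change its parity.\<close>

lemma parity_part_commutant: "parity_part (tensor_par m) q \<in> commutant"
  unfolding commutant_def
proof (intro CollectI conjI ballI subsetI)
  show "flinear (parity_part (tensor_par m) q)" by (rule flinear_parity_part)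
  let ?M = "sym_tensor_rep m n r :: (nat \<Rightarrow> nat, 'k, nat list) lin_rep"
  show "y \<in> coord_space (lr_basis ?M)" if "y \<in> parity_part (tensor_par m) q ` coord_space (lr_basis ?M)" for y
    using that parity_part_in by auto
  fix s x assume "s \<in> carrier (sym_group r)"
  then have s: "s permutes {1..r}" by (simp add: sym_group_carrier)
  show "parity_part (tensor_par m) q (rep_op ?M s x) = rep_op ?M s (parity_part (tensor_par m) q x)"
  proof
    fix K
    show "parity_part (tensor_par m) q (rep_op ?M s x) K = rep_op ?M s (parity_part (tensor_par m) q x) K"
    proof (cases "K \<in> B")
      case True
      then obtain I where I: "I \<in> B" "K = perm_list s I"
        using bij_perm_list[OF s, of m n] by (metis bij_betw_def imageE)
      show ?thesis
        unfolding I(2) sym_tensor_op_apply[OF s I(1)] parity_part_def tensor_par_perm_list[OF s tensor_basisD[OF I(1)]]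
        by simp
    next
      case False
      then show ?thesis
        using rep_op_in[of ?M s x] rep_op_in[of ?M s "parity_part (tensor_par m) q x"]
        by (simp add: coord_space_def parity_part_def)
    qed
  qed
qed

lemma image_invariant:
  assumes R: "retract L T p"
  shows "invariant commutant (lin_map (gl_basis L) B T ` coord_space (gl_basis L))"
  unfolding invariant_def
proof (intro conjI ballI)
  let ?f = "lin_map (gl_basis L) B T" and ?U = "lin_map (gl_basis L) B T ` coord_space (gl_basis L)"
  show "fs.subspace ?U" by (rule fsp.linear_subspace_image[OF flinear_lin_map subspace_coord_space])
  show "?U \<subseteq> coord_space (lr_basis (sym_tensor_rep m n r))" using lin_map_in by auto
  fix c x assume c: "c \<in> commutant" and "x \<in> ?U"
  then obtain u where u: "x = ?f u" by blast
  show "c x \<in> ?U" unfolding u by (subst retract_image[OF R c, symmetric]) (rule imageI[OF retractD(4)[OF R]])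
qed

lemma subspace_projection:
  assumes "fs.subspace W"
  obtains e where "flinear e" "\<And>x. e x \<in> W" "\<And>w. w \<in> W \<Longrightarrow> e w = w"
  using flinear_left_inverse[OF flinear_id assms] by (auto simp: inj_on_def)

text \<open>
  Stability of a subspace \<open>W\<close> is expressed by matrix entries through a scalar matrix
  \<open>E\<close> that is a projection onto \<open>W\<close>: the rows of \<open>E - 1\<close>
  annihilate the action on \<open>W\<close>. This is a relation for the commutant, hence for the
  supergroup. The parity condition follows from the parity projections in the commutant.
\<close>

lemma subrep_of_invariant:
  fixes L :: "('k, 'u, nat) gl_rep"
  assumes R: "retract L T p" and N: "invariant commutant N" "N \<subseteq> lin_map (gl_basis L) B T ` coord_space (gl_basis L)"
  shows "is_gl_subrep m n L {w \<in> coord_space (gl_basis L). lin_map (gl_basis L) B T w \<in> N}"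
    (is "is_gl_subrep m n L ?W")
proof -
  let ?K = "gl_basis L" and ?f = "lin_map (gl_basis L) B T"
  note L = retractD(1)[OF R] and fin = retractD(6)[OF R] and S = invariantD(1)[OF N(1)]
  have W: "fs.subspace ?W"
    by (rule fs.subspaceI) (auto simp: flinear_simps[OF flinear_lin_map] zero_in_coord_space
        fs.subspace_0[OF S] fs.subspace_add[OF S] fs.subspace_scale[OF S]
        fs.subspace_add[OF subspace_coord_space] fs.subspace_scale[OF subspace_coord_space])
  have par: "parity_part (gl_par L) q w \<in> ?W" if w: "w \<in> ?W" for q w
  proof -
    have "?f (parity_part (gl_par L) q w) = parity_part (tensor_par m) q (?f w)"
      using even_matrix_parity_part[OF intertwiner_even[OF retractD(2)[OF R]]] by simp
    moreover have "parity_part (tensor_par m) q (?f w) \<in> N"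
      by (rule invariantD(3)[OF N(1) parity_part_commutant]) (use w in simp)
    ultimately show ?thesis using w parity_part_in by auto
  qed
  have stable: "p (c (?f w)) \<in> ?W" if "c \<in> commutant" "w \<in> ?W" for c w
  proof -
    have "c (?f w) \<in> N" by (rule invariantD(3)[OF N(1) that(1)]) (use that(2) in simp)
    then have "?f (p (c (?f w))) \<in> N" unfolding retract_image[OF R that(1)] .
    then show ?thesis using retractD(4)[OF R] by blast
  qed
  have sub: "?W \<subseteq> coord_space ?K" by blast
  obtain d :: nat and e :: "nat \<Rightarrow> nat \<Rightarrow> 'k"
    where e: "\<And>l. l < d \<Longrightarrow> e l \<in> ?W" "inj_on e {..<d}"
    "inj_on (lin_map {..<d} ?K (\<lambda>i j. e j i)) (coord_space {..<d})"
    "lin_map {..<d} ?K (\<lambda>i j. e j i) ` coord_space {..<d} = ?W"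
    by (rule subspace_enumerated_basis[OF fin W sub subset_refl fs.span_superset]) (rule that; assumption)
  let ?e = "lin_map {..<d} ?K (\<lambda>i j. e j i)"
  obtain P where P: "\<And>u. u \<in> coord_space {..<d} \<Longrightarrow> lin_map ?K {..<d} P (?e u) = u"
    using lin_map_left_inverse[OF finite_lessThan fin e(3)] by blast
  define E where "E i b = (\<Sum>l<d. e l i * P l b)" for i b
  have E: "pairing ?K (E i) w = w i" if w: "w \<in> ?W" and i: "i \<in> ?K" for w i
  proof -
    obtain u where u: "u \<in> coord_space {..<d}" "w = ?e u" using w e(4) by blast
    have "pairing ?K (E i) w = lin_map ?K ?K E w i" using i by (simp add: pairing_def lin_map_def)
    also have "\<dots> = ?e (lin_map ?K {..<d} P w) i"
      unfolding lin_map_compose[OF finite_lessThan] E_def[abs_def] ..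
    also have "\<dots> = w i" unfolding u(2) P[OF u(1)] ..
    finally show ?thesis .
  qed
  show ?thesis
    unfolding is_gl_subrep_def is_super_subspace_def is_subspace_iff
  proof (intro conjI allI impI ballI)
    show "fs.subspace ?W" by (rule W)
    show "?W \<subseteq> coord_space ?K" by blast
    show "(\<lambda>i. if gl_par L i = q then w i else 0) \<in> ?W" if "w \<in> ?W" for w q
      using par[OF that] unfolding parity_part_def .
    fix A :: "('k, 'u) superalgebra" and g x
    assume A: "comm_superalgebra A" and g: "g \<in> carrier (GL m n A)" and x: "x \<in> base_change A ?K ?W"
    interpret A: comm_superalgebra A by fact
    note cl = has_matrix_entriesD(2)[OF L A g]
    obtain F c where F: "finite F" "F \<subseteq> ?W" "c \<in> F \<rightarrow> carrier A" and xF: "x = (\<lambda>i\<in>?K. lincomb A F (\<lambda>u. u i) c)"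
      using x unfolding A.base_change_iff by blast
    have c: "c u \<in> carrier A" if "u \<in> F" for u by (rule funcset_mem[OF F(3) that])
    define y where "y i = lincomb A F (\<lambda>_. 1) (\<lambda>u. lincomb A ?K u (gl_act L A g i) \<otimes>\<^bsub>A\<^esub> c u)" for i
    have act: "(\<Oplus>\<^bsub>A\<^esub>j\<in>?K. gl_act L A g i j \<otimes>\<^bsub>A\<^esub> x j) = y i" if "i \<in> ?K" for i
      unfolding xF y_def by (rule A.base_change_act[OF fin cl F(1) c that])
    have Lu: "lincomb A ?K u (gl_act L A g i) \<in> carrier A" if "i \<in> ?K" for i u
      by (rule A.lincomb_closed[OF cl[OF that]])
    have Luc: "lincomb A ?K u (gl_act L A g i) \<otimes>\<^bsub>A\<^esub> c u \<in> carrier A" if "i \<in> ?K" "u \<in> F" for i u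
      by (rule A.m_closed[OF Lu[OF that(1)] c[OF that(2)]])
    have ycl: "y i \<in> carrier A" if "i \<in> ?K" for i
      unfolding y_def by (rule A.lincomb_closed[OF Luc[OF that]])
    have fixed: "lincomb A ?K u (gl_act L A g i) = lincomb A ?K (E i) (\<lambda>b. lincomb A ?K u (gl_act L A g b))"
      if i: "i \<in> ?K" and u: "u \<in> F" for i u
    proof -
      have "rep_form L A g (unit_vec i) u = rep_form L A g (E i) u"
      proof (rule rep_form_eqI[OF R R A g])
        fix h assume h: "h \<in> commutant"
        have uW: "u \<in> ?W" using F(2) u by blast
        show "pairing ?K (unit_vec i) (p (h (?f u))) = pairing ?K (E i) (p (h (?f u)))"
          unfolding E[OF stable[OF h uW] i] by (rule pairing_unit_vec(1)[OF fin i])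
      qed
      then show ?thesis unfolding rep_form_unit(1)[OF L A g i] unfolding rep_form_def .
    qed
    have "y i = lincomb A {..<d} (\<lambda>l. e l i) (\<lambda>l. lincomb A ?K (P l) y)" if i: "i \<in> ?K" for i
    proof -
      have "y i = lincomb A F (\<lambda>_. 1) (\<lambda>u. lincomb A ?K (E i) (\<lambda>b. lincomb A ?K u (gl_act L A g b) \<otimes>\<^bsub>A\<^esub> c u))"
        unfolding y_def
      proof (rule A.lincomb_cong[OF refl])
        fix u assume u: "u \<in> F"
        show "lincomb A ?K u (gl_act L A g i) \<otimes>\<^bsub>A\<^esub> c u =
            lincomb A ?K (E i) (\<lambda>b. lincomb A ?K u (gl_act L A g b) \<otimes>\<^bsub>A\<^esub> c u)"
          unfolding fixed[OF i u] by (rule A.lincomb_mult_right[OF fin Lu c[OF u]])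
        show "lincomb A ?K (E i) (\<lambda>b. lincomb A ?K u (gl_act L A g b) \<otimes>\<^bsub>A\<^esub> c u) \<in> carrier A"
          by (rule A.lincomb_closed[OF Luc[OF _ u]])
      qed
      also have "\<dots> = lincomb A ?K (E i) y"
        unfolding y_def by (rule A.lincomb_swap[OF F(1) fin Luc])
      also have "\<dots> = lincomb A {..<d} (\<lambda>l. e l i) (\<lambda>l. lincomb A ?K (P l) y)"
        unfolding E_def[abs_def] by (rule A.lincomb_scalars[OF finite_lessThan fin ycl, symmetric])
      finally show ?thesis .
    qed
    then have "(\<lambda>i\<in>?K. \<Oplus>\<^bsub>A\<^esub>j\<in>?K. gl_act L A g i j \<otimes>\<^bsub>A\<^esub> x j) =
        (\<lambda>i\<in>?K. lincomb A {..<d} (\<lambda>l. e l i) (\<lambda>l. lincomb A ?K (P l) y))"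
      by (intro restrict_ext) (simp only: act)
    also have "\<dots> \<in> base_change A ?K ?W"
      by (rule A.base_changeI[OF e(1,2) A.lincomb_closed[OF ycl]])
    finally show "(\<lambda>i\<in>?K. \<Oplus>\<^bsub>A\<^esub>j\<in>?K. gl_act L A g i j \<otimes>\<^bsub>A\<^esub> x j) \<in> base_change A ?K ?W" .
  qed
qed

text \<open>
  The converse transfer, with the projection \<open>e\<close> onto \<open>W\<close> in the role of
  \<open>E\<close>. Membership in \<open>A \<otimes> W\<close> makes the rows of \<open>e -
  1\<close> annihilate \<open>\<rho>(g) w\<close>.
\<close>

lemma invariant_of_subrep:
  assumes R: "retract L T p" and W: "is_gl_subrep m n L W"
  shows "invariant commutant (lin_map (gl_basis L) B T ` W)"
proof -
  let ?K = "gl_basis L" and ?f = "lin_map (gl_basis L) B T"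
  note L = retractD(1)[OF R] and fin = retractD(6)[OF R]
  have S: "fs.subspace W" and sub: "W \<subseteq> coord_space ?K"
    using W by (auto simp: is_gl_subrep_def is_super_subspace_def is_subspace_iff)
  obtain e where e: "flinear e" "\<And>x. e x \<in> W" "\<And>w. w \<in> W \<Longrightarrow> e w = w"
    using subspace_projection[OF S] by blast
  have stable: "p (h (?f w)) \<in> W" if h: "h \<in> commutant" and w: "w \<in> W" for h w
  proof -
    let ?x = "p (h (?f w))"
    have xK: "?x \<in> coord_space ?K" by (rule retractD(4)[OF R])
    have "e ?x i = ?x i" if i: "i \<in> ?K" for i
    proof -
      let ?E = "\<lambda>b. pairing {i} (\<lambda>_. 1) (e (unit_vec b))"
      have E: "pairing ?K ?E v = e v i" if "v \<in> coord_space ?K" for v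
        unfolding pairing_pullback[OF fin e(1) that] by (simp add: pairing_def)
      have "pairing ?K ?E ?x = pairing ?K (unit_vec i) ?x"
      proof (rule rep_form_eqD[OF R h])
        fix A :: "('k, 'u) superalgebra" and g assume A: "comm_superalgebra A" and g: "g \<in> carrier (GL m n A)"
        interpret A: comm_superalgebra A by fact
        note cl = has_matrix_entriesD(2)[OF L A g]
        have Lw: "lincomb A ?K w (gl_act L A g b) \<in> carrier A" if "b \<in> ?K" for b
          by (rule A.lincomb_closed[OF cl[OF that]])
        \<comment> \<open>the vector \<open>1 \<otimes> w\<close> of \<open>A \<otimes> W\<close>\<close>
        let ?x1 = "\<lambda>i\<in>?K. lincomb A {w} (\<lambda>u. u i) (\<lambda>_. \<one>\<^bsub>A\<^esub>)"
        have "?x1 \<in> base_change A ?K W"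
          unfolding A.base_change_iff by (rule exI[of _ "{w}"], rule exI[of _ "\<lambda>_. \<one>\<^bsub>A\<^esub>"]) (use w in auto)
        then have "(\<lambda>i\<in>?K. \<Oplus>\<^bsub>A\<^esub>j\<in>?K. gl_act L A g i j \<otimes>\<^bsub>A\<^esub> ?x1 j) \<in> base_change A ?K W"
          using W A g unfolding is_gl_subrep_def by blast
        moreover have "(\<Oplus>\<^bsub>A\<^esub>j\<in>?K. gl_act L A g b j \<otimes>\<^bsub>A\<^esub> ?x1 j) = lincomb A ?K w (gl_act L A g b)" if b: "b \<in> ?K" for b
        proof -
          have "(\<Oplus>\<^bsub>A\<^esub>j\<in>?K. gl_act L A g b j \<otimes>\<^bsub>A\<^esub> ?x1 j) =
              lincomb A {w} (\<lambda>_. 1) (\<lambda>u. lincomb A ?K u (gl_act L A g b) \<otimes>\<^bsub>A\<^esub> \<one>\<^bsub>A\<^esub>)"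
            by (rule A.base_change_act[OF fin cl finite.insertI[OF finite.emptyI] A.one_closed b])
          also have "\<dots> = lincomb A ?K w (gl_act L A g b)"
            unfolding lincomb_def[of A "{w}"] using Lw[OF b] by (simp add: A.smult_one)
          finally show ?thesis .
        qed
        ultimately have y: "(\<lambda>i\<in>?K. lincomb A ?K w (gl_act L A g i)) \<in> base_change A ?K W"
          by (simp cong: restrict_cong)
        have "lincomb A ?K ?E (\<lambda>i\<in>?K. lincomb A ?K w (gl_act L A g i)) =
            lincomb A ?K (unit_vec i) (\<lambda>i\<in>?K. lincomb A ?K w (gl_act L A g i))"
        proof (rule A.base_change_functional_cong[OF fin y])
          fix u assume u: "u \<in> W"
          then have uK: "u \<in> coord_space ?K" using sub by blast
          show "(\<Sum>b\<in>?K. ?E b * u b) = (\<Sum>b\<in>?K. unit_vec i b * u b)"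
            using E[OF uK] e(3)[OF u] pairing_unit_vec(1)[OF fin i, of u] by (simp only: pairing_def)
        qed
        moreover have "lincomb A ?K q (\<lambda>i\<in>?K. lincomb A ?K w (gl_act L A g i)) = rep_form L A g q w" for q
          unfolding rep_form_def by (rule A.lincomb_cong[OF refl _ Lw]) simp_all
        ultimately show "rep_form L A g ?E w = rep_form L A g (unit_vec i) w" by (simp only:)
      qed
      then show ?thesis unfolding E[OF xK] pairing_unit_vec(1)[OF fin i] .
    qed
    moreover have "e ?x i = ?x i" if "i \<notin> ?K" for i
      using that xK subsetD[OF sub e(2)[of ?x]] by (simp add: coord_space_def)
    ultimately have "e ?x i = ?x i" for i by (cases "i \<in> ?K") simp_all
    then have "e ?x = ?x" by (rule ext)
    then show ?thesis using e(2)[of ?x] by simp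
  qed
  then have "h (?f w) \<in> ?f ` W" if "h \<in> commutant" "w \<in> W" for h w
    by (subst retract_image[OF R that(1), of w, symmetric]) (rule imageI[OF stable[OF that]])
  then show ?thesis
    unfolding invariant_def using fsp.linear_subspace_image[OF flinear_lin_map S] lin_map_in by auto
qed

text \<open>
  By the two preceding lemmas, taking images and preimages under the embedding matches
  subrepresentations with subspaces that are invariant under the commutant.
\<close>

lemma irreducible_iff_simple_image:
  fixes L :: "('k, 'u, nat) gl_rep"
  assumes L: "is_gl_rep m n L" and R: "retract L T p"
  shows "irreducible_gl_rep m n L \<longleftrightarrow>
    simple commutant (lin_map (gl_basis L) B T ` coord_space (gl_basis L))"
proof -
  let ?K = "gl_basis L" and ?f = "lin_map (gl_basis L) B T" and ?U = "lin_map (gl_basis L) B T ` coord_space (gl_basis L)"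
  have f0: "?f ` {0} = {0}" using flinear_simps(3)[OF flinear_lin_map] by simp
  have pf: "p ` ?f ` X = X" if "X \<subseteq> coord_space ?K" for X
  proof -
    have "p (?f u) = u" if "u \<in> X" for u using retractD(5)[OF R] that \<open>X \<subseteq> coord_space ?K\<close> by blast
    then show ?thesis by (simp add: image_image)
  qed
  have inv: "invariant commutant ?U" by (rule image_invariant[OF R])
  have nonzero: "?K = {} \<longleftrightarrow> ?U = {0}"
  proof
    assume "?K = {}"
    then have "coord_space ?K = {0 :: nat \<Rightarrow> 'k}" by (auto simp: coord_space_def)
    then show "?U = {0}" using f0 by simp
  next
    assume U: "?U = {0}"
    show "?K = {}"
    proof (rule ccontr)
      assume "?K \<noteq> {}"
      then obtain i where i: "i \<in> ?K" by blast
      have "?f (unit_vec i) = 0" using U unit_vec_in[OF i] by blast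
      then have "(unit_vec i :: nat \<Rightarrow> 'k) = p 0" using retractD(5)[OF R unit_vec_in[OF i]] by simp
      then have "(unit_vec i :: nat \<Rightarrow> 'k) i = 0" using flinear_simps(3)[OF retractD(3)[OF R]] by simp
      then show False by (simp add: unit_vec_def)
    qed
  qed
  show ?thesis
  proof
    assume irr: "irreducible_gl_rep m n L"
    have "N = {0} \<or> N = ?U" if N: "N \<subseteq> ?U" "invariant commutant N" for N
    proof -
      let ?W = "{w \<in> coord_space ?K. ?f w \<in> N}"
      have "?W = {0} \<or> ?W = coord_space ?K"
        using subrep_of_invariant[OF R N(2,1)] irr unfolding irreducible_gl_rep_def zero_fun_def by blast
      moreover have "N = ?f ` ?W" using N(1) by blast
      ultimately show ?thesis using f0 by (elim disjE) simp_all
    qed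
    moreover have "?U \<noteq> {0}" using nonzero irr by (simp add: irreducible_gl_rep_def)
    ultimately show "simple commutant ?U" unfolding simple_def using inv by blast
  next
    assume U: "simple commutant ?U"
    have "W = {\<lambda>_. 0} \<or> W = coord_space ?K" if W: "is_gl_subrep m n L W" for W
    proof -
      have sub: "W \<subseteq> coord_space ?K" using W by (auto simp: is_gl_subrep_def is_super_subspace_def is_subspace_iff)
      then have "?f ` W = {0} \<or> ?f ` W = ?U"
        using simpleD(3)[OF U invariant_of_subrep[OF R W]] by blast
      then have "p ` ?f ` W = p ` {0} \<or> p ` ?f ` W = p ` ?U" by (elim disjE) simp_all
      moreover have "p ` {0} = {\<lambda>_. 0}" using flinear_simps(3)[OF retractD(3)[OF R]] by (simp add: zero_fun_def)
      ultimately show ?thesis unfolding pf[OF sub] pf[OF subset_refl] by simp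
    qed
    then show "irreducible_gl_rep m n L"
      unfolding irreducible_gl_rep_def using L nonzero simpleD(2)[OF U] by blast
  qed
qed

end

section \<open>Representations of the supergroup on subspaces invariant under the commutant\<close>

lemma (in comm_superalgebra) even_matrices_mult:
  assumes g: "g \<in> even_matrices m n" and h: "h \<in> even_matrices m n"
  shows "g \<otimes>\<^bsub>End_super {..<m + n} (par_V m) A\<^esub> h \<in> even_matrices m n"
proof -
  have "(\<lambda>i\<in>{..<m + n}. \<lambda>j\<in>{..<m + n}. \<Oplus>l\<in>{..<m + n}. g i l \<otimes> h l j) \<in> even_matrices m n"
  proof (rule End_superI, rule finsum_in_grade)
    fix i j l assume "i \<in> {..<m + n}" "j \<in> {..<m + n}" "l \<in> {..<m + n}"
    then have "g i l \<otimes> h l j \<in> grade A ((par_V m i + par_V m l) + (par_V m l + par_V m j))"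
      by (intro grade_mult even_matrix_entry[OF g] even_matrix_entry[OF h]) auto
    also have "(par_V m i + par_V m l) + (par_V m l + par_V m j) = par_V m i + par_V m j"
      by (cases "par_V m i = 0"; cases "par_V m l = 0"; cases "par_V m j = 0") simp_all
    finally show "g i l \<otimes> h l j \<in> grade A (par_V m i + par_V m j)" .
  qed
  then show ?thesis by (simp add: End_super_def)
qed

lemma (in comm_superalgebra) finsum_eq_lincomb:
  "(\<And>z. z \<in> Z \<Longrightarrow> X z \<in> carrier A) \<Longrightarrow> (\<Oplus>z\<in>Z. X z) = lincomb A Z (\<lambda>_. 1) X"
  unfolding lincomb_def by (rule finsum_cong_simple) (auto simp: smult_one)

lemma map_matrix_even:
  assumes A: "comm_superalgebra A" and \<phi>: "\<phi> \<in> superalgebra_hom A A'"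
    and g: "g \<in> carrier (End_super I p A)"
  shows "map_matrix I \<phi> g \<in> carrier (End_super I p A')"
  unfolding map_matrix_def
proof (rule End_superI)
  fix i j assume "i \<in> I" "j \<in> I"
  then have "g i j \<in> grade A (p i + p j)" by (rule End_super_entry[OF g])
  then show "\<phi> (g i j) \<in> grade A' (p i + p j)" using \<phi> unfolding superalgebra_hom_def by blast
qed

context tensor_setting
begin

lemma tensors_form_swap:
  assumes A: "comm_superalgebra A" and g: "g \<in> carrier (End_super {..<m + n} (par_V m) A)"
  shows "rep_form tensors A g p t = lincomb A B p (\<lambda>I. lincomb A B t (\<lambda>J. tensor_coeff m A g I J))"
    "rep_form tensors A g p t = lincomb A B t (\<lambda>J. lincomb A B p (\<lambda>I. tensor_coeff m A g I J))"
proof -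
  interpret comm_superalgebra A by fact
  note cl = tensor_coeff_closed[OF g]
  show 1: "rep_form tensors A g p t = lincomb A B p (\<lambda>I. lincomb A B t (\<lambda>J. tensor_coeff m A g I J))"
    unfolding rep_form_tensors[OF A g] by (rule lincomb_product[OF finite_B finite_B cl, symmetric])
  show "rep_form tensors A g p t = lincomb A B t (\<lambda>J. lincomb A B p (\<lambda>I. tensor_coeff m A g I J))"
    unfolding 1 by (rule lincomb_swap[OF finite_B finite_B cl])
qed

lemma tensors_form_closed:
  assumes A: "comm_superalgebra A" and g: "g \<in> carrier (End_super {..<m + n} (par_V m) A)"
  shows "rep_form tensors A g p t \<in> carrier A"
  unfolding rep_form_tensors[OF A g]
  by (intro comm_superalgebra.lincomb_closed[OF A])
    (auto intro: comm_superalgebra.tensor_coeff_closed[OF A g])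

text \<open>Rows and columns that are homogeneous give homogeneous matrix entries.\<close>

lemma tensors_form_grade:
  assumes A: "comm_superalgebra A" and g: "g \<in> carrier (End_super {..<m + n} (par_V m) A)"
    and p: "\<And>I. I \<in> B \<Longrightarrow> p I \<noteq> 0 \<Longrightarrow> tensor_par m I = a"
    and t: "\<And>J. J \<in> B \<Longrightarrow> t J \<noteq> 0 \<Longrightarrow> tensor_par m J = b"
  shows "rep_form tensors A g p t \<in> grade A (a + b)"
  unfolding rep_form_tensors[OF A g]
proof (rule comm_superalgebra.lincomb_in_grade[OF A])
  interpret comm_superalgebra A by fact
  fix z assume "z \<in> tensor_basis2 m n r"
  then obtain I J where z: "z = (I, J)" "I \<in> B" "J \<in> B" by auto
  have X: "tensor_coeff m A g I J \<in> grade A (tensor_par m I + tensor_par m J)"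
    by (rule tensor_coeff_grade[OF g z(2,3)])
  show "(case z of (I, J) \<Rightarrow> tensor_coeff m A g I J) \<in> carrier A \<and>
      ((case z of (I, J) \<Rightarrow> p I * t J) \<noteq> 0 \<longrightarrow> (case z of (I, J) \<Rightarrow> tensor_coeff m A g I J) \<in> grade A (a + b))"
    unfolding z(1) prod.case
  proof (intro conjI impI)
    show "tensor_coeff m A g I J \<in> carrier A" by (rule grade_closed[OF X])
    assume "p I * t J \<noteq> 0"
    then have "tensor_par m I = a" "tensor_par m J = b" using p[OF z(2)] t[OF z(3)] by auto
    then show "tensor_coeff m A g I J \<in> grade A (a + b)" using X by (simp only:)
  qed
qed

lemma tensors_form_one:
  assumes A: "comm_superalgebra A"
  shows "rep_form tensors A \<one>\<^bsub>End_super {..<m + n} (par_V m) A\<^esub> p t = pairing B p t \<odot>\<^bsub>A\<^esub> \<one>\<^bsub>A\<^esub>"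
proof -
  interpret comm_superalgebra A by fact
  let ?e = "\<one>\<^bsub>End_super {..<m + n} (par_V m) A\<^esub>"
  have e: "?e \<in> carrier (End_super {..<m + n} (par_V m) A)"
    using GL_even_matrix[OF GL_one[of m n]] by (simp add: End_super_def)
  have "rep_form tensors A ?e p t = (\<Oplus>\<^bsub>A\<^esub>z\<in>tensor_basis2 m n r. (case z of (I, J) \<Rightarrow> p I * t J * (if I = J then 1 else 0)) \<odot>\<^bsub>A\<^esub> \<one>\<^bsub>A\<^esub>)"
    unfolding rep_form_tensors[OF A e] lincomb_def
  proof (rule finsum_cong_simple)
    fix z assume "z \<in> tensor_basis2 m n r"
    then obtain I J where z: "z = (I, J)" "I \<in> B" "J \<in> B" by auto
    show "(case z of (I, J) \<Rightarrow> p I * t J) \<odot>\<^bsub>A\<^esub> (case z of (I, J) \<Rightarrow> tensor_coeff m A ?e I J) =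
        (case z of (I, J) \<Rightarrow> p I * t J * (if I = J then 1 else 0)) \<odot>\<^bsub>A\<^esub> \<one>\<^bsub>A\<^esub>"
      unfolding z(1) prod.case tensor_coeff_one[OF refl z(2,3)]
      by (simp add: smult_zero zero_smult)
  qed (auto intro: smult_closed)
  also have "\<dots> = (\<Sum>z\<in>tensor_basis2 m n r. case z of (I, J) \<Rightarrow> p I * t J * (if I = J then 1 else 0)) \<odot>\<^bsub>A\<^esub> \<one>\<^bsub>A\<^esub>"
    by (rule sum_smult[symmetric]) simp
  also have "(\<Sum>z\<in>tensor_basis2 m n r. case z of (I, J) \<Rightarrow> p I * t J * (if I = J then 1 else 0)) =
      (\<Sum>I\<in>B. \<Sum>J\<in>B. p I * t J * (if I = J then 1 else 0))"
    by (rule sum.cartesian_product[symmetric])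
  also have "\<dots> = pairing B p t"
    unfolding pairing_def using finite_B by (intro sum.cong refl) (simp add: if_distrib cong: if_cong)
  finally show ?thesis .
qed

text \<open>
  The representation is \<open>p \<rho>(g) f\<close>, where \<open>f\<close> parametrises
  \<open>U\<close> by a homogeneous basis and \<open>p\<close> is an even linear left inverse of
  \<open>f\<close>. Since \<open>f p\<close> fixes \<open>U\<close> and \<open>U\<close> is
  invariant under the commutant, \<open>f p \<rho>(g) f = \<rho>(g) f\<close>. This relation makes
  \<open>p \<rho>(g) f\<close> multiplicative in \<open>g\<close>.
\<close>

lemma invariant_is_image:
  assumes U: "invariant commutant U"
  obtains L :: "('k, 'u, nat) gl_rep" and T p where "is_gl_rep m n L" "retract L T p"
    "lin_map (gl_basis L) B T ` coord_space (gl_basis L) = U"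
proof -
  let ?tp = "tensor_par m"
  note S = invariantD(1)[OF U]
  have UV: "U \<subseteq> V" using U unfolding invariant_def unfolding lr_basis_sym_tensor_rep by (elim conjE)
  \<comment> \<open>the homogeneous elements of \<open>U\<close>; they span it because the parity projections
    lie in the commutant\<close>
  define H where "H = {u \<in> U. \<exists>q. parity_part ?tp q u = u}"
  have HU: "H \<subseteq> U" by (auto simp: H_def)
  have UH: "U \<subseteq> fs.span H"
  proof
    fix u assume u: "u \<in> U"
    have part: "parity_part ?tp q u \<in> H" for q
    proof -
      have "parity_part ?tp q (parity_part ?tp q u) = parity_part ?tp q u"
        by (rule ext) (simp add: parity_part_def)
      then show ?thesis
        unfolding H_def by (intro CollectI conjI exI[of _ q] invariantD(3)[OF U parity_part_commutant u])
    qed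
    have "u = parity_part ?tp 0 u + parity_part ?tp 1 u"
      by (rule ext) (auto simp: parity_part_def)
    moreover have "parity_part ?tp 0 u + parity_part ?tp 1 u \<in> fs.span H"
      by (intro fs.span_add fs.span_base part)
    ultimately show "u \<in> fs.span H" by simp
  qed
  obtain d :: nat and e :: "nat \<Rightarrow> nat list \<Rightarrow> 'k"
    where eH: "\<And>j. j < d \<Longrightarrow> e j \<in> H"
      and inj: "inj_on (lin_map {..<d} B (\<lambda>i j. e j i)) (coord_space {..<d})"
      and img: "lin_map {..<d} B (\<lambda>i j. e j i) ` coord_space {..<d} = U"
    by (rule subspace_enumerated_basis[OF finite_B S UV HU UH]) (rule that; assumption)
  let ?D = "{..<d}" and ?T = "\<lambda>I j. e j I"
  let ?f = "lin_map ?D B ?T"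
  define par where "par j = (SOME q. parity_part ?tp q (e j) = e j)" for j
  have par: "?tp I = par j" if j: "j < d" and nz: "e j I \<noteq> 0" for j I
  proof -
    have "\<exists>q. parity_part ?tp q (e j) = e j" using eH[OF j] by (simp add: H_def)
    then have "parity_part ?tp (par j) (e j) = e j" unfolding par_def by (rule someI_ex)
    from fun_cong[OF this, of I] show ?thesis using nz by (auto simp: parity_part_def split: if_splits)
  qed
  define t where "t j = ?f (unit_vec j)" for j
  have t_apply: "t j I = (if I \<in> B then e j I else 0)" if "j < d" for j I
    unfolding t_def using that by (subst lin_map_unit_vec) auto
  have tU: "t j \<in> U" if "j < d" for j 
    unfolding t_def img[symmetric] by (rule imageI[OF unit_vec_in]) (simp add: that)
  obtain P where P: "\<And>u. u \<in> coord_space ?D \<Longrightarrow> lin_map B ?D P (?f u) = u"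
    using lin_map_left_inverse[OF finite_lessThan finite_B inj] by blast
  \<comment> \<open>the even part of a left inverse \<open>P\<close> of \<open>f\<close> is again a left
    inverse, since \<open>f\<close> is even\<close>
  define P' where "P' b I = (if par b = ?tp I then P b I else 0)" for b I
  let ?p = "lin_map B ?D P'"
  have pf: "?p (?f u) = u" if u: "u \<in> coord_space ?D" for u
  proof (rule flinear_eq_on_coord_space[OF finite_lessThan flinear_compose[OF flinear_lin_map flinear_lin_map] flinear_id _ u])
    fix j assume "j \<in> ?D"
    then have j: "j < d" by simp
    show "?p (?f (unit_vec j)) = unit_vec j"
    proof
      fix b
      show "?p (?f (unit_vec j)) b = unit_vec j b"
      proof (cases "b < d")
        case b: True
        have *: "lin_map B ?D Q (?f (unit_vec j)) b = (\<Sum>I\<in>B. Q b I * e j I)" for Q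
          using b unfolding t_def[symmetric] unfolding lin_map_def by (auto simp: t_apply[OF j] intro!: sum.cong)
        show ?thesis
        proof (cases "par b = par j")
          case True
          have "(\<Sum>I\<in>B. P' b I * e j I) = (\<Sum>I\<in>B. P b I * e j I)"
          proof (rule sum.cong[OF refl])
            fix I show "P' b I * e j I = P b I * e j I"
              using par[OF j, of I] True by (cases "e j I = 0") (auto simp: P'_def)
          qed
          then show ?thesis using *[of P] *[of P'] P[OF unit_vec_in[OF \<open>j \<in> ?D\<close>]] by simp
        next
          case False
          have "(\<Sum>I\<in>B. P' b I * e j I) = 0"
          proof (rule sum.neutral, rule ballI)
            fix I show "P' b I * e j I = 0"
              using par[OF j, of I] False by (cases "e j I = 0") (auto simp: P'_def)
          qed
          moreover have "unit_vec j b = (0 :: 'k)" using False by (auto simp: unit_vec_def)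
          ultimately show ?thesis using *[of P'] by simp
        qed
      next
        case False
        then show ?thesis using j by (auto simp: lin_map_def unit_vec_def)
      qed
    qed
  qed
  have fp: "?f (?p x) = x" if "x \<in> U" for x
  proof -
    have "x \<in> ?f ` coord_space ?D" using that img by simp
    then obtain u where u: "u \<in> coord_space ?D" "x = ?f u" by (rule imageE)
    show ?thesis unfolding u(2) pf[OF u(1)] ..
  qed
  define L :: "('k, 'u, nat) gl_rep" where
    "L = \<lparr>gl_basis = ?D, gl_par = par, gl_act = (\<lambda>A g. \<lambda>i\<in>?D. \<lambda>j\<in>?D. rep_form tensors A g (P' i) (t j))\<rparr>"
  have D: "gl_basis L = ?D" and gl_par: "gl_par L = par"
    and act_def: "gl_act L A g = (\<lambda>i\<in>?D. \<lambda>j\<in>?D. rep_form tensors A g (P' i) (t j))" for A g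
    by (simp_all add: L_def)
  have act: "gl_act L A g i j = rep_form tensors A g (P' i) (t j)" if "i < d" "j < d" for A g i j
    using that by (simp add: act_def)
  have grade: "rep_form tensors A g (P' i) (t j) \<in> grade A (par i + par j)"
    if A: "comm_superalgebra A" and g: "g \<in> carrier (End_super {..<m + n} (par_V m) A)" and ij: "i < d" "j < d"
    for A :: "('k, 'u) superalgebra" and g i j
  proof (rule tensors_form_grade[OF A g])
    show "?tp I = par i" if "P' i I \<noteq> 0" for I using that by (auto simp: P'_def split: if_splits)
    show "?tp J = par j" if "J \<in> B" "t j J \<noteq> 0" for J using that par[OF ij(2), of J] t_apply[OF ij(2)] by simp
  qed
  have entries: "has_matrix_entries m n L"
    unfolding has_matrix_entries_def D
  proof (intro conjI allI impI ballI)
    fix A :: "('k, 'u) superalgebra" and g i j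
    assume A: "comm_superalgebra A" and g: "g \<in> carrier (GL m n A)" and "i \<in> ?D" "j \<in> ?D"
    then have ij: "i < d" "j < d" by simp_all
    show "gl_act L A g i j \<in> carrier A"
      unfolding act[OF ij] by (rule tensors_form_closed[OF A comm_superalgebra.GL_even_matrix[OF A g]])
  qed simp
  \<comment> \<open>the relation \<open>f p \<rho>(g) f = \<rho>(g) f\<close>\<close>
  have row: "lincomb A ?D (?T I) (\<lambda>l. gl_act L A g l j) = lincomb A B (t j) (\<lambda>J. tensor_coeff m A g I J)"
    if A: "comm_superalgebra A" and g: "g \<in> carrier (GL m n A)" and I: "I \<in> B" and j: "j < d"
    for A :: "('k, 'u) superalgebra" and g I j
  proof -
    interpret comm_superalgebra A by fact
    note ge = GL_even_matrix[OF g]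
    have cl: "lincomb A B (t j) (\<lambda>J. tensor_coeff m A g I' J) \<in> carrier A" if "I' \<in> B" for I'
      by (rule lincomb_closed[OF tensor_coeff_closed[OF ge that]])
    have "lincomb A ?D (?T I) (\<lambda>l. gl_act L A g l j) =
        lincomb A ?D (?T I) (\<lambda>l. lincomb A B (P' l) (\<lambda>I'. lincomb A B (t j) (\<lambda>J. tensor_coeff m A g I' J)))"
      by (rule lincomb_cong[OF refl]) (auto simp: act j tensors_form_swap(1)[OF A ge] intro!: lincomb_closed cl)
    also have "\<dots> = lincomb A B (\<lambda>I'. \<Sum>l\<in>?D. ?T I l * P' l I') (\<lambda>I'. lincomb A B (t j) (\<lambda>J. tensor_coeff m A g I' J))"
      by (rule lincomb_scalars[OF finite_lessThan finite_B cl])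
    also have "\<dots> = rep_form tensors A g (\<lambda>I'. \<Sum>l\<in>?D. ?T I l * P' l I') (t j)"
      by (rule tensors_form_swap(1)[OF A ge, symmetric])
    also have "\<dots> = rep_form tensors A g (unit_vec I) (t j)"
    proof (rule tensors_form_eqI[OF _ A g])
      fix f assume f: "f \<in> commutant"
      have "pairing B (\<lambda>I'. \<Sum>l\<in>?D. ?T I l * P' l I') (f (t j)) = ?f (?p (f (t j))) I"
        unfolding lin_map_compose[OF finite_lessThan] using I by (simp add: pairing_def lin_map_def)
      also have "\<dots> = f (t j) I" by (simp only: fp[OF invariantD(3)[OF U f tU[OF j]]])
      also have "\<dots> = pairing B (unit_vec I) (f (t j))" by (rule pairing_unit_vec(1)[OF finite_B I, symmetric])
      finally show "pairing B (\<lambda>I'. \<Sum>l\<in>?D. ?T I l * P' l I') (f (t j)) = pairing B (unit_vec I) (f (t j))" .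
    qed
    also have "\<dots> = lincomb A B (t j) (\<lambda>J. tensor_coeff m A g I J)"
      unfolding tensors_form_swap(1)[OF A ge] by (rule lincomb_unit_vec[OF finite_B I cl])
    finally show ?thesis .
  qed
  have inter: "gl_intertwiner m n L tensors ?T"
  proof (rule intertwinerI[OF entries tensor_rep_has_matrix_entries])
    show "even_matrix L tensors ?T"
      unfolding even_matrix_def D gl_par tensor_rep_sel using par by (metis lessThan_iff)
    fix A :: "('k, 'u) superalgebra" and g I j
    assume A: "comm_superalgebra A" and g: "g \<in> carrier (GL m n A)" and "I \<in> gl_basis tensors" and "j \<in> gl_basis L"
    then have I: "I \<in> B" and j: "j < d" "j \<in> gl_basis L" by (simp_all add: D)
    interpret comm_superalgebra A by fact
    note ge = GL_even_matrix[OF g]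
    have "rep_form tensors A g (unit_vec I) (t j) = lincomb A B (t j) (\<lambda>J. tensor_coeff m A g I J)"
      unfolding tensors_form_swap(1)[OF A ge]
      by (rule lincomb_unit_vec[OF finite_B I]) (rule lincomb_closed[OF tensor_coeff_closed[OF ge]])
    also have "\<dots> = lincomb A ?D (?T I) (\<lambda>l. gl_act L A g l j)" by (rule row[OF A g I j(1), symmetric])
    also have "\<dots> = rep_form L A g (?T I) (unit_vec j)"
      unfolding rep_form_unit(2)[OF entries A g j(2) j(2)] D ..
    finally show "rep_form tensors A g (unit_vec I) (lin_map (gl_basis L) (gl_basis tensors) ?T (unit_vec j)) =
        rep_form L A g (?T I) (unit_vec j)"
      by (simp only: D tensor_rep_sel t_def)
  qed
  have "is_gl_rep m n L"
    unfolding is_gl_rep_def D gl_par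
  proof (intro conjI allI impI ballI)
    fix A :: "('k, 'u) superalgebra" assume A: "comm_superalgebra A"
    interpret comm_superalgebra A by fact
    show "gl_act L A \<in> hom (GL m n A) (End_super ?D par A)"
    proof (rule homI)
      fix g assume g: "g \<in> carrier (GL m n A)"
      show "gl_act L A g \<in> carrier (End_super ?D par A)"
        unfolding act_def by (rule End_superI) (simp add: grade[OF A GL_even_matrix[OF g]] del: add_bit_eq_xor)
    next
      fix g h assume g: "g \<in> carrier (GL m n A)" and h: "h \<in> carrier (GL m n A)"
      note ge = GL_even_matrix[OF g] and he = GL_even_matrix[OF h]
      let ?gh = "g \<otimes>\<^bsub>End_super {..<m + n} (par_V m) A\<^esub> h"
      note ghe = even_matrices_mult[OF ge he]
      have gh: "g \<otimes>\<^bsub>GL m n A\<^esub> h = ?gh" by (simp add: GL_def units_of_def)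
      have entry: "rep_form tensors A ?gh (P' i) (t j) = (\<Oplus>\<^bsub>A\<^esub>l\<in>?D. gl_act L A g i l \<otimes>\<^bsub>A\<^esub> gl_act L A h l j)"
        if ij: "i < d" "j < d" for i j
      proof -
        note gcl = tensor_coeff_closed[OF ge] and hcl = tensor_coeff_closed[OF he]
        define \<alpha> where "\<alpha> M = lincomb A B (P' i) (\<lambda>I. tensor_coeff m A g I M)" for M
        define \<beta> where "\<beta> M = lincomb A B (t j) (\<lambda>J. tensor_coeff m A h M J)" for M
        have \<alpha>: "\<alpha> M \<in> carrier A" if "M \<in> B" for M
          unfolding \<alpha>_def by (rule lincomb_closed[OF gcl[OF _ that]])
        have \<beta>: "\<beta> M \<in> carrier A" if "M \<in> B" for M
          unfolding \<beta>_def by (rule lincomb_closed[OF hcl[OF that]])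
        have R: "gl_act L A h l j \<in> carrier A" if "l < d" for l
          unfolding act[OF that ij(2)] by (rule tensors_form_closed[OF A he])
        have inner: "lincomb A B (t j) (\<lambda>J. tensor_coeff m A ?gh I J) =
            lincomb A B (\<lambda>_. 1) (\<lambda>M. tensor_coeff m A g I M \<otimes>\<^bsub>A\<^esub> \<beta> M)" if I: "I \<in> B" for I
        proof -
          have "lincomb A B (t j) (\<lambda>J. tensor_coeff m A ?gh I J) =
              lincomb A B (t j) (\<lambda>J. lincomb A B (\<lambda>_. 1) (\<lambda>M. tensor_coeff m A g I M \<otimes>\<^bsub>A\<^esub> tensor_coeff m A h M J))"
          proof (rule lincomb_cong[OF refl])
            fix J assume J: "J \<in> B"
            have cl: "tensor_coeff m A g I M \<otimes>\<^bsub>A\<^esub> tensor_coeff m A h M J \<in> carrier A" if "M \<in> B" for M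
              by (rule m_closed[OF gcl[OF I that] hcl[OF that J]])
            show "tensor_coeff m A ?gh I J =
                lincomb A B (\<lambda>_. 1) (\<lambda>M. tensor_coeff m A g I M \<otimes>\<^bsub>A\<^esub> tensor_coeff m A h M J)"
              unfolding tensor_coeff_mult[OF ge he refl I J] by (rule finsum_eq_lincomb[OF cl])
            show "lincomb A B (\<lambda>_. 1) (\<lambda>M. tensor_coeff m A g I M \<otimes>\<^bsub>A\<^esub> tensor_coeff m A h M J) \<in> carrier A"
              by (rule lincomb_closed[OF cl])
          qed
          also have "\<dots> = lincomb A B (\<lambda>_. 1) (\<lambda>M. lincomb A B (t j) (\<lambda>J. tensor_coeff m A g I M \<otimes>\<^bsub>A\<^esub> tensor_coeff m A h M J))"
            by (rule lincomb_swap[OF finite_B finite_B]) (rule m_closed[OF gcl[OF I] hcl]; assumption)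
          also have "\<dots> = lincomb A B (\<lambda>_. 1) (\<lambda>M. tensor_coeff m A g I M \<otimes>\<^bsub>A\<^esub> \<beta> M)"
          proof (rule lincomb_cong[OF refl])
            fix M assume M: "M \<in> B"
            show "lincomb A B (t j) (\<lambda>J. tensor_coeff m A g I M \<otimes>\<^bsub>A\<^esub> tensor_coeff m A h M J) = tensor_coeff m A g I M \<otimes>\<^bsub>A\<^esub> \<beta> M"
              unfolding \<beta>_def by (rule lincomb_mult_left[OF finite_B hcl[OF M] gcl[OF I M], symmetric])
            show "tensor_coeff m A g I M \<otimes>\<^bsub>A\<^esub> \<beta> M \<in> carrier A" by (rule m_closed[OF gcl[OF I M] \<beta>[OF M]])
          qed
          finally show ?thesis .
        qed
        have g\<beta>: "tensor_coeff m A g I M \<otimes>\<^bsub>A\<^esub> \<beta> M \<in> carrier A" if "I \<in> B" "M \<in> B" for I M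
          by (rule m_closed[OF gcl[OF that] \<beta>[OF that(2)]])
        have "rep_form tensors A ?gh (P' i) (t j) =
            lincomb A B (P' i) (\<lambda>I. lincomb A B (\<lambda>_. 1) (\<lambda>M. tensor_coeff m A g I M \<otimes>\<^bsub>A\<^esub> \<beta> M))"
          unfolding tensors_form_swap(1)[OF A ghe]
          by (rule lincomb_cong[OF refl inner lincomb_closed[OF g\<beta>]])
        also have "\<dots> = lincomb A B (\<lambda>_. 1) (\<lambda>M. lincomb A B (P' i) (\<lambda>I. tensor_coeff m A g I M \<otimes>\<^bsub>A\<^esub> \<beta> M))"
          by (rule lincomb_swap[OF finite_B finite_B g\<beta>])
        also have "\<dots> = lincomb A B (\<lambda>_. 1) (\<lambda>M. \<alpha> M \<otimes>\<^bsub>A\<^esub> \<beta> M)"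
        proof (rule lincomb_cong[OF refl])
          fix M assume M: "M \<in> B"
          show "lincomb A B (P' i) (\<lambda>I. tensor_coeff m A g I M \<otimes>\<^bsub>A\<^esub> \<beta> M) = \<alpha> M \<otimes>\<^bsub>A\<^esub> \<beta> M"
            unfolding \<alpha>_def by (rule lincomb_mult_right[OF finite_B gcl[OF _ M] \<beta>[OF M], symmetric])
          show "\<alpha> M \<otimes>\<^bsub>A\<^esub> \<beta> M \<in> carrier A" by (rule m_closed[OF \<alpha>[OF M] \<beta>[OF M]])
        qed
        also have "\<dots> = (\<Oplus>\<^bsub>A\<^esub>M\<in>B. \<alpha> M \<otimes>\<^bsub>A\<^esub> \<beta> M)"
          by (rule finsum_eq_lincomb[symmetric]) (rule m_closed[OF \<alpha> \<beta>]; assumption)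
        also have "\<dots> = (\<Oplus>\<^bsub>A\<^esub>M\<in>B. \<Oplus>\<^bsub>A\<^esub>l\<in>?D. e l M \<odot>\<^bsub>A\<^esub> (\<alpha> M \<otimes>\<^bsub>A\<^esub> gl_act L A h l j))"
        proof (rule finsum_cong_simple)
          fix M assume M: "M \<in> B"
          have Rl: "gl_act L A h l j \<in> carrier A" if "l \<in> ?D" for l using R that by simp
          have "\<alpha> M \<otimes>\<^bsub>A\<^esub> \<beta> M = \<alpha> M \<otimes>\<^bsub>A\<^esub> lincomb A ?D (?T M) (\<lambda>l. gl_act L A h l j)"
            unfolding \<beta>_def by (simp only: row[OF A h M ij(2)])
          also have "\<dots> = lincomb A ?D (?T M) (\<lambda>l. \<alpha> M \<otimes>\<^bsub>A\<^esub> gl_act L A h l j)"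
            by (rule lincomb_mult_left[OF finite_lessThan Rl \<alpha>[OF M]])
          finally show "\<alpha> M \<otimes>\<^bsub>A\<^esub> \<beta> M = (\<Oplus>\<^bsub>A\<^esub>l\<in>?D. e l M \<odot>\<^bsub>A\<^esub> (\<alpha> M \<otimes>\<^bsub>A\<^esub> gl_act L A h l j))"
            by (simp only: lincomb_def)
          show "(\<Oplus>\<^bsub>A\<^esub>l\<in>?D. e l M \<odot>\<^bsub>A\<^esub> (\<alpha> M \<otimes>\<^bsub>A\<^esub> gl_act L A h l j)) \<in> carrier A"
            using Rl \<alpha>[OF M] by (intro finsum_closed) (auto intro!: smult_closed)
        qed
        also have "\<dots> = (\<Oplus>\<^bsub>A\<^esub>l\<in>?D. \<Oplus>\<^bsub>A\<^esub>M\<in>B. e l M \<odot>\<^bsub>A\<^esub> (\<alpha> M \<otimes>\<^bsub>A\<^esub> gl_act L A h l j))"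
          using R \<alpha> by (intro finsum_swap[OF finite_B finite_lessThan] smult_closed m_closed) auto
        also have "\<dots> = (\<Oplus>\<^bsub>A\<^esub>l\<in>?D. gl_act L A g i l \<otimes>\<^bsub>A\<^esub> gl_act L A h l j)"
        proof (rule finsum_cong_simple)
          fix l assume "l \<in> ?D"
          then have l: "l < d" by simp
          have "gl_act L A g i l = lincomb A B (t l) \<alpha>"
            unfolding act[OF ij(1) l] tensors_form_swap(2)[OF A ge] \<alpha>_def ..
          also have "\<dots> = lincomb A B (e l) \<alpha>"
            by (rule lincomb_cong[OF _ refl \<alpha>]) (simp add: t_apply[OF l])
          finally have gl: "gl_act L A g i l = lincomb A B (e l) \<alpha>" .
          show "(\<Oplus>\<^bsub>A\<^esub>M\<in>B. e l M \<odot>\<^bsub>A\<^esub> (\<alpha> M \<otimes>\<^bsub>A\<^esub> gl_act L A h l j)) = gl_act L A g i l \<otimes>\<^bsub>A\<^esub> gl_act L A h l j"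
            unfolding gl by (subst lincomb_mult_right[OF finite_B \<alpha> R[OF l]]) (simp_all only: lincomb_def)
          show "gl_act L A g i l \<otimes>\<^bsub>A\<^esub> gl_act L A h l j \<in> carrier A"
            unfolding gl by (rule m_closed[OF lincomb_closed[OF \<alpha>] R[OF l]])
        qed
        finally show ?thesis .
      qed
      show "gl_act L A (g \<otimes>\<^bsub>GL m n A\<^esub> h) = gl_act L A g \<otimes>\<^bsub>End_super ?D par A\<^esub> gl_act L A h"
        unfolding gh act_def[of A ?gh] End_super_def[of ?D] monoid.simps restrict2_eq_iff
        using entry by simp
    qed
    show "gl_act L A \<one>\<^bsub>GL m n A\<^esub> = \<one>\<^bsub>End_super ?D par A\<^esub>"
    proof -
      have one: "\<one>\<^bsub>GL m n A\<^esub> = \<one>\<^bsub>End_super {..<m + n} (par_V m) A\<^esub>" by (simp add: GL_def units_of_def)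
      have "pairing B (P' i) (t j) \<odot>\<^bsub>A\<^esub> \<one>\<^bsub>A\<^esub> = (if i = j then \<one>\<^bsub>A\<^esub> else \<zero>\<^bsub>A\<^esub>)" if ij: "i < d" "j < d" for i j
      proof -
        have "pairing B (P' i) (t j) = ?p (t j) i" using ij by (simp add: pairing_def lin_map_def)
        also have "\<dots> = unit_vec j i" unfolding t_def using pf[OF unit_vec_in[of j ?D]] ij by simp
        finally show ?thesis by (simp add: unit_vec_def smult_one zero_smult)
      qed
      then show ?thesis
        unfolding one act_def tensors_form_one[OF A] End_super_def[of ?D] monoid.simps restrict2_eq_iff by simp
    qed
  next
    fix A A' :: "('k, 'u) superalgebra" and \<phi> g
    assume A: "comm_superalgebra A" and A': "comm_superalgebra A'" and \<phi>: "\<phi> \<in> superalgebra_hom A A'"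
      and g: "g \<in> carrier (GL m n A)"
    note ge = comm_superalgebra.GL_even_matrix[OF A g]
    have "rep_form tensors A' (map_matrix {..<m + n} \<phi> g) p u = \<phi> (rep_form tensors A g p u)" for p u
    proof -
      have cl: "(case z of (I, J) \<Rightarrow> tensor_coeff m A g I J) \<in> carrier A" if "z \<in> tensor_basis2 m n r" for z
        using that comm_superalgebra.tensor_coeff_closed[OF A ge] by auto
      have \<phi>cl: "\<phi> x \<in> carrier A'" if "x \<in> carrier A" for x
        using \<phi> that unfolding superalgebra_hom_def by (auto dest: ring_hom_closed)
      have "rep_form tensors A' (map_matrix {..<m + n} \<phi> g) p u =
          lincomb A' (tensor_basis2 m n r) (\<lambda>(I, J). p I * u J) (\<lambda>z. \<phi> (case z of (I, J) \<Rightarrow> tensor_coeff m A g I J))"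
        unfolding rep_form_tensors[OF A' map_matrix_even[OF A \<phi> ge]]
      proof (rule comm_superalgebra.lincomb_cong[OF A' refl])
        fix z assume z: "z \<in> tensor_basis2 m n r"
        then show "(case z of (I, J) \<Rightarrow> tensor_coeff m A' (map_matrix {..<m + n} \<phi> g) I J) =
            \<phi> (case z of (I, J) \<Rightarrow> tensor_coeff m A g I J)"
          using tensor_coeff_hom[OF A \<phi> ge] by auto
        show "\<phi> (case z of (I, J) \<Rightarrow> tensor_coeff m A g I J) \<in> carrier A'" by (rule \<phi>cl[OF cl[OF z]])
      qed
      also have "\<dots> = \<phi> (rep_form tensors A g p u)"
        unfolding rep_form_tensors[OF A ge] by (rule superalgebra_hom_lincomb[OF A A' \<phi> cl, symmetric])
      finally show ?thesis .
    qed
    then show "gl_act L A' (map_matrix {..<m + n} \<phi> g) = map_matrix ?D \<phi> (gl_act L A g)"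
      unfolding act_def map_matrix_def[of ?D] restrict2_eq_iff by simp
  qed simp
  moreover have "retract L ?T ?p"
    unfolding retract_def D using entries inter flinear_lin_map lin_map_in pf by blast
  ultimately show thesis using that img D by metis
qed

text \<open>
  Both directions transfer one intertwining relation between supergroup and commutant. From left
  to right it is \<open>intertwiner_transport\<close>. From right to left, an isomorphism
  \<open>\<psi>\<close> of the images gives the linear map \<open>p' \<psi> f\<close>; it is even
  because \<open>\<psi>\<close> commutes with the parity projections.
\<close>

lemma gl_iso_iff_images_iso:
  fixes L L' :: "('k, 'u, nat) gl_rep"
  assumes L: "is_gl_rep m n L" "retract L T p" and L': "is_gl_rep m n L'" "retract L' T' p'"
  shows "(L, L') \<in> gl_iso m n \<longleftrightarrow>
    (\<exists>\<psi>. intertwines commutant (lin_map (gl_basis L) B T ` coord_space (gl_basis L))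
       (lin_map (gl_basis L') B T' ` coord_space (gl_basis L')) \<psi>)"
proof -
  let ?K = "gl_basis L" and ?K' = "gl_basis L'"
  let ?f = "lin_map ?K B T" and ?f' = "lin_map ?K' B T'"
  note R = retractD[OF L(2)] and R' = retractD[OF L'(2)]
  have bij: "bij_betw ?f (coord_space ?K) (?f ` coord_space ?K)" "bij_betw p (?f ` coord_space ?K) (coord_space ?K)"
  proof -
    show "bij_betw ?f (coord_space ?K) (?f ` coord_space ?K)"
      by (rule bij_betwI[of _ _ _ p]) (auto simp: R(5) R(4))
    show "bij_betw p (?f ` coord_space ?K) (coord_space ?K)"
      by (rule bij_betwI[of _ _ _ ?f]) (auto simp: R(5) R(4))
  qed
  have bij': "bij_betw ?f' (coord_space ?K') (?f' ` coord_space ?K')" "bij_betw p' (?f' ` coord_space ?K') (coord_space ?K')"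
  proof -
    show "bij_betw ?f' (coord_space ?K') (?f' ` coord_space ?K')"
      by (rule bij_betwI[of _ _ _ p']) (auto simp: R'(5) R'(4))
    show "bij_betw p' (?f' ` coord_space ?K') (coord_space ?K')"
      by (rule bij_betwI[of _ _ _ ?f']) (auto simp: R'(5) R'(4))
  qed
  show ?thesis
  proof
    assume "(L, L') \<in> gl_iso m n"
    then obtain S where S: "gl_intertwiner m n L L' S" "bij_betw (lin_map ?K ?K' S) (coord_space ?K) (coord_space ?K')"
      unfolding gl_iso_def by blast
    define T2 where "T2 = (\<lambda>I b. \<Sum>l\<in>?K'. T' I l * S l b)"
    have T2: "gl_intertwiner m n L tensors T2"
      unfolding T2_def by (rule intertwiner_compose[OF R(1) R'(1) tensor_rep_has_matrix_entries S(1) R'(2)])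
    let ?f2 = "lin_map ?K B T2"
    have f2: "?f2 u = ?f' (lin_map ?K ?K' S u)" for u
      unfolding T2_def lin_map_compose[OF R'(6)] ..
    let ?\<psi> = "\<lambda>x. ?f2 (p x)"
    have lin: "flinear ?\<psi>" by (rule flinear_compose[OF flinear_lin_map R(3)])
    have \<psi>f: "?\<psi> (?f u) = ?f2 u" if "u \<in> coord_space ?K" for u by (simp only: R(5)[OF that])
    have "bij_betw ?\<psi> (?f ` coord_space ?K) (?f' ` coord_space ?K')"
      using bij_betw_trans[OF bij_betw_trans[OF bij(2) S(2)] bij'(1)] by (simp only: comp_def f2)
    moreover have "?\<psi> (c x) = c (?\<psi> x)" if c: "c \<in> commutant" and x: "x \<in> ?f ` coord_space ?K" for c x
    proof -
      obtain u where u: "u \<in> coord_space ?K" "x = ?f u" using x by blast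
      have "?\<psi> (c (?f u)) = c (?f2 u)"
        by (rule intertwiner_transport[OF R(1,2) T2 lin flinear_id \<psi>f c])
      then show ?thesis unfolding u(2) \<psi>f[OF u(1)] .
    qed
    ultimately have "intertwines commutant (?f ` coord_space ?K) (?f' ` coord_space ?K') ?\<psi>"
      unfolding intertwines_def using lin by blast
    then show "\<exists>\<psi>. intertwines commutant (?f ` coord_space ?K) (?f' ` coord_space ?K') \<psi>" by blast
  next
    assume "\<exists>\<psi>. intertwines commutant (?f ` coord_space ?K) (?f' ` coord_space ?K') \<psi>"
    then obtain \<psi> where \<psi>: "flinear \<psi>" "bij_betw \<psi> (?f ` coord_space ?K) (?f' ` coord_space ?K')"
      "\<And>c x. c \<in> commutant \<Longrightarrow> x \<in> ?f ` coord_space ?K \<Longrightarrow> \<psi> (c x) = c (\<psi> x)"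
      unfolding intertwines_def by blast
    let ?h = "\<lambda>u. p' (\<psi> (?f u))"
    have h: "flinear ?h" by (rule flinear_compose[OF R'(3) flinear_compose[OF \<psi>(1) flinear_lin_map]])
    have fh: "?f' (?h u) = \<psi> (?f u)" if u: "u \<in> coord_space ?K" for u
    proof -
      have "\<psi> (?f u) \<in> ?f' ` coord_space ?K'" by (rule bij_betw_apply[OF \<psi>(2) imageI[OF u]])
      then obtain v where v: "v \<in> coord_space ?K'" "\<psi> (?f u) = ?f' v" by (rule imageE)
      show ?thesis unfolding v(2) R'(5)[OF v(1)] ..
    qed
    let ?S = "\<lambda>a i. ?h (unit_vec i) a"
    have S: "lin_map ?K ?K' ?S u = ?h u" if "u \<in> coord_space ?K" for u
      by (rule flinear_eq_lin_map[OF R(6) h R'(4) that, symmetric])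
    have "gl_intertwiner m n L L' ?S"
    proof (rule intertwinerI[OF R(1) R'(1) even_matrixI_columns])
      fix i assume i: "i \<in> ?K"
      let ?q = "gl_par L i" and ?e = "unit_vec i"
      have e: "?e \<in> coord_space ?K" by (rule unit_vec_in[OF i])
      have "?f' (parity_part (gl_par L') ?q (?h ?e)) = parity_part (tensor_par m) ?q (?f' (?h ?e))"
        using even_matrix_parity_part[OF intertwiner_even[OF R'(2)]] by simp
      also have "\<dots> = parity_part (tensor_par m) ?q (\<psi> (?f ?e))" by (simp only: fh[OF e])
      also have "\<dots> = \<psi> (parity_part (tensor_par m) ?q (?f ?e))"
        by (rule \<psi>(3)[OF parity_part_commutant imageI[OF e], symmetric])
      also have "parity_part (tensor_par m) ?q (?f ?e) = ?f (parity_part (gl_par L) ?q ?e)"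
        using even_matrix_parity_part[OF intertwiner_even[OF R(2)]] by simp
      also have "parity_part (gl_par L) ?q ?e = ?e" by (rule parity_part_unit_vec)
      finally have "?f' (parity_part (gl_par L') ?q (?h ?e)) = ?f' (?h ?e)" by (simp only: fh[OF e])
      then have "p' (?f' (parity_part (gl_par L') ?q (?h ?e))) = p' (?f' (?h ?e))" by (rule arg_cong)
      then show "parity_part (gl_par L') ?q (?h ?e) = ?h ?e"
        unfolding R'(5)[OF parity_part_in[OF R'(4)]] R'(5)[OF R'(4)] .
    next
      fix A :: "('k, 'u) superalgebra" and g a i
      assume A: "comm_superalgebra A" and g: "g \<in> carrier (GL m n A)" and a: "a \<in> ?K'" and i: "i \<in> ?K"
      have e: "unit_vec i \<in> coord_space ?K" by (rule unit_vec_in[OF i])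
      have "rep_form L' A g (unit_vec a) (?h (unit_vec i)) = rep_form L A g (?S a) (unit_vec i)"
      proof (rule rep_form_eqI[OF L'(2) L(2) A g])
        fix c assume c: "c \<in> commutant"
        let ?x = "c (?f (unit_vec i))"
        have "pairing ?K' (unit_vec a) (p' (c (?f' (?h (unit_vec i))))) = p' (c (\<psi> (?f (unit_vec i)))) a"
          unfolding fh[OF e] by (rule pairing_unit_vec(1)[OF R'(6) a])
        also have "c (\<psi> (?f (unit_vec i))) = \<psi> ?x" by (rule \<psi>(3)[OF c imageI[OF e], symmetric])
        also have "?x = ?f (p ?x)" by (rule retract_image[OF L(2) c, symmetric])
        also have "p' (\<psi> (?f (p ?x))) a = lin_map ?K ?K' ?S (p ?x) a" by (simp only: S[OF R(4)])
        also have "\<dots> = pairing ?K (?S a) (p ?x)" using a by (simp add: lin_map_def pairing_def)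
        finally show "pairing ?K' (unit_vec a) (p' (c (?f' (?h (unit_vec i))))) = pairing ?K (?S a) (p ?x)" .
      qed
      then show "rep_form L' A g (unit_vec a) (lin_map ?K ?K' ?S (unit_vec i)) = rep_form L A g (?S a) (unit_vec i)"
        unfolding S[OF e] .
    qed
    moreover have "bij_betw (lin_map ?K ?K' ?S) (coord_space ?K) (coord_space ?K')"
    proof (rule bij_betw_cong[THEN iffD2, OF S])
      show "bij_betw ?h (coord_space ?K) (coord_space ?K')"
        using bij_betw_trans[OF bij_betw_trans[OF bij(1) \<psi>(2)] bij'(2)] by (simp only: comp_def)
    qed
    ultimately show "(L, L') \<in> gl_iso m n" unfolding gl_iso_def using L(1) L'(1) by blast
  qed
qed

end

section \<open>The correspondence\<close>

text \<open>
  A relation that is total in both directions and carries one equivalence relation to the other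
  induces a bijection of the sets of classes.
\<close>

lemma bij_betw_quotients:
  assumes r: "equiv X r" "A \<subseteq> X" and s: "equiv Y s" "B \<subseteq> Y"
    and total: "\<And>a. a \<in> A \<Longrightarrow> \<exists>b\<in>B. R a b" "\<And>b. b \<in> B \<Longrightarrow> \<exists>a\<in>A. R a b"
    and compat: "\<And>a a' b b'. a \<in> A \<Longrightarrow> a' \<in> A \<Longrightarrow> b \<in> B \<Longrightarrow> b' \<in> B \<Longrightarrow> R a b \<Longrightarrow> R a' b' \<Longrightarrow>
      (a, a') \<in> r \<longleftrightarrow> (b, b') \<in> s"
  shows "\<exists>f. bij_betw f (A // r) (B // s)"
proof -
  have req: "r `` {a} = r `` {a'} \<longleftrightarrow> (a, a') \<in> r" if "a \<in> A" "a' \<in> A" for a a'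
    using eq_equiv_class_iff[OF r(1)] that r(2) by blast
  have seq: "s `` {b} = s `` {b'} \<longleftrightarrow> (b, b') \<in> s" if "b \<in> B" "b' \<in> B" for b b'
    using eq_equiv_class_iff[OF s(1)] that s(2) by blast
  define b where "b c = (SOME b. b \<in> B \<and> (\<exists>a\<in>A. c = r `` {a} \<and> R a b))" for c
  have b: "b c \<in> B \<and> (\<exists>a\<in>A. c = r `` {a} \<and> R a (b c))" if c: "c \<in> A // r" for c
  proof -
    obtain a where a: "a \<in> A" "c = r `` {a}" using c by (rule quotientE)
    obtain b' where "b' \<in> B" "R a b'" using total(1)[OF a(1)] by blast
    then have "\<exists>b. b \<in> B \<and> (\<exists>a\<in>A. c = r `` {a} \<and> R a b)" using a by blast
    then show ?thesis unfolding b_def by (rule someI_ex)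
  qed
  have "bij_betw (\<lambda>c. s `` {b c}) (A // r) (B // s)"
    unfolding bij_betw_def
  proof
    show "inj_on (\<lambda>c. s `` {b c}) (A // r)"
    proof (rule inj_onI)
      fix c c' assume c: "c \<in> A // r" and c': "c' \<in> A // r" and eq: "s `` {b c} = s `` {b c'}"
      obtain a where a: "a \<in> A" "c = r `` {a}" "R a (b c)" using b[OF c] by blast
      obtain a' where a': "a' \<in> A" "c' = r `` {a'}" "R a' (b c')" using b[OF c'] by blast
      have B: "b c \<in> B" "b c' \<in> B" using b[OF c] b[OF c'] by auto
      have "(b c, b c') \<in> s" using eq seq[OF B] by blast
      then have "(a, a') \<in> r" using compat[OF a(1) a'(1) B a(3) a'(3)] by blast
      then show "c = c'" using req[OF a(1) a'(1)] a(2) a'(2) by simp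
    qed
    show "(\<lambda>c. s `` {b c}) ` (A // r) = B // s"
    proof
      show "(\<lambda>c. s `` {b c}) ` (A // r) \<subseteq> B // s" using b by (auto intro: quotientI)
      show "B // s \<subseteq> (\<lambda>c. s `` {b c}) ` (A // r)"
      proof
        fix y assume "y \<in> B // s"
        then obtain b' where b': "b' \<in> B" "y = s `` {b'}" by (rule quotientE)
        obtain a where a: "a \<in> A" "R a b'" using total(2)[OF b'(1)] by blast
        have c: "r `` {a} \<in> A // r" by (rule quotientI[OF a(1)])
        obtain a' where a': "a' \<in> A" "r `` {a} = r `` {a'}" "R a' (b (r `` {a}))" using b[OF c] by blast
        have B: "b (r `` {a}) \<in> B" using b[OF c] by blast
        have "(a, a') \<in> r" using req[OF a(1) a'(1)] a'(2) by blast
        then have "(b', b (r `` {a})) \<in> s" using compat[OF a(1) a'(1) b'(1) B a(2) a'(3)] by blast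
        then have "y = s `` {b (r `` {a})}" using seq[OF b'(1) B] b'(2) by simp
        then show "y \<in> (\<lambda>c. s `` {b c}) ` (A // r)" using c by blast
      qed
    qed
  qed
  then show ?thesis by blast
qed

context tensor_setting
begin

abbreviation sym_tensors :: "(nat \<Rightarrow> nat, 'k, nat list) lin_rep" where
  "sym_tensors \<equiv> sym_tensor_rep m n r"

text \<open>
  Only some pair of embeddings is required to meet; that the isomorphism class of one side
  determines that of the other is part of the bijection.
\<close>

definition corresponds :: "(nat \<Rightarrow> nat, 'k, nat) lin_rep \<Rightarrow> ('k, 'u, nat) gl_rep \<Rightarrow> bool" where
  "corresponds M L \<longleftrightarrow> (\<exists>T T'. lin_embedding (sym_group r) M sym_tensors T \<and> gl_embedding m n L tensors T' \<and>
     lin_map (lr_basis M) B T ` coord_space (lr_basis M) \<inter>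
     lin_map (gl_basis L) B T' ` coord_space (gl_basis L) \<noteq> {0})"

lemma gl_embedding_of_retract:
  assumes "retract L T p"
  shows "gl_embedding m n L tensors T"
  unfolding gl_embedding_def
proof
  show "gl_intertwiner m n L tensors T" by (rule retractD(2)[OF assms])
  show "inj_on (lin_map (gl_basis L) (gl_basis tensors) T) (coord_space (gl_basis L))"
    using retractD(5)[OF assms] by (auto intro: inj_on_inverseI)
qed

lemma irreps_bijection:
  "\<exists>f. bij_betw f (sym_irreps_in_tensors m n r :: (nat \<Rightarrow> nat, 'k, nat) lin_rep set set)
     (gl_irreps_in_tensors m n r :: ('k, 'u, nat) gl_rep set set)"
  unfolding sym_irreps_in_tensors_def gl_irreps_in_tensors_def
proof (rule bij_betw_quotients[OF equiv_lin_iso _ equiv_gl_iso, where R = corresponds])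
  let ?A = "{M :: (nat \<Rightarrow> nat, 'k, nat) lin_rep. irreducible_lin_rep (sym_group r) M \<and>
      lin_occurs_in (sym_group r) M sym_tensors}"
  let ?B = "{L :: ('k, 'u, nat) gl_rep. irreducible_gl_rep m n L \<and> gl_occurs_in m n L tensors}"
  show "?A \<subseteq> {M. is_lin_rep (sym_group r) M}" by (auto simp: irreducible_lin_rep_def)
  show "?B \<subseteq> {L. is_gl_rep m n L}" by (auto simp: irreducible_gl_rep_def)
  {
    fix M assume "M \<in> ?A"
    then obtain T where M: "irreducible_lin_rep (sym_group r) M" and T: "lin_embedding (sym_group r) M sym_tensors T"
      unfolding lin_occurs_in_def lin_embedding_def by blast
    let ?N = "lin_map (lr_basis M) B T ` coord_space (lr_basis M)"
    have N: "simple group_ops ?N" using simple_image[OF M T] by simp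
    note inv = simpleD(1)[OF N]
    obtain t where t: "t \<in> ?N" "t \<noteq> 0" using simpleD(2)[OF N] invariantD(4)[OF inv] by blast
    let ?U = "(\<lambda>c. c t) ` commutant"
    have U: "simple commutant ?U" by (rule simple_orbit_commutant[OF N t])
    obtain L :: "('k, 'u, nat) gl_rep" and T' p where L: "is_gl_rep m n L" "retract L T' p"
      "lin_map (gl_basis L) B T' ` coord_space (gl_basis L) = ?U"
      using invariant_is_image[OF simpleD(1)[OF U]] .
    have irr: "irreducible_gl_rep m n L"
      using irreducible_iff_simple_image[OF L(1,2)] U L(3) by simp
    have emb: "gl_embedding m n L tensors T'" by (rule gl_embedding_of_retract[OF L(2)])
    then have "L \<in> ?B" using irr unfolding gl_embedding_def gl_occurs_in_def by blast
    moreover have "t \<in> ?N \<inter> ?U" by (rule IntI[OF t(1) image_eqI[of t "\<lambda>c. c t", OF refl commutant_id]])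
    then have "corresponds M L"
      unfolding corresponds_def using T emb L(3) t(2) by blast
    ultimately show "\<exists>L\<in>?B. corresponds M L" by blast
  }
  {
    fix L assume "L \<in> ?B"
    then obtain T where L: "irreducible_gl_rep m n L" and T: "gl_embedding m n L tensors T"
      unfolding gl_occurs_in_def gl_embedding_def by blast
    have rep: "is_gl_rep m n L" using L by (simp add: irreducible_gl_rep_def)
    obtain p where p: "retract L T p" by (rule exists_retract[OF gl_rep_has_matrix_entries[OF rep] T])
    let ?U = "lin_map (gl_basis L) B T ` coord_space (gl_basis L)"
    have U: "simple commutant ?U" using irreducible_iff_simple_image[OF rep p] L by simp
    obtain N where N: "simple group_ops N" "N \<inter> ?U \<noteq> {0}"
      using simple_commutant_meets_simple[OF U] by blast
    obtain M :: "(nat \<Rightarrow> nat, 'k, nat) lin_rep" and T' where M: "irreducible_lin_rep (sym_group r) M"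
      "lin_embedding (sym_group r) M sym_tensors T'"
      "lin_map (lr_basis M) (lr_basis sym_tensors) T' ` coord_space (lr_basis M) = N"
      using simple_is_image[OF N(1)] .
    have "M \<in> ?A" using M(1,2) unfolding lin_embedding_def lin_occurs_in_def by blast
    moreover have "corresponds M L"
      unfolding corresponds_def using M(2,3) T N(2) by (intro exI[of _ T'] exI[of _ T]) simp
    ultimately show "\<exists>M\<in>?A. corresponds M L" by blast
  }
  fix M M' L L' assume M: "M \<in> ?A" and M': "M' \<in> ?A" and L: "L \<in> ?B" and L': "L' \<in> ?B"
    and corr: "corresponds M L" and corr': "corresponds M' L'"
  have irr: "irreducible_lin_rep (sym_group r) M" "irreducible_lin_rep (sym_group r) M'"
    "irreducible_gl_rep m n L" "irreducible_gl_rep m n L'" using M M' L L' by auto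
  have rep: "is_lin_rep (sym_group r) M" "is_lin_rep (sym_group r) M'" "is_gl_rep m n L" "is_gl_rep m n L'"
    using irr by (auto simp: irreducible_lin_rep_def irreducible_gl_rep_def)
  obtain T S where T: "lin_embedding (sym_group r) M sym_tensors T" and S: "gl_embedding m n L tensors S"
    and meet: "lin_map (lr_basis M) B T ` coord_space (lr_basis M) \<inter>
      lin_map (gl_basis L) B S ` coord_space (gl_basis L) \<noteq> {0}"
    using corr unfolding corresponds_def by blast
  obtain T' S' where T': "lin_embedding (sym_group r) M' sym_tensors T'" and S': "gl_embedding m n L' tensors S'"
    and meet': "lin_map (lr_basis M') B T' ` coord_space (lr_basis M') \<inter>
      lin_map (gl_basis L') B S' ` coord_space (gl_basis L') \<noteq> {0}"
    using corr' unfolding corresponds_def by blast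
  obtain p where p: "retract L S p" by (rule exists_retract[OF gl_rep_has_matrix_entries[OF rep(3)] S])
  obtain p' where p': "retract L' S' p'" by (rule exists_retract[OF gl_rep_has_matrix_entries[OF rep(4)] S'])
  have N: "simple group_ops (lin_map (lr_basis M) B T ` coord_space (lr_basis M))"
    and N': "simple group_ops (lin_map (lr_basis M') B T' ` coord_space (lr_basis M'))"
    using simple_image[OF irr(1) T] simple_image[OF irr(2) T'] by simp_all
  have U: "simple commutant (lin_map (gl_basis L) B S ` coord_space (gl_basis L))"
    and U': "simple commutant (lin_map (gl_basis L') B S' ` coord_space (gl_basis L'))"
    using irreducible_iff_simple_image[OF rep(3) p] irr(3)
      irreducible_iff_simple_image[OF rep(4) p'] irr(4) by simp_all
  note lin = lin_iso_iff_images_iso[OF rep(1) T rep(2) T', unfolded lr_basis_sym_tensor_rep]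
    and lin' = lin_iso_iff_images_iso[OF rep(2) T' rep(1) T, unfolded lr_basis_sym_tensor_rep]
    and gl = gl_iso_iff_images_iso[OF rep(3) p rep(4) p']
  show "(M, M') \<in> lin_iso (sym_group r) \<longleftrightarrow> (L, L') \<in> gl_iso m n"
  proof
    assume "(M, M') \<in> lin_iso (sym_group r)"
    then show "(L, L') \<in> gl_iso m n"
      unfolding lin gl using commutant_iso_of_group_iso[OF N N' U U' meet meet'] by blast
  next
    assume "(L, L') \<in> gl_iso m n"
    then have "(M', M) \<in> lin_iso (sym_group r)"
      unfolding lin' gl using group_iso_of_commutant_iso[OF N N' U U' meet meet'] by blast
    then show "(M, M') \<in> lin_iso (sym_group r)"
      using equiv_lin_iso unfolding equiv_def sym_def by blast
  qed
qed

end

theorem corollary4p7: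
  fixes emb :: "(nat \<Rightarrow> 'k::{alg_closed_field, field_char_0}) \<Rightarrow> 'u"
    and m n r :: nat
  assumes "inj emb"
  shows "\<exists>f. bij_betw f
           (sym_irreps_in_tensors m n r :: (nat \<Rightarrow> nat, 'k, nat) lin_rep set set)
           (gl_irreps_in_tensors m n r :: ('k, 'u, nat) gl_rep set set)"
  by (rule tensor_setting.irreps_bijection[OF tensor_setting.intro[OF assms]])

end
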